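(* Let $\mathcal A$ be an $A_\infty$-category. There is a quasi-equivalence $$\tilde\nu:\ \mathrm{Tw}(\mathrm{Tw}(\mathcal A)*\mathbb Z)\ \overset{\sim}{\longrightarrow}\ \mathrm{Tw}(\mathbb Z\mathcal A*\mathbb Z).$$
   Context: $k$ is a field and all categories are $k$-linear. $A_\infty$-categories follow Seidel's conventions: graded Hom spaces, structure maps $\mu^d$ of degree $2-d$ ($d\ge 1$), $|a|$ the degree of a homogeneous morphism $a$ and $\|a\|=|a|-1$, with relations $\sum_{m,n}(-1)^{\|a_1\|+\dots+\|a_n\|}\mu^{d-m+1}(a_d,\dots,a_{n+m+1},\mu^m(a_{n+m},\dots,a_{n+1}),a_n,\dots,a_1)=0$. All $A_\infty$-categories are strictly unital and all $A_\infty$-functors are strict and unital. $H^0(\mathcal A)$ has the objects of $\mathcal A$ and morphisms the degree-$0$ cohomology of $(\mathrm{Hom}_{\mathcal A},\mu^1)$. A quasi-equivalence is an $A_\infty$-functor inducing an equivalence on cohomology categories. Category $\mathbb Z\mathcal A$: objects are formal finite direct sums $\bigoplus_{i\in I}X_i[p_i]$ with $X_i\in\mathcal A$, $p_i\in\mathbb Z$; $\mathrm{Hom}_{\mathbb Z\mathcal A}(X[p],Y[q])=\mathrm{Hom}_{\mathrm{gr}\,k}(k[p],k[q])\otimes_k\mathrm{Hom}_{\mathcal A}(X,Y)$ is spanned by elements $s^p_q\otimes a$ of degree $p-q+|a|$, where $s^p_q$ is the identity map $k[p]\to k[q]$, of degree $p-q$ (morphisms between direct sums are matrices); and $$\mu^d_{\mathbb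 Z\mathcal A}(s^{p_{d-1}}_{p_d}\otimes a_d,\dots,s^{p_0}_{p_1}\otimes a_1)=(-1)^{\sum_{i<j}(p_{i-1}-p_i)\|a_j\|}\,s^{p_0}_{p_d}\otimes\mu^d_{\mathcal A}(a_d,\dots,a_1).$$ Twisted complexes: objects of $\mathrm{Tw}(\mathcal A)$ are pairs $(X,\delta_X)$ with $X\in\mathbb Z\mathcal A$ and $\delta_X$ a degree $1$ endomorphism of $X$ in $\mathbb Z\mathcal A$ that is strictly lower triangular (in Seidel's sense: $X$ has a finite filtration preserved by $\delta_X$ such that $\delta_X$ induces zero on the graded pieces) and satisfies $\sum_{d>0}\mu^d_{\mathbb Z\mathcal A}(\delta_X,\dots,\delta_X)=0$. Morphism spaces are those of $\mathbb Z\mathcal A$, and $$\mu^d_{\mathrm{Tw}(\mathcal A)}(f_d,\dots,f_1)=\sum_{i_0,\dots,i_d\ge 0}\mu^{d+i_0+\dots+i_d}_{\mathbb Z\mathcal A}(\delta_{X_d}^{\otimes i_d},f_d,\delta_{X_{d-1}}^{\otimes i_{d-1}},f_{d-1},\dots,f_1,\delta_{X_0}^{\otimes i_0}).$$ Shift action: view $\mathbb Z$ multiplicatively with generator $\sigma$. It acts strictly on $\mathbb Z\mathcal A$ by $\sigma(\bigoplus_iX_i[p_i])=\bigoplus_iX_i[p_i+1]$ and $\sigma(s^p_q\otimes a)=(-1)^{p-q}s^{p+1}_{q+1}\otimes a$; this extends to $\mathrm{Tw}(\mathcal A)$ by $\sigma(X,\delta_X)=(\sigma X,\sigma\delta_X)$.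 Skew group category: for a strict action of a group $G$ on an $A_\infty$-category $\mathcal B$ (a homomorphism from $G$ to invertible $A_\infty$-endofunctors), $\mathcal B*G$ has the objects $\{X\}$ for $X\in\mathcal B$, $\mathrm{Hom}_{\mathcal B*G}(\{X\},\{Y\})=\bigoplus_{g\in G}\mathrm{Hom}_{\mathcal B}(gX,Y)$ (with $a:gX\to Y$ written $a\otimes g$), and $\mu^n(a_n\otimes g_n,\dots,a_1\otimes g_1)=\mu^n_{\mathcal B}(a_n,g_na_{n-1},\dots,g_n\cdots g_2a_1)\otimes g_n\cdots g_1$. $\mathbb Z\mathcal A*\mathbb Z$ and $\mathrm{Tw}(\mathcal A)*\mathbb Z$ are formed with the shift action above. *)

theory Defs
  imports "HOL.Vector_Spaces" "HOL-Library.Function_Algebras" "HOL-Library.Groups_Big_Fun"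
    "HOL-Library.Poly_Mapping"
begin

section \<open>Homogeneous morphisms and \<open>A\<^sub>\<infinity>\<close>-categories\<close>

text \<open>
  A graded vector space is a family of vector spaces indexed by the integers, so only homogeneous
  morphisms occur. A homogeneous morphism carries its source, target and degree, because the
  spaces \<open>Hom A X Y p\<close> are subspaces of a common ambient vector space \<open>'m\<close> and may overlap.

  Strings of morphisms are written in the order \<open>[a\<^sub>d, \<dots>, a\<^sub>1]\<close> in which they are composed.
\<close>

datatype ('o, 'm) hmor = HMor (src: 'o) (tgt: 'o) (deg: int) (val: 'm)

abbreviation rdeg :: "('o, 'm) hmor \<Rightarrow> int"
  where "rdeg a \<equiv> deg a - 1"

definition ksign :: "int \<Rightarrow> 'm::ab_group_add \<Rightarrow> 'm"
  where "ksign e x = (if even e then x else - x)"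

record ('o, 'm, 'k) ainf =
  Obj :: "'o set"
  Hom :: "'o \<Rightarrow> 'o \<Rightarrow> int \<Rightarrow> 'm set"
  scl :: "'k \<Rightarrow> 'm \<Rightarrow> 'm"
  mu :: "('o, 'm) hmor list \<Rightarrow> 'm"

definition mor :: "('o, 'm, 'k) ainf \<Rightarrow> ('o, 'm) hmor \<Rightarrow> bool"
  where "mor A a \<longleftrightarrow>
    src a \<in> Obj A \<and> tgt a \<in> Obj A \<and> val a \<in> Hom A (src a) (tgt a) (deg a)"

definition mors :: "('o, 'm, 'k) ainf \<Rightarrow> ('o, 'm) hmor list \<Rightarrow> bool"
  where "mors A as \<longleftrightarrow>
    as \<noteq> [] \<and> (\<forall>a\<in>set as. mor A a) \<and> successively (\<lambda>b a. src b = tgt a) as"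

definition mu_mor :: "('o, 'm, 'k) ainf \<Rightarrow> ('o, 'm) hmor list \<Rightarrow> ('o, 'm) hmor"
  where "mu_mor A as =
    HMor (src (last as)) (tgt (hd as)) ((\<Sum>a\<leftarrow>as. deg a) + 2 - int (length as)) (mu A as)"

definition is_strict_unit :: "('o, 'm::ab_group_add, 'k) ainf \<Rightarrow> 'o \<Rightarrow> 'm \<Rightarrow> bool"
  where "is_strict_unit A X e \<longleftrightarrow>
    e \<in> Hom A X X 0 \<and>
    mu A [HMor X X 0 e] = 0 \<and>
    (\<forall>a. mor A a \<and> tgt a = X \<longrightarrow> ksign (deg a) (mu A [HMor X X 0 e, a]) = val a) \<and>
    (\<forall>a. mor A a \<and> src a = X \<longrightarrow> mu A [a, HMor X X 0 e] = val a) \<and>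
    (\<forall>as bs. mors A (as @ HMor X X 0 e # bs) \<and> length as + length bs \<ge> 2 \<longrightarrow>
      mu A (as @ HMor X X 0 e # bs) = 0)"

definition strict_unit :: "('o, 'm::ab_group_add, 'k) ainf \<Rightarrow> 'o \<Rightarrow> 'm"
  where "strict_unit A X = (THE e. is_strict_unit A X e)"

locale ainf_category =
  fixes A :: "('o, 'm::ab_group_add, 'k::field) ainf"
  assumes vector_space: "vector_space (scl A)"
    and subspace: "\<lbrakk>X \<in> Obj A; Y \<in> Obj A\<rbrakk> \<Longrightarrow> module.subspace (scl A) (Hom A X Y p)"
    and mu_closed: "mors A as \<Longrightarrow> mor A (mu_mor A as)"
    and mu_add: "\<lbrakk>mors A (as @ HMor X Y p a # bs); mors A (as @ HMor X Y p b # bs)\<rbrakk> \<Longrightarrow>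
      mu A (as @ HMor X Y p (a + b) # bs) =
        mu A (as @ HMor X Y p a # bs) + mu A (as @ HMor X Y p b # bs)"
    and mu_scl: "mors A (as @ HMor X Y p a # bs) \<Longrightarrow>
      mu A (as @ HMor X Y p (scl A c a) # bs) = scl A c (mu A (as @ HMor X Y p a # bs))"
    and ainf_relation: "\<lbrakk>mors A as; d = length as\<rbrakk> \<Longrightarrow>
      (\<Sum>(m, n) \<in> {(m, n). 1 \<le> m \<and> m + n \<le> d}.
        ksign (\<Sum>a\<leftarrow>drop (d - n) as. rdeg a)
          (mu A (take (d - m - n) as @
                 mu_mor A (take m (drop (d - m - n) as)) #
                 drop (d - n) as))) = 0"
    and strict_unit_exists: "X \<in> Obj A \<Longrightarrow> \<exists>e. is_strict_unit A X e"


section \<open>Strict unital \<open>A\<^sub>\<infinity>\<close>-functors\<close>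

text \<open>
  A strict functor has only a linear part; \<open>fmor F a\<close> is the value of \<open>F\<close> on the homogeneous
  morphism \<open>a\<close>, and \<open>fhm F a\<close> the same value together with its source, target and degree.
\<close>

record ('o, 'm, 'p, 'n) func =
  fobj :: "'o \<Rightarrow> 'p"
  fmor :: "('o, 'm) hmor \<Rightarrow> 'n"

definition fhm :: "('o, 'm, 'p, 'n) func \<Rightarrow> ('o, 'm) hmor \<Rightarrow> ('p, 'n) hmor"
  where "fhm F a = HMor (fobj F (src a)) (fobj F (tgt a)) (deg a) (fmor F a)"

definition func_id :: "('o, 'm, 'o, 'm) func"
  where "func_id = \<lparr>fobj = (\<lambda>X. X), fmor = val\<rparr>"

definition func_comp ::
    "('p, 'n, 'q, 'l) func \<Rightarrow> ('o, 'm, 'p, 'n) func \<Rightarrow> ('o, 'm, 'q, 'l) func"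
  where "func_comp G F = \<lparr>fobj = fobj G \<circ> fobj F, fmor = fmor G \<circ> fhm F\<rparr>"

definition ainf_functor ::
    "('o, 'm::ab_group_add, 'k::field) ainf \<Rightarrow> ('p, 'n::ab_group_add, 'k) ainf \<Rightarrow>
     ('o, 'm, 'p, 'n) func \<Rightarrow> bool"
  where "ainf_functor A B F \<longleftrightarrow>
    ainf_category A \<and> ainf_category B \<and>
    (\<forall>X\<in>Obj A. fobj F X \<in> Obj B) \<and>
    (\<forall>a. mor A a \<longrightarrow> mor B (fhm F a)) \<and>
    (\<forall>X\<in>Obj A. \<forall>Y\<in>Obj A. \<forall>p. \<forall>a\<in>Hom A X Y p. \<forall>b\<in>Hom A X Y p.
      fmor F (HMor X Y p (a + b)) = fmor F (HMor X Y p a) + fmor F (HMor X Y p b)) \<and>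
    (\<forall>X\<in>Obj A. \<forall>Y\<in>Obj A. \<forall>p. \<forall>a\<in>Hom A X Y p. \<forall>c.
      fmor F (HMor X Y p (scl A c a)) = scl B c (fmor F (HMor X Y p a))) \<and>
    (\<forall>as. mors A as \<longrightarrow> fmor F (mu_mor A as) = mu B (map (fhm F) as)) \<and>
    (\<forall>X\<in>Obj A. fmor F (HMor X X 0 (strict_unit A X)) = strict_unit B (fobj F X))"


section \<open>Graded categories and the cohomology category\<close>

record ('o, 'h) gcat =
  gobj :: "'o set"
  ghom :: "'o \<Rightarrow> 'o \<Rightarrow> int \<Rightarrow> 'h set"
  gcomp :: "('o, 'h) hmor \<Rightarrow> ('o, 'h) hmor \<Rightarrow> 'h"
  gid :: "'o \<Rightarrow> 'h"

definition gcomp_mor :: "('o, 'h) gcat \<Rightarrow> ('o, 'h) hmor \<Rightarrow> ('o, 'h) hmor \<Rightarrow> ('o, 'h) hmor"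
  where "gcomp_mor C g f = HMor (src f) (tgt g) (deg g + deg f) (gcomp C g f)"

definition gmor :: "('o, 'h) gcat \<Rightarrow> ('o, 'h) hmor \<Rightarrow> bool"
  where "gmor C f \<longleftrightarrow>
    src f \<in> gobj C \<and> tgt f \<in> gobj C \<and> val f \<in> ghom C (src f) (tgt f) (deg f)"

definition graded_functor ::
    "('o, 'h) gcat \<Rightarrow> ('p, 'i) gcat \<Rightarrow> ('o, 'h, 'p, 'i) func \<Rightarrow> bool"
  where "graded_functor C D F \<longleftrightarrow>
    (\<forall>X\<in>gobj C. fobj F X \<in> gobj D) \<and>
    (\<forall>f. gmor C f \<longrightarrow> gmor D (fhm F f)) \<and>
    (\<forall>g f. gmor C g \<and> gmor C f \<and> src g = tgt f \<longrightarrow>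
      fmor F (gcomp_mor C g f) = gcomp D (fhm F g) (fhm F f)) \<and>
    (\<forall>X\<in>gobj C. fmor F (HMor X X 0 (gid C X)) = gid D (fobj F X))"

definition graded_iso :: "('o, 'h) gcat \<Rightarrow> 'o \<Rightarrow> 'o \<Rightarrow> 'h \<Rightarrow> bool"
  where "graded_iso C X Y f \<longleftrightarrow>
    f \<in> ghom C X Y 0 \<and>
    (\<exists>g\<in>ghom C Y X 0.
      gcomp C (HMor Y X 0 g) (HMor X Y 0 f) = gid C X \<and>
      gcomp C (HMor X Y 0 f) (HMor Y X 0 g) = gid C Y)"

definition naturally_isomorphic ::
    "('o, 'h) gcat \<Rightarrow> ('p, 'i) gcat \<Rightarrow> ('o, 'h, 'p, 'i) func \<Rightarrow> ('o, 'h, 'p, 'i) func \<Rightarrow> bool"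
  where "naturally_isomorphic C D F G \<longleftrightarrow>
    (\<exists>\<eta>. (\<forall>X\<in>gobj C. graded_iso D (fobj F X) (fobj G X) (\<eta> X)) \<and>
         (\<forall>f. gmor C f \<longrightarrow>
            gcomp D (HMor (fobj F (tgt f)) (fobj G (tgt f)) 0 (\<eta> (tgt f))) (fhm F f) =
            gcomp D (fhm G f) (HMor (fobj F (src f)) (fobj G (src f)) 0 (\<eta> (src f)))))"

definition graded_equivalence ::
    "('o, 'h) gcat \<Rightarrow> ('p, 'i) gcat \<Rightarrow> ('o, 'h, 'p, 'i) func \<Rightarrow> bool"
  where "graded_equivalence C D F \<longleftrightarrow>
    graded_functor C D F \<and>
    (\<exists>G. graded_functor D C G \<and>
      naturally_isomorphic C C (func_comp G F) func_id \<and>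
      naturally_isomorphic D D (func_comp F G) func_id)"

definition cocycles :: "('o, 'm::zero, 'k) ainf \<Rightarrow> 'o \<Rightarrow> 'o \<Rightarrow> int \<Rightarrow> 'm set"
  where "cocycles A X Y p = {a \<in> Hom A X Y p. mu A [HMor X Y p a] = 0}"

definition coboundaries :: "('o, 'm, 'k) ainf \<Rightarrow> 'o \<Rightarrow> 'o \<Rightarrow> int \<Rightarrow> 'm set"
  where "coboundaries A X Y p = (\<lambda>c. mu A [HMor X Y (p - 1) c]) ` Hom A X Y (p - 1)"

definition coh_class :: "('o, 'm::plus, 'k) ainf \<Rightarrow> 'o \<Rightarrow> 'o \<Rightarrow> int \<Rightarrow> 'm \<Rightarrow> 'm set"
  where "coh_class A X Y p a = (\<lambda>b. a + b) ` coboundaries A X Y p"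

text \<open>
  Composition in cohomology is \<open>[b] \<cdot> [a] = (-1)\<^bsup>|a|\<^esup> [\<mu>\<^sup>2(b, a)]\<close>, following Seidel. A map on
  cohomology classes is given by the union of the (equal) classes over all representatives.
\<close>

definition coh_cat :: "('o, 'm::ab_group_add, 'k) ainf \<Rightarrow> ('o, 'm set) gcat"
  where "coh_cat A =
    \<lparr>gobj = Obj A,
     ghom = (\<lambda>X Y p. coh_class A X Y p ` cocycles A X Y p),
     gcomp = (\<lambda>\<beta> \<alpha>. \<Union>b\<in>val \<beta>. \<Union>a\<in>val \<alpha>.
       coh_class A (src \<alpha>) (tgt \<beta>) (deg \<beta> + deg \<alpha>)
         (ksign (deg \<alpha>)
           (mu A [HMor (src \<beta>) (tgt \<beta>) (deg \<beta>) b, HMor (src \<alpha>) (tgt \<alpha>) (deg \<alpha>) a]))),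
     gid = (\<lambda>X. coh_class A X X 0 (strict_unit A X))\<rparr>"

definition coh_functor ::
    "('p, 'n::ab_group_add, 'k) ainf \<Rightarrow> ('o, 'm, 'p, 'n) func \<Rightarrow> ('o, 'm set, 'p, 'n set) func"
  where "coh_functor B F =
    \<lparr>fobj = fobj F,
     fmor = (\<lambda>\<alpha>. \<Union>a\<in>val \<alpha>.
       coh_class B (fobj F (src \<alpha>)) (fobj F (tgt \<alpha>)) (deg \<alpha>)
         (fmor F (HMor (src \<alpha>) (tgt \<alpha>) (deg \<alpha>) a)))\<rparr>"

definition quasi_equivalence ::
    "('o, 'm::ab_group_add, 'k::field) ainf \<Rightarrow> ('p, 'n::ab_group_add, 'k) ainf \<Rightarrow>
     ('o, 'm, 'p, 'n) func \<Rightarrow> bool"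
  where "quasi_equivalence A B F \<longleftrightarrow>
    ainf_functor A B F \<and> graded_equivalence (coh_cat A) (coh_cat B) (coh_functor B F)"


section \<open>The category \<open>\<int>A\<close>\<close>

text \<open>
  The formal direct sum of the \<open>X\<^sub>i[p\<^sub>i]\<close> for \<open>i < n\<close> is the list of the pairs \<open>(X\<^sub>i, p\<^sub>i)\<close>. The
  entry \<open>f j i\<close> of a matrix goes from the \<open>i\<close>-th summand \<open>X[p]\<close> of the source to the \<open>j\<close>-th
  summand \<open>Y[q]\<close> of the target, and \<open>a\<close> as an entry stands for \<open>s\<^sup>p\<^sub>q \<otimes> a\<close>; in a matrix of degree
  \<open>r = p - q + |a|\<close> the degree of \<open>a\<close> is hence \<open>r - p + q\<close>. Entries out of range are zero.
\<close>

definition entry :: "(('o \<times> int) list, nat \<Rightarrow> nat \<Rightarrow> 'm) hmor \<Rightarrow> nat \<Rightarrow> nat \<Rightarrow> ('o, 'm) hmor"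
  where "entry f j i =
    HMor (fst (src f ! i)) (fst (tgt f ! j)) (deg f - snd (src f ! i) + snd (tgt f ! j))
      (val f j i)"

text \<open>
  The paths \<open>[i\<^sub>d, \<dots>, i\<^sub>0]\<close> through the summands with \<open>i\<^sub>d = j\<close> and \<open>i\<^sub>0 = i\<close>, along which the
  \<open>(j, i)\<close> entry of a \<open>d\<close>-fold matrix composition is a sum.
\<close>

definition paths ::
    "(('o \<times> int) list, nat \<Rightarrow> nat \<Rightarrow> 'm) hmor list \<Rightarrow> nat \<Rightarrow> nat \<Rightarrow> nat list set"
  where "paths fs j i =
    {is. length is = Suc (length fs) \<and> is ! 0 = j \<and> is ! length fs = i \<and>
         (\<forall>t<length fs. is ! t < length (tgt (fs ! t)) \<and> is ! Suc t < length (src (fs ! t)))}"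

text \<open>
  The exponent \<open>\<Sum>\<^bsub>i<j\<^esub> (p\<^bsub>i-1\<^esub> - p\<^sub>i) \<parallel>a\<^sub>j\<parallel>\<close>: position \<open>u\<close> of the list belongs to \<open>i = d - u\<close> and
  position \<open>t\<close> to \<open>j = d - t\<close>, so \<open>i < j\<close> becomes \<open>t < u\<close>.
\<close>

definition shift_exponent ::
    "(('o \<times> int) list, nat \<Rightarrow> nat \<Rightarrow> 'm) hmor list \<Rightarrow> nat list \<Rightarrow> int"
  where "shift_exponent fs is =
    (\<Sum>u<length fs. \<Sum>t<u.
      (snd (src (fs ! u) ! (is ! Suc u)) - snd (tgt (fs ! u) ! (is ! u))) *
      rdeg (entry (fs ! t) (is ! t) (is ! Suc t)))"

definition ZZ ::
    "('o, 'm::ab_group_add, 'k) ainf \<Rightarrow> (('o \<times> int) list, nat \<Rightarrow> nat \<Rightarrow> 'm, 'k) ainf"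
  where "ZZ A =
    \<lparr>Obj = {X. \<forall>x\<in>set X. fst x \<in> Obj A},
     Hom = (\<lambda>X Y r. {f. \<forall>j i.
       if j < length Y \<and> i < length X
       then f j i \<in> Hom A (fst (X ! i)) (fst (Y ! j)) (r - snd (X ! i) + snd (Y ! j))
       else f j i = 0}),
     scl = (\<lambda>c f j i. scl A c (f j i)),
     mu = (\<lambda>fs j i. \<Sum>is\<in>paths fs j i.
       ksign (shift_exponent fs is)
         (mu A (map (\<lambda>t. entry (fs ! t) (is ! t) (is ! Suc t)) [0..<length fs])))\<rparr>"


section \<open>Twisted complexes\<close>

text \<open>
  A filtration of a formal direct sum with \<open>n\<close> summands is given by a decreasing chain \<open>F\<close> of
  sets of summands.
\<close>

definition strictly_lower_triangular :: "nat \<Rightarrow> (nat \<Rightarrow> nat \<Rightarrow> 'm::zero) \<Rightarrow> bool"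
  where "strictly_lower_triangular n \<delta> \<longleftrightarrow>
    (\<exists>F :: nat \<Rightarrow> nat set.
      F 0 = {..<n} \<and> (\<forall>k. F (Suc k) \<subseteq> F k) \<and> (\<exists>N. F N = {}) \<and>
      (\<forall>k. \<forall>i\<in>F k. \<forall>j. \<delta> j i \<noteq> 0 \<longrightarrow> j \<in> F k) \<and>
      (\<forall>k. \<forall>i\<in>F k - F (Suc k). \<forall>j\<in>F k - F (Suc k). \<delta> j i = 0))"

type_synonym ('o, 'm) twc = "('o \<times> int) list \<times> (nat \<Rightarrow> nat \<Rightarrow> 'm)"

definition tw_diff :: "('o, 'm) twc \<Rightarrow> (('o \<times> int) list, nat \<Rightarrow> nat \<Rightarrow> 'm) hmor"
  where "tw_diff T = HMor (fst T) (fst T) 1 (snd T)"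

definition untwist ::
    "(('o, 'm) twc, nat \<Rightarrow> nat \<Rightarrow> 'm) hmor \<Rightarrow> (('o \<times> int) list, nat \<Rightarrow> nat \<Rightarrow> 'm) hmor"
  where "untwist f = HMor (fst (src f)) (fst (tgt f)) (deg f) (val f)"

text \<open>
  For \<open>fs = [f\<^sub>d, \<dots>, f\<^sub>1]\<close> and \<open>ns = [i\<^sub>d, \<dots>, i\<^sub>0]\<close> this is the string
  \<open>\<delta>\<^bsup>i\<^sub>d\<^esup>, f\<^sub>d, \<delta>\<^bsup>i\<^sub>d\<^sub>-\<^sub>1\<^esup>, \<dots>, f\<^sub>1, \<delta>\<^bsup>i\<^sub>0\<^esup>\<close>.
\<close>

definition insert_diffs ::
    "(('o, 'm) twc, nat \<Rightarrow> nat \<Rightarrow> 'm) hmor list \<Rightarrow> nat list \<Rightarrow>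
     (('o \<times> int) list, nat \<Rightarrow> nat \<Rightarrow> 'm) hmor list"
  where "insert_diffs fs ns =
    replicate (hd ns) (tw_diff (tgt (hd fs))) @
    concat (map2 (\<lambda>f n. untwist f # replicate n (tw_diff (src f))) fs (tl ns))"

text \<open>
  The sums over unboundedly many insertions have only finitely many nonzero terms by
  triangularity; \<^const>\<open>Sum_any\<close> is the sum of the nonzero terms.
\<close>

definition Tw ::
    "('o, 'm::ab_group_add, 'k) ainf \<Rightarrow> (('o, 'm) twc, nat \<Rightarrow> nat \<Rightarrow> 'm, 'k) ainf"
  where "Tw A =
    \<lparr>Obj = {T. mor (ZZ A) (tw_diff T) \<and>
       strictly_lower_triangular (length (fst T)) (snd T) \<and>
       Sum_any (\<lambda>d. if d > 0 then mu (ZZ A) (replicate d (tw_diff T)) else 0) = 0},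
     Hom = (\<lambda>S T. Hom (ZZ A) (fst S) (fst T)),
     scl = scl (ZZ A),
     mu = (\<lambda>fs. Sum_any (\<lambda>ns.
       if length ns = Suc (length fs) then mu (ZZ A) (insert_diffs fs ns) else 0))\<rparr>"


section \<open>Shift actions\<close>

text \<open>
  \<open>shift_ZZ n\<close> is the \<open>n\<close>-th power of the generator \<open>\<sigma>\<close>, so that the sign \<open>(-1)\<^bsup>p-q\<^esup>\<close> of \<open>\<sigma>\<close> becomes
  \<open>(-1)\<^bsup>n(p-q)\<^esup>\<close>; the lemmas below state that powers compose correctly.
\<close>

definition shift_ZZ ::
    "int \<Rightarrow> (('o \<times> int) list, nat \<Rightarrow> nat \<Rightarrow> 'm::ab_group_add,
             ('o \<times> int) list, nat \<Rightarrow> nat \<Rightarrow> 'm) func"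
  where "shift_ZZ n =
    \<lparr>fobj = map (\<lambda>(X, p). (X, p + n)),
     fmor = (\<lambda>f j i. if j < length (tgt f) \<and> i < length (src f)
       then ksign (n * (snd (src f ! i) - snd (tgt f ! j))) (val f j i) else val f j i)\<rparr>"

definition shift_Tw ::
    "int \<Rightarrow> (('o, 'm::ab_group_add) twc, nat \<Rightarrow> nat \<Rightarrow> 'm,
             ('o, 'm) twc, nat \<Rightarrow> nat \<Rightarrow> 'm) func"
  where "shift_Tw n =
    \<lparr>fobj = (\<lambda>T. let \<delta> = fhm (shift_ZZ n) (tw_diff T) in (src \<delta>, val \<delta>)),
     fmor = (\<lambda>f. fmor (shift_ZZ n) (untwist f))\<rparr>"

lemma shift_ZZ_0: "shift_ZZ 0 = func_id"
  by (auto simp: shift_ZZ_def func_id_def ksign_def fun_eq_iff)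

lemma shift_ZZ_add: "shift_ZZ (m + n) = func_comp (shift_ZZ m) (shift_ZZ n)"
  by (auto simp: shift_ZZ_def func_comp_def fhm_def ksign_def fun_eq_iff algebra_simps
      case_prod_beta)

lemma shift_Tw_0: "shift_Tw 0 = func_id"
  by (simp add: shift_Tw_def shift_ZZ_0)
     (simp add: func_id_def fhm_def tw_diff_def untwist_def fun_eq_iff)

lemma shift_Tw_add: "shift_Tw (m + n) = func_comp (shift_Tw m) (shift_Tw n)"
  by (simp add: shift_Tw_def shift_ZZ_add)
     (simp add: func_comp_def fhm_def tw_diff_def untwist_def fun_eq_iff)


section \<open>Skew group categories\<close>

text \<open>
  The group is written additively, as is the group of integers in the application, and may be
  noncommutative. The object \<open>{X}\<close> is \<open>X\<close> itself, and \<open>a \<otimes> g\<close> is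
  \<^term>\<open>Poly_Mapping.single g a\<close>; \<open>component f g\<close> is the morphism \<open>gX \<rightarrow> Y\<close> in the summand of \<open>g\<close>.
\<close>

definition component ::
    "('g \<Rightarrow> ('o, 'm, 'o, 'm) func) \<Rightarrow> ('o, 'g \<Rightarrow>\<^sub>0 'm::zero) hmor \<Rightarrow> 'g \<Rightarrow> ('o, 'm) hmor"
  where "component \<rho> f g = HMor (fobj (\<rho> g) (src f)) (tgt f) (deg f) (Poly_Mapping.lookup (val f) g)"

definition skew ::
    "('o, 'm::ab_group_add, 'k) ainf \<Rightarrow> ('g::group_add \<Rightarrow> ('o, 'm, 'o, 'm) func) \<Rightarrow>
     ('o, 'g \<Rightarrow>\<^sub>0 'm, 'k) ainf"
  where "skew B \<rho> =
    \<lparr>Obj = Obj B,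
     Hom = (\<lambda>X Y p. {f. \<forall>g. Poly_Mapping.lookup f g \<in> Hom B (fobj (\<rho> g) X) Y p}),
     scl = (\<lambda>c. Poly_Mapping.map (scl B c)),
     mu = (\<lambda>fs. \<Sum>gs | length gs = length fs \<and>
         (\<forall>t<length fs. gs ! t \<in> Poly_Mapping.keys (val (fs ! t))).
       Poly_Mapping.single (sum_list gs)
         (mu B (map (\<lambda>t. fhm (\<rho> (sum_list (take t gs))) (component \<rho> (fs ! t) (gs ! t)))
           [0..<length fs])))\<rparr>"

end

theory Submission imports Defs
begin

text \<open>
  Forgetting the differentials turns a matrix over \<open>Tw(A) * \<int>\<close> into one over \<open>\<int>A * \<int>\<close>. A twisted complex
  \<open>(Y, \<delta>)\<close> over \<open>Tw(A) * \<int>\<close> has two differentials, \<open>\<delta>\<close> and the diagonal matrix \<open>D\<close> of the differentials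
  of the summands of \<open>Y\<close>, and it is sent to the twisted complex over \<open>\<int>A * \<int>\<close> with differential
  \<open>\<delta> + D\<close>. By multilinearity, inserting \<open>\<delta> + D\<close> everywhere is the same as inserting \<open>\<delta>\<close> everywhere
  and then \<open>D\<close> everywhere, so that the functor is strict; words in \<open>D\<close> alone contribute nothing by the
  Maurer--Cartan equation of the summands. The functor is bijective on morphism spaces. For \<open>\<delta> + D\<close>
  to be strictly triangular, the summands of \<open>Y\<close> have to be split into their own summands.
\<close>

section \<open>Signs and strings of morphisms\<close>

text \<open>Source and target must first be shown to be A-infinity categories. Compositions in
  \<open>ZZ\<close> and \<open>skew\<close> are finite sums over choices made letter by letter, of a
  summand or of a group element, so one lemma on such sums gives the relations of both, and nested
  expansions make compositions over the two skew categories comparable. Sums over inserted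
  differentials come without a bound; they are cut off at a word length \<open>L\<close>, and
  identities are proved for all large \<open>L\<close>, so that finitely many can be used at once.
  The obstacle on objects is that triangularity is judged by positions in the list \<open>Y\<close>.
  A nonzero differential of a summand is a diagonal entry of D, which no filtration by positions
  tolerates; after splitting it links different positions, and ordering first by \<delta> and then
  inside each summand serves both differentials. Splitting every summand would only reach lists of
  single shifted objects. Keeping summands with zero differential whole makes the functor surjective
  on objects, so that an inverse on cohomology can be chosen directly, without homotopies.\<close>

lemma ksign_zero [simp]: "ksign e 0 = 0"
  by (simp add: ksign_def)

lemma ksign_ksign: "ksign a (ksign b x) = ksign (a + b) x"
  by (auto simp: ksign_def)

lemma ksign_plus: "ksign e (x + y) = ksign e x + ksign e y"
  by (simp add: ksign_def)

lemma ksign_sum: "ksign e (sum f S) = (\<Sum>x\<in>S. ksign e (f x))"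
  by (simp add: ksign_def sum_negf)

lemma ksign_cong: "even (a - b) \<Longrightarrow> ksign a x = ksign b x"
  by (auto simp: ksign_def)

lemma ksign_even [simp]: "even e \<Longrightarrow> ksign e x = x"
  by (simp add: ksign_def)

lemma ksign_eq_0_iff [simp]: "ksign e x = 0 \<longleftrightarrow> x = 0"
  by (simp add: ksign_def)

lemma ksign_apply: "ksign e f x = ksign e (f x)"
  by (simp add: ksign_def)

lemma lookup_ksign: "Poly_Mapping.lookup (ksign e f) x = ksign e (Poly_Mapping.lookup f x)"
  by (simp add: ksign_def)

lemma sum_fun_eval: "(\<Sum>x\<in>S. f x) y = (\<Sum>x\<in>S. f x y)"
  by (induction S rule: infinite_finite_induct) auto

lemma sum_list_nth_lessThan: "(\<Sum>x\<leftarrow>xs. f x) = (\<Sum>t<length xs. f (xs ! t))"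
  by (simp add: sum_list_sum_nth atLeast0LessThan)

text \<open>Source and target are parameters because the same notion serves strings of morphisms and
  words with inserted letters, where an inserted letter is a loop at its object. The two ends are
  explicit so that the empty string has a meaning.\<close>

primrec path :: "('l \<Rightarrow> 'o) \<Rightarrow> ('l \<Rightarrow> 'o) \<Rightarrow> 'o \<Rightarrow> 'l list \<Rightarrow> 'o \<Rightarrow> bool" where
  "path sr tg T [] S \<longleftrightarrow> T = S"
| "path sr tg T (x # w) S \<longleftrightarrow> tg x = T \<and> path sr tg (sr x) w S"

lemma path_append: "path sr tg T (u @ v) S \<longleftrightarrow> (\<exists>U. path sr tg T u U \<and> path sr tg U v S)"
  by (induction u arbitrary: T) auto

lemma path_src_unique: "path sr tg T w S \<Longrightarrow> path sr tg T w S' \<Longrightarrow> S = S'"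
  by (induction w arbitrary: T) auto

lemma path_ends: "path sr tg T w S \<Longrightarrow> w \<noteq> [] \<Longrightarrow> T = tg (hd w) \<and> S = sr (last w)"
  by (induction w arbitrary: T) auto

text \<open>Unlike \<open>mors\<close>, this admits the empty string and names both ends, so that it
  distributes over concatenation and suits induction on strings.\<close>

definition pmors :: "('o, 'm, 'k) ainf \<Rightarrow> 'o \<Rightarrow> ('o, 'm) hmor list \<Rightarrow> 'o \<Rightarrow> bool"
  where "pmors A T as S \<longleftrightarrow> (\<forall>a\<in>set as. mor A a) \<and> path src tgt T as S"

lemma pmors_Nil [simp]: "pmors A T [] S \<longleftrightarrow> T = S"
  by (simp add: pmors_def)

lemma pmors_Cons [simp]: "pmors A T (a # as) S \<longleftrightarrow> mor A a \<and> tgt a = T \<and> pmors A (src a) as S"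
  by (auto simp: pmors_def)

lemma pmors_append: "pmors A T (as @ bs) S \<longleftrightarrow> (\<exists>U. pmors A T as U \<and> pmors A U bs S)"
  by (auto simp: pmors_def path_append)

lemma pmors_ends: "pmors A T w S \<Longrightarrow> w \<noteq> [] \<Longrightarrow> T = tgt (hd w) \<and> S = src (last w)"
  unfolding pmors_def using path_ends by metis

lemma path_successively:
  "as \<noteq> [] \<Longrightarrow> path sr tg T as S \<longleftrightarrow>
    T = tg (hd as) \<and> S = sr (last as) \<and> successively (\<lambda>b a. sr b = tg a) as"
proof (induction as arbitrary: T)
  case (Cons a as)
  then show ?case by (cases as) auto
qed simp

lemma mors_pmors: "mors A as \<longleftrightarrow> as \<noteq> [] \<and> (\<exists>T S. pmors A T as S)"
  unfolding mors_def pmors_def using path_successively by metis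

lemma pmors_obj: "pmors A T as S \<Longrightarrow> as \<noteq> [] \<Longrightarrow> T \<in> Obj A \<and> S \<in> Obj A"
proof (induction as arbitrary: T)
  case (Cons a as)
  then show ?case by (cases as) (auto simp: mor_def)
qed simp

lemma mor_HMor [simp]: "mor A (HMor X Y p a) \<longleftrightarrow> X \<in> Obj A \<and> Y \<in> Obj A \<and> a \<in> Hom A X Y p"
  by (simp add: mor_def)

lemma mu_mor_sel [simp]: "src (mu_mor A as) = src (last as)" "tgt (mu_mor A as) = tgt (hd as)"
  "deg (mu_mor A as) = (\<Sum>a\<leftarrow>as. deg a) + 2 - int (length as)" "val (mu_mor A as) = mu A as"
  by (simp_all add: mu_mor_def)

lemma sum_list_rdeg: "(\<Sum>a\<leftarrow>as. rdeg a) = (\<Sum>a\<leftarrow>as. deg a) - int (length as)"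
  by (induction as) auto

lemma fhm_sel [simp]: "src (fhm F a) = fobj F (src a)" "tgt (fhm F a) = fobj F (tgt a)"
  "deg (fhm F a) = deg a" "val (fhm F a) = fmor F a"
  by (simp_all add: fhm_def)

text \<open>The ways to bracket a nonempty middle part. They replace the index pairs (m, n) of the
  A-infinity relation, where m is the length of \<open>Q\<close> and n the length of
  \<open>R\<close>.\<close>

definition splits :: "'a list \<Rightarrow> ('a list \<times> 'a list \<times> 'a list) set"
  where "splits as = {(P, Q, R). P @ Q @ R = as \<and> Q \<noteq> []}"

lemma sum_splits:
  assumes "d = length as"
  shows "(\<Sum>(m, n) \<in> {(m, n). 1 \<le> m \<and> m + n \<le> d}.
      g (take (d - m - n) as) (take m (drop (d - m - n) as)) (drop (d - n) as)) =
    (\<Sum>(P, Q, R) \<in> splits as. g P Q R)"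
proof (rule sum.reindex_bij_witness[where
      i = "\<lambda>(P, Q, R). (length Q, length R)" and
      j = "\<lambda>(m, n). (take (d - m - n) as, take m (drop (d - m - n) as), drop (d - n) as)"])
  fix x assume "x \<in> splits as"
  then obtain P Q R where x: "x = (P, Q, R)" "as = P @ Q @ R" "Q \<noteq> []"
    by (auto simp: splits_def)
  show "(case case x of (P, Q, R) \<Rightarrow> (length Q, length R) of
      (m, n) \<Rightarrow> (take (d - m - n) as, take m (drop (d - m - n) as), drop (d - n) as)) = x"
    using x assms by auto
  show "(case x of (P, Q, R) \<Rightarrow> (length Q, length R)) \<in> {(m, n). 1 \<le> m \<and> m + n \<le> d}"
    using x assms by (auto simp: Suc_le_eq)
next
  fix y :: "nat \<times> nat" assume y: "y \<in> {(m, n). 1 \<le> m \<and> m + n \<le> d}"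
  obtain m n where mn: "y = (m, n)" by fastforce
  have "take m (drop (d - m - n) as) @ drop (d - n) as = drop (d - m - n) as"
    using append_take_drop_id[of m "drop (d - m - n) as"] y mn by simp
  then have "take (d - m - n) as @ take m (drop (d - m - n) as) @ drop (d - n) as = as"
    by simp
  then show "(case y of (m, n) \<Rightarrow> (take (d - m - n) as, take m (drop (d - m - n) as), drop (d - n) as)) \<in> splits as"
    using y mn assms by (auto simp: splits_def)
qed (use assms in auto)

lemma finite_splits [simp]: "finite (splits as)"
proof -
  have "splits as \<subseteq> (\<lambda>(a, b). (take a as, take b (drop a as), drop (a + b) as)) ` ({..length as} \<times> {..length as})"
  proof
    fix x assume "x \<in> splits as"
    then obtain P Q R where x: "x = (P, Q, R)" "as = P @ Q @ R" by (auto simp: splits_def)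
    then have "x = (case (length P, length Q) of (a, b) \<Rightarrow> (take a as, take b (drop a as), drop (a + b) as))"
      "(length P, length Q) \<in> {..length as} \<times> {..length as}"
      by auto
    then show "x \<in> (\<lambda>(a, b). (take a as, take b (drop a as), drop (a + b) as)) ` ({..length as} \<times> {..length as})"
      by blast
  qed
  then show ?thesis by (rule finite_subset) auto
qed

section \<open>Consequences of multilinearity and strict unitality\<close>

context ainf_category
begin

sublocale vs: vector_space "scl A" by (rule vector_space)

lemma Hom_0: "X \<in> Obj A \<Longrightarrow> Y \<in> Obj A \<Longrightarrow> 0 \<in> Hom A X Y p"
  using subspace vs.subspace_0 by blast

lemma Hom_add: "X \<in> Obj A \<Longrightarrow> Y \<in> Obj A \<Longrightarrow> a \<in> Hom A X Y p \<Longrightarrow> b \<in> Hom A X Y p \<Longrightarrow> a + b \<in> Hom A X Y p"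
  using subspace vs.subspace_add by blast

lemma Hom_scl: "X \<in> Obj A \<Longrightarrow> Y \<in> Obj A \<Longrightarrow> a \<in> Hom A X Y p \<Longrightarrow> scl A c a \<in> Hom A X Y p"
  using subspace vs.subspace_scale by blast

lemma Hom_minus: "X \<in> Obj A \<Longrightarrow> Y \<in> Obj A \<Longrightarrow> a \<in> Hom A X Y p \<Longrightarrow> - a \<in> Hom A X Y p"
  using subspace vs.subspace_neg by blast

lemma Hom_ksign: "X \<in> Obj A \<Longrightarrow> Y \<in> Obj A \<Longrightarrow> a \<in> Hom A X Y p \<Longrightarrow> ksign e a \<in> Hom A X Y p"
  by (simp add: ksign_def Hom_minus)

lemma Hom_sum: "X \<in> Obj A \<Longrightarrow> Y \<in> Obj A \<Longrightarrow> (\<And>s. s \<in> S \<Longrightarrow> f s \<in> Hom A X Y p) \<Longrightarrow> sum f S \<in> Hom A X Y p"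
  by (induction S rule: infinite_finite_induct) (auto intro: Hom_0 Hom_add)

lemma mu_in_Hom:
  "pmors A T as S \<Longrightarrow> as \<noteq> [] \<Longrightarrow> p = (\<Sum>a\<leftarrow>as. deg a) + 2 - int (length as) \<Longrightarrow> mu A as \<in> Hom A S T p"
  using mu_closed[of as] pmors_ends[of A T as S] by (auto simp: mors_pmors mu_mor_def)

lemma mu_zero_entry:
  assumes "mors A as" "a \<in> set as" "val a = 0"
  shows "mu A as = 0"
proof -
  obtain us vs where as: "as = us @ a # vs" using assms(2) split_list by metis
  have a: "a = HMor (src a) (tgt a) (deg a) (scl A 0 0)" using assms(3) by (cases a) simp
  have "mors A (us @ HMor (src a) (tgt a) (deg a) 0 # vs)" using assms a as by simp
  from mu_scl[OF this, of 0] show ?thesis using a as by simp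
qed

lemma mors_change_val:
  assumes "mors A (as @ a # bs)" "b \<in> Hom A (src a) (tgt a) (deg a)"
  shows "mors A (as @ HMor (src a) (tgt a) (deg a) b # bs)"
  using assms by (auto simp: mors_pmors pmors_append mor_def)

lemma mu_uminus:
  assumes "mors A (as @ HMor X Y p a # bs)"
  shows "mu A (as @ HMor X Y p (- a) # bs) = - mu A (as @ HMor X Y p a # bs)"
  using mu_scl[OF assms, of "-1"] by simp

lemma mu_ksign:
  assumes "mors A (as @ HMor X Y p a # bs)"
  shows "mu A (as @ HMor X Y p (ksign e a) # bs) = ksign e (mu A (as @ HMor X Y p a # bs))"
  using mu_uminus[OF assms] by (simp add: ksign_def)

lemma mu_sum:
  assumes "mors A (as @ HMor X Y p 0 # bs)" "\<And>s. s \<in> S \<Longrightarrow> f s \<in> Hom A X Y p"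
  shows "mu A (as @ HMor X Y p (sum f S) # bs) = (\<Sum>s\<in>S. mu A (as @ HMor X Y p (f s) # bs))"
proof -
  have XY: "X \<in> Obj A" "Y \<in> Obj A" using assms(1) by (auto simp: mors_pmors pmors_append)
  have m: "mors A (as @ HMor X Y p b # bs)" if "b \<in> Hom A X Y p" for b
    using mors_change_val[OF assms(1), of b] that by simp
  have z: "mu A (as @ HMor X Y p 0 # bs) = 0"
    by (rule mu_zero_entry[OF assms(1), of "HMor X Y p 0"]) auto
  show ?thesis using assms(2)
  proof (induction S rule: infinite_finite_induct)
    case (insert s S)
    have "mors A (as @ HMor X Y p (f s) # bs)" "mors A (as @ HMor X Y p (sum f S) # bs)"
      using insert by (auto intro!: m Hom_sum XY)
    from mu_add[OF this] insert show ?case by simp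
  qed (use z in auto)
qed

lemma pmors_mu_mor:
  assumes "pmors A T (P @ Q @ R) S" "Q \<noteq> []"
  shows "pmors A T (P @ mu_mor A Q # R) S"
proof -
  obtain U V where U: "pmors A T P U" "pmors A U Q V" "pmors A V R S"
    using assms(1) by (auto simp: pmors_append)
  have "mor A (mu_mor A Q)" using U assms(2) by (intro mu_closed) (auto simp: mors_pmors)
  then show ?thesis using U pmors_ends[OF U(2) assms(2)] by (auto simp: pmors_append)
qed

lemma mors_mu_mor: "mors A (P @ Q @ R) \<Longrightarrow> Q \<noteq> [] \<Longrightarrow> mors A (P @ mu_mor A Q # R)"
  using pmors_mu_mor by (fastforce simp: mors_pmors)

lemma relation_splits:
  assumes "mors A as"
  shows "(\<Sum>(P, Q, R) \<in> splits as. ksign (\<Sum>a\<leftarrow>R. rdeg a) (mu A (P @ mu_mor A Q # R))) = 0"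
  using ainf_relation[OF assms refl]
    sum_splits[OF refl, where as = as and g = "\<lambda>P Q R. ksign (\<Sum>a\<leftarrow>R. rdeg a) (mu A (P @ mu_mor A Q # R))"]
  by simp

text \<open>The composition of \<open>e\<close> with \<open>e'\<close> equals \<open>e'\<close>
  because \<open>e\<close> is a left unit, and \<open>e\<close> because \<open>e'\<close> is a right
  unit; the degree 0 makes the sign trivial.\<close>

lemma strict_unit_unique:
  assumes "X \<in> Obj A" "is_strict_unit A X e" "is_strict_unit A X e'"
  shows "e = e'"
proof -
  have m: "mor A (HMor X X 0 e)" "mor A (HMor X X 0 e')"
    using assms by (auto simp: is_strict_unit_def)
  have "ksign (deg (HMor X X 0 e')) (mu A [HMor X X 0 e, HMor X X 0 e']) = val (HMor X X 0 e')"
    using assms(2) m unfolding is_strict_unit_def by (metis hmor.sel(2))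
  moreover have "mu A [HMor X X 0 e, HMor X X 0 e'] = val (HMor X X 0 e)"
    using assms(3) m unfolding is_strict_unit_def by (metis hmor.sel(1))
  ultimately show ?thesis by simp
qed

lemma strict_unit_eq: "X \<in> Obj A \<Longrightarrow> is_strict_unit A X e \<Longrightarrow> strict_unit A X = e"
  unfolding strict_unit_def using strict_unit_unique by blast

lemma strict_unit_is: "X \<in> Obj A \<Longrightarrow> is_strict_unit A X (strict_unit A X)"
  using strict_unit_exists strict_unit_eq by metis

end

section \<open>Sums over the runs of an automaton\<close>

text \<open>
  A string of letters is read from left to right starting in state \<open>j\<close>. In state \<open>j\<close> the letter
  \<open>f\<close> may lead to any state \<open>k \<in> N f j\<close>, and then emits \<open>en f j k\<close>. Both the paths in a
  composition of matrices and the strings of group elements in a skew category are of this form.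
\<close>

primrec ex :: "('f \<Rightarrow> 'i \<Rightarrow> 'i set) \<Rightarrow> ('f \<Rightarrow> 'i \<Rightarrow> 'i \<Rightarrow> 'e) \<Rightarrow> 'f list \<Rightarrow> 'i \<Rightarrow>
    ('i \<Rightarrow> 'e list \<Rightarrow> 'm::comm_monoid_add) \<Rightarrow> 'm" where
  "ex N en [] = (\<lambda>j \<Phi>. \<Phi> j [])"
| "ex N en (f # fs) = (\<lambda>j \<Phi>. \<Sum>k\<in>N f j. ex N en fs k (\<lambda>i E. \<Phi> i (en f j k # E)))"

text \<open>The computations that contribute to \<open>ex\<close>. The sum itself is not taken over
  the pairs \<open>(i, E)\<close>, because different sequences of states may emit the same string
  and each of them counts.\<close>

primrec run :: "('f \<Rightarrow> 'i \<Rightarrow> 'i set) \<Rightarrow> ('f \<Rightarrow> 'i \<Rightarrow> 'i \<Rightarrow> 'e) \<Rightarrow> 'f list \<Rightarrow> 'i \<Rightarrow> 'i \<Rightarrow> 'e list \<Rightarrow> bool" where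
  "run N en [] = (\<lambda>j i E. i = j \<and> E = [])"
| "run N en (f # fs) = (\<lambda>j i E. \<exists>k\<in>N f j. \<exists>E'. E = en f j k # E' \<and> run N en fs k i E')"

lemma ex_cong:
  "(\<And>i E. run N en fs j i E \<Longrightarrow> \<Phi> i E = \<Psi> i E) \<Longrightarrow> ex N en fs j \<Phi> = ex N en fs j \<Psi>"
proof (induction fs arbitrary: j \<Phi> \<Psi>)
  case (Cons f fs)
  show ?case unfolding ex.simps
    by (intro sum.cong refl Cons.IH Cons.prems) auto
qed simp

lemma ex_append:
  "ex N en (fs @ gs) j \<Phi> = ex N en fs j (\<lambda>k E. ex N en gs k (\<lambda>i E'. \<Phi> i (E @ E')))"
  by (induction fs arbitrary: j \<Phi>) auto

lemma run_append:
  "run N en (fs @ gs) j i E \<longleftrightarrow> (\<exists>k E1 E2. E = E1 @ E2 \<and> run N en fs j k E1 \<and> run N en gs k i E2)"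
proof (induction fs arbitrary: j E)
  case (Cons f fs)
  show ?case
  proof
    assume "run N en ((f # fs) @ gs) j i E"
    then obtain k E' l E1 E2 where "k \<in> N f j" "E = en f j k # E'" "E' = E1 @ E2"
      "run N en fs k l E1" "run N en gs l i E2" using Cons by auto
    then show "\<exists>k E1 E2. E = E1 @ E2 \<and> run N en (f # fs) j k E1 \<and> run N en gs k i E2"
      by (intro exI[of _ l] exI[of _ "en f j k # E1"] exI[of _ E2]) auto
  next
    assume "\<exists>k E1 E2. E = E1 @ E2 \<and> run N en (f # fs) j k E1 \<and> run N en gs k i E2"
    then show "run N en ((f # fs) @ gs) j i E" using Cons by fastforce
  qed
qed auto

lemma run_length: "run N en fs j i E \<Longrightarrow> length E = length fs"
  by (induction fs arbitrary: j E) auto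

lemma ex_sum: "ex N en fs j (\<lambda>i E. \<Sum>x\<in>X. \<Phi> x i E) = (\<Sum>x\<in>X. ex N en fs j (\<Phi> x))"
proof (induction fs arbitrary: j \<Phi>)
  case (Cons f fs)
  show ?case unfolding ex.simps Cons.IH by (rule sum.swap)
qed simp

lemma ex_plus: "ex N en fs j (\<lambda>i E. \<Phi> i E + \<Psi> i E) = ex N en fs j \<Phi> + ex N en fs j \<Psi>"
  by (induction fs arbitrary: j \<Phi> \<Psi>) (auto simp: sum.distrib)

lemma ex_zero [simp]: "ex N en fs j (\<lambda>i E. 0) = 0"
  by (induction fs arbitrary: j) auto

lemma ex_zero_cong: "(\<And>i E. run N en fs j i E \<Longrightarrow> \<Phi> i E = 0) \<Longrightarrow> ex N en fs j \<Phi> = 0"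
  using ex_cong[of N en fs j \<Phi> "\<lambda>_ _. 0"] by simp

lemma ex_swap:
  "ex N en fs j (\<lambda>i E. ex N' en' gs k (\<Psi> i E)) = ex N' en' gs k (\<lambda>i' E'. ex N en fs j (\<lambda>i E. \<Psi> i E i' E'))"
proof (induction fs arbitrary: j \<Psi>)
  case (Cons f fs)
  show ?case unfolding ex.simps Cons.IH ex_sum ..
qed simp

text \<open>Additivity is asked for only on a set \<open>H\<close> closed under addition, since
  compositions are additive on hom spaces but not on the ambient vector space. With the identity for
  \<open>h\<close> it shows that an expansion stays in a hom space.\<close>

lemma ex_hom:
  assumes H: "0 \<in> H" "\<And>a b. a \<in> H \<Longrightarrow> b \<in> H \<Longrightarrow> a + b \<in> H"
    and h: "h 0 = 0" "\<And>a b. a \<in> H \<Longrightarrow> b \<in> H \<Longrightarrow> h (a + b) = h a + h b"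
    and "\<And>i E. run N en fs j i E \<Longrightarrow> \<Phi> i E \<in> H"
  shows "h (ex N en fs j \<Phi>) = ex N en fs j (\<lambda>i E. h (\<Phi> i E)) \<and> ex N en fs j \<Phi> \<in> H"
  using assms(5)
proof (induction fs arbitrary: j \<Phi>)
  case (Cons f fs)
  have IH: "h (ex N en fs k (\<lambda>i E. \<Phi> i (en f j k # E))) = ex N en fs k (\<lambda>i E. h (\<Phi> i (en f j k # E)))"
    "ex N en fs k (\<lambda>i E. \<Phi> i (en f j k # E)) \<in> H" if "k \<in> N f j" for k
    using that Cons.prems by (auto intro!: Cons.IH[THEN conjunct1] Cons.IH[THEN conjunct2])
  have "h (sum F S) = (\<Sum>x\<in>S. h (F x)) \<and> sum F S \<in> H" if "\<And>x. x \<in> S \<Longrightarrow> F x \<in> H" for F and S :: "'c set"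
    using that by (induction S rule: infinite_finite_induct) (auto simp: h H)
  from this[of "N f j" "\<lambda>k. ex N en fs k (\<lambda>i E. \<Phi> i (en f j k # E))"] IH
  show ?case by simp
qed simp

lemma ex_additive:
  assumes "h 0 = 0" "\<And>a b. h (a + b) = h a + h b"
  shows "h (ex N en fs j \<Phi>) = ex N en fs j (\<lambda>i E. h (\<Phi> i E))"
  using ex_hom[of UNIV h N en fs j \<Phi>] assms by simp

lemma ex_ksign: "ksign e (ex N en fs j \<Phi>) = ex N en fs j (\<lambda>i E. ksign e (\<Phi> i E))"
  by (rule ex_additive) (auto simp: ksign_plus)

text \<open>Extra transitions do no harm if they emit letters on which the summand vanishes. This
  serves to replace transition sets that depend on the letter by uniform ones.\<close>

lemma ex_neutral:
  assumes "\<And>f j. f \<in> set fs \<Longrightarrow> N f j \<subseteq> N' f j \<and> finite (N' f j)"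
    and "\<And>f j k. f \<in> set fs \<Longrightarrow> k \<in> N' f j - N f j \<Longrightarrow> bad (en f j k)"
    and "\<And>i E e. run N' en fs j i E \<Longrightarrow> e \<in> set E \<Longrightarrow> bad e \<Longrightarrow> \<Phi> i E = 0"
  shows "ex N en fs j \<Phi> = ex N' en fs j \<Phi>"
  using assms
proof (induction fs arbitrary: j \<Phi>)
  case (Cons f fs)
  have 1: "ex N en fs k (\<lambda>i E. \<Phi> i (en f j k # E)) = ex N' en fs k (\<lambda>i E. \<Phi> i (en f j k # E))"
    if "k \<in> N' f j" for k
  proof (rule Cons.IH)
    show "\<Phi> i (en f j k # E) = 0" if "run N' en fs k i E" "e \<in> set E" "bad e" for i E e
      using that \<open>k \<in> N' f j\<close> by (intro Cons.prems(3)[of i _ e]) auto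
  qed (use Cons.prems in auto)
  have "(\<Sum>k\<in>N f j. ex N' en fs k (\<lambda>i E. \<Phi> i (en f j k # E))) =
        (\<Sum>k\<in>N' f j. ex N' en fs k (\<lambda>i E. \<Phi> i (en f j k # E)))"
  proof (rule sum.mono_neutral_left)
    show "\<forall>k\<in>N' f j - N f j. ex N' en fs k (\<lambda>i E. \<Phi> i (en f j k # E)) = 0"
      using Cons.prems(2)[of f] Cons.prems(3) by (intro ballI ex_zero_cong) fastforce
  qed (use Cons.prems(1)[of f] in auto)
  moreover have "(\<Sum>k\<in>N f j. ex N en fs k (\<lambda>i E. \<Phi> i (en f j k # E))) =
      (\<Sum>k\<in>N f j. ex N' en fs k (\<lambda>i E. \<Phi> i (en f j k # E)))"
    using 1 Cons.prems(1)[of f j] by (intro sum.cong) auto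
  ultimately show ?case by simp
qed simp

lemma ex_proj: "ex N en fs j (\<lambda>i E. \<Phi> i (map q E)) = ex N (\<lambda>f j k. q (en f j k)) fs j \<Phi>"
proof (induction fs arbitrary: j \<Phi>)
  case (Cons f fs)
  show ?case unfolding ex.simps list.map by (intro sum.cong refl Cons.IH)
qed simp

lemma finite_run:
  assumes "\<And>f j. finite (N f j)"
  shows "finite {(i, E). run N en fs j i E}"
proof (induction fs arbitrary: j)
  case (Cons f fs)
  have "{(i, E). run N en (f # fs) j i E} \<subseteq>
    (\<Union>k\<in>N f j. (\<lambda>(i, E). (i, en f j k # E)) ` {(i, E). run N en fs k i E})"
    by auto
  then show ?case by (rule finite_subset) (intro finite_UN_I finite_imageI assms Cons.IH)
qed auto

lemma finite_run_ends:
  assumes "\<And>f j. finite (N f j)"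
  shows "finite {i. \<exists>E. run N en fs j i E}"
proof -
  have "{i. \<exists>E. run N en fs j i E} = fst ` {(i, E). run N en fs j i E}" by force
  then show ?thesis using finite_run[of N en fs j, OF assms] by simp
qed

text \<open>Two automata in series, the second one reading what the first one emits, act as a single
  automaton on pairs of states. All nested expansions are flattened in this way.\<close>

lemma ex_ex:
  assumes "\<And>f j. finite (N f j)" "\<And>e h. finite (M e h)"
  shows "ex N en fs j (\<lambda>i E. ex M em E h (\<lambda>g E'. \<Phi> (i, g) (zip E E'))) =
    ex (\<lambda>f (j, h). Sigma (N f j) (\<lambda>k. M (en f j k) h))
       (\<lambda>f (j, h) (k, h'). (en f j k, em (en f j k) h h')) fs (j, h) \<Phi>"
proof (induction fs arbitrary: j h \<Phi>)
  case (Cons f fs)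
  have "ex N en (f # fs) j (\<lambda>i E. ex M em E h (\<lambda>g E'. \<Phi> (i, g) (zip E E'))) =
    (\<Sum>k\<in>N f j. \<Sum>h'\<in>M (en f j k) h. ex N en fs k (\<lambda>i E. ex M em E h'
      (\<lambda>g E'. \<Phi> (i, g) ((en f j k, em (en f j k) h h') # zip E E'))))"
    by (simp add: ex_sum)
  also have "\<dots> = (\<Sum>k\<in>N f j. \<Sum>h'\<in>M (en f j k) h. ex (\<lambda>f (j, h). Sigma (N f j) (\<lambda>k. M (en f j k) h))
       (\<lambda>f (j, h) (k, h'). (en f j k, em (en f j k) h h')) fs (k, h')
       (\<lambda>s E. \<Phi> s ((en f j k, em (en f j k) h h') # E)))"
    by (intro sum.cong refl Cons.IH)
  also have "\<dots> = (\<Sum>(k, h')\<in>Sigma (N f j) (\<lambda>k. M (en f j k) h).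
       ex (\<lambda>f (j, h). Sigma (N f j) (\<lambda>k. M (en f j k) h))
       (\<lambda>f (j, h) (k, h'). (en f j k, em (en f j k) h h')) fs (k, h')
       (\<lambda>s E. \<Phi> s ((en f j k, em (en f j k) h h') # E)))"
    by (rule sum.Sigma) (auto simp: assms)
  finally show ?case by (auto intro!: sum.cong)
qed simp

text \<open>States may be renamed if transitions correspond bijectively and emit the same letters.
  The renaming \<open>\<psi>\<close> depends on the object reached in the string, and only valid
  states at that object are considered.\<close>

lemma ex_reindex:
  assumes "path sr tg T fs S" "valid T s"
    and "\<And>f s. f \<in> set fs \<Longrightarrow> valid (tg f) s \<Longrightarrow>
      bij_betw (\<psi> (sr f)) (N (\<beta> f) s) (N' f (\<psi> (tg f) s)) \<and>
      (\<forall>k\<in>N (\<beta> f) s. valid (sr f) k \<and> en (\<beta> f) s k = en' f (\<psi> (tg f) s) (\<psi> (sr f) k))"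
  shows "ex N en (map \<beta> fs) s (\<lambda>k E. \<Phi> (\<psi> S k) E) = ex N' en' fs (\<psi> T s) \<Phi>"
  using assms
proof (induction fs arbitrary: T s \<Phi>)
  case (Cons f fs)
  have f: "bij_betw (\<psi> (sr f)) (N (\<beta> f) s) (N' f (\<psi> T s))"
    "\<And>k. k \<in> N (\<beta> f) s \<Longrightarrow> valid (sr f) k \<and> en (\<beta> f) s k = en' f (\<psi> T s) (\<psi> (sr f) k)"
    using Cons.prems by auto
  have "ex N en (map \<beta> (f # fs)) s (\<lambda>k E. \<Phi> (\<psi> S k) E) =
    (\<Sum>k\<in>N (\<beta> f) s. ex N en (map \<beta> fs) k (\<lambda>i E. \<Phi> (\<psi> S i) (en (\<beta> f) s k # E)))" by simp
  also have "\<dots> = (\<Sum>k\<in>N (\<beta> f) s. ex N' en' fs (\<psi> (sr f) k) (\<lambda>i E. \<Phi> i (en' f (\<psi> T s) (\<psi> (sr f) k) # E)))"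
    using f Cons.prems by (intro sum.cong refl) (subst Cons.IH[symmetric], auto)
  also have "\<dots> = (\<Sum>k\<in>N' f (\<psi> T s). ex N' en' fs k (\<lambda>i E. \<Phi> i (en' f (\<psi> T s) k # E)))"
    by (rule sum.reindex_bij_betw[OF f(1)])
  finally show ?case by simp
qed simp

text \<open>A letter carries the difference of shifts p_(i-1) - p_i beside its morphism over
  \<open>A\<close>. Strings are written in the order of composition, so the letters behind
  \<open>x\<close> are those with smaller index, and the recursion yields the exponent in the
  definition of composition in \<int>A.\<close>

primrec sexp :: "(int \<times> ('o, 'm) hmor) list \<Rightarrow> int" where
  "sexp [] = 0"
| "sexp (x # E) = (\<Sum>y\<leftarrow>E. fst y) * rdeg (snd x) + sexp E"

lemma sexp_append:
  "sexp (E @ E') = sexp E + sexp E' + (\<Sum>y\<leftarrow>E'. fst y) * (\<Sum>x\<leftarrow>E. rdeg (snd x))"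
  by (induction E) (auto simp: algebra_simps)

text \<open>The filter on the final state turns a sum over all runs into a single entry of a
  composition.\<close>

definition smu :: "('o, 'm::ab_group_add, 'k) ainf \<Rightarrow> 'i \<Rightarrow> 'i \<Rightarrow> (int \<times> ('o, 'm) hmor) list \<Rightarrow> 'm"
  where "smu A i0 i E = (if i = i0 then ksign (sexp E) (mu A (map snd E)) else 0)"

text \<open>A split is determined by the lengths of its first two parts, so lists of equal length
  have corresponding splits.\<close>

lemma sum_splits_transfer:
  assumes "length E = length fs"
  shows "(\<Sum>(xs, ys, zs) \<in> splits fs. g (take (length xs) E) (take (length ys) (drop (length xs) E))
      (drop (length xs + length ys) E)) = (\<Sum>(P, Q, R) \<in> splits E. g P Q R)"
  unfolding sum_splits[OF refl, where as = E and g = g, symmetric]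
    sum_splits[OF assms, where g = "\<lambda>P Q R. g (take (length P) E) (take (length Q) (drop (length P) E))
      (drop (length P + length Q) E)", symmetric]
  using assms by (intro sum.cong refl) (auto simp: min_def)

lemma splits_map:
  "(\<Sum>(P, Q, R) \<in> splits (map q E). g P Q R) = (\<Sum>(P, Q, R) \<in> splits E. g (map q P) (map q Q) (map q R))"
  by (subst sum_splits_transfer[of "map q E" E, symmetric], simp)
     (auto intro!: sum.cong simp: splits_def)

section \<open>The relation for compositions that expand over runs\<close>

context ainf_category
begin

text \<open>
  If composition in a new category is a sum of signed compositions in \<open>A\<close> over the runs of an
  automaton, the relations of \<open>A\<close> along all runs add up to those of the new category. Here \<open>M ys\<close> is
  the composition of \<open>ys\<close> as a new letter.
\<close>

lemma expansion_relation:
  fixes N :: "'f \<Rightarrow> 'i \<Rightarrow> 'i set" and en :: "'f \<Rightarrow> 'i \<Rightarrow> 'i \<Rightarrow> int \<times> ('o, 'm) hmor" and M :: "'f list \<Rightarrow> 'f"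
    and dg :: "'f \<Rightarrow> int"
  assumes fin: "\<And>f k. finite (N f k)"
    and runs: "\<And>i E. run N en fs j i E \<Longrightarrow> mors A (map snd E)"
    and runsM: "\<And>xs ys zs i E. fs = xs @ ys @ zs \<Longrightarrow> ys \<noteq> [] \<Longrightarrow>
      run N en (xs @ M ys # zs) j i E \<Longrightarrow> mors A (map snd E)"
    and dg: "\<And>f k l. f \<in> set fs \<Longrightarrow> fst (en f k l) + deg (snd (en f k l)) = dg f"
    and enM: "\<And>xs ys zs k E1 l E2. fs = xs @ ys @ zs \<Longrightarrow> ys \<noteq> [] \<Longrightarrow> run N en xs j k E1 \<Longrightarrow>
      run N en ys k l E2 \<Longrightarrow> \<exists>v. en (M ys) k l = ((\<Sum>y\<leftarrow>E2. fst y),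
        HMor (src (mu_mor A (map snd E2))) (tgt (mu_mor A (map snd E2))) (deg (mu_mor A (map snd E2))) v)"
    and valM: "\<And>xs ys zs k E1 l. fs = xs @ ys @ zs \<Longrightarrow> ys \<noteq> [] \<Longrightarrow> run N en xs j k E1 \<Longrightarrow>
      val (snd (en (M ys) k l)) = ex N en ys k (smu A l)"
    and outM: "\<And>xs ys zs k E1 l. fs = xs @ ys @ zs \<Longrightarrow> ys \<noteq> [] \<Longrightarrow> run N en xs j k E1 \<Longrightarrow>
      l \<notin> N (M ys) k \<Longrightarrow> ex N en ys k (smu A l) = 0"
  shows "(\<Sum>(xs, ys, zs)\<in>splits fs. ksign (\<Sum>z\<leftarrow>zs. dg z - 1) (ex N en (xs @ M ys # zs) j (smu A i0))) = 0"
proof -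
  \<comment> \<open>\<open>U\<close> is a summand of the nested expansion, with the sign of the
    outer string times that of the inner one. \<open>Z\<close> is the matching summand of the
    relation of \<open>A\<close> for the run \<open>E1 @ E2 @ E3\<close>, with the sign of the whole
    run in front.\<close>
  define U where "U E1 E2 i E3 = (if i = i0
      then ksign (sexp (E1 @ ((\<Sum>y\<leftarrow>E2. fst y), mu_mor A (map snd E2)) # E3) + sexp E2)
        (mu A (map snd E1 @ mu_mor A (map snd E2) # map snd E3)) else 0)" for E1 E2 i E3
  define Z where "Z E1 E2 i E3 = (if i = i0
      then ksign (sexp (E1 @ E2 @ E3)) (ksign (\<Sum>a\<leftarrow>map snd E3. rdeg a)
        (mu A (map snd E1 @ mu_mor A (map snd E2) # map snd E3))) else 0)" for E1 E2 i E3
  have split: "ksign (\<Sum>z\<leftarrow>zs. dg z - 1) (ex N en (xs @ M ys # zs) j (smu A i0)) =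
      ex N en fs j (\<lambda>i E. Z (take (length xs) E) (take (length ys) (drop (length xs) E)) i
      (drop (length xs + length ys) E))"
    if fs: "fs = xs @ ys @ zs" and ys: "ys \<noteq> []" for xs ys zs
  proof -
    \<comment> \<open>The transitions of the composite letter \<open>M ys\<close> and the end states
      of runs over \<open>ys\<close> need not coincide. An end state that is no transition has value
      zero by \<open>outM\<close>, and a transition that no run reaches has value zero as an empty
      sum; both kinds are removed before the sums are compared.\<close>
    have inner: "(\<Sum>l\<in>N (M ys) k. ex N en zs l (\<lambda>i E3. smu A i0 i (E1 @ en (M ys) k l # E3))) =
        ex N en ys k (\<lambda>l E2. ex N en zs l (\<lambda>i E3. U E1 E2 i E3))"
      if E1: "run N en xs j k E1" for k E1
    proof -
      define ends where "ends = {l. \<exists>E. run N en ys k l E}"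
      have fin_ends: "finite ends" unfolding ends_def by (rule finite_run_ends[OF fin])
      let ?e = "\<lambda>l. snd (en (M ys) k l)"
      have z: "smu A i0 i (E1 @ en (M ys) k l # E3) = 0"
        if "mors A (map snd E1 @ HMor (src (?e l)) (tgt (?e l)) (deg (?e l)) v # map snd E3)"
          "val (?e l) = 0" for i l E3 v
      proof -
        have "src (?e l) \<in> Obj A" "tgt (?e l) \<in> Obj A" using that(1) by (auto simp: mors_pmors pmors_append)
        then have 0: "0 \<in> Hom A (src (?e l)) (tgt (?e l)) (deg (?e l))" by (rule Hom_0)
        have "mors A (map snd E1 @ HMor (src (?e l)) (tgt (?e l)) (deg (?e l)) 0 # map snd E3)"
          using mors_change_val[OF that(1), of 0] 0 by simp
        moreover have "HMor (src (?e l)) (tgt (?e l)) (deg (?e l)) 0 = ?e l" using that(2) by (cases "?e l") simp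
        ultimately have "mu A (map snd E1 @ ?e l # map snd E3) = 0"
          using that(2) by (intro mu_zero_entry[of _ "?e l"]) auto
        then show ?thesis by (simp add: smu_def)
      qed
      have mrun: "mors A (map snd E1 @ map snd E2 @ map snd E3)"
        if "run N en ys k l E2" "run N en zs l i E3" for l i E2 E3
      proof -
        have "run N en fs j i (E1 @ E2 @ E3)" using E1 that unfolding fs run_append by blast
        from runs[OF this] show ?thesis by simp
      qed
      have E2ne: "map snd E2 \<noteq> []" if "run N en ys k l E2" for l E2
        using ys run_length[OF that] by auto
      have A: "ex N en zs l (\<lambda>i E3. smu A i0 i (E1 @ en (M ys) k l # E3)) = 0"
        if l: "l \<in> ends" "l \<notin> N (M ys) k" for l
      proof (rule ex_zero_cong)
        fix i E3 assume E3: "run N en zs l i E3"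
        obtain E2 where E2: "run N en ys k l E2" using l by (auto simp: ends_def)
        obtain v where v: "en (M ys) k l = ((\<Sum>y\<leftarrow>E2. fst y), HMor (src (mu_mor A (map snd E2)))
            (tgt (mu_mor A (map snd E2))) (deg (mu_mor A (map snd E2))) v)"
          using enM[OF fs ys E1 E2] by blast
        have "mors A (map snd E1 @ mu_mor A (map snd E2) # map snd E3)"
          by (rule mors_mu_mor[OF mrun[OF E2 E3] E2ne[OF E2]])
        moreover have "HMor (src (?e l)) (tgt (?e l)) (deg (?e l)) (mu A (map snd E2)) = mu_mor A (map snd E2)"
          unfolding v by (simp add: mu_mor_def)
        moreover have "val (?e l) = 0" using valM[OF fs ys E1] outM[OF fs ys E1 l(2)] by simp
        ultimately show "smu A i0 i (E1 @ en (M ys) k l # E3) = 0" by (intro z[of _ "mu A (map snd E2)"]) simp_all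
      qed
      have B: "ex N en zs l (\<lambda>i E3. smu A i0 i (E1 @ en (M ys) k l # E3)) = 0"
        if l: "l \<notin> ends" "l \<in> N (M ys) k" for l
      proof (rule ex_zero_cong)
        fix i E3 assume E3: "run N en zs l i E3"
        have "run N en (xs @ M ys # zs) j i (E1 @ en (M ys) k l # E3)"
          unfolding run_append using E1 E3 l
          by (intro exI[of _ k] exI[of _ E1] exI[of _ "en (M ys) k l # E3"]) auto
        then have "mors A (map snd (E1 @ en (M ys) k l # E3))" by (rule runsM[OF fs ys])
        moreover have "HMor (src (?e l)) (tgt (?e l)) (deg (?e l)) (val (?e l)) = ?e l" by simp
        moreover have "val (?e l) = 0"
          unfolding valM[OF fs ys E1] using l by (intro ex_zero_cong) (auto simp: smu_def ends_def)
        ultimately show "smu A i0 i (E1 @ en (M ys) k l # E3) = 0" by (intro z[of _ "val (?e l)"]) simp_all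
      qed
      \<comment> \<open>At an end state the value of the composite letter is itself a sum over runs,
        and linearity in this one letter moves the sum out of the outer composition.\<close>
      have C: "ex N en zs l (\<lambda>i E3. smu A i0 i (E1 @ en (M ys) k l # E3)) =
          ex N en zs l (\<lambda>i E3. ex N en ys k (\<lambda>l' E2. if l' = l then U E1 E2 i E3 else 0))"
        if l: "l \<in> ends" for l
      proof (rule ex_cong)
        fix i E3 assume E3: "run N en zs l i E3"
        obtain E20 where E20: "run N en ys k l E20" using l by (auto simp: ends_def)
        have sk: "\<exists>v. en (M ys) k l = ((\<Sum>y\<leftarrow>E2. fst y), HMor (src (mu_mor A (map snd E2)))
            (tgt (mu_mor A (map snd E2))) (deg (mu_mor A (map snd E2))) v)" if "run N en ys k l E2" for E2
          using enM[OF fs ys E1 that] by blast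
        let ?H = "\<lambda>v. HMor (src (?e l)) (tgt (?e l)) (deg (?e l)) v"
        let ?h = "\<lambda>v. mu A (map snd E1 @ ?H v # map snd E3)"
        let ?Hom = "Hom A (src (?e l)) (tgt (?e l)) (deg (?e l))"
        have sk2: "?H (mu A (map snd E2)) = mu_mor A (map snd E2)" if "run N en ys k l E2" for E2
          using sk[OF that] by (auto simp: mu_mor_def)
        have m: "mors A (map snd E1 @ mu_mor A (map snd E2) # map snd E3)" if "run N en ys k l E2" for E2
          by (rule mors_mu_mor[OF mrun[OF that E3] E2ne[OF that]])
        have m0: "mors A (map snd E1 @ ?H (mu A (map snd E20)) # map snd E3)"
          using m[OF E20] sk2[OF E20] by simp
        have obj: "src (?e l) \<in> Obj A" "tgt (?e l) \<in> Obj A" using m0 by (auto simp: mors_pmors pmors_append)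
        have mv: "mors A (map snd E1 @ ?H v # map snd E3)" if "v \<in> ?Hom" for v
          using mors_change_val[OF m0, of v] that by simp
        have hz: "?h 0 = 0"
          by (rule mu_zero_entry[of _ "?H 0"]) (use obj in \<open>auto intro!: mv Hom_0\<close>)
        have ha: "?h (a + b) = ?h a + ?h b" if "a \<in> ?Hom" "b \<in> ?Hom" for a b
          by (intro mu_add mv that)
        have in_Hom: "smu A l l' E2 \<in> ?Hom" if E2: "run N en ys k l' E2" for l' E2
        proof (cases "l' = l")
          case True
          then have r: "run N en ys k l E2" using E2 by simp
          have "mor A (mu_mor A (map snd E2))" using m[OF r] by (auto simp: mors_pmors pmors_append)
          then have "mu A (map snd E2) \<in> ?Hom" unfolding sk2[OF r, symmetric] by simp
          then show ?thesis using True obj by (simp add: smu_def Hom_ksign)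
        qed (simp add: smu_def Hom_0 obj)
        have hex: "?h (ex N en ys k (smu A l)) = ex N en ys k (\<lambda>l' E2. ?h (smu A l l' E2))"
          by (rule ex_hom[THEN conjunct1, of ?Hom]) (use obj hz ha in_Hom in \<open>auto intro: Hom_0 Hom_add\<close>)
        have "?e l = ?H (ex N en ys k (smu A l))" using valM[OF fs ys E1, of l] by (cases "?e l") simp
        then have "smu A i0 i (E1 @ en (M ys) k l # E3) = (if i = i0 then ksign (sexp (E1 @ en (M ys) k l # E3))
            (ex N en ys k (\<lambda>l' E2. ?h (smu A l l' E2))) else 0)"
          unfolding smu_def[of A i0] hex[symmetric] by simp
        also have "\<dots> = ex N en ys k (\<lambda>l' E2. if i = i0 then ksign (sexp (E1 @ en (M ys) k l # E3)) (?h (smu A l l' E2)) else 0)"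
          by (simp add: ex_ksign)
        also have "\<dots> = ex N en ys k (\<lambda>l' E2. if l' = l then U E1 E2 i E3 else 0)"
        proof (rule ex_cong)
          fix l' E2 assume E2: "run N en ys k l' E2"
          show "(if i = i0 then ksign (sexp (E1 @ en (M ys) k l # E3)) (?h (smu A l l' E2)) else 0) =
            (if l' = l then U E1 E2 i E3 else 0)"
          proof (cases "l' = l")
            case True
            then have r: "run N en ys k l E2" using E2 by simp
            have "?h (ksign (sexp E2) (mu A (map snd E2))) = ksign (sexp E2) (?h (mu A (map snd E2)))"
              using m[OF r] unfolding sk2[OF r, symmetric] by (rule mu_ksign)
            moreover have "sexp (E1 @ en (M ys) k l # E3) =
                sexp (E1 @ ((\<Sum>y\<leftarrow>E2. fst y), mu_mor A (map snd E2)) # E3)"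
              using sk[OF r] by (auto simp: sexp_append)
            ultimately show ?thesis using True by (simp add: U_def smu_def ksign_ksign sk2[OF r])
          qed (simp add: smu_def hz)
        qed
        finally show "smu A i0 i (E1 @ en (M ys) k l # E3) =
            ex N en ys k (\<lambda>l' E2. if l' = l then U E1 E2 i E3 else 0)" .
      qed
      have "(\<Sum>l\<in>N (M ys) k. ex N en zs l (\<lambda>i E3. smu A i0 i (E1 @ en (M ys) k l # E3))) =
          (\<Sum>l\<in>N (M ys) k \<union> ends. ex N en zs l (\<lambda>i E3. smu A i0 i (E1 @ en (M ys) k l # E3)))"
        by (rule sum.mono_neutral_left) (use A fin fin_ends in auto)
      also have "\<dots> = (\<Sum>l\<in>ends. ex N en zs l (\<lambda>i E3. smu A i0 i (E1 @ en (M ys) k l # E3)))"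
        by (rule sum.mono_neutral_right) (use B fin fin_ends in auto)
      also have "\<dots> = (\<Sum>l\<in>ends. ex N en ys k (\<lambda>l' E2. ex N en zs l (\<lambda>i E3. if l' = l then U E1 E2 i E3 else 0)))"
        by (intro sum.cong refl) (simp add: C ex_swap[of _ _ zs])
      also have "\<dots> = ex N en ys k (\<lambda>l' E2. \<Sum>l\<in>ends. ex N en zs l (\<lambda>i E3. if l' = l then U E1 E2 i E3 else 0))"
        by (simp add: ex_sum)
      also have "\<dots> = ex N en ys k (\<lambda>l E2. ex N en zs l (\<lambda>i E3. U E1 E2 i E3))"
      proof (rule ex_cong)
        fix l' E2 assume "run N en ys k l' E2"
        then have l': "l' \<in> ends" by (auto simp: ends_def)
        have "(\<Sum>l\<in>ends. ex N en zs l (\<lambda>i E3. if l' = l then U E1 E2 i E3 else 0)) =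
          (\<Sum>l\<in>ends. if l' = l then ex N en zs l (\<lambda>i E3. U E1 E2 i E3) else 0)"
          by (intro sum.cong) auto
        also have "\<dots> = ex N en zs l' (\<lambda>i E3. U E1 E2 i E3)" using l' fin_ends by simp
        finally show "(\<Sum>l\<in>ends. ex N en zs l (\<lambda>i E3. if l' = l then U E1 E2 i E3 else 0)) =
          ex N en zs l' (\<lambda>i E3. U E1 E2 i E3)" .
      qed
      finally show ?thesis .
    qed
    \<comment> \<open>The degree of a letter is its shift difference plus the degree of the emitted
      morphism, whatever the states are; hence the sign of \<open>zs\<close> can be computed along
      any run.\<close>
    have dgsum: "(\<Sum>z\<leftarrow>zs. dg z - 1) = (\<Sum>y\<leftarrow>E3. fst y) + (\<Sum>a\<leftarrow>map snd E3. rdeg a)"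
      if "run N en zs l i E3" for l i E3
    proof -
      have "set zs' \<subseteq> set fs \<Longrightarrow> run N en zs' l i E \<Longrightarrow>
          (\<Sum>z\<leftarrow>zs'. dg z - 1) = (\<Sum>y\<leftarrow>E. fst y) + (\<Sum>a\<leftarrow>map snd E. rdeg a)" for zs' l E
        by (induction zs' arbitrary: l E) (auto simp: dg[symmetric])
      then show ?thesis using that fs by auto
    qed
    have "ksign (\<Sum>z\<leftarrow>zs. dg z - 1) (ex N en (xs @ M ys # zs) j (smu A i0)) =
        ksign (\<Sum>z\<leftarrow>zs. dg z - 1) (ex N en xs j (\<lambda>k E1. ex N en ys k (\<lambda>l E2. ex N en zs l (\<lambda>i E3. U E1 E2 i E3))))"
      unfolding ex_append ex.simps by (intro arg_cong[of _ _ "ksign _"] ex_cong inner)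
    also have "\<dots> = ex N en xs j (\<lambda>k E1. ex N en ys k (\<lambda>l E2. ex N en zs l (\<lambda>i E3.
        ksign (\<Sum>z\<leftarrow>zs. dg z - 1) (U E1 E2 i E3))))"
      by (simp add: ex_ksign)
    also have "\<dots> = ex N en xs j (\<lambda>k E1. ex N en ys k (\<lambda>l E2. ex N en zs l (\<lambda>i E3. Z E1 E2 i E3)))"
    proof (intro ex_cong)
      fix k E1 l E2 i E3
      assume r: "run N en xs j k E1" "run N en ys k l E2" "run N en zs l i E3"
      define a b c where "a = (\<Sum>a\<leftarrow>map snd E1. rdeg a)" "b = (\<Sum>a\<leftarrow>map snd E2. rdeg a)" "c = (\<Sum>a\<leftarrow>map snd E3. rdeg a)"
      define u v w where "u = (\<Sum>y\<leftarrow>E1. fst y)" "v = (\<Sum>y\<leftarrow>E2. fst y)" "w = (\<Sum>y\<leftarrow>E3. fst y)"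
      \<comment> \<open>A composition of degree 2 - d raises the total reduced degree by one. The
        exponent of the merged string therefore exceeds that of the run by \<open>w\<close>, the
        total shift along \<open>E3\<close>, and this is cancelled by the shift part of the sign of
        \<open>zs\<close>.\<close>
      have "rdeg (mu_mor A (map snd E2)) = b + 1"
        unfolding a_b_c_def(2) sum_list_rdeg by simp
      then have s1: "sexp (E1 @ ((\<Sum>y\<leftarrow>E2. fst y), mu_mor A (map snd E2)) # E3) = 
          sexp E1 + (w * (b + 1) + sexp E3) + (v + w) * a"
        by (simp add: sexp_append a_b_c_def u_v_w_def comp_def algebra_simps)
      have s2: "sexp (E1 @ E2 @ E3) = sexp E1 + (sexp E2 + sexp E3 + w * b) + (v + w) * a"
        by (simp add: sexp_append a_b_c_def u_v_w_def comp_def)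
      show "ksign (\<Sum>z\<leftarrow>zs. dg z - 1) (U E1 E2 i E3) = Z E1 E2 i E3"
        unfolding U_def Z_def dgsum[OF r(3)] s1 s2
        by (auto simp: ksign_ksign a_b_c_def(3)[symmetric] u_v_w_def(3)[symmetric] algebra_simps
            intro!: ksign_cong)
    qed
    also have "\<dots> = ex N en fs j (\<lambda>i E. Z (take (length xs) E) (take (length ys) (drop (length xs) E)) i
      (drop (length xs + length ys) E))"
      unfolding fs ex_append by (intro ex_cong) (simp add: run_length)
    finally show ?thesis .
  qed
  have "(\<Sum>(xs, ys, zs)\<in>splits fs. ksign (\<Sum>z\<leftarrow>zs. dg z - 1) (ex N en (xs @ M ys # zs) j (smu A i0))) =
    (\<Sum>(xs, ys, zs)\<in>splits fs. ex N en fs j (\<lambda>i E. Z (take (length xs) E) (take (length ys) (drop (length xs) E)) i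
      (drop (length xs + length ys) E)))"
  proof (rule sum.cong)
    fix x assume "x \<in> splits fs"
    then obtain xs ys zs where "x = (xs, ys, zs)" "fs = xs @ ys @ zs" "ys \<noteq> []"
      by (auto simp: splits_def)
    with split[of xs ys zs] show "(case x of (xs, ys, zs) \<Rightarrow> ksign (\<Sum>z\<leftarrow>zs. dg z - 1) (ex N en (xs @ M ys # zs) j (smu A i0))) =
      (case x of (xs, ys, zs) \<Rightarrow> ex N en fs j (\<lambda>i E. Z (take (length xs) E) (take (length ys) (drop (length xs) E)) i
      (drop (length xs + length ys) E)))"
      by simp
  qed simp
  also have "\<dots> = ex N en fs j (\<lambda>i E. \<Sum>(xs, ys, zs)\<in>splits fs. Z (take (length xs) E) (take (length ys) (drop (length xs) E)) i
      (drop (length xs + length ys) E))"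
    unfolding case_prod_beta by (rule ex_sum[symmetric])
  also have "\<dots> = 0"
  proof (rule ex_zero_cong)
    fix i E assume r: "run N en fs j i E"
    have "(\<Sum>(xs, ys, zs)\<in>splits fs. Z (take (length xs) E) (take (length ys) (drop (length xs) E)) i
      (drop (length xs + length ys) E)) = (\<Sum>(P, Q, R)\<in>splits E. Z P Q i R)"
      by (rule sum_splits_transfer[OF run_length[OF r]])
    also have "\<dots> = (\<Sum>(P, Q, R)\<in>splits E. if i = i0 then ksign (sexp E) (ksign (\<Sum>a\<leftarrow>map snd R. rdeg a)
        (mu A (map snd P @ mu_mor A (map snd Q) # map snd R))) else 0)"
      by (rule sum.cong) (auto simp: Z_def splits_def)
    also have "\<dots> = (if i = i0 then ksign (sexp E) (\<Sum>(P, Q, R)\<in>splits (map snd E).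
        ksign (\<Sum>a\<leftarrow>R. rdeg a) (mu A (P @ mu_mor A Q # R))) else 0)"
      unfolding splits_map by (simp add: ksign_sum case_prod_beta)
    also have "\<dots> = 0" by (simp add: relation_splits[OF runs[OF r]])
    finally show "(\<Sum>(xs, ys, zs)\<in>splits fs. Z (take (length xs) E) (take (length ys) (drop (length xs) E)) i
      (drop (length xs + length ys) E)) = 0" .
  qed
  finally show ?thesis .
qed

end

section \<open>The category \<open>\<int>A\<close> is an \<open>A\<^sub>\<infinity>\<close>-category\<close>

text \<open>The states are the indices of the summands. Checking that \<open>j\<close> is in range
  at this place reproduces the range conditions of \<open>paths\<close>, so that runs and paths
  correspond.\<close>

definition Nz :: "(('o \<times> int) list, nat \<Rightarrow> nat \<Rightarrow> 'm) hmor \<Rightarrow> nat \<Rightarrow> nat set"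
  where "Nz f j = (if j < length (tgt f) then {..<length (src f)} else {})"

definition ez :: "(('o \<times> int) list, nat \<Rightarrow> nat \<Rightarrow> 'm) hmor \<Rightarrow> nat \<Rightarrow> nat \<Rightarrow> int \<times> ('o, 'm) hmor"
  where "ez f j k = (snd (src f ! k) - snd (tgt f ! j), entry f j k)"

lemma finite_Nz [simp]: "finite (Nz f j)"
  by (simp add: Nz_def)

lemma entry_sel [simp]: "src (entry f j i) = fst (src f ! i)" "tgt (entry f j i) = fst (tgt f ! j)"
  "deg (entry f j i) = deg f - snd (src f ! i) + snd (tgt f ! j)" "val (entry f j i) = val f j i"
  by (simp_all add: entry_def)

lemma paths_Nil: "paths [] j i = (if i = j then {[j]} else {})"
  by (auto simp: paths_def length_Suc_conv)

lemma paths_Cons: "paths (f # fs) j i = (\<Union>k\<in>Nz f j. (#) j ` paths fs k i)"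
proof (intro equalityI subsetI)
  fix ks assume ks: "ks \<in> paths (f # fs) j i"
  then obtain is' where is': "ks = j # is'" by (cases ks) (auto simp: paths_def)
  have b: "j < length (tgt f) \<and> is' ! 0 < length (src f)"
    using ks unfolding is' paths_def by fastforce
  have "\<forall>t<length fs. is' ! t < length (tgt (fs ! t)) \<and> is' ! Suc t < length (src (fs ! t))"
    using ks unfolding is' paths_def by fastforce
  then have "is' \<in> paths fs (is' ! 0) i" using ks unfolding is' paths_def by auto
  then show "ks \<in> (\<Union>k\<in>Nz f j. (#) j ` paths fs k i)" using b is' by (auto simp: Nz_def)
next
  fix ks assume "ks \<in> (\<Union>k\<in>Nz f j. (#) j ` paths fs k i)"
  then show "ks \<in> paths (f # fs) j i"
    by (auto simp: Nz_def paths_def less_Suc_eq_0_disj split: if_splits)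
qed

lemma finite_paths [simp]: "finite (paths fs j i)"
  by (induction fs arbitrary: j) (auto simp: paths_Nil paths_Cons)

lemma sum_paths:
  "(\<Sum>ks\<in>paths fs j i. \<Phi> (map (\<lambda>t. ez (fs ! t) (ks ! t) (ks ! Suc t)) [0..<length fs])) =
    ex Nz ez fs j (\<lambda>i' E. if i' = i then \<Phi> E else 0)"
proof (induction fs arbitrary: j \<Phi>)
  case (Cons f fs)
  have "(\<Sum>ks\<in>paths (f # fs) j i. \<Phi> (map (\<lambda>t. ez ((f # fs) ! t) (ks ! t) (ks ! Suc t)) [0..<length (f # fs)])) =
    (\<Sum>k\<in>Nz f j. \<Sum>ks\<in>(#) j ` paths fs k i. \<Phi> (map (\<lambda>t. ez ((f # fs) ! t) (ks ! t) (ks ! Suc t)) [0..<length (f # fs)]))"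
    unfolding paths_Cons
  proof (rule sum.UNION_disjoint)
    show "\<forall>k\<in>Nz f j. \<forall>l\<in>Nz f j. k \<noteq> l \<longrightarrow> (#) j ` paths fs k i \<inter> (#) j ` paths fs l i = {}"
      by (auto simp: paths_def)
  qed auto
  also have "\<dots> = (\<Sum>k\<in>Nz f j. \<Sum>ks\<in>paths fs k i.
      \<Phi> (ez f j k # map (\<lambda>t. ez (fs ! t) (ks ! t) (ks ! Suc t)) [0..<length fs]))"
  proof (rule sum.cong[OF refl])
    fix k
    have "\<Phi> (map (\<lambda>t. ez ((f # fs) ! t) ((j # ks) ! t) ((j # ks) ! Suc t)) [0..<length (f # fs)]) =
        \<Phi> (ez f j k # map (\<lambda>t. ez (fs ! t) (ks ! t) (ks ! Suc t)) [0..<length fs])"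
      if "ks \<in> paths fs k i" for ks
    proof -
      have "ks ! 0 = k" using that by (simp add: paths_def)
      then show ?thesis by (simp add: map_upt_Suc del: upt_Suc)
    qed
    then show "(\<Sum>ks\<in>(#) j ` paths fs k i. \<Phi> (map (\<lambda>t. ez ((f # fs) ! t) (ks ! t) (ks ! Suc t)) [0..<length (f # fs)])) =
      (\<Sum>ks\<in>paths fs k i. \<Phi> (ez f j k # map (\<lambda>t. ez (fs ! t) (ks ! t) (ks ! Suc t)) [0..<length fs]))"
      by (subst sum.reindex) (auto simp: inj_on_def simp del: upt_Suc intro!: sum.cong)
  qed
  also have "\<dots> = ex Nz ez (f # fs) j (\<lambda>i' E. if i' = i then \<Phi> E else 0)"
    using Cons.IH[where \<Phi> = "\<lambda>E. \<Phi> (ez f j _ # E)"] by simp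
  finally show ?case .
qed (auto simp: paths_Nil)

text \<open>Matches the recursive exponent with the double sum in
  \<open>shift_exponent\<close>.\<close>

lemma sexp_nth: "sexp E = (\<Sum>u<length E. \<Sum>t<u. fst (E ! u) * rdeg (snd (E ! t)))"
proof (induction E)
  case (Cons x E)
  have "(\<Sum>u<length (x # E). \<Sum>t<u. fst ((x # E) ! u) * rdeg (snd ((x # E) ! t))) =
    (\<Sum>u<length E. fst (E ! u) * rdeg (snd x) + (\<Sum>t<u. fst (E ! u) * rdeg (snd (E ! t))))"
    by (simp add: sum.lessThan_Suc_shift del: sum.lessThan_Suc)
  then show ?case using Cons by (simp add: sum.distrib sum_distrib_right sum_list_nth_lessThan)
qed simp

lemma mu_ZZ: "mu (ZZ A) fs j i = ex Nz ez fs j (smu A i)"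
proof -
  have "mu (ZZ A) fs j i = (\<Sum>ks\<in>paths fs j i. (\<lambda>E. ksign (sexp E) (mu A (map snd E)))
      (map (\<lambda>t. ez (fs ! t) (ks ! t) (ks ! Suc t)) [0..<length fs]))"
    by (auto simp: ZZ_def shift_exponent_def sexp_nth ez_def comp_def intro!: sum.cong)
  also have "\<dots> = ex Nz ez fs j (smu A i)"
    using sum_paths[where \<Phi> = "\<lambda>E. ksign (sexp E) (mu A (map snd E))"]
    by (rule trans) (simp add: smu_def cong: ex_cong)
  finally show ?thesis .
qed

lemma ZZ_sel: "Obj (ZZ A) = {X. \<forall>x\<in>set X. fst x \<in> Obj A}"
  "f \<in> Hom (ZZ A) X Y r \<longleftrightarrow> (\<forall>j i. if j < length Y \<and> i < length X
       then f j i \<in> Hom A (fst (X ! i)) (fst (Y ! j)) (r - snd (X ! i) + snd (Y ! j)) else f j i = 0)"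
  "scl (ZZ A) = (\<lambda>c f j i. scl A c (f j i))"
  by (simp_all add: ZZ_def)

lemma mor_ZZ_entry:
  assumes "mor (ZZ A) f" "j < length (tgt f)" "i < length (src f)"
  shows "mor A (entry f j i)"
  using assms by (auto simp: mor_def ZZ_sel)

text \<open>The shift differences along a run telescope, so the total shift and the total degree
  depend on the two ends only. The disjunction covers the empty string, in which no letter forces
  \<open>j\<close> to be in range.\<close>

lemma run_ZZ:
  assumes "pmors (ZZ A) T fs S" "run Nz ez fs j i E" "fs \<noteq> [] \<or> j < length T"
  shows "j < length T \<and> i < length S \<and> pmors A (fst (T ! j)) (map snd E) (fst (S ! i)) \<and>
    (\<Sum>y\<leftarrow>E. fst y) = snd (S ! i) - snd (T ! j) \<and>
    (\<Sum>y\<leftarrow>E. deg (snd y)) = (\<Sum>f\<leftarrow>fs. deg f) - (snd (S ! i) - snd (T ! j))"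
  using assms
proof (induction fs arbitrary: T j E)
  case (Cons f fs)
  then obtain k E' where k: "k \<in> Nz f j" "E = ez f j k # E'" "run Nz ez fs k i E'" by auto
  have r: "j < length T" "k < length (src f)" "T = tgt f" "mor (ZZ A) f"
    using k(1) Cons.prems(1) by (auto simp: Nz_def split: if_splits)
  from Cons.IH[OF _ k(3), of "src f"] Cons.prems r mor_ZZ_entry[of A f j k]
  show ?case by (auto simp: k(2) ez_def algebra_simps)
qed auto

lemma run_append_Cons:
  "run N en as j k E \<Longrightarrow> l \<in> N f k \<Longrightarrow> run N en bs l i E' \<Longrightarrow>
    run N en (as @ f # bs) j i (E @ en f k l # E')"
  unfolding run_append by (intro exI[of _ k] exI[of _ E] exI[of _ "en f k l # E'"]) auto

lemma ex_append_Cons: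
  "ex N en (as @ f # bs) j \<Phi> =
    ex N en as j (\<lambda>k E. \<Sum>l\<in>N f k. ex N en bs l (\<lambda>i E'. \<Phi> i (E @ en f k l # E')))"
  by (simp add: ex_append)

lemma Nz_HMor [simp]: "Nz (HMor X Y p a) j = (if j < length Y then {..<length X} else {})"
  by (simp add: Nz_def)

lemma ez_HMor: "ez (HMor X Y p a) j k =
  (snd (X ! k) - snd (Y ! j), HMor (fst (X ! k)) (fst (Y ! j)) (p - snd (X ! k) + snd (Y ! j)) (a j k))"
  by (simp add: ez_def entry_def)

section \<open>The axioms for \<int>A\<close>

context ainf_category
begin

lemma run_ZZ_mors:
  assumes "mors (ZZ A) fs" "run Nz ez fs j i E"
  shows "mors A (map snd E)"
proof -
  obtain T S where "pmors (ZZ A) T fs S" "fs \<noteq> []" using assms(1) by (auto simp: mors_pmors)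
  with run_ZZ[OF this(1) assms(2)] run_length[OF assms(2)] show ?thesis by (auto simp: mors_pmors)
qed

lemma smu_zero_entry: "mors A (map snd E) \<Longrightarrow> e \<in> set E \<Longrightarrow> val (snd e) = 0 \<Longrightarrow> smu A i i' E = 0"
  using mu_zero_entry[of "map snd E" "snd e"] by (auto simp: smu_def)

lemma mu_ZZ_outside:
  assumes "pmors (ZZ A) T fs S" "fs \<noteq> []" "\<not> (j < length T \<and> i < length S)"
  shows "mu (ZZ A) fs j i = 0"
  unfolding mu_ZZ
proof (rule ex_zero_cong)
  fix i' E assume "run Nz ez fs j i' E"
  from run_ZZ[OF assms(1) this] assms(2,3) show "smu A i i' E = 0" by (auto simp: smu_def)
qed

lemma ZZ_vector_space: "vector_space (scl (ZZ A))"
  by unfold_locales (auto simp: ZZ_sel fun_eq_iff vs.scale_right_distrib vs.scale_left_distrib)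

lemma ZZ_subspace:
  assumes "X \<in> Obj (ZZ A)" "Y \<in> Obj (ZZ A)"
  shows "module.subspace (scl (ZZ A)) (Hom (ZZ A) X Y p)"
proof -
  interpret Z: vector_space "scl (ZZ A)" by (rule ZZ_vector_space)
  have "fst (X ! i) \<in> Obj A" if "i < length X" for i using assms that by (auto simp: ZZ_sel)
  moreover have "fst (Y ! i) \<in> Obj A" if "i < length Y" for i using assms that by (auto simp: ZZ_sel)
  ultimately show ?thesis
    by (auto simp: Z.subspace_def ZZ_sel(2) intro: Hom_0 Hom_add Hom_scl) (auto simp: ZZ_sel(3) intro: Hom_scl)
qed

lemma ZZ_mu_closed:
  assumes "mors (ZZ A) fs"
  shows "mor (ZZ A) (mu_mor (ZZ A) fs)"
proof -
  obtain T S where TS: "pmors (ZZ A) T fs S" "fs \<noteq> []" using assms by (auto simp: mors_pmors)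
  have obj: "T \<in> Obj (ZZ A)" "S \<in> Obj (ZZ A)" using pmors_obj[OF TS] by auto
  let ?p = "(\<Sum>a\<leftarrow>fs. deg a) + 2 - int (length fs)"
  have "mu (ZZ A) fs \<in> Hom (ZZ A) S T ?p"
    unfolding ZZ_sel(2)
  proof (intro allI)
    fix j i
    show "if j < length T \<and> i < length S then mu (ZZ A) fs j i \<in> Hom A (fst (S ! i)) (fst (T ! j)) (?p - snd (S ! i) + snd (T ! j))
         else mu (ZZ A) fs j i = 0"
    proof (cases "j < length T \<and> i < length S")
      case True
      let ?H = "Hom A (fst (S ! i)) (fst (T ! j)) (?p - snd (S ! i) + snd (T ! j))"
      have o: "fst (S ! i) \<in> Obj A" "fst (T ! j) \<in> Obj A" using True obj by (auto simp: ZZ_sel)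
      have "smu A i i' E \<in> ?H" if r: "run Nz ez fs j i' E" for i' E
      proof (cases "i' = i")
        case True
        then have p: "pmors A (fst (T ! j)) (map snd E) (fst (S ! i))" "map snd E \<noteq> []"
          "(\<Sum>y\<leftarrow>E. deg (snd y)) = (\<Sum>f\<leftarrow>fs. deg f) - (snd (S ! i) - snd (T ! j))"
          using run_ZZ[OF TS(1) r] run_length[OF r] TS(2) by auto
        have "mu A (map snd E) \<in> ?H"
          by (rule mu_in_Hom[OF p(1,2)]) (use p(3) run_length[OF r] in \<open>simp add: comp_def\<close>)
        then show ?thesis using True o by (simp add: smu_def Hom_ksign)
      qed (simp add: smu_def Hom_0 o)
      then have "ex Nz ez fs j (smu A i) \<in> ?H"
        using o by (intro ex_hom[THEN conjunct2, of _ "\<lambda>x. x"]) (auto intro: Hom_0 Hom_add)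
      then show ?thesis using True by (simp add: mu_ZZ)
    qed (use mu_ZZ_outside[OF TS] in auto)
  qed
  then show ?thesis using pmors_ends[OF TS] obj by (simp add: mor_def)
qed

lemma ZZ_run_letter:
  assumes "mors (ZZ A) (as @ HMor X Y p a # bs)" "run Nz ez as j k E"
    "l \<in> Nz (HMor X Y p a) k" "run Nz ez bs l i E'"
  shows "mors A (map snd E @ snd (ez (HMor X Y p a) k l) # map snd E')"
  using run_ZZ_mors[OF assms(1) run_append_Cons[of Nz ez as j k E, OF assms(2,3,4)]] by simp

text \<open>Signs depend on shifts and degrees only, which is what makes them irrelevant for
  linearity.\<close>

lemma sexp_ez_HMor: "sexp (E @ ez (HMor X Y p a) k l # E') = sexp (E @ ez (HMor X Y p 0) k l # E')"
  by (simp add: sexp_append ez_HMor)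

lemma ZZ_mu_add:
  assumes "mors (ZZ A) (as @ HMor X Y p a # bs)" "mors (ZZ A) (as @ HMor X Y p b # bs)"
  shows "mu (ZZ A) (as @ HMor X Y p (a + b) # bs) =
        mu (ZZ A) (as @ HMor X Y p a # bs) + mu (ZZ A) (as @ HMor X Y p b # bs)"
proof (intro ext)
  fix j i
  have "mu (ZZ A) (as @ HMor X Y p (a + b) # bs) j i =
    ex Nz ez as j (\<lambda>k E. \<Sum>l\<in>Nz (HMor X Y p a) k. ex Nz ez bs l (\<lambda>i' E'.
      smu A i i' (E @ ez (HMor X Y p a) k l # E') + smu A i i' (E @ ez (HMor X Y p b) k l # E')))"
    unfolding mu_ZZ ex_append_Cons
  proof (intro ex_cong sum.cong)
    fix k E l i' E'
    assume "run Nz ez as j k E" "l \<in> Nz (HMor X Y p a) k" "run Nz ez bs l i' E'"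
    then have "mors A (map snd E @ snd (ez (HMor X Y p a) k l) # map snd E')"
      "mors A (map snd E @ snd (ez (HMor X Y p b) k l) # map snd E')"
      using ZZ_run_letter[OF assms(1)] ZZ_run_letter[OF assms(2)] by auto
    then show "smu A i i' (E @ ez (HMor X Y p (a + b)) k l # E') =
      smu A i i' (E @ ez (HMor X Y p a) k l # E') + smu A i i' (E @ ez (HMor X Y p b) k l # E')"
      using sexp_ez_HMor[of E X Y p _ k l E'] by (auto simp: smu_def ez_HMor mu_add ksign_plus sexp_append)
  qed simp
  then show "mu (ZZ A) (as @ HMor X Y p (a + b) # bs) j i =
        (mu (ZZ A) (as @ HMor X Y p a # bs) + mu (ZZ A) (as @ HMor X Y p b # bs)) j i"
    by (simp add: mu_ZZ ex_append_Cons ex_plus sum.distrib)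
qed

lemma ZZ_mu_scl:
  assumes "mors (ZZ A) (as @ HMor X Y p a # bs)"
  shows "mu (ZZ A) (as @ HMor X Y p (scl (ZZ A) c a) # bs) = scl (ZZ A) c (mu (ZZ A) (as @ HMor X Y p a # bs))"
proof (intro ext)
  fix j i
  have "mu (ZZ A) (as @ HMor X Y p (scl (ZZ A) c a) # bs) j i =
    ex Nz ez as j (\<lambda>k E. \<Sum>l\<in>Nz (HMor X Y p a) k. ex Nz ez bs l (\<lambda>i' E'.
      scl A c (smu A i i' (E @ ez (HMor X Y p a) k l # E'))))"
    unfolding mu_ZZ ex_append_Cons
  proof (intro ex_cong sum.cong)
    fix k E l i' E'
    assume "run Nz ez as j k E" "l \<in> Nz (HMor X Y p a) k" "run Nz ez bs l i' E'"
    then have "mors A (map snd E @ snd (ez (HMor X Y p a) k l) # map snd E')"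
      using ZZ_run_letter[OF assms(1)] by auto
    then show "smu A i i' (E @ ez (HMor X Y p (scl (ZZ A) c a)) k l # E') =
      scl A c (smu A i i' (E @ ez (HMor X Y p a) k l # E'))"
      using sexp_ez_HMor[of E X Y p _ k l E']
      by (auto simp: smu_def ez_HMor mu_scl ZZ_sel ksign_def sexp_append)
  qed simp
  also have "\<dots> = ex Nz ez (as @ HMor X Y p a # bs) j (\<lambda>i' E. scl A c (smu A i i' E))"
    by (simp add: ex_append_Cons)
  also have "\<dots> = scl A c (ex Nz ez (as @ HMor X Y p a # bs) j (smu A i))"
    by (rule ex_additive[symmetric]) (auto simp: vs.scale_right_distrib)
  finally show "mu (ZZ A) (as @ HMor X Y p (scl (ZZ A) c a) # bs) j i =
      scl (ZZ A) c (mu (ZZ A) (as @ HMor X Y p a # bs)) j i"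
    by (simp add: mu_ZZ ZZ_sel)
qed

text \<open>An entrywise instance of \<open>expansion_relation\<close>. The composite letter is the
  matrix product, whose entries are sums over runs by \<open>mu_ZZ\<close> and vanish out of
  range.\<close>

lemma ZZ_relation:
  assumes "mors (ZZ A) fs"
  shows "(\<Sum>(xs, ys, zs)\<in>splits fs. ksign (\<Sum>z\<leftarrow>zs. rdeg z) (mu (ZZ A) (xs @ mu_mor (ZZ A) ys # zs))) = 0"
proof (intro ext)
  fix j i
  have piece: "\<exists>T S. pmors (ZZ A) T ys S" if "fs = xs @ ys @ zs" for xs ys zs
    using assms that by (auto simp: mors_pmors pmors_append)
  have "(\<Sum>(xs, ys, zs)\<in>splits fs. ksign (\<Sum>z\<leftarrow>zs. rdeg z) (ex Nz ez (xs @ mu_mor (ZZ A) ys # zs) j (smu A i))) = 0"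
  proof (rule expansion_relation)
    show "mors A (map snd E)" if "run Nz ez fs j i E" for i E
      using run_ZZ_mors[OF assms that] .
  next
    fix xs ys zs i E
    assume fs: "fs = xs @ ys @ zs" "ys \<noteq> []" and r: "run Nz ez (xs @ mu_mor (ZZ A) ys # zs) j i E"
    obtain T S where TS: "pmors (ZZ A) T fs S" using assms by (auto simp: mors_pmors)
    then obtain U V where U: "pmors (ZZ A) T xs U" "pmors (ZZ A) U ys V" "pmors (ZZ A) V zs S"
      by (auto simp: fs pmors_append)
    have "mor (ZZ A) (mu_mor (ZZ A) ys)" using U fs by (intro ZZ_mu_closed) (auto simp: mors_pmors)
    then have "mors (ZZ A) (xs @ mu_mor (ZZ A) ys # zs)"
      using U pmors_ends[OF U(2) fs(2)] by (auto simp: mors_pmors pmors_append)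
    then show "mors A (map snd E)" using r by (rule run_ZZ_mors)
  next
    fix f :: "(('o \<times> int) list, nat \<Rightarrow> nat \<Rightarrow> 'm) hmor" and k l
    show "fst (ez f k l) + deg (snd (ez f k l)) = deg f" by (simp add: ez_def)
  next
    fix xs ys zs k E1 l E2
    assume fs: "fs = xs @ ys @ zs" "ys \<noteq> []" and r: "run Nz ez ys k l E2"
    obtain T S where TS: "pmors (ZZ A) T ys S" using piece[OF fs(1)] by auto
    have E2: "map snd E2 \<noteq> []" using run_length[OF r] fs by auto
    note R = run_ZZ[OF TS r disjI1[OF fs(2)]]
    show "\<exists>v. ez (mu_mor (ZZ A) ys) k l = (\<Sum>y\<leftarrow>E2. fst y,
        HMor (src (mu_mor A (map snd E2))) (tgt (mu_mor A (map snd E2))) (deg (mu_mor A (map snd E2))) v)"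
      using R pmors_ends[of A _ "map snd E2"] E2 pmors_ends[OF TS fs(2)] run_length[OF r]
      by (intro exI[of _ "mu (ZZ A) ys k l"]) (auto simp: ez_def entry_def comp_def)
  next
    fix xs ys zs k E1 l
    show "val (snd (ez (mu_mor (ZZ A) ys) k l)) = ex Nz ez ys k (smu A l)"
      by (simp add: ez_def mu_ZZ)
  next
    fix xs ys zs k E1 l
    assume fs: "fs = xs @ ys @ zs" "ys \<noteq> []" and l: "l \<notin> Nz (mu_mor (ZZ A) ys) k"
    obtain T S where TS: "pmors (ZZ A) T ys S" using piece[OF fs(1)] by auto
    show "ex Nz ez ys k (smu A l) = 0"
      unfolding mu_ZZ[symmetric]
      by (rule mu_ZZ_outside[OF TS fs(2)]) (use l pmors_ends[OF TS fs(2)] in \<open>auto simp: Nz_def\<close>)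
  qed simp
  then show "(\<Sum>(xs, ys, zs)\<in>splits fs. ksign (\<Sum>z\<leftarrow>zs. rdeg z) (mu (ZZ A) (xs @ mu_mor (ZZ A) ys # zs))) j i = (0 :: nat \<Rightarrow> nat \<Rightarrow> 'm) j i"
    by (simp add: sum_fun_eval case_prod_beta ksign_apply mu_ZZ)
qed

definition idm :: "('o \<times> int) list \<Rightarrow> nat \<Rightarrow> nat \<Rightarrow> 'm"
  where "idm X j i = (if j = i \<and> i < length X then strict_unit A (fst (X ! i)) else 0)"

text \<open>An off-diagonal entry of the identity matrix is a zero letter, so only runs that stay at
  the same summand survive, and on them the letter is a strict unit of \<open>A\<close>.\<close>

lemma ZZ_unit:
  assumes "X \<in> Obj (ZZ A)"
  shows "is_strict_unit (ZZ A) X (idm X)"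
proof -
  let ?e = "\<lambda>k. strict_unit A (fst (X ! k))"
  let ?D = "HMor X X 0 (idm X)"
  have o: "fst (X ! i) \<in> Obj A" if "i < length X" for i using assms that by (auto simp: ZZ_sel)
  have u: "is_strict_unit A (fst (X ! i)) (?e i)" if "i < length X" for i
    by (rule strict_unit_is[OF o[OF that]])
  have D: "mor (ZZ A) ?D"
    using assms u o by (auto simp: ZZ_sel(2) idm_def is_strict_unit_def Hom_0)
  have ez_D: "ez ?D k k = (0, HMor (fst (X ! k)) (fst (X ! k)) 0 (?e k))" if "k < length X" for k
    using that by (simp add: ez_HMor idm_def)
  have ez_D': "val (snd (ez ?D k l)) = 0" if "k \<noteq> l" for k l
    using that by (simp add: ez_HMor idm_def)
  have "mu (ZZ A) [?D] = 0"
  proof (intro ext)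
    fix j i
    have "smu A i k [ez ?D j k] = 0" if k: "k \<in> Nz ?D j" for k
    proof (cases "k = j")
      case True
      then have "j < length X" using k by (auto split: if_splits)
      then show ?thesis using u[of j] True by (auto simp: smu_def ez_D is_strict_unit_def)
    next
      case False
      have "mors (ZZ A) [?D]" using D by (simp add: mors_pmors)
      then have "mors A (map snd [ez ?D j k])" by (rule run_ZZ_mors[of _ j k]) (use k in \<open>auto split: if_splits\<close>)
      then show ?thesis using ez_D'[of j k] False by (intro smu_zero_entry) auto
    qed
    then show "mu (ZZ A) [?D] j i = (0 :: nat \<Rightarrow> nat \<Rightarrow> 'm) j i" by (simp add: mu_ZZ)
  qed
  moreover have "ksign (deg a) (mu (ZZ A) [?D, a]) = val a" if a: "mor (ZZ A) a" "tgt a = X" for a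
  proof (intro ext)
    fix j i
    have m: "mors (ZZ A) [?D, a]" using D a by (simp add: mors_pmors)
    show "ksign (deg a) (mu (ZZ A) [?D, a]) j i = val a j i"
    proof (cases "j < length X \<and> i < length (src a)")
      case True
      have "mu (ZZ A) [?D, a] j i = (\<Sum>k\<in>Nz ?D j. \<Sum>l\<in>Nz a k. smu A i l [ez ?D j k, ez a k l])"
        by (simp add: mu_ZZ)
      also have "\<dots> = (\<Sum>k\<in>{j}. \<Sum>l\<in>Nz a k. smu A i l [ez ?D j k, ez a k l])"
      proof (rule sum.mono_neutral_right)
        show "\<forall>k\<in>Nz ?D j - {j}. (\<Sum>l\<in>Nz a k. smu A i l [ez ?D j k, ez a k l]) = 0"
        proof (intro ballI sum.neutral)
          fix k l assume k: "k \<in> Nz ?D j - {j}" "l \<in> Nz a k"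
          have "mors A (map snd [ez ?D j k, ez a k l])"
            by (rule run_ZZ_mors[OF m, of j l]) (use k in \<open>auto split: if_splits\<close>)
          then show "smu A i l [ez ?D j k, ez a k l] = 0"
            using ez_D'[of j k] k by (intro smu_zero_entry) auto
        qed
      qed (use True in auto)
      also have "\<dots> = (\<Sum>l\<in>Nz a j. if l = i then ksign (sexp [ez ?D j j, ez a j i]) (mu A [snd (ez ?D j j), snd (ez a j i)]) else 0)"
        by (auto simp: smu_def ez_HMor intro!: sum.cong)
      \<comment> \<open>The unit has reduced degree -1, so the shift sign is that of the shift
        difference of \<open>a\<close>. It turns the degree of the matrix \<open>a\<close> into the
        degree of its entry, as the unit axiom of \<open>A\<close> demands.\<close>
      also have "\<dots> = ksign (snd (src a ! i) - snd (tgt a ! j)) (mu A [snd (ez ?D j j), entry a j i])"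
        using True a by (auto simp: Nz_def ez_HMor ez_def intro!: ksign_cong)
      finally have "ksign (deg a) (mu (ZZ A) [?D, a]) j i = 
          ksign (deg (entry a j i)) (mu A [snd (ez ?D j j), entry a j i])"
        by (auto simp: ksign_apply ksign_ksign algebra_simps intro!: ksign_cong)
      also have "\<dots> = val (entry a j i)"
        using u[of j] True mor_ZZ_entry[OF a(1), of j i] a(2) by (auto simp: ez_D is_strict_unit_def)
      finally show ?thesis by simp
    next
      case False
      then have "mu (ZZ A) [?D, a] j i = 0"
        using D a by (intro mu_ZZ_outside[of X _ "src a"]) auto
      moreover have "val a j i = 0" using False a by (auto simp: mor_def ZZ_sel(2))
      ultimately show ?thesis by (simp add: ksign_apply)
    qed
  qed
  moreover have "mu (ZZ A) [a, ?D] = val a" if a: "mor (ZZ A) a" "src a = X" for a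
  proof (intro ext)
    fix j i
    have m: "mors (ZZ A) [a, ?D]" using D a by (simp add: mors_pmors)
    show "mu (ZZ A) [a, ?D] j i = val a j i"
    proof (cases "j < length (tgt a) \<and> i < length X")
      case True
      have "mu (ZZ A) [a, ?D] j i = (\<Sum>k\<in>Nz a j. \<Sum>l\<in>Nz ?D k. smu A i l [ez a j k, ez ?D k l])"
        by (simp add: mu_ZZ)
      also have "\<dots> = (\<Sum>k\<in>Nz a j. \<Sum>l\<in>Nz ?D k. if l = k then smu A i l [ez a j k, ez ?D k l] else 0)"
      proof (intro sum.cong refl)
        fix k l assume k: "k \<in> Nz a j" "l \<in> Nz ?D k"
        have "mors A (map snd [ez a j k, ez ?D k l])"
          by (rule run_ZZ_mors[OF m, of j l]) (use k in \<open>auto split: if_splits\<close>)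
        then have "smu A i l [ez a j k, ez ?D k l] = 0" if "l \<noteq> k"
          using ez_D'[of k l] that by (intro smu_zero_entry) auto
        then show "smu A i l [ez a j k, ez ?D k l] = (if l = k then smu A i l [ez a j k, ez ?D k l] else 0)"
          by simp
      qed
      also have "\<dots> = (\<Sum>k\<in>Nz a j. if k = i then mu A [entry a j i, snd (ez ?D i i)] else 0)"
        using a True by (intro sum.cong) (auto simp: Nz_def smu_def ez_def)
      also have "\<dots> = mu A [entry a j i, snd (ez ?D i i)]"
        using True a by (auto simp: Nz_def)
      also have "\<dots> = val (entry a j i)"
        using u[of i] True mor_ZZ_entry[OF a(1), of j i] a(2) by (auto simp: ez_D is_strict_unit_def)
      finally show ?thesis by simp
    next
      case False
      then have "mu (ZZ A) [a, ?D] j i = 0"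
        using D a by (intro mu_ZZ_outside[of "tgt a" _ X]) auto
      moreover have "val a j i = 0" using False a by (auto simp: mor_def ZZ_sel(2))
      ultimately show ?thesis by simp
    qed
  qed
  moreover have "mu (ZZ A) (as @ ?D # bs) = 0"
    if m: "mors (ZZ A) (as @ ?D # bs)" and l: "length as + length bs \<ge> 2" for as bs
  proof (intro ext)
    fix j i
    have "ex Nz ez (as @ ?D # bs) j (smu A i) = 0"
      unfolding ex_append_Cons
    proof (intro ex_zero_cong sum.neutral ballI)
      fix k E l i' E'
      assume r: "run Nz ez as j k E" "l \<in> Nz ?D k" "run Nz ez bs l i' E'"
      have mm: "mors A (map snd (E @ ez ?D k l # E'))" using ZZ_run_letter[OF m r] by simp
      show "smu A i i' (E @ ez ?D k l # E') = 0"
      proof (cases "k = l")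
        case True
        then have k: "k < length X" using r by (auto split: if_splits)
        have "mu A (map snd E @ HMor (fst (X ! k)) (fst (X ! k)) 0 (?e k) # map snd E') = 0"
          using u[OF k] mm \<open>length as + length bs \<ge> 2\<close> run_length[OF r(1)] run_length[OF r(3)] True ez_D[OF k]
          by (simp add: is_strict_unit_def)
        then show ?thesis using True ez_D[OF k] by (simp add: smu_def)
      next
        case False
        then show ?thesis using ez_D' by (intro smu_zero_entry[OF mm, of "ez ?D k l"]) auto
      qed
    qed
    then show "mu (ZZ A) (as @ ?D # bs) j i = (0 :: nat \<Rightarrow> nat \<Rightarrow> 'm) j i" by (simp add: mu_ZZ)
  qed
  ultimately show ?thesis using D by (simp add: is_strict_unit_def)
qed

lemma ainf_category_ZZ: "ainf_category (ZZ A)"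
proof (rule ainf_category.intro)
  show "vector_space (scl (ZZ A))" by (rule ZZ_vector_space)
  show "\<And>X Y p. X \<in> Obj (ZZ A) \<Longrightarrow> Y \<in> Obj (ZZ A) \<Longrightarrow> module.subspace (scl (ZZ A)) (Hom (ZZ A) X Y p)"
    by (rule ZZ_subspace)
  show "\<And>as. mors (ZZ A) as \<Longrightarrow> mor (ZZ A) (mu_mor (ZZ A) as)" by (rule ZZ_mu_closed)
  show "\<And>X. X \<in> Obj (ZZ A) \<Longrightarrow> \<exists>e. is_strict_unit (ZZ A) X e" using ZZ_unit by blast
next
  fix as :: "(('o \<times> int) list, nat \<Rightarrow> nat \<Rightarrow> 'm) hmor list" and d
  assume "mors (ZZ A) as" "d = length as"
    then show "(\<Sum>(m, n)\<in>{(m, n). 1 \<le> m \<and> m + n \<le> d}. ksign (\<Sum>a\<leftarrow>drop (d - n) as. rdeg a)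
      (mu (ZZ A) (take (d - m - n) as @ mu_mor (ZZ A) (take m (drop (d - m - n) as)) # drop (d - n) as))) = 0"
    using sum_splits[OF \<open>d = length as\<close>, of "\<lambda>P Q R. ksign (\<Sum>a\<leftarrow>R. rdeg a) (mu (ZZ A) (P @ mu_mor (ZZ A) Q # R))"]
      ZZ_relation by simp
qed (simp_all add: ZZ_mu_add ZZ_mu_scl)

end

section \<open>Skew group categories of strict actions\<close>

lemma fhm_comp: "fhm (func_comp G F) a = fhm G (fhm F a)"
  by (simp add: fhm_def func_comp_def)

lemma fhm_id: "fhm func_id a = a"
  by (cases a) (simp add: fhm_def func_id_def)

lemma lookup_map_0: "f 0 = 0 \<Longrightarrow> Poly_Mapping.lookup (Poly_Mapping.map f p) k = f (Poly_Mapping.lookup p k)"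
  by (simp add: Poly_Mapping.map.rep_eq when_def)

lemma ksign_flip: "ksign e x = y \<Longrightarrow> x = ksign e y"
  by (auto simp: ksign_def split: if_splits)

lemma sum_list_zero: "(\<And>x. x \<in> set xs \<Longrightarrow> f x = (0 :: int)) \<Longrightarrow> (\<Sum>x\<leftarrow>xs. f x) = 0"
  by (induction xs) auto

lemma sexp_zero: "(\<And>x. x \<in> set E \<Longrightarrow> fst x = 0) \<Longrightarrow> sexp E = 0"
proof (induction E)
  case (Cons x E)
  have "(\<Sum>y\<leftarrow>E. fst y) = 0" using Cons.prems by (intro sum_list_zero) auto
  then show ?case using Cons by simp
qed simp

text \<open>Additive notation for a homomorphism into the invertible strict endofunctors:
  \<open>act_0\<close> and \<open>act_add\<close> also provide the inverse
  \<open>\<rho> (- g)\<close>, from which compatibility with units is derived below.\<close>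

locale strict_action = ainf_category B for B :: "('o, 'm::ab_group_add, 'k::field) ainf" +
  fixes \<rho> :: "'g::group_add \<Rightarrow> ('o, 'm, 'o, 'm) func"
  assumes act_0: "\<rho> 0 = func_id"
    and act_add: "\<rho> (g + h) = func_comp (\<rho> g) (\<rho> h)"
    and act_obj: "X \<in> Obj B \<Longrightarrow> fobj (\<rho> g) X \<in> Obj B"
    and act_mor: "mor B f \<Longrightarrow> mor B (fhm (\<rho> g) f)"
    and act_plus: "\<lbrakk>X \<in> Obj B; Y \<in> Obj B; a \<in> Hom B X Y p; b \<in> Hom B X Y p\<rbrakk> \<Longrightarrow>
      fmor (\<rho> g) (HMor X Y p (a + b)) = fmor (\<rho> g) (HMor X Y p a) + fmor (\<rho> g) (HMor X Y p b)"
    and act_scl: "\<lbrakk>X \<in> Obj B; Y \<in> Obj B; a \<in> Hom B X Y p\<rbrakk> \<Longrightarrow>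
      fmor (\<rho> g) (HMor X Y p (scl B c a)) = scl B c (fmor (\<rho> g) (HMor X Y p a))"
    and act_mu: "mors B as \<Longrightarrow> fmor (\<rho> g) (mu_mor B as) = mu B (map (fhm (\<rho> g)) as)"
begin

text \<open>The state is the sum of the group elements read so far. Passing from \<open>h\<close> to
  \<open>k\<close> means choosing the component of \<open>- h + k\<close>, and it is transported by
  \<open>\<rho> h\<close>, as the formula for composition in a skew category prescribes. No shifts
  are involved, hence the 0.\<close>

abbreviation es :: "('o, 'g \<Rightarrow>\<^sub>0 'm) hmor \<Rightarrow> 'g \<Rightarrow> 'g \<Rightarrow> int \<times> ('o, 'm) hmor"
  where "es f h k \<equiv> (0, fhm (\<rho> h) (component \<rho> f (- h + k)))"

abbreviation Nk :: "('o, 'g \<Rightarrow>\<^sub>0 'm) hmor \<Rightarrow> 'g \<Rightarrow> 'g set"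
  where "Nk f h \<equiv> (+) h ` Poly_Mapping.keys (val f)"

text \<open>Transitions along one fixed set of group elements. The keys of \<open>a + b\<close> may
  differ from those of \<open>a\<close> and \<open>b\<close>, so sums with the transitions
  \<open>Nk\<close> cannot be compared term by term.\<close>

abbreviation Nf :: "'g set \<Rightarrow> ('o, 'g \<Rightarrow>\<^sub>0 'm) hmor \<Rightarrow> 'g \<Rightarrow> 'g set"
  where "Nf K f h \<equiv> (+) h ` K"

lemma fhm_fhm: "fhm (\<rho> g) (fhm (\<rho> h) a) = fhm (\<rho> (g + h)) a"
  by (simp add: act_add fhm_comp)

lemma fhm_0 [simp]: "fhm (\<rho> 0) a = a"
  by (simp add: act_0 fhm_id)

lemma fobj_0 [simp]: "fobj (\<rho> 0) X = X"
  by (simp add: act_0 func_id_def)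

lemma fobj_fobj: "fobj (\<rho> g) (fobj (\<rho> h) X) = fobj (\<rho> (g + h)) X"
  by (simp add: act_add func_comp_def)

lemma act_zero: "X \<in> Obj B \<Longrightarrow> Y \<in> Obj B \<Longrightarrow> fmor (\<rho> g) (HMor X Y p 0) = 0"
  using act_scl[of X Y 0 p g 0] Hom_0 by simp

lemma act_ksign:
  assumes "X \<in> Obj B" "Y \<in> Obj B" "a \<in> Hom B X Y p"
  shows "fmor (\<rho> g) (HMor X Y p (ksign e a)) = ksign e (fmor (\<rho> g) (HMor X Y p a))"
  using act_scl[OF assms, of g "-1"] by (simp add: ksign_def)

lemma act_ksign_mor:
  "mor B a \<Longrightarrow> fmor (\<rho> g) (HMor (src a) (tgt a) (deg a) (ksign e (val a))) = ksign e (fmor (\<rho> g) a)"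
  using act_ksign[of "src a" "tgt a" "val a" "deg a" g e] by (simp add: mor_def)

lemma pmors_act: "pmors B T as S \<Longrightarrow> pmors B (fobj (\<rho> g) T) (map (fhm (\<rho> g)) as) (fobj (\<rho> g) S)"
  by (induction as arbitrary: T) (auto simp: act_mor)

lemma mors_act: "mors B as \<Longrightarrow> mors B (map (fhm (\<rho> g)) as)"
  unfolding mors_pmors by (auto dest: pmors_act)

text \<open>Since \<open>\<rho> g\<close> has the inverse \<open>\<rho> (- g)\<close>, a string
  around the image of \<open>X\<close> can be moved back, composed there with the unit
  \<open>e\<close>, and moved forward again by \<open>act_mu\<close>.\<close>

lemma is_strict_unit_act:
  assumes X: "X \<in> Obj B" and e: "is_strict_unit B X e"
  shows "is_strict_unit B (fobj (\<rho> g) X) (fmor (\<rho> g) (HMor X X 0 e))"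
proof -
  let ?R = "fhm (\<rho> g)" and ?R' = "fhm (\<rho> (- g))"
  let ?E = "HMor X X 0 e"
  let ?E' = "HMor (fobj (\<rho> g) X) (fobj (\<rho> g) X) 0 (fmor (\<rho> g) ?E)"
  have E': "?R ?E = ?E'" by (simp add: fhm_def)
  have E: "mor B ?E" using X e by (simp add: is_strict_unit_def)
  have U: "mor B a \<Longrightarrow> tgt a = X \<Longrightarrow> ksign (deg a) (mu B [?E, a]) = val a"
    "mor B a \<Longrightarrow> src a = X \<Longrightarrow> mu B [a, ?E] = val a" for a
    using e unfolding is_strict_unit_def by blast+
  have RR': "?R (?R' a) = a" for a by (simp add: fhm_fhm)
  have inv_obj: "fobj (\<rho> (- g)) (fobj (\<rho> g) Y) = Y" for Y by (simp add: fobj_fobj)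
  have "mor B (?R ?E)" using E by (rule act_mor)
  then have 1: "fmor (\<rho> g) ?E \<in> Hom B (fobj (\<rho> g) X) (fobj (\<rho> g) X) 0" by (simp add: mor_def)
  have "mu B [?E'] = fmor (\<rho> g) (mu_mor B [?E])"
    using act_mu[of "[?E]" g] E by (simp add: mors_pmors E')
  also have "\<dots> = 0" using e X by (simp add: mu_mor_def is_strict_unit_def act_zero)
  finally have 2: "mu B [?E'] = 0" .
  have 3: "ksign (deg a) (mu B [?E', a]) = val a" if a: "mor B a" "tgt a = fobj (\<rho> g) X" for a
  proof -
    let ?a = "?R' a"
    have a': "mor B ?a" "tgt ?a = X" using a by (auto simp: act_mor inv_obj)
    have "mu B [?E', a] = fmor (\<rho> g) (mu_mor B [?E, ?a])"
      using act_mu[of "[?E, ?a]" g] E a' by (simp add: mors_pmors E' RR')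
    moreover have "ksign (deg ?a) (mu B [?E, ?a]) = val ?a" by (rule U(1)[OF a'])
    then have "mu B [?E, ?a] = ksign (deg ?a) (val ?a)" by (rule ksign_flip)
    then have "mu_mor B [?E, ?a] = HMor (src ?a) (tgt ?a) (deg ?a) (ksign (deg ?a) (val ?a))"
      using a' by (simp add: mu_mor_def)
    ultimately have "mu B [?E', a] = ksign (deg ?a) (fmor (\<rho> g) ?a)"
      by (simp only: act_ksign_mor[OF a'(1)])
    also have "fmor (\<rho> g) ?a = val a" using arg_cong[OF RR'[of a], of val] by simp
    finally show ?thesis by (simp add: ksign_ksign)
  qed
  have 4: "mu B [a, ?E'] = val a" if a: "mor B a" "src a = fobj (\<rho> g) X" for a
  proof -
    let ?a = "?R' a"
    have a': "mor B ?a" "src ?a = X" using a by (auto simp: act_mor inv_obj)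
    have "mu B [a, ?E'] = fmor (\<rho> g) (mu_mor B [?a, ?E])"
      using act_mu[of "[?a, ?E]" g] E a' by (simp add: mors_pmors E' RR')
    also have "mu_mor B [?a, ?E] = ?a"
      using U(2)[OF a'] a' by (cases ?a) (simp add: mu_mor_def)
    also have "fmor (\<rho> g) ?a = val a" using arg_cong[OF RR'[of a], of val] by simp
    finally show ?thesis .
  qed
  have 5: "mu B (as @ ?E' # bs) = 0"
    if m: "mors B (as @ ?E' # bs)" and l: "length as + length bs \<ge> 2" for as bs
  proof -
    have R'E': "?R' ?E' = ?E" unfolding E'[symmetric] by (simp add: fhm_fhm)
    let ?s = "map ?R' as @ ?E # map ?R' bs"
    have ms: "mors B ?s" using mors_act[OF m, of "- g"] R'E' by simp
    have eq: "map ?R ?s = as @ ?E' # bs"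
      by (simp add: comp_def RR' E')
    have z: "mu B ?s = 0" using e ms l by (simp add: is_strict_unit_def)
    have ms': "mor B (mu_mor B ?s)" by (rule mu_closed[OF ms])
    then have "fmor (\<rho> g) (mu_mor B ?s) = 0"
      unfolding mu_mor_def z by (intro act_zero) simp_all
    then show ?thesis using act_mu[OF ms, of g] eq by simp
  qed
  show ?thesis unfolding is_strict_unit_def using 1 2 3 4 5 by blast
qed

abbreviation SK :: "('o, 'g \<Rightarrow>\<^sub>0 'm, 'k) ainf" where "SK \<equiv> skew B \<rho>"

lemma skew_sel: "Obj SK = Obj B"
  "f \<in> Hom SK X Y p \<longleftrightarrow> (\<forall>g. Poly_Mapping.lookup f g \<in> Hom B (fobj (\<rho> g) X) Y p)"
  "scl SK c f = Poly_Mapping.map (scl B c) f"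
  by (simp_all add: skew_def)

lemma component_sel [simp]: "src (component \<rho> f g) = fobj (\<rho> g) (src f)" "tgt (component \<rho> f g) = tgt f"
  "deg (component \<rho> f g) = deg f" "val (component \<rho> f g) = Poly_Mapping.lookup (val f) g"
  by (simp_all add: component_def)

definition choices :: "('o, 'g \<Rightarrow>\<^sub>0 'm) hmor list \<Rightarrow> 'g list set"
  where "choices fs = {gs. length gs = length fs \<and>
    (\<forall>t<length fs. gs ! t \<in> Poly_Mapping.keys (val (fs ! t)))}"

lemma choices_Nil: "choices [] = {[]}"
  by (auto simp: choices_def)

lemma choices_Cons: "choices (f # fs) = (\<Union>g\<in>Poly_Mapping.keys (val f). (#) g ` choices fs)"
proof (intro equalityI subsetI)
  fix gs assume gs: "gs \<in> choices (f # fs)"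
  then obtain g gs' where g: "gs = g # gs'" by (cases gs) (auto simp: choices_def)
  have "g \<in> Poly_Mapping.keys (val f)" using gs unfolding g choices_def by fastforce
  moreover have "gs' \<in> choices fs" using gs unfolding g choices_def by fastforce
  ultimately show "gs \<in> (\<Union>g\<in>Poly_Mapping.keys (val f). (#) g ` choices fs)" using g by auto
qed (auto simp: choices_def less_Suc_eq_0_disj)

lemma finite_choices [simp]: "finite (choices fs)"
  by (induction fs) (auto simp: choices_Nil choices_Cons)

text \<open>The start state \<open>h\<close> is arbitrary because the induction moves along the
  partial sums of group elements.\<close>

lemma sum_choices:
  "(\<Sum>gs\<in>choices fs. \<Phi> (h + sum_list gs) (map (\<lambda>t. (0 :: int, fhm (\<rho> (h + sum_list (take t gs)))
      (component \<rho> (fs ! t) (gs ! t)))) [0..<length fs])) = ex Nk es fs h \<Phi>"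
proof (induction fs arbitrary: h \<Phi>)
  case (Cons f fs)
  let ?F = "\<lambda>gs. \<Phi> (h + sum_list gs) (map (\<lambda>t. (0 :: int, fhm (\<rho> (h + sum_list (take t gs)))
      (component \<rho> ((f # fs) ! t) (gs ! t)))) [0..<length (f # fs)])"
  have "(\<Sum>gs\<in>choices (f # fs). ?F gs) = (\<Sum>g\<in>Poly_Mapping.keys (val f). \<Sum>gs\<in>(#) g ` choices fs. ?F gs)"
    unfolding choices_Cons by (rule sum.UNION_disjoint) auto
  also have "\<dots> = (\<Sum>g\<in>Poly_Mapping.keys (val f). \<Sum>gs\<in>choices fs. ?F (g # gs))"
    by (rule sum.cong[OF refl], subst sum.reindex) (simp_all add: inj_on_def)
  also have "\<dots> = (\<Sum>g\<in>Poly_Mapping.keys (val f). \<Sum>gs\<in>choices fs.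
      (\<lambda>k E. \<Phi> k (es f h (h + g) # E)) (h + g + sum_list gs)
      (map (\<lambda>t. (0 :: int, fhm (\<rho> (h + g + sum_list (take t gs))) (component \<rho> (fs ! t) (gs ! t)))) [0..<length fs]))"
    by (simp add: map_upt_Suc add.assoc del: upt_Suc)
  also have "\<dots> = (\<Sum>g\<in>Poly_Mapping.keys (val f). ex Nk es fs (h + g) (\<lambda>k E. \<Phi> k (es f h (h + g) # E)))"
    by (intro sum.cong refl) (rule Cons.IH)
  also have "\<dots> = ex Nk es (f # fs) h \<Phi>"
    unfolding ex.simps by (subst sum.reindex) (auto simp: inj_on_def)
  finally show ?case .
qed (simp add: choices_Nil)

lemma run_skew:
  assumes "pmors SK T fs S" "run N es fs h i E"
  shows "pmors B (fobj (\<rho> h) T) (map snd E) (fobj (\<rho> i) S) \<and> (\<forall>x\<in>set E. fst x = 0) \<and>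
    (\<Sum>x\<leftarrow>E. deg (snd x)) = (\<Sum>f\<leftarrow>fs. deg f)"
  using assms
proof (induction fs arbitrary: T h E)
  case (Cons f fs)
  then obtain k E' where k: "k \<in> N f h" "E = es f h k # E'" "run N es fs k i E'" by auto
  have f: "mor SK f" "tgt f = T" "pmors SK (src f) fs S" using Cons.prems by auto
  have "mor B (component \<rho> f g)" for g
    using f(1) by (auto simp: mor_def skew_sel intro: act_obj)
  with Cons.IH[OF f(3) k(3)] f show ?case by (auto simp: k(2) act_mor fobj_fobj)
qed auto

lemma run_skew_mors: "mors SK fs \<Longrightarrow> run N es fs h i E \<Longrightarrow> mors B (map snd E)"
  unfolding mors_pmors using run_skew run_length by fastforce

lemma lookup_mu_skew:
  assumes "mors SK fs"
  shows "Poly_Mapping.lookup (mu SK fs) g = ex Nk es fs 0 (smu B g)"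
proof -
  have "Poly_Mapping.lookup (mu SK fs) g = (\<Sum>gs\<in>choices fs. (\<lambda>k E. if k = g then mu B (map snd E) else 0)
      (0 + sum_list gs) (map (\<lambda>t. (0 :: int, fhm (\<rho> (0 + sum_list (take t gs)))
      (component \<rho> (fs ! t) (gs ! t)))) [0..<length fs]))"
    by (auto simp: skew_def choices_def lookup_sum lookup_single comp_def when_def intro!: sum.cong)
  also have "\<dots> = ex Nk es fs 0 (\<lambda>k E. if k = g then mu B (map snd E) else 0)"
    by (rule sum_choices)
  also have "\<dots> = ex Nk es fs 0 (smu B g)"
  proof (rule ex_cong)
    fix k E assume r: "run Nk es fs 0 k E"
    obtain T S where "pmors SK T fs S" using assms by (auto simp: mors_pmors)
    from run_skew[OF this r] have "sexp E = 0" by (intro sexp_zero) auto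
    then show "(if k = g then mu B (map snd E) else 0) = smu B g k E" by (simp add: smu_def)
  qed
  finally show ?thesis .
qed

lemma smu_zero_entry': "mors B (map snd E) \<Longrightarrow> e \<in> set E \<Longrightarrow> val (snd e) = 0 \<Longrightarrow> smu B i i' E = 0"
  using mu_zero_entry[of "map snd E" "snd e"] by (auto simp: smu_def)

text \<open>A group element outside the keys of a letter selects its zero component, and the action
  preserves zero morphisms.\<close>

lemma ex_Nk_Nf:
  assumes "pmors SK T fs S" "finite K" "\<And>f. f \<in> set fs \<Longrightarrow> Poly_Mapping.keys (val f) \<subseteq> K"
    and "\<And>i E e. run (Nf K) es fs h i E \<Longrightarrow> e \<in> set E \<Longrightarrow> val (snd e) = 0 \<Longrightarrow> \<Phi> i E = 0"
  shows "ex Nk es fs h \<Phi> = ex (Nf K) es fs h \<Phi>"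
proof (rule ex_neutral[where bad = "\<lambda>e. val (snd e) = 0"])
  fix f j k assume f: "f \<in> set fs" and k: "k \<in> Nf K f j - Nk f j"
  have "mor SK f" using assms(1) f by (auto simp: pmors_def)
  moreover have "- j + k \<notin> Poly_Mapping.keys (val f)" using k by (metis Diff_iff add_minus_cancel imageI)
  ultimately show "val (snd (es f j k)) = 0"
    by (auto simp: component_def in_keys_iff mor_def skew_sel(1) intro!: act_zero act_obj)
qed (use assms in auto)

lemma lookup_mu_skew_Nf:
  assumes "mors SK fs" "finite K" "\<And>f. f \<in> set fs \<Longrightarrow> Poly_Mapping.keys (val f) \<subseteq> K"
  shows "Poly_Mapping.lookup (mu SK fs) g = ex (Nf K) es fs 0 (smu B g)"
proof -
  obtain T S where "pmors SK T fs S" using assms(1) by (auto simp: mors_pmors)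
  then show ?thesis unfolding lookup_mu_skew[OF assms(1)]
    by (rule ex_Nk_Nf) (use assms in \<open>auto intro: smu_zero_entry' run_skew_mors\<close>)
qed

text \<open>Equivariance of the automaton: to start at \<open>g + h\<close> instead of
  \<open>h\<close> means to apply \<open>\<rho> g\<close> to every emitted letter.\<close>

lemma ex_translate:
  "ex Nk es fs (g + h) \<Psi> = ex Nk es fs h (\<lambda>l E. \<Psi> (g + l) (map (\<lambda>x. (fst x, fhm (\<rho> g) (snd x))) E))"
proof (induction fs arbitrary: h \<Psi>)
  case (Cons f fs)
  have "Nk f (g + h) = (+) g ` Nk f h" by (simp add: image_image add.assoc)
  then have "ex Nk es (f # fs) (g + h) \<Psi> =
      (\<Sum>k\<in>Nk f h. ex Nk es fs (g + k) (\<lambda>i E. \<Psi> i (es f (g + h) (g + k) # E)))"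
    unfolding ex.simps by (simp only:, subst sum.reindex) (simp_all add: inj_on_def)
  also have "\<dots> = (\<Sum>k\<in>Nk f h. ex Nk es fs k (\<lambda>l E. \<Psi> (g + l)
      (es f (g + h) (g + k) # map (\<lambda>x. (fst x, fhm (\<rho> g) (snd x))) E)))"
    by (intro sum.cong refl) (rule Cons.IH)
  also have "\<dots> = ex Nk es (f # fs) h (\<lambda>l E. \<Psi> (g + l) (map (\<lambda>x. (fst x, fhm (\<rho> g) (snd x))) E))"
  proof -
    have "- (g + h) + (g + k) = - h + k" for k
      by (simp only: minus_add add.assoc minus_add_cancel)
    then show ?thesis by (simp add: fhm_fhm)
  qed
  finally show ?case .
qed simp

lemma act_ex:
  assumes "X \<in> Obj B" "Y \<in> Obj B" "\<And>i E. run N en fs j i E \<Longrightarrow> \<Phi> i E \<in> Hom B X Y p"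
  shows "fmor (\<rho> g) (HMor X Y p (ex N en fs j \<Phi>)) = ex N en fs j (\<lambda>i E. fmor (\<rho> g) (HMor X Y p (\<Phi> i E)))"
  by (rule ex_hom[THEN conjunct1, of "Hom B X Y p"]) (use assms in \<open>auto intro: Hom_0 Hom_add act_zero act_plus\<close>)

lemma smu_skew_Hom:
  assumes "pmors SK T fs S" "fs \<noteq> []" "run N es fs h i E"
  shows "smu B g i E \<in> Hom B (fobj (\<rho> g) S) (fobj (\<rho> h) T) ((\<Sum>a\<leftarrow>fs. deg a) + 2 - int (length fs))"
proof -
  have o: "fobj (\<rho> g) S \<in> Obj B" "fobj (\<rho> h) T \<in> Obj B" for g h
    using pmors_obj[OF assms(1,2)] by (auto simp: skew_sel intro: act_obj)
  have "map snd E \<noteq> []" using run_length[OF assms(3)] assms(2) by auto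
  then have "mu B (map snd E) \<in> Hom B (fobj (\<rho> i) S) (fobj (\<rho> h) T) ((\<Sum>a\<leftarrow>fs. deg a) + 2 - int (length fs))"
    using run_skew[OF assms(1,3)] run_length[OF assms(3)]
    by (intro mu_in_Hom) (auto simp: comp_def)
  then show ?thesis using o by (auto simp: smu_def Hom_ksign Hom_0)
qed

section \<open>The axioms for the skew group category\<close>

lemma skew_vector_space: "vector_space (scl SK)"
  by unfold_locales (auto simp: skew_sel lookup_map_0 lookup_add vs.scale_right_distrib vs.scale_left_distrib
      intro!: poly_mapping_eqI)

lemma skew_subspace:
  assumes "X \<in> Obj SK" "Y \<in> Obj SK"
  shows "module.subspace (scl SK) (Hom SK X Y p)"
proof -
  interpret Z: vector_space "scl SK" by (rule skew_vector_space)
  show ?thesis using assms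
    by (auto simp: Z.subspace_def skew_sel lookup_add lookup_map_0 intro!: Hom_0 Hom_add Hom_scl act_obj)
qed

lemma skew_mu_closed:
  assumes "mors SK fs"
  shows "mor SK (mu_mor SK fs)"
proof -
  obtain T S where TS: "pmors SK T fs S" "fs \<noteq> []" using assms by (auto simp: mors_pmors)
  have obj: "T \<in> Obj B" "S \<in> Obj B" using pmors_obj[OF TS] by (auto simp: skew_sel)
  let ?p = "(\<Sum>a\<leftarrow>fs. deg a) + 2 - int (length fs)"
  have "ex Nk es fs 0 (smu B g) \<in> Hom B (fobj (\<rho> g) S) T ?p" for g
    using smu_skew_Hom[OF TS, of Nk 0 _ _ g] obj
    by (intro ex_hom[THEN conjunct2, of _ "\<lambda>x. x"]) (auto intro: Hom_0 Hom_add act_obj)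
  then have "mu SK fs \<in> Hom SK S T ?p" by (simp add: skew_sel(2) lookup_mu_skew[OF assms])
  then show ?thesis using pmors_ends[OF TS] obj by (simp add: mor_def skew_sel(1))
qed

lemma skew_run_letter:
  assumes "mors SK (as @ f # bs)" "run N es as j k E" "l \<in> N f k" "run N es bs l i E'"
  shows "mors B (map snd E @ snd (es f k l) # map snd E')"
  using run_skew_mors[OF assms(1) run_append_Cons[of N es as j k E, OF assms(2,3,4)]] by simp

lemma es_HMor: "es (HMor X Y p a) k l = (0, HMor (fobj (\<rho> l) X) (fobj (\<rho> k) Y) p
    (fmor (\<rho> k) (HMor (fobj (\<rho> (- k + l)) X) Y p (Poly_Mapping.lookup a (- k + l)))))"
  by (simp add: component_def fhm_def fobj_fobj)

lemma skew_mu_add: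
  assumes m: "mors SK (as @ HMor X Y p a # bs)" "mors SK (as @ HMor X Y p b # bs)"
  shows "mu SK (as @ HMor X Y p (a + b) # bs) =
        mu SK (as @ HMor X Y p a # bs) + mu SK (as @ HMor X Y p b # bs)"
proof (rule poly_mapping_eqI)
  fix g
  have o: "X \<in> Obj B" "Y \<in> Obj B" and ab: "a \<in> Hom SK X Y p" "b \<in> Hom SK X Y p"
    using m by (auto simp: mors_pmors pmors_append skew_sel(1))
  interpret Z: vector_space "scl SK" by (rule skew_vector_space)
  have "a + b \<in> Hom SK X Y p" using ab o skew_subspace[of X Y p] Z.subspace_add by (simp add: skew_sel(1))
  then have m3: "mors SK (as @ HMor X Y p (a + b) # bs)"
    using m o by (auto simp: mors_pmors pmors_append)
  \<comment> \<open>One finite set of group elements for all three strings; cancellation in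
    \<open>a + b\<close> does not matter as long as the keys stay inside \<open>K\<close>.\<close>
  define K where "K = Poly_Mapping.keys a \<union> Poly_Mapping.keys b \<union> (\<Union>f\<in>set (as @ bs). Poly_Mapping.keys (val f))"
  have K: "finite K" "Poly_Mapping.keys (a + b) \<subseteq> K" "Poly_Mapping.keys a \<subseteq> K" "Poly_Mapping.keys b \<subseteq> K"
    using Poly_Mapping.keys_add[of a b] by (auto simp: K_def)
  have L: "Poly_Mapping.lookup (mu SK (as @ HMor X Y p c # bs)) g = ex (Nf K) es (as @ HMor X Y p c # bs) 0 (smu B g)"
    if "mors SK (as @ HMor X Y p c # bs)" "Poly_Mapping.keys c \<subseteq> K" for c
    by (rule lookup_mu_skew_Nf) (use that K in \<open>auto simp: K_def\<close>)
  have "ex (Nf K) es (as @ HMor X Y p (a + b) # bs) 0 (smu B g) =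
    ex (Nf K) es as 0 (\<lambda>k E. \<Sum>l\<in>Nf K (HMor X Y p a) k. ex (Nf K) es bs l (\<lambda>i' E'.
      smu B g i' (E @ es (HMor X Y p a) k l # E') + smu B g i' (E @ es (HMor X Y p b) k l # E')))"
    unfolding ex_append_Cons
  proof (intro ex_cong sum.cong)
    fix k E l i' E'
    assume r: "run (Nf K) es as 0 k E" "l \<in> Nf K (HMor X Y p a) k" "run (Nf K) es bs l i' E'"
    have r2: "mors B (map snd E @ snd (es (HMor X Y p a) k l) # map snd E')"
      "mors B (map snd E @ snd (es (HMor X Y p b) k l) # map snd E')"
      using skew_run_letter[OF m(1) r] skew_run_letter[OF m(2) r(1) _ r(3)] r(2) by auto
    have "Poly_Mapping.lookup a x \<in> Hom B (fobj (\<rho> x) X) Y p" "Poly_Mapping.lookup b x \<in> Hom B (fobj (\<rho> x) X) Y p" for x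
      using ab by (auto simp: skew_sel)
    then show "smu B g i' (E @ es (HMor X Y p (a + b)) k l # E') =
      smu B g i' (E @ es (HMor X Y p a) k l # E') + smu B g i' (E @ es (HMor X Y p b) k l # E')"
      using r2 o
      by (auto simp: smu_def es_HMor lookup_add act_plus act_obj sexp_append mu_add ksign_plus)
  qed simp
  then show "Poly_Mapping.lookup (mu SK (as @ HMor X Y p (a + b) # bs)) g =
        Poly_Mapping.lookup (mu SK (as @ HMor X Y p a # bs) + mu SK (as @ HMor X Y p b # bs)) g"
    using L[OF m3 K(2)] L[OF m(1) K(3)] L[OF m(2) K(4)]
    by (simp add: lookup_add ex_append_Cons ex_plus sum.distrib)
qed

lemma skew_mu_scl:
  assumes m: "mors SK (as @ HMor X Y p a # bs)"
  shows "mu SK (as @ HMor X Y p (scl SK c a) # bs) = scl SK c (mu SK (as @ HMor X Y p a # bs))"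
proof (rule poly_mapping_eqI)
  fix g
  have o: "X \<in> Obj B" "Y \<in> Obj B" and a: "a \<in> Hom SK X Y p"
    using m by (auto simp: mors_pmors pmors_append skew_sel(1))
  interpret Z: vector_space "scl SK" by (rule skew_vector_space)
  have "scl SK c a \<in> Hom SK X Y p" using a o skew_subspace[of X Y p] Z.subspace_scale by (simp add: skew_sel(1))
  then have m2: "mors SK (as @ HMor X Y p (scl SK c a) # bs)"
    using m o by (auto simp: mors_pmors pmors_append)
  define K where "K = Poly_Mapping.keys a \<union> (\<Union>f\<in>set (as @ bs). Poly_Mapping.keys (val f))"
  have "Poly_Mapping.keys (scl SK c a) \<subseteq> Poly_Mapping.keys a"
    by (auto simp: skew_sel(3) in_keys_iff lookup_map_0)
  then have K: "finite K" "Poly_Mapping.keys (scl SK c a) \<subseteq> K" "Poly_Mapping.keys a \<subseteq> K"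
    by (auto simp: K_def)
  have L: "Poly_Mapping.lookup (mu SK (as @ HMor X Y p c # bs)) g = ex (Nf K) es (as @ HMor X Y p c # bs) 0 (smu B g)"
    if "mors SK (as @ HMor X Y p c # bs)" "Poly_Mapping.keys c \<subseteq> K" for c
    by (rule lookup_mu_skew_Nf) (use that K in \<open>auto simp: K_def\<close>)
  have "ex (Nf K) es (as @ HMor X Y p (scl SK c a) # bs) 0 (smu B g) =
    ex (Nf K) es as 0 (\<lambda>k E. \<Sum>l\<in>Nf K (HMor X Y p a) k. ex (Nf K) es bs l (\<lambda>i' E'.
      scl B c (smu B g i' (E @ es (HMor X Y p a) k l # E'))))"
    unfolding ex_append_Cons
  proof (intro ex_cong sum.cong)
    fix k E l i' E'
    assume r: "run (Nf K) es as 0 k E" "l \<in> Nf K (HMor X Y p a) k" "run (Nf K) es bs l i' E'"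
    have r2: "mors B (map snd E @ snd (es (HMor X Y p a) k l) # map snd E')"
      using skew_run_letter[OF m r] by auto
    have "Poly_Mapping.lookup a x \<in> Hom B (fobj (\<rho> x) X) Y p" for x
      using a by (auto simp: skew_sel)
    then show "smu B g i' (E @ es (HMor X Y p (scl SK c a)) k l # E') =
      scl B c (smu B g i' (E @ es (HMor X Y p a) k l # E'))"
      using r2 o
      by (auto simp: smu_def es_HMor skew_sel(3) lookup_map_0 act_scl act_obj sexp_append mu_scl ksign_def)
  qed simp
  also have "\<dots> = ex (Nf K) es (as @ HMor X Y p a # bs) 0 (\<lambda>i' E. scl B c (smu B g i' E))"
    by (simp add: ex_append_Cons)
  also have "\<dots> = scl B c (ex (Nf K) es (as @ HMor X Y p a # bs) 0 (smu B g))"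
    by (rule ex_additive[symmetric]) (auto simp: vs.scale_right_distrib)
  finally show "Poly_Mapping.lookup (mu SK (as @ HMor X Y p (scl SK c a) # bs)) g =
        Poly_Mapping.lookup (scl SK c (mu SK (as @ HMor X Y p a # bs))) g"
    using L[OF m2 K(2)] L[OF m K(3)] by (simp add: skew_sel(3) lookup_map_0)
qed

lemma skew_relation:
  assumes "mors SK fs"
  shows "(\<Sum>(xs, ys, zs)\<in>splits fs. ksign (\<Sum>z\<leftarrow>zs. rdeg z) (mu SK (xs @ mu_mor SK ys # zs))) = 0"
proof (rule poly_mapping_eqI)
  fix g
  have pieces: "\<exists>T U V S. pmors SK T xs U \<and> pmors SK U ys V \<and> pmors SK V zs S" if "fs = xs @ ys @ zs" for xs ys zs
    using assms that by (auto simp: mors_pmors pmors_append)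
  have mM: "mors SK (xs @ mu_mor SK ys # zs)" if fs: "fs = xs @ ys @ zs" "ys \<noteq> []" for xs ys zs
  proof -
    obtain T U V S where U: "pmors SK T xs U" "pmors SK U ys V" "pmors SK V zs S"
      using pieces[OF fs(1)] by blast
    have "mor SK (mu_mor SK ys)" using U fs by (intro skew_mu_closed) (auto simp: mors_pmors)
    then show ?thesis
      using U pmors_ends[OF U(2) fs(2)] by (auto simp: mors_pmors pmors_append)
  qed
  \<comment> \<open>Strictness of the action enters here. In state \<open>k\<close> the composite
    letter emits \<open>\<rho> k\<close> of a composition; \<open>act_mu\<close> moves
    \<open>\<rho> k\<close> to the individual letters, and \<open>ex_translate\<close> recognizes
    the result as the runs that start at \<open>k\<close>.\<close>
  have valM: "val (snd (es (mu_mor SK ys) k l)) = ex Nk es ys k (smu B l)"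
    if fs: "fs = xs @ ys @ zs" "ys \<noteq> []" for xs ys zs k l
  proof -
    obtain T S where TS: "pmors SK T ys S" using pieces[OF fs(1)] by blast
    have m: "mors SK ys" using TS fs by (auto simp: mors_pmors)
    have obj: "T \<in> Obj B" "S \<in> Obj B" using pmors_obj[OF TS fs(2)] by (auto simp: skew_sel)
    let ?g = "- k + l"
    let ?p = "(\<Sum>a\<leftarrow>ys. deg a) + 2 - int (length ys)"
    have "val (snd (es (mu_mor SK ys) k l)) = fmor (\<rho> k) (HMor (fobj (\<rho> ?g) S) T ?p (ex Nk es ys 0 (smu B ?g)))"
      using pmors_ends[OF TS fs(2)] lookup_mu_skew[OF m] by (simp add: component_def)
    also have "\<dots> = ex Nk es ys 0 (\<lambda>i E. fmor (\<rho> k) (HMor (fobj (\<rho> ?g) S) T ?p (smu B ?g i E)))"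
      using smu_skew_Hom[OF TS fs(2), of Nk 0] obj by (intro act_ex act_obj) auto
    also have "\<dots> = ex Nk es ys 0 (\<lambda>i E. smu B l (k + i) (map (\<lambda>x. (fst x, fhm (\<rho> k) (snd x))) E))"
    proof (rule ex_cong)
      fix i E assume r: "run Nk es ys 0 i E"
      note R = run_skew[OF TS r]
      have ne: "map snd E \<noteq> []" using run_length[OF r] fs by auto
      have s: "sexp E = 0" "sexp (map (\<lambda>x. (fst x, fhm (\<rho> k) (snd x))) E) = 0"
        using R by (auto intro!: sexp_zero)
      show "fmor (\<rho> k) (HMor (fobj (\<rho> ?g) S) T ?p (smu B ?g i E)) =
        smu B l (k + i) (map (\<lambda>x. (fst x, fhm (\<rho> k) (snd x))) E)"
      proof (cases "i = ?g")
        case True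
        then have ends: "src (last (map snd E)) = fobj (\<rho> ?g) S" "tgt (hd (map snd E)) = T"
          using R pmors_ends[OF _ ne, of B] by auto
        have "(\<Sum>a\<leftarrow>map snd E. deg a) + 2 - int (length (map snd E)) = ?p"
          using R run_length[OF r] by (simp add: comp_def)
        with ends have "HMor (fobj (\<rho> ?g) S) T ?p (smu B ?g i E) = mu_mor B (map snd E)"
          using True s unfolding mu_mor_def by (simp add: smu_def)
        moreover have "mors B (map snd E)" using R ne by (auto simp: mors_pmors)
        ultimately have "fmor (\<rho> k) (HMor (fobj (\<rho> ?g) S) T ?p (smu B ?g i E)) = mu B (map (fhm (\<rho> k)) (map snd E))"
          by (simp add: act_mu)
        then show ?thesis using True s by (simp add: smu_def comp_def)
      next
        case False
        then have "k + i \<noteq> l" by auto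
        then show ?thesis using False obj by (simp add: smu_def act_zero act_obj)
      qed
    qed
    also have "\<dots> = ex Nk es ys (k + 0) (smu B l)" by (rule ex_translate[symmetric])
    finally show ?thesis by simp
  qed
  have "(\<Sum>(xs, ys, zs)\<in>splits fs. ksign (\<Sum>z\<leftarrow>zs. rdeg z) (ex Nk es (xs @ mu_mor SK ys # zs) 0 (smu B g))) = 0"
  proof (rule expansion_relation)
    show "mors B (map snd E)" if "run Nk es fs 0 i E" for i E
      using run_skew_mors[OF assms that] .
    show "mors B (map snd E)" if "fs = xs @ ys @ zs" "ys \<noteq> []" "run Nk es (xs @ mu_mor SK ys # zs) 0 i E" for xs ys zs i E
      using run_skew_mors[OF mM[OF that(1,2)] that(3)] .
    show "fst (es f k l) + deg (snd (es f k l)) = deg f" for f k l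
      by simp
  next
    fix xs ys zs k E1 l E2
    assume fs: "fs = xs @ ys @ zs" "ys \<noteq> []" and r: "run Nk es ys k l E2"
    obtain T S where TS: "pmors SK T ys S" using pieces[OF fs(1)] by blast
    have ne: "map snd E2 \<noteq> []" using run_length[OF r] fs by auto
    note R = run_skew[OF TS r]
    have "(\<Sum>y\<leftarrow>E2. fst y) = 0" using R by (intro sum_list_zero) auto
    then show "\<exists>v. es (mu_mor SK ys) k l = (\<Sum>y\<leftarrow>E2. fst y,
        HMor (src (mu_mor B (map snd E2))) (tgt (mu_mor B (map snd E2))) (deg (mu_mor B (map snd E2))) v)"
      using R pmors_ends[of B _ "map snd E2"] ne pmors_ends[OF TS fs(2)] run_length[OF r]
      by (intro exI[of _ "val (snd (es (mu_mor SK ys) k l))"]) (auto simp: fhm_def fobj_fobj comp_def)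
  next
    fix xs ys zs k E1 l
    assume fs: "fs = xs @ ys @ zs" "ys \<noteq> []" and l: "l \<notin> Nk (mu_mor SK ys) k"
    have "- k + l \<notin> Poly_Mapping.keys (mu SK ys)" using l by (metis add_minus_cancel imageI mu_mor_sel(4))
    then have z: "Poly_Mapping.lookup (mu SK ys) (- k + l) = 0" by (simp add: in_keys_iff)
    obtain T S where TS: "pmors SK T ys S" using pieces[OF fs(1)] by blast
    show "ex Nk es ys k (smu B l) = 0"
      unfolding valM[OF fs, symmetric] using z pmors_ends[OF TS fs(2)] pmors_obj[OF TS fs(2)]
      by (auto simp: component_def skew_sel(1) intro!: act_zero act_obj)
  qed (use valM in auto)
  moreover have "Poly_Mapping.lookup (\<Sum>(xs, ys, zs)\<in>splits fs. ksign (\<Sum>z\<leftarrow>zs. rdeg z) (mu SK (xs @ mu_mor SK ys # zs))) g =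
      (\<Sum>(xs, ys, zs)\<in>splits fs. ksign (\<Sum>z\<leftarrow>zs. rdeg z) (ex Nk es (xs @ mu_mor SK ys # zs) 0 (smu B g)))"
    unfolding lookup_sum by (intro sum.cong refl) (auto simp: splits_def lookup_ksign lookup_mu_skew mM)
  ultimately show "Poly_Mapping.lookup (\<Sum>(xs, ys, zs)\<in>splits fs. ksign (\<Sum>z\<leftarrow>zs. rdeg z) (mu SK (xs @ mu_mor SK ys # zs))) g =
      Poly_Mapping.lookup 0 g" by simp
qed

text \<open>In state \<open>h\<close> the unit is emitted after transport by
  \<open>\<rho> h\<close>, so it acts as a unit along every run precisely because the action
  preserves strict units.\<close>

lemma skew_unit:
  assumes X: "X \<in> Obj B"
  shows "is_strict_unit SK X (Poly_Mapping.single 0 (strict_unit B X))"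
proof -
  let ?I = "Poly_Mapping.single (0 :: 'g) (strict_unit B X)"
  let ?D = "HMor X X 0 ?I"
  let ?e = "\<lambda>h. HMor (fobj (\<rho> h) X) (fobj (\<rho> h) X) 0 (fmor (\<rho> h) (HMor X X 0 (strict_unit B X)))"
  have u: "is_strict_unit B (fobj (\<rho> h) X) (fmor (\<rho> h) (HMor X X 0 (strict_unit B X)))" for h
    by (rule is_strict_unit_act[OF X strict_unit_is[OF X]])
  have u0: "is_strict_unit B X (strict_unit B X)" by (rule strict_unit_is[OF X])
  have D: "mor SK ?D"
    using X u0 by (auto simp: skew_sel lookup_single when_def is_strict_unit_def intro!: Hom_0 act_obj)
  have es_D: "es ?D h h = (0, ?e h)" for h by (simp add: component_def fhm_def)
  have es_D': "val (snd (es ?D h k)) = 0" if "h \<noteq> k" for h k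
  proof -
    have "- h + k \<noteq> 0" using that by (metis add_minus_cancel add.right_neutral)
    then show ?thesis using X by (simp add: es_HMor lookup_single when_def act_zero act_obj)
  qed
  have run0: "mors B (map snd E)" if "mors SK fs" "run (Nf K) es fs 0 i E" for fs K i E
    using run_skew_mors that .
  have "mu SK [?D] = 0"
  proof (rule poly_mapping_eqI)
    fix g
    have m: "mors SK [?D]" using D by (simp add: mors_pmors)
    have "smu B g k [es ?D 0 k] = 0" for k
    proof (cases "k = 0")
      case True
      have "mu B [?e 0] = 0" using u[of 0] by (simp add: is_strict_unit_def)
      then show ?thesis using True es_D[of 0] by (simp add: smu_def)
    next
      case False
      have "mors B (map snd [es ?D 0 k])" by (rule run0[OF m, of "{k}" k]) auto
      then show ?thesis using es_D'[of 0 k] False by (intro smu_zero_entry') auto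
    qed
    then show "Poly_Mapping.lookup (mu SK [?D]) g = Poly_Mapping.lookup 0 g"
      unfolding lookup_mu_skew[OF m] by simp
  qed
  moreover have "ksign (deg a) (mu SK [?D, a]) = val a" if a: "mor SK a" "tgt a = X" for a
  proof (rule poly_mapping_eqI)
    fix g
    \<comment> \<open>0 is the key of the unit, and \<open>g\<close> is the component that is read
      off, which need not be a key of \<open>a\<close>.\<close>
    define K where "K = insert g (insert 0 (Poly_Mapping.keys (val a)))"
    have m: "mors SK [?D, a]" using D a by (simp add: mors_pmors)
    have "Poly_Mapping.lookup (mu SK [?D, a]) g = ex (Nf K) es [?D, a] 0 (smu B g)"
      by (rule lookup_mu_skew_Nf[OF m]) (auto simp: K_def split: if_splits)
    also have "\<dots> = (\<Sum>k\<in>K. \<Sum>l\<in>(+) k ` K. smu B g l [es ?D 0 k, es a k l])"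
      by simp
    also have "\<dots> = (\<Sum>k\<in>{0}. \<Sum>l\<in>(+) k ` K. smu B g l [es ?D 0 k, es a k l])"
    proof (rule sum.mono_neutral_right)
      show "\<forall>k\<in>K - {0}. (\<Sum>l\<in>(+) k ` K. smu B g l [es ?D 0 k, es a k l]) = 0"
      proof (intro ballI sum.neutral)
        fix k l assume k: "k \<in> K - {0}" "l \<in> (+) k ` K"
        have "mors B (map snd [es ?D 0 k, es a k l])"
          by (rule run0[OF m, of K l]) (use k in auto)
        then show "smu B g l [es ?D 0 k, es a k l] = 0"
          using es_D'[of 0 k] k by (intro smu_zero_entry') auto
      qed
    qed (auto simp: K_def)
    also have "\<dots> = (\<Sum>l\<in>K. if l = g then mu B [?e 0, component \<rho> a g] else 0)"
      using es_D[of 0] by (auto simp: smu_def intro!: sum.cong)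
    also have "\<dots> = mu B [?e 0, component \<rho> a g]" by (simp add: K_def)
    finally have "Poly_Mapping.lookup (ksign (deg a) (mu SK [?D, a])) g =
        ksign (deg (component \<rho> a g)) (mu B [?e 0, component \<rho> a g])" by (simp add: lookup_ksign)
    also have "\<dots> = val (component \<rho> a g)"
    proof -
      have "mor B (component \<rho> a g)" using a by (auto simp: mor_def skew_sel intro: act_obj)
      moreover have "tgt (component \<rho> a g) = fobj (\<rho> 0) X" using a by simp
      ultimately show ?thesis using u[of 0] unfolding is_strict_unit_def by blast
    qed
    finally show "Poly_Mapping.lookup (ksign (deg a) (mu SK [?D, a])) g = Poly_Mapping.lookup (val a) g" by simp
  qed
  moreover have "mu SK [a, ?D] = val a" if a: "mor SK a" "src a = X" for a
  proof (rule poly_mapping_eqI)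
    fix g
    define K where "K = insert g (insert 0 (Poly_Mapping.keys (val a)))"
    have K: "finite K" "g \<in> K" "0 \<in> K" by (auto simp: K_def)
    have m: "mors SK [a, ?D]" using D a by (simp add: mors_pmors)
    have "Poly_Mapping.lookup (mu SK [a, ?D]) g = ex (Nf K) es [a, ?D] 0 (smu B g)"
      by (rule lookup_mu_skew_Nf[OF m]) (auto simp: K_def split: if_splits)
    also have "\<dots> = (\<Sum>k\<in>K. \<Sum>l\<in>(+) k ` K. smu B g l [es a 0 k, es ?D k l])"
      by simp
    also have "\<dots> = (\<Sum>k\<in>K. \<Sum>l\<in>(+) k ` K. if l = k then smu B g k [es a 0 k, es ?D k k] else 0)"
    proof (intro sum.cong refl)
      fix k l assume k: "k \<in> K" "l \<in> (+) k ` K"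
      have "mors B (map snd [es a 0 k, es ?D k l])"
        by (rule run0[OF m, of K l]) (use k in auto)
      then have "smu B g l [es a 0 k, es ?D k l] = 0" if "l \<noteq> k"
        using es_D'[of k l] that by (intro smu_zero_entry'[where e = "es ?D k l"]) auto
      then show "smu B g l [es a 0 k, es ?D k l] = (if l = k then smu B g k [es a 0 k, es ?D k k] else 0)"
        by simp
    qed
    also have "\<dots> = (\<Sum>k\<in>K. smu B g k [es a 0 k, es ?D k k])"
    proof (intro sum.cong refl)
      fix k assume "k \<in> K"
      have "k \<in> (+) k ` K" using K(3) by (metis add.right_neutral imageI)
      then show "(\<Sum>l\<in>(+) k ` K. if l = k then smu B g k [es a 0 k, es ?D k k] else 0) = smu B g k [es a 0 k, es ?D k k]"
        using K by (subst sum.delta) auto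
    qed
    also have "\<dots> = (\<Sum>k\<in>K. if k = g then mu B [component \<rho> a g, ?e g] else 0)"
      by (intro sum.cong refl) (simp only: es_D, auto simp: smu_def)
    also have "\<dots> = mu B [component \<rho> a g, ?e g]" using K by simp
    also have "\<dots> = val (component \<rho> a g)"
    proof -
      have "mor B (component \<rho> a g)" using a by (auto simp: mor_def skew_sel intro: act_obj)
      moreover have "src (component \<rho> a g) = fobj (\<rho> g) X" using a by simp
      ultimately show ?thesis using u[of g] unfolding is_strict_unit_def by blast
    qed
    finally show "Poly_Mapping.lookup (mu SK [a, ?D]) g = Poly_Mapping.lookup (val a) g" by simp
  qed
  moreover have "mu SK (as @ ?D # bs) = 0"
    if m: "mors SK (as @ ?D # bs)" and l: "length as + length bs \<ge> 2" for as bs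
  proof (rule poly_mapping_eqI)
    fix g
    have "ex Nk es (as @ ?D # bs) 0 (smu B g) = 0"
      unfolding ex_append_Cons
    proof (intro ex_zero_cong sum.neutral ballI)
      fix k E l i' E'
      assume r: "run Nk es as 0 k E" "l \<in> Nk ?D k" "run Nk es bs l i' E'"
      have mm: "mors B (map snd (E @ es ?D k l # E'))" using skew_run_letter[OF m r] by simp
      show "smu B g i' (E @ es ?D k l # E') = 0"
      proof (cases "k = l")
        case True
        have "mu B (map snd E @ ?e k # map snd E') = 0"
          using u[of k] mm \<open>length as + length bs \<ge> 2\<close> run_length[OF r(1)] run_length[OF r(3)]
          unfolding True[symmetric] es_D by (simp add: is_strict_unit_def)
        then show ?thesis unfolding True[symmetric] es_D by (simp add: smu_def)
      next
        case False
        then show ?thesis using es_D' by (intro smu_zero_entry'[OF mm, of "es ?D k l"]) auto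
      qed
    qed
    then show "Poly_Mapping.lookup (mu SK (as @ ?D # bs)) g = Poly_Mapping.lookup 0 g"
      by (simp add: lookup_mu_skew[OF m])
  qed
  ultimately show ?thesis using D by (simp add: is_strict_unit_def)
qed

lemma ainf_category_skew: "ainf_category SK"
proof (rule ainf_category.intro)
  show "vector_space (scl SK)" by (rule skew_vector_space)
  show "\<And>X Y p. X \<in> Obj SK \<Longrightarrow> Y \<in> Obj SK \<Longrightarrow> module.subspace (scl SK) (Hom SK X Y p)"
    by (rule skew_subspace)
  show "\<And>as. mors SK as \<Longrightarrow> mor SK (mu_mor SK as)" by (rule skew_mu_closed)
  show "\<And>X. X \<in> Obj SK \<Longrightarrow> \<exists>e. is_strict_unit SK X e" using skew_unit by (auto simp: skew_sel(1))
next
  fix as :: "('o, 'g \<Rightarrow>\<^sub>0 'm) hmor list" and d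
  assume "mors SK as" "d = length as"
  then show "(\<Sum>(m, n)\<in>{(m, n). 1 \<le> m \<and> m + n \<le> d}. ksign (\<Sum>a\<leftarrow>drop (d - n) as. rdeg a)
      (mu SK (take (d - m - n) as @ mu_mor SK (take m (drop (d - m - n) as)) # drop (d - n) as))) = 0"
    using sum_splits[OF \<open>d = length as\<close>, of "\<lambda>P Q R. ksign (\<Sum>a\<leftarrow>R. rdeg a) (mu SK (P @ mu_mor SK Q # R))"]
      skew_relation by simp
qed (simp_all add: skew_mu_add skew_mu_scl)

end

section \<open>Words with inserted letters\<close>

text \<open>
  In a word, \<open>Inr f\<close> is a letter of the given string and \<open>Inl T\<close> an inserted endomorphism of the
  object \<open>T\<close>.
\<close>

primrec rights :: "('a + 'b) list \<Rightarrow> 'b list" where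
  "rights [] = []"
| "rights (x # w) = (case x of Inl _ \<Rightarrow> rights w | Inr f \<Rightarrow> f # rights w)"

lemma rights_append [simp]: "rights (u @ v) = rights u @ rights v"
  by (induction u) (auto split: sum.splits)

lemma rights_replicate_Inl [simp]: "rights (replicate n (Inl T)) = []"
  by (induction n) auto

lemma length_rights: "length (rights w) \<le> length w"
  by (induction w) (auto split: sum.splits)

abbreviation wpath :: "('l \<Rightarrow> 'o) \<Rightarrow> ('l \<Rightarrow> 'o) \<Rightarrow> 'o \<Rightarrow> ('o + 'l) list \<Rightarrow> 'o \<Rightarrow> bool"
  where "wpath sr tg \<equiv> path (case_sum id sr) (case_sum id tg)"

text \<open>The bound on the length makes the set finite. Unbounded sums over insertions are
  replaced by sums over these sets for all large \<open>L\<close>.\<close>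

definition words :: "('l \<Rightarrow> 'o) \<Rightarrow> ('l \<Rightarrow> 'o) \<Rightarrow> 'o \<Rightarrow> 'l list \<Rightarrow> 'o \<Rightarrow> nat \<Rightarrow> ('o + 'l) list set"
  where "words sr tg T fs S L = {w. rights w = fs \<and> wpath sr tg T w S \<and> length w \<le> L}"

primrec ins :: "('l \<Rightarrow> 'o) \<Rightarrow> 'o \<Rightarrow> 'l list \<Rightarrow> nat list \<Rightarrow> ('o + 'l) list" where
  "ins sr T [] ns = replicate (hd ns) (Inl T)"
| "ins sr T (f # fs) ns = replicate (hd ns) (Inl T) @ Inr f # ins sr (sr f) fs (tl ns)"

primrec counts :: "('o + 'l) list \<Rightarrow> nat list" where
  "counts [] = [0]"
| "counts (x # w) = (case x of Inl _ \<Rightarrow> Suc (hd (counts w)) # tl (counts w) | Inr _ \<Rightarrow> 0 # counts w)"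

definition box :: "nat \<Rightarrow> nat \<Rightarrow> nat list set"
  where "box d L = {ns. length ns = Suc d \<and> sum_list ns + d \<le> L}"

lemma wpath_replicate: "wpath sr tg T (replicate n (Inl T)) T"
  by (induction n) auto

lemma wpath_rights_Nil: "wpath sr tg T w S \<Longrightarrow> rights w = [] \<Longrightarrow> w = replicate (length w) (Inl T) \<and> S = T"
  by (induction w arbitrary: T) (auto split: sum.splits)

lemma path_rights: "wpath sr tg T w S \<Longrightarrow> path sr tg T (rights w) S"
  by (induction w arbitrary: T) (auto split: sum.splits)

lemma finite_box [simp]: "finite (box d L)"
proof -
  have "box d L \<subseteq> {ns. set ns \<subseteq> {..L} \<and> length ns = Suc d}"
    using member_le_sum_list by (fastforce simp: box_def)
  then show ?thesis by (rule finite_subset) (simp add: finite_lists_length_eq)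
qed

lemma ins_words:
  assumes "path sr tg T fs S" "length ns = Suc (length fs)"
  shows "rights (ins sr T fs ns) = fs \<and> wpath sr tg T (ins sr T fs ns) S \<and>
    length (ins sr T fs ns) = sum_list ns + length fs \<and> counts (ins sr T fs ns) = ns"
  using assms
proof (induction fs arbitrary: T ns)
  case Nil
  then obtain n where "ns = [n]" by (cases ns) auto
  moreover have "counts (replicate n (Inl T)) = [n]" by (induction n) auto
  ultimately show ?case using Nil wpath_replicate by auto
next
  case (Cons f fs)
  then obtain n ms where ns: "ns = n # ms" "length ms = Suc (length fs)" by (cases ns) auto
  have c: "counts (replicate n (Inl T) @ Inr f # w) = n # counts w" for w
    by (induction n) auto
  from Cons.IH[of "sr f" ms] Cons.prems ns show ?case
    using wpath_replicate[of sr tg T n] by (auto simp: path_append c)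
qed

lemma counts_words: "wpath sr tg T w S \<Longrightarrow> length (counts w) = Suc (length (rights w)) \<and>
    sum_list (counts w) + length (rights w) = length w \<and> ins sr T (rights w) (counts w) = w"
proof (induction w arbitrary: T)
  case (Cons x w)
  show ?case
  proof (cases x)
    case (Inl U)
    then have U: "U = T" "wpath sr tg T w S" using Cons.prems by auto
    from Cons.IH[OF U(2)] obtain n ms where "counts w = n # ms" by (cases "counts w") auto
    with Cons.IH[OF U(2)] Inl U show ?thesis by (cases "rights w") auto
  next
    case (Inr f)
    with Cons show ?thesis by auto
  qed
qed auto

text \<open>A word is the same as the given string with a list of multiplicities, by the mutually
  inverse maps \<open>ins\<close> and \<open>counts\<close>. Multiplicities are the form in
  \<open>Tw\<close>, while words can be cut and concatenated.\<close>

lemma sum_box_words: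
  assumes "path sr tg T fs S"
  shows "(\<Sum>ns\<in>box (length fs) L. \<Phi> (ins sr T fs ns)) = (\<Sum>w\<in>words sr tg T fs S L. \<Phi> w)"
  by (rule sum.reindex_bij_witness[where i = counts and j = "ins sr T fs"])
     (use ins_words[OF assms] counts_words in \<open>fastforce simp: box_def words_def\<close>)+

lemma finite_words [simp]: "finite (words sr tg T fs S L)"
proof (cases "path sr tg T fs S")
  case True
  have "words sr tg T fs S L \<subseteq> ins sr T fs ` box (length fs) L"
  proof
    fix w assume "w \<in> words sr tg T fs S L"
    then have w: "wpath sr tg T w S" "rights w = fs" "length w \<le> L" by (auto simp: words_def)
    from counts_words[OF w(1)] w show "w \<in> ins sr T fs ` box (length fs) L"
      by (intro image_eqI[of _ _ "counts w"]) (auto simp: box_def)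
  qed
  then show ?thesis by (rule finite_subset) simp
next
  case False
  then have "words sr tg T fs S L = {}" using path_rights by (fastforce simp: words_def)
  then show ?thesis by simp
qed

lemma rights_eq_append_Cons:
  "rights w = xs @ f # zs \<Longrightarrow> \<exists>P R. w = P @ Inr f # R \<and> rights P = xs \<and> rights R = zs"
proof (induction w arbitrary: xs)
  case (Cons x w)
  show ?case
  proof (cases x)
    case (Inl U)
    then obtain P R where "w = P @ Inr f # R" "rights P = xs" "rights R = zs" using Cons by auto
    then show ?thesis using Inl by (intro exI[of _ "x # P"] exI[of _ R]) auto
  next
    case (Inr g)
    then have g: "g # rights w = xs @ f # zs" using Cons.prems by simp
    show ?thesis
    proof (cases "xs = []")
      case True
      then show ?thesis using g Inr by (intro exI[of _ "[]"] exI[of _ w]) auto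
    next
      case False
      then have xs: "xs = g # tl xs" "rights w = tl xs @ f # zs" using g by (cases xs; simp)+
      from Cons.IH[OF xs(2)] obtain P R where "w = P @ Inr f # R" "rights P = tl xs" "rights R = zs"
        by blast
      then show ?thesis using Inr xs(1) by (intro exI[of _ "x # P"] exI[of _ R]) simp
    qed
  qed
qed simp

text \<open>The prefix condition fixes how many letters \<open>Inr\<close> stand before the
  separating one, and hence its position.\<close>

lemma append_Inr_unique:
  "P @ Inr f # R = P' @ Inr f # R' \<Longrightarrow> rights P = rights P' \<Longrightarrow> P = P' \<and> R = R'"
proof (induction P arbitrary: P')
  case Nil
  then show ?case by (cases P') (auto split: sum.splits)
next
  case (Cons x P)
  then show ?case by (cases P') (auto split: sum.splits)
qed

lemma sum_words_append_Cons:
  "(\<Sum>w\<in>words sr tg T (xs @ f # zs) S L. \<Phi> w) =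
    (\<Sum>(P, R)\<in>{(P, R). P \<in> words sr tg T xs (tg f) L \<and> R \<in> words sr tg (sr f) zs S L \<and> Suc (length P + length R) \<le> L}.
      \<Phi> (P @ Inr f # R))"
proof -
  let ?S = "{(P, R). P \<in> words sr tg T xs (tg f) L \<and> R \<in> words sr tg (sr f) zs S L \<and> Suc (length P + length R) \<le> L}"
  have "bij_betw (\<lambda>(P, R). P @ Inr f # R) ?S (words sr tg T (xs @ f # zs) S L)"
  proof (rule bij_betw_imageI)
    show "inj_on (\<lambda>(P, R). P @ Inr f # R) ?S"
    proof (rule inj_onI)
      fix x y assume xy: "x \<in> ?S" "y \<in> ?S" "(case x of (P, R) \<Rightarrow> P @ Inr f # R) = (case y of (P, R) \<Rightarrow> P @ Inr f # R)"
      obtain P R P' R' where "x = (P, R)" "y = (P', R')" by (cases x, cases y)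
      then show "x = y" using xy append_Inr_unique[of P f R P' R'] by (simp add: words_def)
    qed
    show "(\<lambda>(P, R). P @ Inr f # R) ` ?S = words sr tg T (xs @ f # zs) S L"
    proof (intro equalityI subsetI)
      fix w assume "w \<in> (\<lambda>(P, R). P @ Inr f # R) ` ?S"
      then show "w \<in> words sr tg T (xs @ f # zs) S L" by (auto simp: words_def path_append)
    next
      fix w assume w: "w \<in> words sr tg T (xs @ f # zs) S L"
      then obtain P R where PR: "w = P @ Inr f # R" "rights P = xs" "rights R = zs"
        using rights_eq_append_Cons[of w xs f zs] by (auto simp: words_def)
      then have "(P, R) \<in> ?S" using w by (auto simp: words_def path_append)
      then show "w \<in> (\<lambda>(P, R). P @ Inr f # R) ` ?S" using PR(1) by (intro image_eqI[of _ _ "(P, R)"]) simp_all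
    qed
  qed
  from sum.reindex_bij_betw[OF this, of \<Phi>] show ?thesis by (simp add: case_prod_beta)
qed

text \<open>Pigeonhole: d letters leave d + 1 gaps, and if every gap held at most N - 1 insertions,
  the length would be at most (d + 1)(N - 1) + d, which is less than (d + 1) N.\<close>

lemma words_block:
  assumes "wpath sr tg T w S" "0 < N" "(length (rights w) + 1) * N \<le> length w"
  shows "\<exists>u U v. w = u @ replicate N (Inl U) @ v \<and> U \<in> insert T (sr ` set (rights w))"
  using assms
proof (induction "length (rights w)" arbitrary: w T rule: less_induct)
  case less
  define a where "a = takeWhile isl w"
  define b where "b = dropWhile isl w"
  have w: "w = a @ b" by (simp add: a_def b_def)
  obtain U where U: "wpath sr tg T a U" "wpath sr tg U b S"
    using less.prems(1) unfolding w path_append by blast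
  have ra: "rights a = []" unfolding a_def by (induction w) (auto split: sum.splits)
  from wpath_rights_Nil[OF U(1) ra] have a: "a = replicate (length a) (Inl T)" "U = T" by blast+
  show ?case
  proof (cases "N \<le> length a")
    case True
    have r: "replicate (length a) (Inl T) = replicate N (Inl T) @ replicate (length a - N) (Inl T)"
      using True by (simp add: replicate_add[symmetric])
    have "w = [] @ replicate N (Inl T) @ (replicate (length a - N) (Inl T) @ b) \<and> T \<in> insert T (sr ` set (rights w))"
      by (rule conjI, subst w, subst a(1)) (simp_all only: r append_Nil append_assoc insert_iff simp_thms)
    then show ?thesis by (intro exI)
  next
    case False
    have "b \<noteq> []"
    proof
      assume "b = []"
      then have "length w = length a" using w by simp
      moreover have "N \<le> (length (rights w) + 1) * N" by simp
      ultimately show False using False less.prems(3) by linarith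
    qed
    then obtain x c where b: "b = x # c" by (cases b) auto
    have "\<not> isl x" using b b_def by (metis hd_dropWhile list.distinct(1) list.sel(1))
    then obtain f where x: "x = Inr f" by (cases x) auto
    have rw: "rights w = f # rights c" using w ra b x by simp
    have wc: "wpath sr tg (sr f) c S" using U(2) b x by simp
    have "length w = length a + Suc (length c)" using w b by simp
    then have len: "(length (rights c) + 1) * N \<le> length c"
      using less.prems(3) rw False by (simp add: algebra_simps)
    have "length (rights c) < length (rights w)" using rw by simp
    from less.hyps[OF this wc less.prems(2) len]
    obtain u V v where c: "c = u @ replicate N (Inl V) @ v" "V \<in> insert (sr f) (sr ` set (rights c))"
      by blast
    have "w = (a @ x # u) @ replicate N (Inl V) @ v" unfolding w b c(1) by simp
    moreover have "V \<in> insert T (sr ` set (rights w))" unfolding rw using c(2) by auto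
    ultimately have "w = (a @ x # u) @ replicate N (Inl V) @ v \<and> V \<in> insert T (sr ` set (rights w))" ..
    then show ?thesis by (intro exI)
  qed
qed

section \<open>Twisted complexes form an \<open>A\<^sub>\<infinity>\<close>-category\<close>

text \<open>The rank of a summand is the first step of the filtration that omits it. A filtration is
  thereby traded for a numerical function that every nonzero entry raises, which is easier to follow
  along a run.\<close>

lemma strictly_lower_triangular_rank:
  assumes "strictly_lower_triangular n \<delta>"
  shows "\<exists>r N. (\<forall>i<n. r i < (N::nat)) \<and> (\<forall>j i. i < n \<longrightarrow> \<delta> j i \<noteq> 0 \<longrightarrow> r i < r j)"
proof -
  obtain F N where F0: "F 0 = {..<n}" and dec: "\<And>k. F (Suc k) \<subseteq> F k" and N: "F N = {}"
    and pres: "\<And>k i j. i \<in> F k \<Longrightarrow> \<delta> j i \<noteq> 0 \<Longrightarrow> j \<in> F k"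
    and gr: "\<And>k i j. i \<in> F k - F (Suc k) \<Longrightarrow> j \<in> F k - F (Suc k) \<Longrightarrow> \<delta> j i = 0"
    using assms unfolding strictly_lower_triangular_def by blast
  define r where "r i = (LEAST k. i \<notin> F k)" for i
  have anti: "l \<le> k \<Longrightarrow> F k \<subseteq> F l" for l k
    using lift_Suc_antimono_le[of F l k] dec by blast
  have notin: "i \<notin> F (r i)" for i unfolding r_def by (rule LeastI[of _ N]) (simp add: N)
  have isin: "i \<in> F k \<longleftrightarrow> k < r i" for i k
    using notin anti not_less_Least[of k "\<lambda>k. i \<notin> F k"] unfolding r_def by (meson linorder_not_le subsetD)
  have bound: "r i < Suc N" for i unfolding r_def using Least_le[of "\<lambda>k. i \<notin> F k" N] N by auto
  have "r i < r j" if i: "i < n" and d: "\<delta> j i \<noteq> 0" for i j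
  proof -
    have "0 < r i" using i F0 isin by auto
    then obtain k where k: "r i = Suc k" using gr0_implies_Suc by blast
    have ik: "i \<in> F k" "i \<notin> F (Suc k)" using isin k by auto
    have "j \<in> F k" by (rule pres[OF ik(1) d])
    moreover have "j \<in> F (Suc k)" using gr[of i k j] ik \<open>j \<in> F k\<close> d by blast
    ultimately show ?thesis using isin k by simp
  qed
  with bound show ?thesis by blast
qed

text \<open>The filtration consists of the upper level sets of the rank.\<close>

lemma rank_strictly_lower_triangular:
  fixes r :: "nat \<Rightarrow> nat"
  assumes "\<And>j i. i < n \<Longrightarrow> \<delta> j i \<noteq> 0 \<Longrightarrow> j < n \<and> r i < r j"
  shows "strictly_lower_triangular n \<delta>"
proof -
  define F where "F k = {i. i < n \<and> k \<le> r i}" for k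
  have "F (Suc (Max (insert 0 (r ` {..<n})))) = {}"
    by (auto simp: F_def not_le less_Suc_eq_le)
  moreover have "\<delta> j i = 0" if "i \<in> F k - F (Suc k)" "j \<in> F k - F (Suc k)" for i j k
  proof (rule ccontr)
    assume "\<delta> j i \<noteq> 0"
    then have "r i < r j" using assms[of i j] that by (auto simp: F_def)
    then show False using that by (auto simp: F_def)
  qed
  moreover have "j \<in> F k" if "i \<in> F k" "\<delta> j i \<noteq> 0" for i j k
    using assms[of i j] that by (auto simp: F_def)
  moreover have "F 0 = {..<n}" "\<forall>k. F (Suc k) \<subseteq> F k" by (auto simp: F_def)
  ultimately show ?thesis
    unfolding strictly_lower_triangular_def by (intro exI[of _ F] conjI) blast+
qed

context ainf_category
begin

text \<open>Runs are read from the target to the source, so every nonzero letter lowers the rank by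
  at least one.\<close>

lemma run_rank:
  assumes "run Nz ez D k l E" "\<And>d j i. d \<in> set D \<Longrightarrow> i < n \<Longrightarrow> val d j i \<noteq> 0 \<Longrightarrow> r i < (r j :: nat)"
    and "\<And>d. d \<in> set D \<Longrightarrow> length (src d) = n" "\<And>e. e \<in> set E \<Longrightarrow> val (snd e) \<noteq> 0"
  shows "r l + length D \<le> r k"
  using assms
proof (induction D arbitrary: k E)
  case (Cons d D)
  then obtain k' E' where k': "k' \<in> Nz d k" "E = ez d k k' # E'" "run Nz ez D k' l E'" by auto
  have "r l + length D \<le> r k'" using Cons.IH[OF k'(3)] Cons.prems k' by auto
  moreover have "k' < n" using k'(1) Cons.prems(3)[of d] by (auto simp: Nz_def split: if_splits)
  then have "r k' < r k" using Cons.prems(2)[of d k' k] Cons.prems(4)[of "ez d k k'"] k' by (auto simp: ez_def)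
  ultimately show ?case by simp
qed simp

text \<open>A block longer than the available ranks contains a zero letter on each run. The letters
  of the block only have to be triangular for a common rank; they may differ, because later blocks
  mix two differentials of the same object.\<close>

lemma ZZ_block_zero:
  assumes "mors (ZZ A) (u @ D @ v)" "D \<noteq> []" "N \<le> length D"
    and "\<And>d j i. d \<in> set D \<Longrightarrow> i < n \<Longrightarrow> val d j i \<noteq> 0 \<Longrightarrow> r i < (r j :: nat)"
    and "\<And>d. d \<in> set D \<Longrightarrow> length (src d) = n \<and> length (tgt d) = n" "\<And>i. i < n \<Longrightarrow> r i < N"
  shows "mu (ZZ A) (u @ D @ v) = 0"
proof (intro ext)
  fix j i
  have "ex Nz ez (u @ D @ v) j (smu A i) = 0"
  proof (rule ex_zero_cong)
    fix i' E assume R: "run Nz ez (u @ D @ v) j i' E"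
    then obtain k l E1 E2 E3 where E: "E = E1 @ E2 @ E3" "run Nz ez D k l E2"
      unfolding run_append by blast
    obtain d D' where D: "D = d # D'" using assms(2) by (cases D) auto
    have "k < n" using E(2) assms(5)[of d] by (auto simp: D Nz_def split: if_splits)
    then have "r k < length D" using assms(3) assms(6)[of k] by simp
    then have "\<not> r l + length D \<le> r k" by simp
    then obtain e where "e \<in> set E2" "val (snd e) = 0"
      using run_rank[OF E(2), where n = n and r = r] assms(4,5) by blast
    then show "smu A i i' E = 0" using E(1)
      by (intro smu_zero_entry[OF run_ZZ_mors[OF assms(1) R], of e]) auto
  qed
  then show "mu (ZZ A) (u @ D @ v) j i = (0 :: nat \<Rightarrow> nat \<Rightarrow> 'm) j i" by (simp add: mu_ZZ)
qed

end

abbreviation rl :: "('o, 'm) twc + (('o, 'm) twc, nat \<Rightarrow> nat \<Rightarrow> 'm) hmor \<Rightarrow>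
    (('o \<times> int) list, nat \<Rightarrow> nat \<Rightarrow> 'm) hmor"
  where "rl \<equiv> case_sum tw_diff untwist"

lemma untwist_sel [simp]: "src (untwist f) = fst (src f)" "tgt (untwist f) = fst (tgt f)"
  "deg (untwist f) = deg f" "val (untwist f) = val f"
  by (simp_all add: untwist_def)

lemma tw_diff_sel [simp]: "src (tw_diff T) = fst T" "tgt (tw_diff T) = fst T"
  "deg (tw_diff T) = 1" "val (tw_diff T) = snd T"
  by (simp_all add: tw_diff_def)

lemma insert_diffs_ins:
  assumes "fs \<noteq> []" "length ns = Suc (length fs)"
  shows "insert_diffs fs ns = map rl (ins src (tgt (hd fs)) fs ns)"
proof -
  have aux: "concat (map2 (\<lambda>f n. untwist f # replicate n (tw_diff (src f))) fs ms) =
      (case fs of [] \<Rightarrow> [] | f # gs \<Rightarrow> untwist f # map rl (ins src (src f) gs ms))"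
    if "length ms = length fs" for ms and fs :: "(('a, 'b) twc, nat \<Rightarrow> nat \<Rightarrow> 'b) hmor list"
    using that
  proof (induction fs arbitrary: ms)
    case (Cons f fs)
    then obtain m ms' where ms: "ms = m # ms'" "length ms' = length fs" by (cases ms) auto
    show ?case using Cons.IH[OF ms(2)] ms by (cases fs) auto
  qed simp
  show ?thesis using aux[of "tl ns" fs] assms by (cases fs) (auto simp: insert_diffs_def)
qed

lemma Tw_sel: "T \<in> Obj (Tw A) \<longleftrightarrow> mor (ZZ A) (tw_diff T) \<and> strictly_lower_triangular (length (fst T)) (snd T) \<and>
     Sum_any (\<lambda>d. if d > 0 then mu (ZZ A) (replicate d (tw_diff T)) else 0) = 0"
  "Hom (Tw A) X Y = Hom (ZZ A) (fst X) (fst Y)"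
  "scl (Tw A) = scl (ZZ A)"
  by (simp_all add: Tw_def)

lemma Tw_obj_ZZ: "T \<in> Obj (Tw A) \<Longrightarrow> fst T \<in> Obj (ZZ A)"
  by (auto simp: Tw_sel mor_def)

lemma mor_untwist: "mor (Tw A) f \<Longrightarrow> mor (ZZ A) (untwist f)"
  using Tw_obj_ZZ[of "src f" A] Tw_obj_ZZ[of "tgt f" A] by (simp add: mor_def Tw_sel(2))

lemma wpath_pmors:
  assumes "wpath src tgt T w S" "pmors (Tw A) T (rights w) S" "T \<in> Obj (Tw A)"
  shows "pmors (ZZ A) (fst T) (map rl w) (fst S)"
  using assms
proof (induction w arbitrary: T)
  case (Cons x w)
  show ?case
  proof (cases x)
    case (Inl U)
    moreover have "mor (ZZ A) (tw_diff T)" using Cons.prems(3) by (simp add: Tw_sel(1))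
    ultimately show ?thesis using Cons.IH[of T] Cons.prems by auto
  next
    case (Inr f)
    then have f: "mor (Tw A) f" "tgt f = T" using Cons.prems by auto
    then have "src f \<in> Obj (Tw A)" by (simp add: mor_def)
    then show ?thesis using Inr Cons.IH[of "src f"] Cons.prems f mor_untwist[OF f(1)] by simp
  qed
qed simp

text \<open>Differentials have degree 1 and reduced degree 0, so inserting them changes neither
  signs nor the degree of the composition.\<close>

lemma wpath_degs:
  "(\<Sum>a\<leftarrow>map rl w. rdeg a) = (\<Sum>a\<leftarrow>rights w. rdeg a)"
  "(\<Sum>a\<leftarrow>map rl w. deg a) - int (length w) = (\<Sum>a\<leftarrow>rights w. deg a) - int (length (rights w))"
  by (induction w) (auto split: sum.splits)

section \<open>Nilpotency and truncation of the sums over insertions\<close>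

context ainf_category
begin

definition nilp :: "('o, 'm) twc \<Rightarrow> nat \<Rightarrow> bool"
  where "nilp T N \<longleftrightarrow> 0 < N \<and> (\<forall>n\<ge>N. \<forall>u v. mors (ZZ A) (u @ replicate n (tw_diff T) @ v) \<longrightarrow>
    mu (ZZ A) (u @ replicate n (tw_diff T) @ v) = 0)"

lemma nilp_mono: "nilp T N \<Longrightarrow> N \<le> N' \<Longrightarrow> nilp T N'"
  unfolding nilp_def by (meson le_trans less_le_trans)

lemma Tw_nilpotent:
  assumes T: "strictly_lower_triangular (length (fst T)) (snd T)"
  shows "\<exists>N. nilp T N"
proof -
  obtain r N where r: "\<And>i. i < length (fst T) \<Longrightarrow> r i < (N :: nat)"
    "\<And>j i. i < length (fst T) \<Longrightarrow> snd T j i \<noteq> 0 \<Longrightarrow> r i < r j"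
    using strictly_lower_triangular_rank[OF T] by blast
  have "mu (ZZ A) (u @ replicate n (tw_diff T) @ v) = 0"
    if "Suc N \<le> n" "mors (ZZ A) (u @ replicate n (tw_diff T) @ v)" for u v n
    by (rule ZZ_block_zero[OF that(2), where N = N and n = "length (fst T)" and r = r]) (use that r in auto)
  then have "nilp T (Suc N)" unfolding nilp_def by blast
  then show ?thesis by blast
qed

lemma Tw_nilpotent_finite:
  assumes "finite Ob" "Ob \<subseteq> Obj (Tw A)"
  shows "\<exists>N>0. \<forall>T\<in>Ob. nilp T N"
  using assms
proof (induction Ob rule: finite_induct)
  case (insert T Ob)
  then obtain N where N: "N > 0" "\<forall>T\<in>Ob. nilp T N" by auto
  obtain N' where N': "nilp T N'" using Tw_nilpotent[of T] insert.prems by (auto simp: Tw_sel(1))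
  have "max N N' > 0 \<and> (\<forall>T\<in>insert T Ob. nilp T (max N N'))"
    using N nilp_mono[OF N', of "max N N'"] nilp_mono[of _ N "max N N'"] by auto
  then show ?case by blast
qed auto

text \<open>The bound is uniform in the ends of the word and in the surrounding strings
  \<open>u\<close> and \<open>v\<close>. The surroundings matter in the A-infinity relation, where a
  long word may sit beside a composite letter.\<close>

definition tw_bound :: "('o, 'm) twc set \<Rightarrow> nat \<Rightarrow> nat \<Rightarrow> bool"
  where "tw_bound Ob d L0 \<longleftrightarrow> (\<forall>w T S u v. wpath src tgt T w S \<and> T \<in> Ob \<and> src ` set (rights w) \<subseteq> Ob \<and>
    length (rights w) \<le> d \<and> L0 \<le> length w \<and> mors (ZZ A) (u @ map rl w @ v) \<longrightarrow>
    mu (ZZ A) (u @ map rl w @ v) = 0)"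

lemma tw_boundD:
  "tw_bound Ob d L0 \<Longrightarrow> wpath src tgt T w S \<Longrightarrow> T \<in> Ob \<Longrightarrow> src ` set (rights w) \<subseteq> Ob \<Longrightarrow>
    length (rights w) \<le> d \<Longrightarrow> L0 \<le> length w \<Longrightarrow> mors (ZZ A) (u @ map rl w @ v) \<Longrightarrow>
    mu (ZZ A) (u @ map rl w @ v) = 0"
  unfolding tw_bound_def by blast

text \<open>By \<open>words_block\<close>, a word with at most \<open>d\<close> letters and length
  (d + 1) N contains N consecutive copies of one differential, where N is a common nilpotency bound
  for the finitely many objects that can occur.\<close>

lemma Tw_vanish:
  assumes "finite Ob" "Ob \<subseteq> Obj (Tw A)"
  shows "\<exists>L0. tw_bound Ob d L0"
proof -
  obtain N where N: "N > 0" "\<And>T. T \<in> Ob \<Longrightarrow> nilp T N"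
    using Tw_nilpotent_finite[OF assms] by blast
  show ?thesis
    unfolding tw_bound_def
  proof (intro exI[of _ "(d + 1) * N"] allI impI, elim conjE)
    fix w T S u v
    assume w: "wpath src tgt T w S" "T \<in> Ob" "src ` set (rights w) \<subseteq> Ob" "length (rights w) \<le> d"
      "(d + 1) * N \<le> length w" and m: "mors (ZZ A) (u @ map rl w @ v)"
    have "(length (rights w) + 1) * N \<le> (d + 1) * N" using w(4) by (intro mult_right_mono) auto
    then have "(length (rights w) + 1) * N \<le> length w" using w(5) by linarith
    from words_block[OF w(1) N(1) this] obtain u' U v' where
      U: "w = u' @ replicate N (Inl U) @ v'" "U \<in> Ob" using w by blast
    have eq: "u @ map rl w @ v = (u @ map rl u') @ replicate N (tw_diff U) @ (map rl v' @ v)"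
      unfolding U(1) by simp
    show "mu (ZZ A) (u @ map rl w @ v) = 0"
      using N(2)[OF U(2)] m unfolding eq nilp_def by blast
  qed
qed

text \<open>Words beyond the vanishing bound contribute nothing, so the sum of nonzero terms is the
  sum over words of length at most \<open>L\<close> for each large \<open>L\<close>. As an eventual
  identity it can be combined with others for a common \<open>L\<close>.\<close>

lemma mu_Tw_words:
  assumes "pmors (Tw A) T fs S" "fs \<noteq> []"
  shows "\<forall>\<^sub>F L in sequentially. mu (Tw A) fs = (\<Sum>w\<in>words src tgt T fs S L. mu (ZZ A) (map rl w))"
proof -
  have T: "T \<in> Obj (Tw A)" using pmors_obj[OF assms] by simp
  have p: "path src tgt T fs S" using assms by (simp add: pmors_def)
  have "insert T (src ` set fs) \<subseteq> Obj (Tw A)" using T assms by (auto simp: pmors_def mor_def)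
  moreover have "finite (insert T (src ` set fs))" by simp
  ultimately obtain L0 where L0: "tw_bound (insert T (src ` set fs)) (length fs) L0"
    using Tw_vanish by blast
  have "mu (Tw A) fs = (\<Sum>w\<in>words src tgt T fs S L. mu (ZZ A) (map rl w))" if L: "L0 \<le> L" for L
  proof -
    let ?g = "\<lambda>ns. if length ns = Suc (length fs) then mu (ZZ A) (insert_diffs fs ns) else 0"
    have hd: "tgt (hd fs) = T" using pmors_ends[OF assms] by simp
    have "{ns. ?g ns \<noteq> 0} \<subseteq> box (length fs) L"
    proof
      fix ns assume "ns \<in> {ns. ?g ns \<noteq> 0}"
      then have ns: "length ns = Suc (length fs)" "mu (ZZ A) (insert_diffs fs ns) \<noteq> 0" by (auto split: if_splits)
      note I = ins_words[OF p ns(1)]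
      have "pmors (ZZ A) (fst T) (map rl (ins src T fs ns)) (fst S)"
        by (rule wpath_pmors) (use I assms T in auto)
      moreover have "ins src T fs ns \<noteq> []" using I assms(2) by (metis rights.simps(1))
      ultimately have "mors (ZZ A) (map rl (ins src T fs ns))" by (auto simp: mors_pmors)
      then have "\<not> L0 \<le> length (ins src T fs ns)"
        using tw_boundD[OF L0, of T "ins src T fs ns" S "[]" "[]"] ns I insert_diffs_ins[OF assms(2) ns(1)] hd
        by auto
      then show "ns \<in> box (length fs) L" using I ns L by (auto simp: box_def)
    qed
    then have "mu (Tw A) fs = (\<Sum>ns\<in>box (length fs) L. ?g ns)"
      by (simp add: Tw_def Sum_any.expand_superset)
    also have "\<dots> = (\<Sum>ns\<in>box (length fs) L. mu (ZZ A) (map rl (ins src T fs ns)))"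
      using insert_diffs_ins[OF assms(2)] hd by (intro sum.cong) (auto simp: box_def)
    also have "\<dots> = (\<Sum>w\<in>words src tgt T fs S L. mu (ZZ A) (map rl w))"
      by (rule sum_box_words[OF p])
    finally show ?thesis .
  qed
  then show ?thesis unfolding eventually_sequentially by blast
qed

lemma Maurer_Cartan_eventually:
  assumes "mor (ZZ A) (tw_diff T)" "strictly_lower_triangular (length (fst T)) (snd T)"
  shows "\<forall>\<^sub>F L in sequentially. Sum_any (\<lambda>d. if d > 0 then mu (ZZ A) (replicate d (tw_diff T)) else 0) =
    (\<Sum>d\<in>{1..L}. mu (ZZ A) (replicate d (tw_diff T)))"
proof -
  obtain r N where r: "\<And>i. i < length (fst T) \<Longrightarrow> r i < (N :: nat)"
    "\<And>j i. i < length (fst T) \<Longrightarrow> snd T j i \<noteq> 0 \<Longrightarrow> r i < r j"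
    using strictly_lower_triangular_rank[OF assms(2)] by blast
  have m: "mors (ZZ A) (replicate d (tw_diff T))" if "d > 0" for d
  proof -
    have "pmors (ZZ A) (fst T) (replicate d (tw_diff T)) (fst T)"
      using assms(1) by (induction d) auto
    then show ?thesis using that by (auto simp: mors_pmors)
  qed
  have z: "mu (ZZ A) (replicate d (tw_diff T)) = 0" if "Suc N \<le> d" for d
    using ZZ_block_zero[of "[]" "replicate d (tw_diff T)" "[]" N "length (fst T)" r] m[of d] that r by simp
  have "Sum_any (\<lambda>d. if d > 0 then mu (ZZ A) (replicate d (tw_diff T)) else 0) =
    (\<Sum>d\<in>{1..L}. mu (ZZ A) (replicate d (tw_diff T)))" if "N \<le> L" for L
  proof -
    have "{d. (if d > 0 then mu (ZZ A) (replicate d (tw_diff T)) else 0) \<noteq> 0} \<subseteq> {1..L}"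
      using z that by (force simp: not_less_eq_eq split: if_splits)
    then have "Sum_any (\<lambda>d. if d > 0 then mu (ZZ A) (replicate d (tw_diff T)) else 0) =
      (\<Sum>d\<in>{1..L}. if d > 0 then mu (ZZ A) (replicate d (tw_diff T)) else 0)"
      by (intro Sum_any.expand_superset) auto
    then show ?thesis by simp
  qed
  then show ?thesis unfolding eventually_sequentially by blast
qed

end

text \<open>Twisted complexes are pairs; without these rules the simplifier leaves quantified
  twisted complexes whole.\<close>

declare split_paired_Ex [simp del] split_paired_All [simp del]

lemma wpath_append_Inr:
  "wpath sr tg T P (tg f) \<Longrightarrow> wpath sr tg (sr f) R S \<Longrightarrow> wpath sr tg T (P @ Inr f # R) S"
  by (auto simp: path_append)

section \<open>The axioms for twisted complexes\<close>

context ainf_category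
begin

interpretation Z: ainf_category "ZZ A" by (rule ainf_category_ZZ)

lemma words_pmors:
  assumes "w \<in> words src tgt T fs S L" "pmors (Tw A) T fs S" "T \<in> Obj (Tw A)"
  shows "pmors (ZZ A) (fst T) (map rl w) (fst S)"
  using assms wpath_pmors[of T w S A] by (auto simp: words_def)

lemma words_ne: "w \<in> words sr tg T fs S L \<Longrightarrow> fs \<noteq> [] \<Longrightarrow> w \<noteq> []"
  by (auto simp: words_def)

lemma Tw_mu_closed:
  assumes "mors (Tw A) fs"
  shows "mor (Tw A) (mu_mor (Tw A) fs)"
proof -
  obtain T S where TS: "pmors (Tw A) T fs S" "fs \<noteq> []" using assms by (auto simp: mors_pmors)
  have obj: "T \<in> Obj (Tw A)" "S \<in> Obj (Tw A)" using pmors_obj[OF TS] by auto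
  let ?p = "(\<Sum>a\<leftarrow>fs. deg a) + 2 - int (length fs)"
  obtain L where L: "mu (Tw A) fs = (\<Sum>w\<in>words src tgt T fs S L. mu (ZZ A) (map rl w))"
    using mu_Tw_words[OF TS] by (auto simp: eventually_sequentially)
  have "mu (ZZ A) (map rl w) \<in> Hom (ZZ A) (fst S) (fst T) ?p" if w: "w \<in> words src tgt T fs S L" for w
  proof -
    have "rights w = fs" using w by (simp add: words_def)
    then show ?thesis
      using words_pmors[OF w TS(1) obj(1)] words_ne[OF w TS(2)] wpath_degs(2)[of w]
      by (intro Z.mu_in_Hom) auto
  qed
  then have "mu (Tw A) fs \<in> Hom (ZZ A) (fst S) (fst T) ?p"
    unfolding L using obj by (intro Z.Hom_sum Tw_obj_ZZ)
  then show ?thesis using obj pmors_ends[OF TS] by (simp add: mor_def Tw_sel(2))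
qed

abbreviation pairs where
  "pairs T xs U V zs S L \<equiv> {(P, R). P \<in> words src tgt T xs U L \<and> R \<in> words src tgt V zs S L \<and> Suc (length P + length R) \<le> L}"

text \<open>Cutting words at \<open>f\<close> isolates the dependence on this letter. It is used for
  linearity, for units, and for the composite letter in the relation.\<close>

lemma mu_Tw_pairs:
  assumes "pmors (Tw A) T (xs @ f # zs) S"
  shows "\<forall>\<^sub>F L in sequentially. mu (Tw A) (xs @ f # zs) =
    (\<Sum>(P, R)\<in>pairs T xs (tgt f) (src f) zs S L. mu (ZZ A) (map rl P @ untwist f # map rl R))"
  using mu_Tw_words[OF assms] unfolding sum_words_append_Cons by (auto elim!: eventually_mono simp: case_prod_beta)

lemma pairs_pmors:
  assumes "pmors (Tw A) T (xs @ f # zs) S" "(P, R) \<in> pairs T xs (tgt f) (src f) zs S L"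
  shows "pmors (ZZ A) (fst T) (map rl P @ untwist f # map rl R) (fst S)"
proof -
  have "T \<in> Obj (Tw A)" using pmors_obj[OF assms(1)] by simp
  then show ?thesis
    using wpath_pmors[of T "P @ Inr f # R" S A] wpath_append_Inr[of src tgt T P f R S] assms
    by (auto simp: words_def)
qed

lemma untwist_HMor: "untwist (HMor X Y p a) = HMor (fst X) (fst Y) p a"
  by (simp add: untwist_def)

lemma Tw_mu_add:
  assumes "mors (Tw A) (as @ HMor X Y p a # bs)" "mors (Tw A) (as @ HMor X Y p b # bs)"
  shows "mu (Tw A) (as @ HMor X Y p (a + b) # bs) =
        mu (Tw A) (as @ HMor X Y p a # bs) + mu (Tw A) (as @ HMor X Y p b # bs)"
proof -
  obtain T S where TS: "pmors (Tw A) T (as @ HMor X Y p a # bs) S"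
    using assms(1) by (auto simp: mors_pmors)
  then have TS2: "pmors (Tw A) T (as @ HMor X Y p b # bs) S"
    using assms(2) by (auto simp: mors_pmors pmors_append)
  have XY: "fst X \<in> Obj (ZZ A)" "fst Y \<in> Obj (ZZ A)" using TS by (auto simp: pmors_append intro: Tw_obj_ZZ)
  have "a \<in> Hom (ZZ A) (fst X) (fst Y) p" "b \<in> Hom (ZZ A) (fst X) (fst Y) p"
    using TS TS2 by (auto simp: pmors_append Tw_sel(2))
  then have "a + b \<in> Hom (ZZ A) (fst X) (fst Y) p" using XY Z.Hom_add by blast
  then have TS3: "pmors (Tw A) T (as @ HMor X Y p (a + b) # bs) S"
    using TS by (auto simp: pmors_append Tw_sel(2))
  have "\<forall>\<^sub>F L in sequentially. mu (Tw A) (as @ HMor X Y p (a + b) # bs) =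
        mu (Tw A) (as @ HMor X Y p a # bs) + mu (Tw A) (as @ HMor X Y p b # bs)"
    using mu_Tw_pairs[OF TS] mu_Tw_pairs[OF TS2] mu_Tw_pairs[OF TS3]
  proof eventually_elim
    case (elim L)
    show ?case unfolding elim hmor.sel sum.distrib[symmetric]
    proof (rule sum.cong, simp, clarsimp simp: untwist_HMor)
      fix P R assume PR: "P \<in> words src tgt T as Y L" "R \<in> words src tgt X bs S L" "Suc (length P + length R) \<le> L"
      show "mu (ZZ A) (map rl P @ HMor (fst X) (fst Y) p (a + b) # map rl R) =
        mu (ZZ A) (map rl P @ HMor (fst X) (fst Y) p a # map rl R) + mu (ZZ A) (map rl P @ HMor (fst X) (fst Y) p b # map rl R)"
        using pairs_pmors[OF TS, of P R L] pairs_pmors[OF TS2, of P R L] PR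
        by (intro Z.mu_add) (auto simp: mors_pmors untwist_HMor)
    qed
  qed
  then show ?thesis by simp
qed

lemma Tw_mu_scl:
  assumes "mors (Tw A) (as @ HMor X Y p a # bs)"
  shows "mu (Tw A) (as @ HMor X Y p (scl (Tw A) c a) # bs) = scl (Tw A) c (mu (Tw A) (as @ HMor X Y p a # bs))"
proof -
  obtain T S where TS: "pmors (Tw A) T (as @ HMor X Y p a # bs) S"
    using assms(1) by (auto simp: mors_pmors)
  have XY: "fst X \<in> Obj (ZZ A)" "fst Y \<in> Obj (ZZ A)" using TS by (auto simp: pmors_append intro: Tw_obj_ZZ)
  have "a \<in> Hom (ZZ A) (fst X) (fst Y) p" using TS by (auto simp: pmors_append Tw_sel(2))
  then have "scl (ZZ A) c a \<in> Hom (ZZ A) (fst X) (fst Y) p" using XY Z.Hom_scl by blast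
  then have TS3: "pmors (Tw A) T (as @ HMor X Y p (scl (ZZ A) c a) # bs) S"
    using TS by (auto simp: pmors_append Tw_sel(2))
  have "\<forall>\<^sub>F L in sequentially. mu (Tw A) (as @ HMor X Y p (scl (ZZ A) c a) # bs) =
        scl (ZZ A) c (mu (Tw A) (as @ HMor X Y p a # bs))"
    using mu_Tw_pairs[OF TS] mu_Tw_pairs[OF TS3]
  proof eventually_elim
    case (elim L)
    show ?case unfolding elim hmor.sel Z.vs.scale_sum_right
    proof (rule sum.cong, simp, clarsimp simp: untwist_HMor)
      fix P R assume PR: "P \<in> words src tgt T as Y L" "R \<in> words src tgt X bs S L" "Suc (length P + length R) \<le> L"
      show "mu (ZZ A) (map rl P @ HMor (fst X) (fst Y) p (scl (ZZ A) c a) # map rl R) =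
        scl (ZZ A) c (mu (ZZ A) (map rl P @ HMor (fst X) (fst Y) p a # map rl R))"
        using pairs_pmors[OF TS, of P R L] PR
        by (intro Z.mu_scl) (auto simp: mors_pmors untwist_HMor)
    qed
  qed
  then show ?thesis by (simp add: Tw_sel(3))
qed

lemma Maurer_Cartan_sum:
  assumes "T \<in> Obj (Tw A)"
  shows "\<forall>\<^sub>F L in sequentially. (\<Sum>d\<in>{1..L}. mu (ZZ A) (replicate d (tw_diff T))) = 0"
proof -
  have T: "mor (ZZ A) (tw_diff T)" "strictly_lower_triangular (length (fst T)) (snd T)"
    and 0: "Sum_any (\<lambda>d. if d > 0 then mu (ZZ A) (replicate d (tw_diff T)) else 0) = 0"
    using assms unfolding Tw_sel(1) by blast+
  from Maurer_Cartan_eventually[OF T] show ?thesis unfolding 0 by eventually_elim (rule sym)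
qed

text \<open>
  The relation for \<open>fs\<close> is the sum of the relations in \<open>\<int>A\<close> for all words with letters \<open>fs\<close>. In a
  split \<open>(P, Q, R)\<close> of a word, either \<open>Q\<close> contains a letter of \<open>fs\<close>, or \<open>Q\<close> is a power of \<open>\<delta>\<close>; the
  terms of the second kind cancel by the Maurer--Cartan equation.
\<close>

lemma Tw_relation:
  assumes "mors (Tw A) fs"
  shows "(\<Sum>(xs, ys, zs)\<in>splits fs. ksign (\<Sum>z\<leftarrow>zs. rdeg z) (mu (Tw A) (xs @ mu_mor (Tw A) ys # zs))) = 0"
proof -
  obtain T S where TS: "pmors (Tw A) T fs S" "fs \<noteq> []" using assms by (auto simp: mors_pmors)
  have Tobj: "T \<in> Obj (Tw A)" using pmors_obj[OF TS] by simp
  define Ob where "Ob = insert T (src ` set fs)"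
  have Ob: "finite Ob" "Ob \<subseteq> Obj (Tw A)" using TS Tobj by (auto simp: Ob_def pmors_def mor_def)
  obtain L0 where L0: "tw_bound Ob (length fs) L0" using Tw_vanish[OF Ob] by blast
  have pieces: "pmors (Tw A) T xs (tgt (hd ys)) \<and> pmors (Tw A) (tgt (hd ys)) ys (src (last ys)) \<and>
      pmors (Tw A) (src (last ys)) zs S" if "(xs, ys, zs) \<in> splits fs" for xs ys zs
  proof -
    have s: "fs = xs @ ys @ zs" "ys \<noteq> []" using that by (auto simp: splits_def)
    then obtain U V where "pmors (Tw A) T xs U" "pmors (Tw A) U ys V" "pmors (Tw A) V zs S"
      using TS(1) by (auto simp: pmors_append)
    then show ?thesis using pmors_ends[of "Tw A" U ys V] s(2) by auto
  qed
  have pM: "pmors (Tw A) T (xs @ mu_mor (Tw A) ys # zs) S" if s: "(xs, ys, zs) \<in> splits fs" for xs ys zs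
  proof -
    have ys: "ys \<noteq> []" using s by (auto simp: splits_def)
    have "mor (Tw A) (mu_mor (Tw A) ys)" using pieces[OF s] ys by (intro Tw_mu_closed) (auto simp: mors_pmors)
    then show ?thesis using pieces[OF s] ys by (auto simp: pmors_append)
  qed
  let ?W = "\<lambda>T xs S L. words src tgt T xs S L"
  have ev1: "\<forall>\<^sub>F L in sequentially. \<forall>(xs, ys, zs)\<in>splits fs. mu (Tw A) ys =
      (\<Sum>w\<in>?W (tgt (hd ys)) ys (src (last ys)) L. mu (ZZ A) (map rl w))"
  proof (intro eventually_ball_finite ballI)
    fix x assume x: "x \<in> splits fs"
    obtain xs ys zs where "x = (xs, ys, zs)" by (cases x)
    moreover from this x have "ys \<noteq> []" by (simp add: splits_def)
    ultimately show "\<forall>\<^sub>F L in sequentially. case x of (xs, ys, zs) \<Rightarrow> mu (Tw A) ys =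
      (\<Sum>w\<in>?W (tgt (hd ys)) ys (src (last ys)) L. mu (ZZ A) (map rl w))"
      using mu_Tw_words[of "tgt (hd ys)" ys "src (last ys)"] pieces[of xs ys zs] x by simp
  qed simp
  have ev2: "\<forall>\<^sub>F L in sequentially. \<forall>(xs, ys, zs)\<in>splits fs. mu (Tw A) (xs @ mu_mor (Tw A) ys # zs) =
      (\<Sum>(P, R)\<in>pairs T xs (tgt (hd ys)) (src (last ys)) zs S L. mu (ZZ A) (map rl P @ untwist (mu_mor (Tw A) ys) # map rl R))"
  proof (intro eventually_ball_finite ballI)
    fix x assume x: "x \<in> splits fs"
    obtain xs ys zs where "x = (xs, ys, zs)" by (cases x)
    with x show "\<forall>\<^sub>F L in sequentially. case x of (xs, ys, zs) \<Rightarrow> mu (Tw A) (xs @ mu_mor (Tw A) ys # zs) =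
      (\<Sum>(P, R)\<in>pairs T xs (tgt (hd ys)) (src (last ys)) zs S L. mu (ZZ A) (map rl P @ untwist (mu_mor (Tw A) ys) # map rl R))"
      using mu_Tw_pairs[OF pM[of xs ys zs]] by simp
  qed simp
  have ev3: "\<forall>\<^sub>F L in sequentially. \<forall>U\<in>Ob. (\<Sum>d\<in>{1..L}. mu (ZZ A) (replicate d (tw_diff U))) = 0"
    using Ob Maurer_Cartan_sum by (intro eventually_ball_finite) auto
  have "\<forall>\<^sub>F L in sequentially. (\<forall>(xs, ys, zs)\<in>splits fs. mu (Tw A) ys =
      (\<Sum>w\<in>?W (tgt (hd ys)) ys (src (last ys)) L. mu (ZZ A) (map rl w))) \<and>
      (\<forall>(xs, ys, zs)\<in>splits fs. mu (Tw A) (xs @ mu_mor (Tw A) ys # zs) =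
      (\<Sum>(P, R)\<in>pairs T xs (tgt (hd ys)) (src (last ys)) zs S L. mu (ZZ A) (map rl P @ untwist (mu_mor (Tw A) ys) # map rl R))) \<and>
      (\<forall>U\<in>Ob. (\<Sum>d\<in>{1..L}. mu (ZZ A) (replicate d (tw_diff U))) = 0)"
    by (intro eventually_conj ev1 ev2 ev3)
  then obtain L1 where L1: "\<And>L. L1 \<le> L \<Longrightarrow> (\<forall>(xs, ys, zs)\<in>splits fs. mu (Tw A) ys =
      (\<Sum>w\<in>?W (tgt (hd ys)) ys (src (last ys)) L. mu (ZZ A) (map rl w))) \<and>
      (\<forall>(xs, ys, zs)\<in>splits fs. mu (Tw A) (xs @ mu_mor (Tw A) ys # zs) =
      (\<Sum>(P, R)\<in>pairs T xs (tgt (hd ys)) (src (last ys)) zs S L. mu (ZZ A) (map rl P @ untwist (mu_mor (Tw A) ys) # map rl R))) \<and>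
      (\<forall>U\<in>Ob. (\<Sum>d\<in>{1..L}. mu (ZZ A) (replicate d (tw_diff U))) = 0)"
    unfolding eventually_sequentially by blast
  define L where "L = max L0 L1"
  have LL: "L0 \<le> L" "L1 \<le> L" by (auto simp: L_def)
  have mu_ys: "mu (Tw A) ys = (\<Sum>w\<in>?W (tgt (hd ys)) ys (src (last ys)) L. mu (ZZ A) (map rl w))"
    if "(xs, ys, zs) \<in> splits fs" for xs ys zs
    using L1[OF LL(2)] that by blast
  \<comment> \<open>The bound \<open>2 * L + 1\<close> admits all pairs of words of length at most
    \<open>L\<close> on the two sides of the composite letter; the eventual identity holds at this
    bound as well.\<close>
  have mu_M: "mu (Tw A) (xs @ mu_mor (Tw A) ys # zs) = (\<Sum>(P, R)\<in>pairs T xs (tgt (hd ys)) (src (last ys)) zs S (2 * L + 1).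
      mu (ZZ A) (map rl P @ untwist (mu_mor (Tw A) ys) # map rl R))"
    if "(xs, ys, zs) \<in> splits fs" for xs ys zs
    using L1[of "2 * L + 1"] LL(2) that by fastforce
  have MC: "(\<Sum>d\<in>{1..L}. mu (ZZ A) (replicate d (tw_diff U))) = 0" if "U \<in> Ob" for U
    using L1[OF LL(2)] that by blast
  define g where "g P Q R = ksign (\<Sum>a\<leftarrow>map rl R. rdeg a) (mu (ZZ A) (map rl P @ mu_mor (ZZ A) (map rl Q) # map rl R))"
    for P Q R :: "(('o, 'm) twc + (('o, 'm) twc, nat \<Rightarrow> nat \<Rightarrow> 'm) hmor) list"
  have endsOb: "U \<in> Ob \<and> src ` set (rights Q) \<subseteq> Ob \<and> length (rights Q) \<le> length fs"
    if "wpath src tgt T P U" "rights P @ rights Q @ r = fs" for P U Q r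
  proof -
    have "wpath src tgt T P U \<Longrightarrow> src ` set (rights P) \<subseteq> Ob \<Longrightarrow> U \<in> Ob" for P U
      by (induction P rule: rev_induct) (auto simp: path_append Ob_def split: sum.splits)
    moreover have "src ` set (rights P) \<subseteq> Ob" "src ` set (rights Q) \<subseteq> Ob" using that(2) by (auto simp: Ob_def)
    moreover have "length (rights Q) \<le> length fs" using that(2) by auto
    ultimately show ?thesis using that(1) by blast
  qed
  have wp: "\<exists>U V. wpath src tgt T P U \<and> wpath src tgt U Q V \<and> wpath src tgt V R S"
    if "P @ Q @ R \<in> ?W T fs S L'" for P Q R L'
    using that by (auto simp: words_def path_append)
  \<comment> \<open>A long \<open>P\<close> or \<open>R\<close> makes the outer composition vanish,
    a long \<open>Q\<close> makes the composite letter zero. The sum over splits of words may thus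
    be restricted to triples whose parts are bounded independently.\<close>
  have vanish: "g P Q R = 0"
    if w: "P @ Q @ R \<in> ?W T fs S L'" "Q \<noteq> []" "\<not> (length P \<le> L \<and> length Q \<le> L \<and> length R \<le> L)" for P Q R L'
  proof -
    obtain U V where UV: "wpath src tgt T P U" "wpath src tgt U Q V" "wpath src tgt V R S" using wp[OF w(1)] by blast
    have rt: "rights P @ rights Q @ rights R = fs" using w(1) by (simp add: words_def)
    have m: "pmors (ZZ A) (fst T) (map rl P @ map rl Q @ map rl R) (fst S)"
      using words_pmors[OF w(1) TS(1) Tobj] by simp
    have mM: "pmors (ZZ A) (fst T) (map rl P @ mu_mor (ZZ A) (map rl Q) # map rl R) (fst S)"
      by (rule Z.pmors_mu_mor[OF m]) (use w(2) in simp)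
    have T: "wpath src tgt T [] T" by simp
    note eP = endsOb[OF T, of P "rights Q @ rights R"]
    note eQ = endsOb[OF UV(1), of Q "rights R"]
    have UVP: "wpath src tgt T (P @ Q) V" using UV by (auto simp: path_append)
    note eR = endsOb[OF UVP, of R "[]"]
    consider "L0 \<le> length P" | "L0 \<le> length Q" | "L0 \<le> length R" using w(3) LL(1) by linarith
    then show ?thesis
    proof cases
      case 1
      have "mu (ZZ A) ([] @ map rl P @ mu_mor (ZZ A) (map rl Q) # map rl R) = 0"
        by (rule tw_boundD[OF L0 UV(1)]) (use eP rt mM 1 in \<open>auto simp: mors_pmors\<close>)
      then show ?thesis by (simp add: g_def)
    next
      case 2
      have "\<exists>U V. pmors (ZZ A) U (map rl Q) V" using m by (auto simp: pmors_append)
      then have "mors (ZZ A) ([] @ map rl Q @ [])" using w(2) by (auto simp: mors_pmors)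
      then have "mu (ZZ A) ([] @ map rl Q @ []) = 0"
        by (intro tw_boundD[OF L0 UV(2)]) (use eQ rt 2 in auto)
      then have "mu (ZZ A) (map rl P @ mu_mor (ZZ A) (map rl Q) # map rl R) = 0"
        using mM by (intro Z.mu_zero_entry[of _ "mu_mor (ZZ A) (map rl Q)"]) (auto simp: mors_pmors)
      then show ?thesis by (simp add: g_def)
    next
      case 3
      have "mu (ZZ A) ((map rl P @ [mu_mor (ZZ A) (map rl Q)]) @ map rl R @ []) = 0"
        by (rule tw_boundD[OF L0 UV(3)]) (use eR rt mM 3 in \<open>auto simp: mors_pmors\<close>)
      then show ?thesis by (simp add: g_def)
    qed
  qed
  let ?Big = "SIGMA w:?W T fs S (3 * L). splits w"
  \<comment> \<open>Three parts of length at most \<open>L\<close> form a word of length at most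
    \<open>3 * L\<close>, so \<open>Om\<close> is contained in the splits for which the relations of
    \<int>A have just been added up.\<close>
  define Om where "Om = {(P, Q, R). P @ Q @ R \<in> ?W T fs S (3 * L) \<and> Q \<noteq> [] \<and> length P \<le> L \<and> length Q \<le> L \<and> length R \<le> L}"
  have finBig: "finite ?Big" by (intro finite_SigmaI) auto
  have all0: "(\<Sum>(P, Q, R)\<in>snd ` ?Big. g P Q R) = 0"
  proof -
    have "(\<Sum>(P, Q, R)\<in>snd ` ?Big. g P Q R) = (\<Sum>(w, P, Q, R)\<in>?Big. g P Q R)"
      by (subst sum.reindex) (auto simp: inj_on_def splits_def case_prod_beta)
    also have "\<dots> = (\<Sum>w\<in>?W T fs S (3 * L). \<Sum>(P, Q, R)\<in>splits w. g P Q R)"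
      by (simp add: sum.Sigma)
    also have "\<dots> = 0"
    proof (rule sum.neutral, rule ballI)
      fix w assume w: "w \<in> ?W T fs S (3 * L)"
      have "mors (ZZ A) (map rl w)" using words_pmors[OF w TS(1) Tobj] words_ne[OF w TS(2)] by (auto simp: mors_pmors)
      from Z.relation_splits[OF this] show "(\<Sum>(P, Q, R)\<in>splits w. g P Q R) = 0"
        unfolding splits_map g_def .
    qed
    finally show ?thesis .
  qed
  have OmBig: "Om \<subseteq> snd ` ?Big"
  proof
    fix x assume "x \<in> Om"
    then obtain P Q R where "x = (P, Q, R)" "P @ Q @ R \<in> ?W T fs S (3 * L)" "Q \<noteq> []" by (auto simp: Om_def)
    then show "x \<in> snd ` ?Big" by (intro image_eqI[of _ _ "(P @ Q @ R, x)"]) (auto simp: splits_def)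
  qed
  have sumOm: "(\<Sum>(P, Q, R)\<in>Om. g P Q R) = 0"
  proof -
    have "(\<Sum>(P, Q, R)\<in>Om. g P Q R) = (\<Sum>(P, Q, R)\<in>snd ` ?Big. g P Q R)"
    proof (rule sum.mono_neutral_left)
      show "\<forall>x\<in>snd ` ?Big - Om. (case x of (P, Q, R) \<Rightarrow> g P Q R) = 0"
      proof
        fix x assume x: "x \<in> snd ` ?Big - Om"
        obtain P Q R where PQR: "x = (P, Q, R)" by (cases x)
        then have "P @ Q @ R \<in> ?W T fs S (3 * L)" "Q \<noteq> []" using x by (auto simp: splits_def)
        then show "(case x of (P, Q, R) \<Rightarrow> g P Q R) = 0"
          using vanish[of P Q R "3 * L"] x PQR by (auto simp: Om_def)
      qed
    qed (use finBig OmBig in auto)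
    then show ?thesis using all0 by simp
  qed
  define Om1 where "Om1 = {(P, Q, R)\<in>Om. rights Q \<noteq> []}"
  define Om2 where "Om2 = {(P, Q, R)\<in>Om. rights Q = []}"
  have finOm: "finite Om" using finite_subset[OF OmBig] finBig by blast
  have Om12: "(\<Sum>(P, Q, R)\<in>Om. g P Q R) = (\<Sum>(P, Q, R)\<in>Om1. g P Q R) + (\<Sum>(P, Q, R)\<in>Om2. g P Q R)"
  proof -
    have "Om = Om1 \<union> Om2" "Om1 \<inter> Om2 = {}" by (auto simp: Om1_def Om2_def)
    then show ?thesis using finOm by (simp add: sum.union_disjoint)
  qed
  have "(\<Sum>(P, Q, R)\<in>Om2. g P Q R) = 0"
  proof -
    \<comment> \<open>The object at which the prefix \<open>P\<close> ends; it is the one whose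
      differential fills a middle part without letters.\<close>
    define e where "e P = (THE U. wpath src tgt T P U)" for P :: "(('o, 'm) twc + (('o, 'm) twc, nat \<Rightarrow> nat \<Rightarrow> 'm) hmor) list"
    have e: "e P = U" if "wpath src tgt T P U" for P U
      unfolding e_def using that path_src_unique by (intro the_equality) blast+
    define Lam where "Lam = {(P, R). P @ R \<in> ?W T fs S (3 * L) \<and> length P \<le> L \<and> length R \<le> L}"
    have Lam_wp: "wpath src tgt T P (e P) \<and> wpath src tgt (e P) R S \<and> e P \<in> Ob" if PR: "(P, R) \<in> Lam" for P R
    proof -
      obtain U where U: "wpath src tgt T P U" "wpath src tgt U R S" "rights P @ rights R = fs"
        using PR by (auto simp: Lam_def words_def path_append)
      then show ?thesis using e[OF U(1)] endsOb[OF U(1), of R "[]"] by auto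
    qed
    \<comment> \<open>A middle part without letters of \<open>fs\<close> is a power of the
      differential of \<open>e P\<close>, so only its length \<open>q\<close> is free. For fixed
      \<open>P\<close> and \<open>R\<close> the sum over \<open>q\<close> is the truncated
      Maurer--Cartan sum, inserted as one letter.\<close>
    have "(\<Sum>(P, Q, R)\<in>Om2. g P Q R) = (\<Sum>((P, R), q)\<in>Lam \<times> {1..L}. g P (replicate q (Inl (e P))) R)"
    proof (rule sum.reindex_bij_witness[where i = "\<lambda>((P, R), q). (P, replicate q (Inl (e P)), R)"
          and j = "\<lambda>(P, Q, R). ((P, R), length Q)"])
      fix x assume "x \<in> Om2"
      then obtain P Q R where x: "x = (P, Q, R)" "(P, Q, R) \<in> Om" "rights Q = []" by (auto simp: Om2_def)
      then have PQR: "P @ Q @ R \<in> ?W T fs S (3 * L)" by (auto simp: Om_def)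
      then obtain U V where UV: "wpath src tgt T P U" "wpath src tgt U Q V" "wpath src tgt V R S" using wp by blast
      from wpath_rights_Nil[OF UV(2) x(3)] have Q: "replicate (length Q) (Inl U) = Q" "V = U" by auto
      then show "(\<lambda>((P, R), q). (P, replicate q (Inl (e P)), R)) ((\<lambda>(P, Q, R). ((P, R), length Q)) x) = x"
        using x(1) e[OF UV(1)] by simp
      have "P @ R \<in> ?W T fs S (3 * L)" using PQR UV Q(2) x(3) by (auto simp: words_def path_append)
      then show "(case x of (P, Q, R) \<Rightarrow> ((P, R), length Q)) \<in> Lam \<times> {1..L}"
        using x by (auto simp: Om_def Lam_def Suc_le_eq)
      show "(\<lambda>((P, R), q). g P (replicate q (Inl (e P))) R) ((\<lambda>(P, Q, R). ((P, R), length Q)) x) =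
        (case x of (P, Q, R) \<Rightarrow> g P Q R)"
        using Q x(1) e[OF UV(1)] by simp
    next
      fix y assume y: "y \<in> Lam \<times> {1..L}"
      obtain P R q where y1: "y = ((P, R), q)" by (metis surj_pair)
      then have PR: "(P, R) \<in> Lam" "1 \<le> q" "q \<le> L" using y by auto
      note lw = Lam_wp[OF PR(1)]
      show "(\<lambda>(P, Q, R). ((P, R), length Q)) ((\<lambda>((P, R), q). (P, replicate q (Inl (e P)), R)) y) = y"
        using y1 by simp
      have "wpath src tgt T (P @ replicate q (Inl (e P)) @ R) S"
        using lw wpath_replicate[of src tgt "e P" q] by (auto simp: path_append)
      then have "(P, replicate q (Inl (e P)), R) \<in> Om2"
        using PR by (auto simp: Om2_def Om_def Lam_def words_def)
      then show "(\<lambda>((P, R), q). (P, replicate q (Inl (e P)), R)) y \<in> Om2" using y1 by simp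
    qed
    also have "\<dots> = (\<Sum>(P, R)\<in>Lam. \<Sum>q\<in>{1..L}. g P (replicate q (Inl (e P))) R)"
      unfolding case_prod_beta by (subst sum.cartesian_product) (simp add: case_prod_beta)
    also have "\<dots> = 0"
    proof (rule sum.neutral, rule ballI)
      fix x assume x: "x \<in> Lam"
      obtain P R where PR: "x = (P, R)" by (cases x)
      note lw = Lam_wp[OF x[unfolded PR]]
      let ?U = "fst (e P)"
      have m: "pmors (ZZ A) (fst T) (map rl P @ map rl R) (fst S)"
        using x words_pmors[of "P @ R", OF _ TS(1) Tobj] by (auto simp: PR Lam_def)
      have U: "tw_diff (e P) = HMor ?U ?U 1 (snd (e P))" "mor (ZZ A) (tw_diff (e P))"
        using lw Ob(2) by (auto simp: tw_diff_def Tw_sel(1))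
      have p: "pmors (ZZ A) (fst T) (map rl (P @ replicate q (Inl (e P)) @ R)) (fst S)" for q
      proof (rule words_pmors[OF _ TS(1) Tobj, where L = "length (P @ replicate q (Inl (e P)) @ R)"])
        have "wpath src tgt T (P @ replicate q (Inl (e P)) @ R) S"
          using lw wpath_replicate[of src tgt "e P" q] by (auto simp: path_append)
        then show "P @ replicate q (Inl (e P)) @ R \<in> ?W T fs S (length (P @ replicate q (Inl (e P)) @ R))"
          using x by (auto simp: PR Lam_def words_def)
      qed
      have pq: "pmors (ZZ A) (fst T) (map rl P @ HMor ?U ?U 2 (mu (ZZ A) (replicate q (tw_diff (e P)))) # map rl R) (fst S)"
        "mu_mor (ZZ A) (replicate q (tw_diff (e P))) = HMor ?U ?U 2 (mu (ZZ A) (replicate q (tw_diff (e P))))"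
        if q: "q \<in> {1..L}" for q
      proof -
        have "(\<Sum>a\<leftarrow>replicate q (tw_diff (e P)). deg a) = int q" by (simp add: sum_list_replicate)
        then show eq: "mu_mor (ZZ A) (replicate q (tw_diff (e P))) = HMor ?U ?U 2 (mu (ZZ A) (replicate q (tw_diff (e P))))"
          using q by (simp add: mu_mor_def)
        have "pmors (ZZ A) (fst T) (map rl P @ replicate q (tw_diff (e P)) @ map rl R) (fst S)" using p[of q] by simp
        from Z.pmors_mu_mor[OF this] q show "pmors (ZZ A) (fst T) (map rl P @ HMor ?U ?U 2 (mu (ZZ A) (replicate q (tw_diff (e P)))) # map rl R) (fst S)"
          unfolding eq by simp
      qed
      have "(\<Sum>q\<in>{1..L}. g P (replicate q (Inl (e P))) R) = ksign (\<Sum>a\<leftarrow>map rl R. rdeg a)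
         (\<Sum>q\<in>{1..L}. mu (ZZ A) (map rl P @ HMor ?U ?U 2 (mu (ZZ A) (replicate q (tw_diff (e P)))) # map rl R))"
        by (simp add: g_def ksign_sum pq)
      also have "\<dots> = 0"
      proof (cases "1 \<le> L")
        case True
        have Uo: "?U \<in> Obj (ZZ A)" using U(2) by (simp add: mor_def)
        have m0: "mors (ZZ A) (map rl P @ HMor ?U ?U 2 0 # map rl R)"
          using pq(1)[of 1] True Uo Z.Hom_0 by (auto simp: mors_pmors pmors_append)
        have "(\<Sum>q\<in>{1..L}. mu (ZZ A) (map rl P @ HMor ?U ?U 2 (mu (ZZ A) (replicate q (tw_diff (e P)))) # map rl R)) =
          mu (ZZ A) (map rl P @ HMor ?U ?U 2 (\<Sum>q\<in>{1..L}. mu (ZZ A) (replicate q (tw_diff (e P)))) # map rl R)"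
        proof (rule Z.mu_sum[OF m0, symmetric])
          fix q assume "q \<in> {1..L}"
          from pq(1)[OF this] show "mu (ZZ A) (replicate q (tw_diff (e P))) \<in> Hom (ZZ A) ?U ?U 2" 
            by (auto simp: pmors_append)
        qed
        also have "\<dots> = 0" using m0 MC[of "e P"] lw
          by (intro Z.mu_zero_entry[of _ "HMor ?U ?U 2 0"]) auto
        finally show ?thesis by simp
      qed simp
      finally show "(case x of (P, R) \<Rightarrow> \<Sum>q\<in>{1..L}. g P (replicate q (Inl (e P))) R) = 0" using PR by simp
    qed
    finally show ?thesis .
  qed
  then have Om1_0: "(\<Sum>(P, Q, R)\<in>Om1. g P Q R) = 0" using sumOm Om12 by simp
  let ?X = "\<lambda>(xs, ys, zs). ?W T xs (tgt (hd ys)) L \<times> ?W (tgt (hd ys)) ys (src (last ys)) L \<times> ?W (src (last ys)) zs S L"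
  \<comment> \<open>Inner and outer insertions are cut off at the same \<open>L\<close>, so the
    nested composition becomes a sum over three independent words.\<close>
  have summand: "ksign (\<Sum>z\<leftarrow>zs. rdeg z) (mu (Tw A) (xs @ mu_mor (Tw A) ys # zs)) =
      (\<Sum>(P, Q, R)\<in>?X (xs, ys, zs). g P Q R)" if s: "(xs, ys, zs) \<in> splits fs" for xs ys zs
  proof -
    let ?U = "tgt (hd ys)" and ?V = "src (last ys)"
    let ?p = "(\<Sum>a\<leftarrow>ys. deg a) + 2 - int (length ys)"
    have fs: "fs = xs @ ys @ zs" "ys \<noteq> []" using s by (auto simp: splits_def)
    have M: "untwist (mu_mor (Tw A) ys) = HMor (fst ?V) (fst ?U) ?p (\<Sum>w\<in>?W ?U ys ?V L. mu (ZZ A) (map rl w))"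
      unfolding mu_ys[OF s, symmetric] by (simp add: untwist_def)
    let ?pr = "pairs T xs ?U ?V zs S (2 * L + 1)"
    have inW: "P @ Q @ R \<in> ?W T fs S L'"
      if "P \<in> ?W T xs ?U LP" "Q \<in> ?W ?U ys ?V LQ" "R \<in> ?W ?V zs S LR" "length P + length Q + length R \<le> L'" for P Q R LP LQ LR L'
      using that fs(1) by (auto simp: words_def path_append)
    have mM: "mu_mor (ZZ A) (map rl Q) = HMor (fst ?V) (fst ?U) ?p (mu (ZZ A) (map rl Q))"
      if Q: "Q \<in> ?W ?U ys ?V L" for Q
    proof -
      have "pmors (ZZ A) (fst ?U) (map rl Q) (fst ?V)" "map rl Q \<noteq> []"
        using words_pmors[OF Q] pieces[OF s] pmors_obj[of "Tw A" ?U ys ?V] fs(2) words_ne[OF Q] by auto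
      from pmors_ends[OF this] show ?thesis
        using wpath_degs(2)[of Q] Q by (auto simp: mu_mor_def words_def)
    qed
    have "mu (Tw A) (xs @ mu_mor (Tw A) ys # zs) =
      (\<Sum>(P, R)\<in>?W T xs ?U L \<times> ?W ?V zs S L. mu (ZZ A) (map rl P @ untwist (mu_mor (Tw A) ys) # map rl R))"
      unfolding mu_M[OF s]
    proof (rule sum.mono_neutral_right)
      show "finite ?pr"
        by (rule finite_subset[of _ "?W T xs ?U (2 * L + 1) \<times> ?W ?V zs S (2 * L + 1)"]) auto
      show "?W T xs ?U L \<times> ?W ?V zs S L \<subseteq> ?pr" by (auto simp: words_def)
      show "\<forall>x\<in>?pr - ?W T xs ?U L \<times> ?W ?V zs S L. (case x of (P, R) \<Rightarrow> mu (ZZ A) (map rl P @ untwist (mu_mor (Tw A) ys) # map rl R)) = 0"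
      proof
        fix x assume x: "x \<in> ?pr - ?W T xs ?U L \<times> ?W ?V zs S L"
        obtain P R where PR: "x = (P, R)" by (cases x)
        have W: "P \<in> ?W T xs ?U (2 * L + 1)" "R \<in> ?W ?V zs S (2 * L + 1)" "\<not> (length P \<le> L \<and> length R \<le> L)"
          using x PR by (auto simp: words_def)
        have wPR: "wpath src tgt T P ?U" "wpath src tgt ?V R S" "rights P = xs" "rights R = zs" using W by (auto simp: words_def)
        have p: "pmors (ZZ A) (fst T) (map rl P @ untwist (mu_mor (Tw A) ys) # map rl R) (fst S)"
          using pairs_pmors[OF pM[OF s], of P R "2 * L + 1"] x PR by auto
        have T: "wpath src tgt T [] T" by simp
        have VOb: "?V \<in> Ob" using fs by (auto simp: Ob_def)
        consider "L0 \<le> length P" | "L0 \<le> length R" using W(3) LL(1) by linarith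
        then have "mu (ZZ A) (map rl P @ untwist (mu_mor (Tw A) ys) # map rl R) = 0"
        proof cases
          case 1
          have "mu (ZZ A) ([] @ map rl P @ untwist (mu_mor (Tw A) ys) # map rl R) = 0"
            by (rule tw_boundD[OF L0 wPR(1)]) (use p 1 wPR fs in \<open>auto simp: mors_pmors Ob_def\<close>)
          then show ?thesis by simp
        next
          case 2
          have "mu (ZZ A) ((map rl P @ [untwist (mu_mor (Tw A) ys)]) @ map rl R @ []) = 0"
            by (rule tw_boundD[OF L0 wPR(2)]) (use p 2 wPR fs VOb in \<open>auto simp: mors_pmors Ob_def\<close>)
          then show ?thesis by simp
        qed
        then show "(case x of (P, R) \<Rightarrow> mu (ZZ A) (map rl P @ untwist (mu_mor (Tw A) ys) # map rl R)) = 0" using PR by simp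
      qed
    qed
    also have "\<dots> = (\<Sum>(P, R)\<in>?W T xs ?U L \<times> ?W ?V zs S L. \<Sum>Q\<in>?W ?U ys ?V L.
        mu (ZZ A) (map rl P @ mu_mor (ZZ A) (map rl Q) # map rl R))"
    proof (rule sum.cong[OF refl])
      fix x assume x: "x \<in> ?W T xs ?U L \<times> ?W ?V zs S L"
      obtain P R where PR: "x = (P, R)" by (cases x)
      then have W: "P \<in> ?W T xs ?U L" "R \<in> ?W ?V zs S L" using x by auto
      have p: "pmors (ZZ A) (fst T) (map rl P @ untwist (mu_mor (Tw A) ys) # map rl R) (fst S)"
        by (rule pairs_pmors[OF pM[OF s], of P R "2 * L + 1"]) (use W in \<open>auto simp: words_def\<close>)
      have o: "fst ?U \<in> Obj (ZZ A)" "fst ?V \<in> Obj (ZZ A)" using p by (auto simp: pmors_append mor_def)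
      have m0: "mors (ZZ A) (map rl P @ HMor (fst ?V) (fst ?U) ?p 0 # map rl R)"
        using p o Z.Hom_0 by (auto simp: mors_pmors pmors_append)
      have "mu (ZZ A) (map rl P @ untwist (mu_mor (Tw A) ys) # map rl R) =
          (\<Sum>Q\<in>?W ?U ys ?V L. mu (ZZ A) (map rl P @ HMor (fst ?V) (fst ?U) ?p (mu (ZZ A) (map rl Q)) # map rl R))"
        unfolding M
      proof (rule Z.mu_sum[OF m0])
        fix Q assume Q: "Q \<in> ?W ?U ys ?V L"
        have "mors (ZZ A) (map rl Q)"
          using words_pmors[OF Q] pieces[OF s] pmors_obj[of "Tw A" ?U ys ?V] fs(2) words_ne[OF Q] by (auto simp: mors_pmors)
        from Z.mu_closed[OF this] show "mu (ZZ A) (map rl Q) \<in> Hom (ZZ A) (fst ?V) (fst ?U) ?p"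
          unfolding mM[OF Q] by simp
      qed
      then show "(case x of (P, R) \<Rightarrow> mu (ZZ A) (map rl P @ untwist (mu_mor (Tw A) ys) # map rl R)) =
        (case x of (P, R) \<Rightarrow> \<Sum>Q\<in>?W ?U ys ?V L. mu (ZZ A) (map rl P @ mu_mor (ZZ A) (map rl Q) # map rl R))"
        using PR mM by simp
    qed
    \<comment> \<open>Inserted differentials have reduced degree 0, so the sign of \<open>zs\<close>
      is the sign of every word \<open>R\<close> over \<open>zs\<close>.\<close>
    finally have "ksign (\<Sum>z\<leftarrow>zs. rdeg z) (mu (Tw A) (xs @ mu_mor (Tw A) ys # zs)) =
      (\<Sum>(P, R)\<in>?W T xs ?U L \<times> ?W ?V zs S L. \<Sum>Q\<in>?W ?U ys ?V L. g P Q R)"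
      by (auto simp: ksign_sum case_prod_beta g_def words_def wpath_degs(1)[unfolded map_map] intro!: sum.cong)
    also have "\<dots> = (\<Sum>((P, R), Q)\<in>(?W T xs ?U L \<times> ?W ?V zs S L) \<times> ?W ?U ys ?V L. g P Q R)"
      unfolding case_prod_beta by (subst sum.cartesian_product) (simp add: case_prod_beta)
    also have "\<dots> = (\<Sum>(P, Q, R)\<in>?X (xs, ys, zs). g P Q R)"
      by (rule sum.reindex_bij_witness[where i = "\<lambda>(P, Q, R). ((P, R), Q)" and j = "\<lambda>((P, R), Q). (P, Q, R)"]) auto
    finally show ?thesis .
  qed
  have "(\<Sum>(xs, ys, zs)\<in>splits fs. ksign (\<Sum>z\<leftarrow>zs. rdeg z) (mu (Tw A) (xs @ mu_mor (Tw A) ys # zs))) =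
    (\<Sum>x\<in>splits fs. \<Sum>(P, Q, R)\<in>?X x. g P Q R)"
    using summand by (intro sum.cong refl) auto
  also have "\<dots> = (\<Sum>(x, (P, Q, R))\<in>Sigma (splits fs) ?X. g P Q R)"
    by (rule sum.Sigma) auto
  \<comment> \<open>A triple determines its split of \<open>fs\<close> by deleting the inserted
    letters. The ends of \<open>Q\<close> are forced because \<open>Q\<close> contains at least one
    letter of \<open>fs\<close>.\<close>
  also have "\<dots> = (\<Sum>(P, Q, R)\<in>Om1. g P Q R)"
  proof (rule sum.reindex_bij_witness[where i = "\<lambda>(P, Q, R). ((rights P, rights Q, rights R), (P, Q, R))" and j = snd])
    fix y assume "y \<in> Sigma (splits fs) ?X"
    then obtain xs ys zs P Q R where y: "y = ((xs, ys, zs), (P, Q, R))" "(xs, ys, zs) \<in> splits fs"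
      "P \<in> ?W T xs (tgt (hd ys)) L" "Q \<in> ?W (tgt (hd ys)) ys (src (last ys)) L" "R \<in> ?W (src (last ys)) zs S L"
      by auto
    show "(case snd y of (P, Q, R) \<Rightarrow> ((rights P, rights Q, rights R), (P, Q, R))) = y"
      using y by (auto simp: words_def)
    show "snd y \<in> Om1" using y by (auto simp: Om1_def Om_def words_def splits_def path_append)
    show "(case snd y of (P, Q, R) \<Rightarrow> g P Q R) = (case y of (x, (P, Q, R)) \<Rightarrow> g P Q R)"
      using y(1) by simp
  next
    fix x assume "x \<in> Om1"
    then obtain P Q R where x: "x = (P, Q, R)" "(P, Q, R) \<in> Om" "rights Q \<noteq> []" by (auto simp: Om1_def)
    then have PQR: "P @ Q @ R \<in> ?W T fs S (3 * L)" by (auto simp: Om_def)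
    obtain U V where UV: "wpath src tgt T P U" "wpath src tgt U Q V" "wpath src tgt V R S" using wp[OF PQR] by blast
    have "U = tgt (hd (rights Q)) \<and> V = src (last (rights Q))"
      by (rule path_ends[OF path_rights[OF UV(2)] x(3)])
    then show "(case x of (P, Q, R) \<Rightarrow> ((rights P, rights Q, rights R), (P, Q, R))) \<in> Sigma (splits fs) ?X"
      using x UV PQR by (auto simp: Om_def words_def splits_def)
  qed auto
  also have "\<dots> = 0" by (rule Om1_0)
  finally show ?thesis .
qed

text \<open>For a single unit the only possible contributions beyond the unit itself are products
  with one differential, from the left and from the right; they cancel because the differential has
  degree 1. In longer strings no insertion is compatible with strict unitality.\<close>

lemma Tw_unit:
  assumes T: "T \<in> Obj (Tw A)"
  shows "is_strict_unit (Tw A) T (idm (fst T))"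
proof -
  let ?X = "fst T"
  let ?D = "HMor T T 0 (idm ?X)"
  let ?E = "HMor ?X ?X 0 (idm ?X)"
  have X: "?X \<in> Obj (ZZ A)" using T by (rule Tw_obj_ZZ)
  have u: "is_strict_unit (ZZ A) ?X (idm ?X)" by (rule ZZ_unit[OF X])
  have u1: "mor (ZZ A) a \<Longrightarrow> tgt a = ?X \<Longrightarrow> ksign (deg a) (mu (ZZ A) [?E, a]) = val a"
    "mor (ZZ A) a \<Longrightarrow> src a = ?X \<Longrightarrow> mu (ZZ A) [a, ?E] = val a" for a
    using u unfolding is_strict_unit_def by blast+
  have u2: "mu (ZZ A) (as @ ?E # bs) = 0" if "mors (ZZ A) (as @ ?E # bs)" "2 \<le> length as + length bs" for as bs
    using u that unfolding is_strict_unit_def by blast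
  have D: "mor (Tw A) ?D" using T u by (simp add: Tw_sel(2) is_strict_unit_def)
  have UD: "untwist ?D = ?E" by (simp add: untwist_HMor)
  let ?g = "\<lambda>(P, R). mu (ZZ A) (map rl P @ untwist ?D # map rl R)"
  \<comment> \<open>Strict unitality of \<int>A kills every word with at least two letters beside
    the unit, so only the finitely many short words in \<open>Y\<close> have to be listed.\<close>
  have red: "mu (Tw A) (as @ ?D # bs) = (\<Sum>x\<in>Y. ?g x)"
    if p: "pmors (Tw A) U (as @ ?D # bs) S" and Y: "\<And>L. 2 \<le> L \<Longrightarrow> Y \<subseteq> pairs U as T T bs S L"
      "\<And>P R L. (P, R) \<in> pairs U as T T bs S L \<Longrightarrow> length P + length R \<le> 1 \<Longrightarrow> (P, R) \<in> Y" for as bs U S Y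
  proof -
    have "\<forall>\<^sub>F L in sequentially. mu (Tw A) (as @ ?D # bs) = (\<Sum>x\<in>Y. ?g x)"
      using mu_Tw_pairs[OF p] eventually_ge_at_top[of 2]
    proof eventually_elim
      case (elim L)
      have fin: "finite (pairs U as T T bs S L)"
        by (rule finite_subset[of _ "words src tgt U as T L \<times> words src tgt T bs S L"]) auto
      have "(\<Sum>x\<in>pairs U as T T bs S L. ?g x) = (\<Sum>x\<in>Y. ?g x)"
      proof (rule sum.mono_neutral_right[OF fin Y(1)[OF elim(2)]], rule ballI)
        fix x assume x: "x \<in> pairs U as T T bs S L - Y"
        obtain P R where PR: "x = (P, R)" by (cases x)
        have "pmors (ZZ A) (fst U) (map rl P @ untwist ?D # map rl R) (fst S)"
          using pairs_pmors[OF p, of P R L] x PR by auto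
        moreover have "\<not> length P + length R \<le> 1" using Y(2)[of P R L] x PR by blast
        ultimately show "?g x = 0" unfolding PR UD prod.case
          by (intro u2) (unfold mors_pmors, blast, simp)
      qed
      then show ?case using elim(1) by simp
    qed
    then show ?thesis by simp
  qed
  have dT: "mor (ZZ A) (tw_diff T)" using T by (simp add: Tw_sel(1))
  have len1: "P = [] \<or> (\<exists>x. P = [x])" if "length P \<le> 1" for P :: "(('o, 'm) twc + (('o, 'm) twc, nat \<Rightarrow> nat \<Rightarrow> 'm) hmor) list"
    using that by (cases P) auto
  have "mu (Tw A) [?D] = 0"
  proof -
    have "mu (Tw A) ([] @ ?D # []) = (\<Sum>x\<in>{([], []), ([Inl T], []), ([], [Inl T])}. ?g x)"
    proof (rule red[where U = T and S = T])
      show "pmors (Tw A) T ([] @ ?D # []) T" using D by simp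
      show "{([], []), ([Inl T], []), ([], [Inl T])} \<subseteq> pairs T [] T T [] T L" if "2 \<le> L" for L
        using that by (auto simp: words_def)
      fix P R L assume PR: "(P, R) \<in> pairs T [] T T [] T L" "length P + length R \<le> 1"
      then have "P = replicate (length P) (Inl T)" "R = replicate (length R) (Inl T)"
        using wpath_rights_Nil[of src tgt T P T] wpath_rights_Nil[of src tgt T R T]
        unfolding words_def by blast+
      moreover have "length P = 0 \<and> length R = 0 \<or> length P = 1 \<and> length R = 0 \<or> length P = 0 \<and> length R = 1"
        using PR(2) by linarith
      ultimately show "(P, R) \<in> {([], []), ([Inl T], []), ([], [Inl T])}"
        by (metis One_nat_def insertCI replicate_0 replicate_Suc)
    qed
    also have "\<dots> = mu (ZZ A) [?E] + mu (ZZ A) [tw_diff T, ?E] + mu (ZZ A) [?E, tw_diff T]"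
      by (simp add: UD)
    also have "mu (ZZ A) [?E] = 0" using u by (simp add: is_strict_unit_def)
    also have "mu (ZZ A) [tw_diff T, ?E] = snd T" using u1(2)[OF dT] by simp
    also have "mu (ZZ A) [?E, tw_diff T] = - snd T" using ksign_flip[OF u1(1)[OF dT]] by (simp add: ksign_def)
    finally show ?thesis by (simp add: fun_eq_iff)
  qed
  moreover have "ksign (deg a) (mu (Tw A) [?D, a]) = val a" if a: "mor (Tw A) a" "tgt a = T" for a
  proof -
    have "mu (Tw A) ([] @ ?D # [a]) = (\<Sum>x\<in>{([], [Inr a])}. ?g x)"
    proof (rule red[where U = T and S = "src a"])
      show "pmors (Tw A) T ([] @ ?D # [a]) (src a)" using D a by simp
      show "{([], [Inr a])} \<subseteq> pairs T [] T T [a] (src a) L" if "2 \<le> L" for L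
        using that a by (auto simp: words_def)
      fix P R L assume PR: "(P, R) \<in> pairs T [] T T [a] (src a) L" "length P + length R \<le> 1"
      then have R: "rights R = [a]" by (auto simp: words_def)
      then have "R \<noteq> []" by auto
      then obtain x where "R = [x]" "P = []" using PR(2) len1[of R] by auto
      then show "(P, R) \<in> {([], [Inr a])}" using R by (auto split: sum.splits)
    qed
    then show ?thesis using u1(1)[OF mor_untwist[OF a(1)]] a(2) by (simp add: UD)
  qed
  moreover have "mu (Tw A) [a, ?D] = val a" if a: "mor (Tw A) a" "src a = T" for a
  proof -
    have "mu (Tw A) ([a] @ ?D # []) = (\<Sum>x\<in>{([Inr a], [])}. ?g x)"
    proof (rule red[where U = "tgt a" and S = T])
      show "pmors (Tw A) (tgt a) ([a] @ ?D # []) T" using D a by simp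
      show "{([Inr a], [])} \<subseteq> pairs (tgt a) [a] T T [] T L" if "2 \<le> L" for L
        using that a by (auto simp: words_def)
      fix P R L assume PR: "(P, R) \<in> pairs (tgt a) [a] T T [] T L" "length P + length R \<le> 1"
      then have P: "rights P = [a]" by (auto simp: words_def)
      then have "P \<noteq> []" by auto
      then obtain x where "P = [x]" "R = []" using PR(2) len1[of P] by auto
      then show "(P, R) \<in> {([Inr a], [])}" using P by (auto split: sum.splits)
    qed
    then show ?thesis using u1(2)[OF mor_untwist[OF a(1)]] a(2) by (simp add: UD)
  qed
  moreover have "mu (Tw A) (as @ ?D # bs) = 0"
    if m: "mors (Tw A) (as @ ?D # bs)" and l: "length as + length bs \<ge> 2" for as bs
  proof -
    obtain U S where p: "pmors (Tw A) U (as @ ?D # bs) S" using m by (auto simp: mors_pmors)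
    have "mu (Tw A) (as @ ?D # bs) = (\<Sum>x\<in>{}. ?g x)"
    proof (rule red[OF p])
      fix P R L assume PR: "(P, R) \<in> pairs U as T T bs S L" "length P + length R \<le> 1"
      then have "length as \<le> length P" "length bs \<le> length R" using length_rights[of P] length_rights[of R] by (auto simp: words_def)
      then show "(P, R) \<in> {}" using PR(2) l by simp
    qed simp
    then show ?thesis by simp
  qed
  ultimately show ?thesis using D by (simp add: is_strict_unit_def)
qed

lemma ainf_category_Tw: "ainf_category (Tw A)"
proof (rule ainf_category.intro)
  show "vector_space (scl (Tw A))" unfolding Tw_sel(3) by (rule ZZ_vector_space)
  show "\<And>X Y p. X \<in> Obj (Tw A) \<Longrightarrow> Y \<in> Obj (Tw A) \<Longrightarrow> module.subspace (scl (Tw A)) (Hom (Tw A) X Y p)"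
    unfolding Tw_sel(2,3) by (intro ZZ_subspace Tw_obj_ZZ)
  show "\<And>as. mors (Tw A) as \<Longrightarrow> mor (Tw A) (mu_mor (Tw A) as)" by (rule Tw_mu_closed)
  show "\<And>X. X \<in> Obj (Tw A) \<Longrightarrow> \<exists>e. is_strict_unit (Tw A) X e" using Tw_unit by blast
next
  fix as :: "(('o, 'm) twc, nat \<Rightarrow> nat \<Rightarrow> 'm) hmor list" and d
  assume "mors (Tw A) as" "d = length as"
  then show "(\<Sum>(m, n)\<in>{(m, n). 1 \<le> m \<and> m + n \<le> d}. ksign (\<Sum>a\<leftarrow>drop (d - n) as. rdeg a)
      (mu (Tw A) (take (d - m - n) as @ mu_mor (Tw A) (take m (drop (d - m - n) as)) # drop (d - n) as))) = 0"
    using sum_splits[OF \<open>d = length as\<close>, of "\<lambda>P Q R. ksign (\<Sum>a\<leftarrow>R. rdeg a) (mu (Tw A) (P @ mu_mor (Tw A) Q # R))"]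
      Tw_relation by simp
qed (simp_all add: Tw_mu_add Tw_mu_scl)

end

section \<open>Functors that are surjective on objects and bijective on morphisms\<close>

lemma fobj_func_id [simp]: "fobj func_id X = X"
  by (simp add: func_id_def)

text \<open>A section of \<open>F\<close> on objects is chosen and morphisms are pulled back along
  the bijections, which gives \<open>G\<close>. Then \<open>F\<close> after \<open>G\<close> fixes
  all objects and morphisms, and \<open>G\<close> after \<open>F\<close> is compared with the
  identity through preimages of identities.\<close>

lemma graded_equivalenceI:
  assumes F: "graded_functor C D F"
    and surj: "\<And>Y. Y \<in> gobj D \<Longrightarrow> \<exists>X\<in>gobj C. fobj F X = Y"
    and bij: "\<And>X Y p. X \<in> gobj C \<Longrightarrow> Y \<in> gobj C \<Longrightarrow>
      bij_betw (\<lambda>a. fmor F (HMor X Y p a)) (ghom C X Y p) (ghom D (fobj F X) (fobj F Y) p)"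
    and compC: "\<And>g f. gmor C g \<Longrightarrow> gmor C f \<Longrightarrow> src g = tgt f \<Longrightarrow> gcomp C g f \<in> ghom C (src f) (tgt g) (deg g + deg f)"
    and idC: "\<And>X. X \<in> gobj C \<Longrightarrow> gid C X \<in> ghom C X X 0"
    and idD: "\<And>X. X \<in> gobj D \<Longrightarrow> gid D X \<in> ghom D X X 0"
    and idl: "\<And>f. gmor D f \<Longrightarrow> gcomp D (HMor (tgt f) (tgt f) 0 (gid D (tgt f))) f = val f"
    and idr: "\<And>f. gmor D f \<Longrightarrow> gcomp D f (HMor (src f) (src f) 0 (gid D (src f))) = val f"
  shows "graded_equivalence C D F"
proof -
  have Fobj: "\<And>X. X \<in> gobj C \<Longrightarrow> fobj F X \<in> gobj D"
    and Fcomp: "\<And>g f. gmor C g \<Longrightarrow> gmor C f \<Longrightarrow> src g = tgt f \<Longrightarrow> fmor F (gcomp_mor C g f) = gcomp D (fhm F g) (fhm F f)"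
    and Fid: "\<And>X. X \<in> gobj C \<Longrightarrow> fmor F (HMor X X 0 (gid C X)) = gid D (fobj F X)"
    and Fmor: "\<And>f. gmor C f \<Longrightarrow> gmor D (fhm F f)"
    using F by (auto simp: graded_functor_def)
  define s where "s Y = (SOME X. X \<in> gobj C \<and> fobj F X = Y)" for Y
  have s: "s Y \<in> gobj C" "fobj F (s Y) = Y" if "Y \<in> gobj D" for Y
    using someI_ex[of "\<lambda>X. X \<in> gobj C \<and> fobj F X = Y"] surj[OF that] by (auto simp: s_def)
  define pre where "pre X Y p b = inv_into (ghom C X Y p) (\<lambda>a. fmor F (HMor X Y p a)) b" for X Y p b
  have pre: "pre X Y p b \<in> ghom C X Y p" "fmor F (HMor X Y p (pre X Y p b)) = b"
    if "X \<in> gobj C" "Y \<in> gobj C" "b \<in> ghom D (fobj F X) (fobj F Y) p" for X Y p b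
  proof -
    have "b \<in> (\<lambda>a. fmor F (HMor X Y p a)) ` ghom C X Y p"
      using bij_betw_imp_surj_on[OF bij[OF that(1,2), of p]] that(3) by simp
    then show "pre X Y p b \<in> ghom C X Y p" "fmor F (HMor X Y p (pre X Y p b)) = b"
      unfolding pre_def by (rule inv_into_into, rule f_inv_into_f)
  qed
  have inj: "a = b" if "X \<in> gobj C" "Y \<in> gobj C" "a \<in> ghom C X Y p" "b \<in> ghom C X Y p"
    "fmor F (HMor X Y p a) = fmor F (HMor X Y p b)" for X Y p a b
    using bij[OF that(1,2), of p] that(3-5) unfolding bij_betw_def inj_on_def by blast
  define G where "G = \<lparr>fobj = s, fmor = (\<lambda>f. pre (s (src f)) (s (tgt f)) (deg f) (val f))\<rparr>"
  have Gsel: "fobj G = s" "fmor G f = pre (s (src f)) (s (tgt f)) (deg f) (val f)" for f by (auto simp: G_def)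
  have Gmor: "gmor C (fhm G f)" if "gmor D f" for f
    using that s pre(1)[of "s (src f)" "s (tgt f)" "val f" "deg f"] by (auto simp: gmor_def Gsel)
  have FG: "fhm F (fhm G f) = f" if "gmor D f" for f
    using that s pre(2)[of "s (src f)" "s (tgt f)" "val f" "deg f"]
    by (cases f) (auto simp: gmor_def Gsel fhm_def)
  have Fgc: "fmor F (HMor (src f) (tgt g) p (gcomp C g f)) = gcomp D (fhm F g) (fhm F f)"
    if "gmor C g" "gmor C f" "src g = tgt f" "p = deg g + deg f" for g f p
    using Fcomp[OF that(1-3)] that(4) by (simp add: gcomp_mor_def)
  have GF: "graded_functor D C G"
    unfolding graded_functor_def
  proof (intro conjI ballI allI impI)
    fix g f assume gf: "gmor D g \<and> gmor D f \<and> src g = tgt f"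
    have m: "gmor C (fhm G g)" "gmor C (fhm G f)" "src (fhm G g) = tgt (fhm G f)" using gf Gmor by auto
    have o: "src f \<in> gobj D" "tgt g \<in> gobj D" using gf by (auto simp: gmor_def)
    have c: "gcomp C (fhm G g) (fhm G f) \<in> ghom C (s (src f)) (s (tgt g)) (deg g + deg f)"
      using compC[OF m] by (simp add: Gsel)
    have F2: "fmor F (HMor (s (src f)) (s (tgt g)) (deg g + deg f) (gcomp C (fhm G g) (fhm G f))) = gcomp D g f"
      using Fgc[OF m, of "deg g + deg f"] gf FG by (simp add: Gsel)
    have "gcomp D g f \<in> ghom D (fobj F (s (src f))) (fobj F (s (tgt g))) (deg g + deg f)"
      using bij_betw_apply[OF bij[OF s(1)[OF o(1)] s(1)[OF o(2)]] c] F2 by simp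
    note p = pre[OF s(1)[OF o(1)] s(1)[OF o(2)] this]
    show "fmor G (gcomp_mor D g f) = gcomp C (fhm G g) (fhm G f)"
      using inj[OF s(1)[OF o(1)] s(1)[OF o(2)] p(1) c] p(2) F2 by (simp add: Gsel gcomp_mor_def)
  next
    fix X assume X: "X \<in> gobj D"
    have "gid D X \<in> ghom D (fobj F (s X)) (fobj F (s X)) 0" using idD[OF X] s[OF X] by simp
    note p = pre[OF s(1)[OF X] s(1)[OF X] this]
    show "fmor G (HMor X X 0 (gid D X)) = gid C (fobj G X)"
      using inj[OF s(1)[OF X] s(1)[OF X] p(1) idC[OF s(1)[OF X]]] p(2) Fid[OF s(1)[OF X]] s(2)[OF X]
      by (simp add: Gsel)
  next
    show "\<And>X. X \<in> gobj D \<Longrightarrow> fobj G X \<in> gobj C" unfolding Gsel by (rule s(1))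
    show "\<And>f. gmor D f \<Longrightarrow> gmor C (fhm G f)" by (rule Gmor)
  qed
  have n1: "naturally_isomorphic C C (func_comp G F) func_id"
  proof -
    \<comment> \<open>The objects \<open>s (fobj F X)\<close> and \<open>X\<close> have the same
      image, so the identity of that image lifts to a morphism between them; naturality and
      invertibility can be checked after applying \<open>F\<close>.\<close>
    define \<eta> where "\<eta> X = pre (s (fobj F X)) X 0 (gid D (fobj F X))" for X
    have o: "fobj (func_comp G F) X = s (fobj F X)" for X
      by (simp add: func_comp_def Gsel)
    have \<eta>: "\<eta> X \<in> ghom C (s (fobj F X)) X 0" "fmor F (HMor (s (fobj F X)) X 0 (\<eta> X)) = gid D (fobj F X)"
      "gmor C (HMor (s (fobj F X)) X 0 (\<eta> X))"
      "fhm F (HMor (s (fobj F X)) X 0 (\<eta> X)) = HMor (fobj F X) (fobj F X) 0 (gid D (fobj F X))"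
      if X: "X \<in> gobj C" for X
    proof -
      have "gid D (fobj F X) \<in> ghom D (fobj F (s (fobj F X))) (fobj F X) 0"
        using idD[OF Fobj[OF X]] s[OF Fobj[OF X]] by simp
      note p = pre[OF s(1)[OF Fobj[OF X]] X this]
      show "\<eta> X \<in> ghom C (s (fobj F X)) X 0" "fmor F (HMor (s (fobj F X)) X 0 (\<eta> X)) = gid D (fobj F X)"
        using p by (auto simp: \<eta>_def)
      then show "gmor C (HMor (s (fobj F X)) X 0 (\<eta> X))"
        "fhm F (HMor (s (fobj F X)) X 0 (\<eta> X)) = HMor (fobj F X) (fobj F X) 0 (gid D (fobj F X))"
        using X s[OF Fobj[OF X]] by (auto simp: gmor_def fhm_def)
    qed
    have "graded_iso C (s (fobj F X)) X (\<eta> X)" if X: "X \<in> gobj C" for X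
    proof -
      let ?Y = "s (fobj F X)"
      have Y: "?Y \<in> gobj C" "fobj F ?Y = fobj F X" using s[OF Fobj[OF X]] by auto
      define \<theta> where "\<theta> = pre X ?Y 0 (gid D (fobj F X))"
      have "gid D (fobj F X) \<in> ghom D (fobj F X) (fobj F ?Y) 0"
        using idD[OF Fobj[OF X]] Y by simp
      note p = pre[OF X Y(1) this]
      have \<theta>: "\<theta> \<in> ghom C X ?Y 0" "gmor C (HMor X ?Y 0 \<theta>)"
        "fhm F (HMor X ?Y 0 \<theta>) = HMor (fobj F X) (fobj F X) 0 (gid D (fobj F X))"
        using p X Y by (auto simp: \<theta>_def gmor_def fhm_def)
      have idm: "gmor D (HMor (fobj F X) (fobj F X) 0 (gid D (fobj F X)))"
        using Fobj[OF X] idD by (auto simp: gmor_def)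
      have ii: "gcomp D (HMor (fobj F X) (fobj F X) 0 (gid D (fobj F X))) (HMor (fobj F X) (fobj F X) 0 (gid D (fobj F X))) = gid D (fobj F X)"
        using idl[OF idm] by simp
      have "gcomp C (HMor X ?Y 0 \<theta>) (HMor ?Y X 0 (\<eta> X)) = gid C ?Y"
        using compC[OF \<theta>(2) \<eta>(3)[OF X]] Fgc[OF \<theta>(2) \<eta>(3)[OF X], of 0] \<theta>(3) \<eta>(4)[OF X] ii Fid[OF Y(1)] Y
        by (intro inj[OF Y(1) Y(1) _ idC[OF Y(1)], of _ ]) auto
      moreover have "gcomp C (HMor ?Y X 0 (\<eta> X)) (HMor X ?Y 0 \<theta>) = gid C X"
        using compC[OF \<eta>(3)[OF X] \<theta>(2)] Fgc[OF \<eta>(3)[OF X] \<theta>(2), of 0] \<theta>(3) \<eta>(4)[OF X] ii Fid[OF X] Y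
        by (intro inj[OF X X _ idC[OF X]]) auto
      ultimately show ?thesis using \<eta>(1)[OF X] \<theta>(1) unfolding graded_iso_def by blast
    qed
    moreover have "gcomp C (HMor (s (fobj F (tgt f))) (tgt f) 0 (\<eta> (tgt f))) (fhm (func_comp G F) f) =
        gcomp C (fhm func_id f) (HMor (s (fobj F (src f))) (src f) 0 (\<eta> (src f)))" if f: "gmor C f" for f
    proof -
      have o2: "src f \<in> gobj C" "tgt f \<in> gobj C" using f by (auto simp: gmor_def)
      note m = Gmor[OF Fmor[OF f]]
      let ?g = "fhm G (fhm F f)"
      have e1: "src (HMor (s (fobj F (tgt f))) (tgt f) 0 (\<eta> (tgt f))) = tgt ?g" by (simp add: Gsel)
      have e2: "src f = tgt (HMor (s (fobj F (src f))) (src f) 0 (\<eta> (src f)))" by simp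
      have "gcomp C (HMor (s (fobj F (tgt f))) (tgt f) 0 (\<eta> (tgt f))) ?g =
          gcomp C f (HMor (s (fobj F (src f))) (src f) 0 (\<eta> (src f)))"
      proof (rule inj[of "s (fobj F (src f))" "tgt f" _ "deg f"])
        have "fmor F (HMor (s (fobj F (src f))) (tgt f) (deg f) (gcomp C (HMor (s (fobj F (tgt f))) (tgt f) 0 (\<eta> (tgt f))) ?g)) =
           gcomp D (HMor (tgt (fhm F f)) (tgt (fhm F f)) 0 (gid D (tgt (fhm F f)))) (fhm F f)"
          using Fgc[OF \<eta>(3)[OF o2(2)] m e1, of "deg f"] by (simp add: Gsel \<eta>(4)[OF o2(2)] FG[OF Fmor[OF f]])
        moreover have "fmor F (HMor (s (fobj F (src f))) (tgt f) (deg f) (gcomp C f (HMor (s (fobj F (src f))) (src f) 0 (\<eta> (src f))))) =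
           gcomp D (fhm F f) (HMor (src (fhm F f)) (src (fhm F f)) 0 (gid D (src (fhm F f))))"
          using Fgc[OF f \<eta>(3)[OF o2(1)] e2, of "deg f"] by (simp add: \<eta>(4)[OF o2(1)])
        ultimately show "fmor F (HMor (s (fobj F (src f))) (tgt f) (deg f) (gcomp C (HMor (s (fobj F (tgt f))) (tgt f) 0 (\<eta> (tgt f))) ?g)) =
          fmor F (HMor (s (fobj F (src f))) (tgt f) (deg f) (gcomp C f (HMor (s (fobj F (src f))) (src f) 0 (\<eta> (src f)))))"
          using idl[OF Fmor[OF f]] idr[OF Fmor[OF f]] by simp
        show "gcomp C (HMor (s (fobj F (tgt f))) (tgt f) 0 (\<eta> (tgt f))) ?g \<in> ghom C (s (fobj F (src f))) (tgt f) (deg f)"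
          using compC[OF \<eta>(3)[OF o2(2)] m e1] by (simp add: Gsel)
        show "gcomp C f (HMor (s (fobj F (src f))) (src f) 0 (\<eta> (src f))) \<in> ghom C (s (fobj F (src f))) (tgt f) (deg f)"
          using compC[OF f \<eta>(3)[OF o2(1)] e2] by simp
      qed (use o2 s Fobj in auto)
      then show ?thesis by (simp add: fhm_comp fhm_id)
    qed
    ultimately show ?thesis unfolding naturally_isomorphic_def o fobj_func_id by blast
  qed
  have n2: "naturally_isomorphic D D (func_comp F G) func_id"
    unfolding naturally_isomorphic_def
  proof (intro exI[of _ "gid D"] conjI ballI allI impI)
    fix X assume X: "X \<in> gobj D"
    have idm: "gmor D (HMor X X 0 (gid D X))" using X idD by (auto simp: gmor_def)
    have "fobj (func_comp F G) X = X" using s(2)[OF X] by (simp add: func_comp_def Gsel)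
    then show "graded_iso D (fobj (func_comp F G) X) (fobj func_id X) (gid D X)"
      using idl[OF idm] idD[OF X] unfolding graded_iso_def by auto
  next
    fix f assume f: "gmor D f"
    have o: "fobj (func_comp F G) (tgt f) = tgt f" "fobj (func_comp F G) (src f) = src f"
      using s(2) f by (auto simp: func_comp_def Gsel gmor_def)
    show "gcomp D (HMor (fobj (func_comp F G) (tgt f)) (fobj func_id (tgt f)) 0 (gid D (tgt f))) (fhm (func_comp F G) f) =
      gcomp D (fhm func_id f) (HMor (fobj (func_comp F G) (src f)) (fobj func_id (src f)) 0 (gid D (src f)))"
      unfolding o fobj_func_id fhm_comp fhm_id FG[OF f] using idl[OF f] idr[OF f] by simp
  qed
  show ?thesis unfolding graded_equivalence_def using F GF n1 n2 by blast
qed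

section \<open>Cohomology of an A-infinity category\<close>

context ainf_category
begin

lemma cob_Hom:
  assumes "X \<in> Obj A" "Y \<in> Obj A" "b \<in> coboundaries A X Y p"
  shows "b \<in> Hom A X Y p"
proof -
  obtain c where c: "b = mu A [HMor X Y (p - 1) c]" "c \<in> Hom A X Y (p - 1)" using assms(3) by (auto simp: coboundaries_def)
  show ?thesis unfolding c(1) by (rule mu_in_Hom[of Y _ X]) (use c assms in auto)
qed

text \<open>The relation for a single letter has only one split and says that the differential
  squares to zero.\<close>

lemma cob_cocycle:
  assumes "X \<in> Obj A" "Y \<in> Obj A" "b \<in> coboundaries A X Y p"
  shows "b \<in> cocycles A X Y p"
proof -
  obtain c where c: "b = mu A [HMor X Y (p - 1) c]" "c \<in> Hom A X Y (p - 1)" using assms(3) by (auto simp: coboundaries_def)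
  have "splits [HMor X Y (p - 1) c] = {([], [HMor X Y (p - 1) c], [])}"
    by (auto simp: splits_def append_eq_Cons_conv)
  then have "mu A [mu_mor A [HMor X Y (p - 1) c]] = 0"
    using relation_splits[of "[HMor X Y (p - 1) c]"] assms c by (auto simp: mors_pmors)
  then have "mu A [HMor X Y p b] = 0" by (simp add: mu_mor_def c)
  then show ?thesis using cob_Hom[OF assms] by (simp add: cocycles_def)
qed

lemma mu1_add: "X \<in> Obj A \<Longrightarrow> Y \<in> Obj A \<Longrightarrow> a \<in> Hom A X Y p \<Longrightarrow> b \<in> Hom A X Y p \<Longrightarrow>
    mu A [HMor X Y p (a + b)] = mu A [HMor X Y p a] + mu A [HMor X Y p b]"
  using mu_add[of "[]" X Y p a "[]" b] by (simp add: mors_pmors)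

lemma cob_add:
  assumes "X \<in> Obj A" "Y \<in> Obj A" "a \<in> coboundaries A X Y p" "b \<in> coboundaries A X Y p"
  shows "a + b \<in> coboundaries A X Y p"
proof -
  obtain c d where c: "a = mu A [HMor X Y (p - 1) c]" "c \<in> Hom A X Y (p - 1)"
    and d: "b = mu A [HMor X Y (p - 1) d]" "d \<in> Hom A X Y (p - 1)"
    using assms(3,4) by (auto simp: coboundaries_def)
  have "a + b = mu A [HMor X Y (p - 1) (c + d)]" using mu1_add[OF assms(1,2) c(2) d(2)] c d by simp
  then show ?thesis using Hom_add[OF assms(1,2) c(2) d(2)] unfolding coboundaries_def by (rule image_eqI)
qed

lemma cob_uminus:
  assumes "X \<in> Obj A" "Y \<in> Obj A" "a \<in> coboundaries A X Y p"
  shows "- a \<in> coboundaries A X Y p"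
proof -
  obtain c where c: "a = mu A [HMor X Y (p - 1) c]" "c \<in> Hom A X Y (p - 1)" using assms(3) by (auto simp: coboundaries_def)
  have "- a = mu A [HMor X Y (p - 1) (- c)]"
    using mu_uminus[of "[]" X Y "p - 1" c "[]"] c assms by (simp add: mors_pmors)
  then show ?thesis using Hom_minus[OF assms(1,2) c(2)] unfolding coboundaries_def by (rule image_eqI)
qed

lemma cob_ksign: "X \<in> Obj A \<Longrightarrow> Y \<in> Obj A \<Longrightarrow> a \<in> coboundaries A X Y p \<Longrightarrow> ksign e a \<in> coboundaries A X Y p"
  by (simp add: ksign_def cob_uminus)

lemma cob_0:
  assumes "X \<in> Obj A" "Y \<in> Obj A"
  shows "0 \<in> coboundaries A X Y p"
proof -
  have "mu A [HMor X Y (p - 1) 0] = 0"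
    by (rule mu_zero_entry[of _ "HMor X Y (p - 1) 0"]) (use assms in \<open>auto simp: mors_pmors Hom_0\<close>)
  from this[symmetric] Hom_0[OF assms] show ?thesis unfolding coboundaries_def by (rule image_eqI)
qed

lemma coh_class_cong:
  assumes "X \<in> Obj A" "Y \<in> Obj A" "b - a \<in> coboundaries A X Y p"
  shows "coh_class A X Y p b = coh_class A X Y p a"
proof -
  have "b + c \<in> coh_class A X Y p a" if "c \<in> coboundaries A X Y p" for c
  proof -
    have "b + c = a + ((b - a) + c)" by (simp add: algebra_simps)
    then show ?thesis using cob_add[OF assms(1,2,3) that] unfolding coh_class_def by (rule image_eqI)
  qed
  moreover have "a + c \<in> coh_class A X Y p b" if "c \<in> coboundaries A X Y p" for c
  proof -
    have "a + c = b + (- (b - a) + c)" by (simp add: algebra_simps)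
    then show ?thesis using cob_add[OF assms(1,2) cob_uminus[OF assms] that] unfolding coh_class_def by (rule image_eqI)
  qed
  ultimately show ?thesis by (auto simp: coh_class_def)
qed

lemma coh_class_self: "X \<in> Obj A \<Longrightarrow> Y \<in> Obj A \<Longrightarrow> a \<in> coh_class A X Y p a"
  using cob_0[of X Y p] unfolding coh_class_def by (intro image_eqI[of _ _ 0]) simp_all

lemma coh_class_diff: "b \<in> coh_class A X Y p a \<Longrightarrow> b - a \<in> coboundaries A X Y p"
  by (auto simp: coh_class_def)

lemma cocycle_add_cob:
  assumes "X \<in> Obj A" "Y \<in> Obj A" "a \<in> cocycles A X Y p" "b \<in> coboundaries A X Y p"
  shows "a + b \<in> cocycles A X Y p"
  using assms cob_cocycle[OF assms(1,2,4)] by (auto simp: cocycles_def mu1_add Hom_add)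

lemma coh_class_cocycles:
  assumes "X \<in> Obj A" "Y \<in> Obj A" "a \<in> cocycles A X Y p"
  shows "coh_class A X Y p a \<subseteq> cocycles A X Y p"
  using cocycle_add_cob[OF assms] by (auto simp: coh_class_def)

text \<open>The relation for two letters, with its three splits.\<close>

lemma leibniz:
  assumes "X \<in> Obj A" "Y \<in> Obj A" "Z \<in> Obj A" "b \<in> Hom A Y Z q" "a \<in> Hom A X Y p"
  shows "mu A [HMor X Z (q + p) (mu A [HMor Y Z q b, HMor X Y p a])] +
    ksign (p - 1) (mu A [HMor Y Z (q + 1) (mu A [HMor Y Z q b]), HMor X Y p a]) +
    mu A [HMor Y Z q b, HMor X Y (p + 1) (mu A [HMor X Y p a])] = 0"
proof -
  let ?b = "HMor Y Z q b" and ?a = "HMor X Y p a"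
  have "splits [?b, ?a] = {([], [?b, ?a], []), ([], [?b], [?a]), ([?b], [?a], [])}"
    by (auto simp: splits_def append_eq_Cons_conv)
  then show ?thesis
    using relation_splits[of "[?b, ?a]"] assms by (auto simp: mors_pmors mu_mor_def algebra_simps)
qed

lemma mu2_cocycle:
  assumes o: "X \<in> Obj A" "Y \<in> Obj A" "Z \<in> Obj A" and b: "b \<in> cocycles A Y Z q" and a: "a \<in> cocycles A X Y p"
  shows "mu A [HMor Y Z q b, HMor X Y p a] \<in> cocycles A X Z (q + p)"
proof -
  have h: "b \<in> Hom A Y Z q" "a \<in> Hom A X Y p" "mu A [HMor Y Z q b] = 0" "mu A [HMor X Y p a] = 0"
    using a b by (auto simp: cocycles_def)
  have "mu A [HMor Y Z (q + 1) 0, HMor X Y p a] = 0"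
    by (rule mu_zero_entry[of _ "HMor Y Z (q + 1) 0"]) (use o h in \<open>auto simp: mors_pmors Hom_0\<close>)
  moreover have "mu A [HMor Y Z q b, HMor X Y (p + 1) 0] = 0"
    by (rule mu_zero_entry[of _ "HMor X Y (p + 1) 0"]) (use o h in \<open>auto simp: mors_pmors Hom_0\<close>)
  moreover have "mu A [HMor Y Z q b, HMor X Y p a] \<in> Hom A X Z (q + p)"
    by (rule mu_in_Hom[of Z _ X]) (use o h in auto)
  ultimately show ?thesis using leibniz[OF o h(1,2)] h by (simp add: cocycles_def)
qed

lemma mu2_cob_right:
  assumes o: "X \<in> Obj A" "Y \<in> Obj A" "Z \<in> Obj A" and b: "b \<in> cocycles A Y Z q" and a: "a \<in> coboundaries A X Y p"
  shows "mu A [HMor Y Z q b, HMor X Y p a] \<in> coboundaries A X Z (q + p)"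
proof -
  obtain c where c: "a = mu A [HMor X Y (p - 1) c]" "c \<in> Hom A X Y (p - 1)" using a by (auto simp: coboundaries_def)
  have h: "b \<in> Hom A Y Z q" "mu A [HMor Y Z q b] = 0" using b by (auto simp: cocycles_def)
  have "mu A [HMor Y Z (q + 1) 0, HMor X Y (p - 1) c] = 0"
    by (rule mu_zero_entry[of _ "HMor Y Z (q + 1) 0"]) (use o h c in \<open>auto simp: mors_pmors Hom_0\<close>)
  then have "mu A [HMor X Z (q + (p - 1)) (mu A [HMor Y Z q b, HMor X Y (p - 1) c])] + mu A [HMor Y Z q b, HMor X Y p a] = 0"
    using leibniz[OF o h(1) c(2)] h c by simp
  then have "mu A [HMor Y Z q b, HMor X Y p a] = - mu A [HMor X Z (q + p - 1) (mu A [HMor Y Z q b, HMor X Y (p - 1) c])]"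
    by (simp add: eq_neg_iff_add_eq_0 add.commute add_diff_eq)
  moreover have "mu A [HMor Y Z q b, HMor X Y (p - 1) c] \<in> Hom A X Z (q + p - 1)"
    by (rule mu_in_Hom[of Z _ X]) (use o h c in auto)
  then have "mu A [HMor X Z (q + p - 1) (mu A [HMor Y Z q b, HMor X Y (p - 1) c])] \<in> coboundaries A X Z (q + p)"
    unfolding coboundaries_def by (rule imageI)
  ultimately show ?thesis using cob_uminus o by simp
qed

lemma mu2_cob_left:
  assumes o: "X \<in> Obj A" "Y \<in> Obj A" "Z \<in> Obj A" and b: "b \<in> coboundaries A Y Z q" and a: "a \<in> cocycles A X Y p"
  shows "mu A [HMor Y Z q b, HMor X Y p a] \<in> coboundaries A X Z (q + p)"
proof -
  obtain c where c: "b = mu A [HMor Y Z (q - 1) c]" "c \<in> Hom A Y Z (q - 1)" using b by (auto simp: coboundaries_def)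
  have h: "a \<in> Hom A X Y p" "mu A [HMor X Y p a] = 0" using a by (auto simp: cocycles_def)
  have "mu A [HMor Y Z (q - 1) c, HMor X Y (p + 1) 0] = 0"
    by (rule mu_zero_entry[of _ "HMor X Y (p + 1) 0"]) (use o h c in \<open>auto simp: mors_pmors Hom_0\<close>)
  then have "mu A [HMor X Z (q - 1 + p) (mu A [HMor Y Z (q - 1) c, HMor X Y p a])] + ksign (p - 1) (mu A [HMor Y Z q b, HMor X Y p a]) = 0"
    using leibniz[OF o c(2) h(1)] h c by simp
  then have "ksign (p - 1) (mu A [HMor Y Z q b, HMor X Y p a]) = - mu A [HMor X Z (q + p - 1) (mu A [HMor Y Z (q - 1) c, HMor X Y p a])]"
    by (simp add: eq_neg_iff_add_eq_0 add.commute add_diff_eq diff_add_eq)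
  then have "mu A [HMor Y Z q b, HMor X Y p a] = ksign (p - 1) (- mu A [HMor X Z (q + p - 1) (mu A [HMor Y Z (q - 1) c, HMor X Y p a])])"
    by (rule ksign_flip)
  moreover have "mu A [HMor Y Z (q - 1) c, HMor X Y p a] \<in> Hom A X Z (q + p - 1)"
    by (rule mu_in_Hom[of Z _ X]) (use o h c in auto)
  then have "mu A [HMor X Z (q + p - 1) (mu A [HMor Y Z (q - 1) c, HMor X Y p a])] \<in> coboundaries A X Z (q + p)"
    unfolding coboundaries_def by (rule imageI)
  ultimately show ?thesis using cob_uminus cob_ksign o by simp
qed

text \<open>The union in \<open>coh_cat\<close> runs over all representatives. Changing them alters
  the product by terms with one coboundary factor, which are coboundaries by
  \<open>mu2_cob_left\<close> and \<open>mu2_cob_right\<close>, so the union consists of one and the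
  same class.\<close>

lemma coh_gcomp:
  assumes o: "X \<in> Obj A" "Y \<in> Obj A" "Z \<in> Obj A" and b: "b \<in> cocycles A Y Z q" and a: "a \<in> cocycles A X Y p"
  shows "gcomp (coh_cat A) (HMor Y Z q (coh_class A Y Z q b)) (HMor X Y p (coh_class A X Y p a)) =
    coh_class A X Z (q + p) (ksign p (mu A [HMor Y Z q b, HMor X Y p a]))"
proof -
  have "coh_class A X Z (q + p) (ksign p (mu A [HMor Y Z q b', HMor X Y p a'])) =
      coh_class A X Z (q + p) (ksign p (mu A [HMor Y Z q b, HMor X Y p a]))"
    if b': "b' \<in> coh_class A Y Z q b" and a': "a' \<in> coh_class A X Y p a" for a' b'
  proof (rule coh_class_cong[OF o(1,3)])
    define d e where "d = b' - b" "e = a' - a"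
    have de: "d \<in> coboundaries A Y Z q" "e \<in> coboundaries A X Y p" "b' = b + d" "a' = a + e"
      using coh_class_diff[OF b'] coh_class_diff[OF a'] by (auto simp: d_e_def)
    have a'c: "a' \<in> cocycles A X Y p" using cocycle_add_cob[OF o(1,2) a de(2)] unfolding de(4) .
    have H: "b \<in> Hom A Y Z q" "d \<in> Hom A Y Z q" "a \<in> Hom A X Y p" "e \<in> Hom A X Y p" "a' \<in> Hom A X Y p"
      using a b a'c cob_Hom[OF o(2,3) de(1)] cob_Hom[OF o(1,2) de(2)] by (simp_all add: cocycles_def)
    have 1: "mu A [HMor Y Z q b', HMor X Y p a'] = mu A [HMor Y Z q b, HMor X Y p a'] + mu A [HMor Y Z q d, HMor X Y p a']"
      unfolding de(3) using mu_add[of "[]" Y Z q b "[HMor X Y p a']" d] H o by (simp add: mors_pmors)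
    have 2: "mu A [HMor Y Z q b, HMor X Y p a'] = mu A [HMor Y Z q b, HMor X Y p a] + mu A [HMor Y Z q b, HMor X Y p e]"
      unfolding de(4) using mu_add[of "[HMor Y Z q b]" X Y p a "[]" e] H o by (simp add: mors_pmors)
    have "ksign p (mu A [HMor Y Z q b', HMor X Y p a']) - ksign p (mu A [HMor Y Z q b, HMor X Y p a]) =
      ksign p (mu A [HMor Y Z q b, HMor X Y p e]) + ksign p (mu A [HMor Y Z q d, HMor X Y p a'])"
      unfolding 1 2 ksign_plus by (simp only: add_diff_cancel_left' add.assoc)
    also have "\<dots> \<in> coboundaries A X Z (q + p)"
      by (intro cob_add cob_ksign o mu2_cob_right mu2_cob_left b de a'c)
    finally show "ksign p (mu A [HMor Y Z q b', HMor X Y p a']) - ksign p (mu A [HMor Y Z q b, HMor X Y p a]) \<in> coboundaries A X Z (q + p)" .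
  qed
  note key = this
  let ?K = "coh_class A X Z (q + p) (ksign p (mu A [HMor Y Z q b, HMor X Y p a]))"
  have "gcomp (coh_cat A) (HMor Y Z q (coh_class A Y Z q b)) (HMor X Y p (coh_class A X Y p a)) =
    (\<Union>b'\<in>coh_class A Y Z q b. \<Union>a'\<in>coh_class A X Y p a.
      coh_class A X Z (q + p) (ksign p (mu A [HMor Y Z q b', HMor X Y p a'])))"
    by (simp add: coh_cat_def)
  also have "\<dots> = (\<Union>b'\<in>coh_class A Y Z q b. \<Union>a'\<in>coh_class A X Y p a. ?K)"
    by (intro SUP_cong refl key)
  also have "\<dots> = ?K"
    using coh_class_self[OF o(2,3), of b q] coh_class_self[OF o(1,2), of a p] by blast
  finally show ?thesis .
qed

lemma coh_cat_sel: "gobj (coh_cat A) = Obj A" "ghom (coh_cat A) X Y p = coh_class A X Y p ` cocycles A X Y p"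
  "gid (coh_cat A) X = coh_class A X X 0 (strict_unit A X)"
  by (simp_all add: coh_cat_def)

lemma gmor_coh: "gmor (coh_cat A) f \<longleftrightarrow> (\<exists>X Y p a. X \<in> Obj A \<and> Y \<in> Obj A \<and> a \<in> cocycles A X Y p \<and>
    f = HMor X Y p (coh_class A X Y p a))"
  by (cases f) (auto simp: gmor_def coh_cat_sel)

lemma ksign_cocycle: "X \<in> Obj A \<Longrightarrow> Y \<in> Obj A \<Longrightarrow> a \<in> cocycles A X Y p \<Longrightarrow> ksign e a \<in> cocycles A X Y p"
  using mu_uminus[of "[]" X Y p a "[]"] by (auto simp: cocycles_def ksign_def Hom_minus mors_pmors)

lemma coh_comp_closed:
  assumes "gmor (coh_cat A) g" "gmor (coh_cat A) f" "src g = tgt f"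
  shows "gcomp (coh_cat A) g f \<in> ghom (coh_cat A) (src f) (tgt g) (deg g + deg f)"
proof -
  obtain Y Z q b where g: "g = HMor Y Z q (coh_class A Y Z q b)" "Y \<in> Obj A" "Z \<in> Obj A" "b \<in> cocycles A Y Z q"
    using assms(1) gmor_coh by blast
  obtain X p a where f: "f = HMor X Y p (coh_class A X Y p a)" "X \<in> Obj A" "a \<in> cocycles A X Y p"
    using assms(2,3) gmor_coh g by auto
  show ?thesis unfolding g(1) f(1) coh_gcomp[OF f(2) g(2,3,4) f(3)] coh_cat_sel hmor.sel
    by (intro imageI ksign_cocycle mu2_cocycle g f)
qed

lemma unit_cocycle: "X \<in> Obj A \<Longrightarrow> strict_unit A X \<in> cocycles A X X 0"
  using strict_unit_is[of X] by (auto simp: cocycles_def is_strict_unit_def)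

lemma coh_id: "X \<in> Obj A \<Longrightarrow> gid (coh_cat A) X \<in> ghom (coh_cat A) X X 0"
  by (simp add: coh_cat_sel unit_cocycle)

lemma coh_idl:
  assumes "gmor (coh_cat A) f"
  shows "gcomp (coh_cat A) (HMor (tgt f) (tgt f) 0 (gid (coh_cat A) (tgt f))) f = val f"
proof -
  obtain X Y p a where f: "f = HMor X Y p (coh_class A X Y p a)" "X \<in> Obj A" "Y \<in> Obj A" "a \<in> cocycles A X Y p"
    using assms gmor_coh by blast
  have "mor A (HMor X Y p a)" using f by (auto simp: cocycles_def)
  then have "ksign (deg (HMor X Y p a)) (mu A [HMor Y Y 0 (strict_unit A Y), HMor X Y p a]) = val (HMor X Y p a)"
    using strict_unit_is[OF f(3)] unfolding is_strict_unit_def by (metis hmor.sel(2))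
  then show ?thesis using coh_gcomp[OF f(2,3,3) unit_cocycle[OF f(3)] f(4)] by (simp add: f(1) coh_cat_sel)
qed

lemma coh_idr:
  assumes "gmor (coh_cat A) f"
  shows "gcomp (coh_cat A) f (HMor (src f) (src f) 0 (gid (coh_cat A) (src f))) = val f"
proof -
  obtain X Y p a where f: "f = HMor X Y p (coh_class A X Y p a)" "X \<in> Obj A" "Y \<in> Obj A" "a \<in> cocycles A X Y p"
    using assms gmor_coh by blast
  have "mor A (HMor X Y p a)" using f by (auto simp: cocycles_def)
  then have "mu A [HMor X Y p a, HMor X X 0 (strict_unit A X)] = val (HMor X Y p a)"
    using strict_unit_is[OF f(2)] unfolding is_strict_unit_def by (metis hmor.sel(1))
  then show ?thesis using coh_gcomp[OF f(2,2,3) f(4) unit_cocycle[OF f(2)]] by (simp add: f(1) coh_cat_sel)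
qed

end

text \<open>Bijections on morphism spaces that commute with all compositions identify cocycles and
  coboundaries, hence also the cohomology. Units are then preserved: strings through
  \<open>fobj F X\<close> lift to \<open>A\<close>, so the image of a unit is a strict unit, and
  strict units are unique.\<close>

lemma quasi_equivalenceI:
  fixes A :: "('o, 'm::ab_group_add, 'k::field) ainf" and B :: "('p, 'n::ab_group_add, 'k) ainf"
    and F :: "('o, 'm, 'p, 'n) func"
  assumes A: "ainf_category A" and B: "ainf_category B"
    and obj: "\<And>X. X \<in> Obj A \<Longrightarrow> fobj F X \<in> Obj B"
    and surj: "\<And>Y. Y \<in> Obj B \<Longrightarrow> \<exists>X\<in>Obj A. fobj F X = Y"
    and bij: "\<And>X Y p. X \<in> Obj A \<Longrightarrow> Y \<in> Obj A \<Longrightarrow>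
      bij_betw (\<lambda>a. fmor F (HMor X Y p a)) (Hom A X Y p) (Hom B (fobj F X) (fobj F Y) p)"
    and add: "\<And>X Y p a b. X \<in> Obj A \<Longrightarrow> Y \<in> Obj A \<Longrightarrow> a \<in> Hom A X Y p \<Longrightarrow> b \<in> Hom A X Y p \<Longrightarrow>
      fmor F (HMor X Y p (a + b)) = fmor F (HMor X Y p a) + fmor F (HMor X Y p b)"
    and scl: "\<And>X Y p a c. X \<in> Obj A \<Longrightarrow> Y \<in> Obj A \<Longrightarrow> a \<in> Hom A X Y p \<Longrightarrow>
      fmor F (HMor X Y p (scl A c a)) = scl B c (fmor F (HMor X Y p a))"
    and mu: "\<And>as. mors A as \<Longrightarrow> fmor F (mu_mor A as) = mu B (map (fhm F) as)"
  shows "quasi_equivalence A B F"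
proof -
  interpret A: ainf_category A by (rule A)
  interpret B: ainf_category B by (rule B)
  let ?f = "\<lambda>X Y p a. fmor F (HMor X Y p a)"
  have hom: "?f X Y p a \<in> Hom B (fobj F X) (fobj F Y) p" if "X \<in> Obj A" "Y \<in> Obj A" "a \<in> Hom A X Y p" for X Y p a
    using bij[OF that(1,2), of p] that(3) unfolding bij_betw_def by blast
  have mor: "mor B (fhm F a)" if "mor A a" for a
    using that hom[of "src a" "tgt a" "val a" "deg a"] obj by (simp add: mor_def)
  have zero: "?f X Y p 0 = 0" if "X \<in> Obj A" "Y \<in> Obj A" for X Y p
    using add[OF that A.Hom_0[OF that] A.Hom_0[OF that], of p] by simp
  have uminus: "?f X Y p (- a) = - ?f X Y p a" if "X \<in> Obj A" "Y \<in> Obj A" "a \<in> Hom A X Y p" for X Y p a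
    using add[OF that(1,2,3) A.Hom_minus[OF that]] zero[OF that(1,2), of p] by (simp add: eq_neg_iff_add_eq_0 add.commute)
  have ksg: "?f X Y p (ksign e a) = ksign e (?f X Y p a)" if "X \<in> Obj A" "Y \<in> Obj A" "a \<in> Hom A X Y p" for X Y p a e
    using uminus[OF that] by (simp add: ksign_def)
  have unit: "?f X X 0 (strict_unit A X) = strict_unit B (fobj F X)" if X: "X \<in> Obj A" for X
  proof -
    let ?e = "strict_unit A X"
    let ?E = "HMor X X 0 ?e"
    let ?E' = "HMor (fobj F X) (fobj F X) 0 (?f X X 0 ?e)"
    have E': "fhm F ?E = ?E'" by (simp add: fhm_def)
    have e: "is_strict_unit A X ?e" by (rule A.strict_unit_is[OF X])
    then have U: "mor A a \<Longrightarrow> tgt a = X \<Longrightarrow> ksign (deg a) (mu A [?E, a]) = val a"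
      "mor A a \<Longrightarrow> src a = X \<Longrightarrow> mu A [a, ?E] = val a"
      "mors A (as @ ?E # bs) \<Longrightarrow> 2 \<le> length as + length bs \<Longrightarrow> mu A (as @ ?E # bs) = 0" for a as bs
      unfolding is_strict_unit_def by blast+
    have E: "mor A ?E" "mu A [?E] = 0" using e X by (auto simp: is_strict_unit_def)
    \<comment> \<open>A section on objects normalized at \<open>fobj F X\<close>, so that the lift
      of the image of the unit is the unit itself.\<close>
    define s where "s Y = (if Y = fobj F X then X else (SOME Z. Z \<in> Obj A \<and> fobj F Z = Y))" for Y
    have s: "s Y \<in> Obj A \<and> fobj F (s Y) = Y" if "Y \<in> Obj B" for Y
      using someI_ex[of "\<lambda>Z. Z \<in> Obj A \<and> fobj F Z = Y"] surj[OF that] X by (auto simp: s_def)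
    define l where "l b = HMor (s (src b)) (s (tgt b)) (deg b)
      (inv_into (Hom A (s (src b)) (s (tgt b)) (deg b)) (?f (s (src b)) (s (tgt b)) (deg b)) (val b))" for b
    have l: "mor A (l b) \<and> fhm F (l b) = b" if b: "mor B b" for b
    proof -
      have o: "src b \<in> Obj B" "tgt b \<in> Obj B" using b by (auto simp: mor_def)
      let ?H = "Hom A (s (src b)) (s (tgt b)) (deg b)" and ?g = "?f (s (src b)) (s (tgt b)) (deg b)"
      have im: "?g ` ?H = Hom B (src b) (tgt b) (deg b)"
        using bij[of "s (src b)" "s (tgt b)" "deg b"] s[OF o(1)] s[OF o(2)] by (simp add: bij_betw_def)
      have "val b \<in> ?g ` ?H" using b unfolding im by (simp add: mor_def)
      then have "inv_into ?H ?g (val b) \<in> ?H" "?g (inv_into ?H ?g (val b)) = val b"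
        by (rule inv_into_into, rule f_inv_into_f)
      then show ?thesis using s[OF o(1)] s[OF o(2)] by (cases b) (simp add: l_def fhm_def)
    qed
    have lE: "l ?E' = ?E"
    proof -
      have "inj_on (?f X X 0) (Hom A X X 0)" using bij[OF X X, of 0] by (rule bij_betw_imp_inj_on)
      then have "inv_into (Hom A X X 0) (?f X X 0) (?f X X 0 ?e) = ?e" using E(1) by (intro inv_into_f_f) auto
      then show ?thesis by (simp add: l_def s_def)
    qed
    have lends: "src (l b) = s (src b)" "tgt (l b) = s (tgt b)" "deg (l b) = deg b" for b by (auto simp: l_def)
    have sX: "s (fobj F X) = X" by (simp add: s_def)
    have lp: "pmors B T bs S \<Longrightarrow> pmors A (s T) (map l bs) (s S)" for T bs S
      by (induction bs arbitrary: T) (auto simp: l lends)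
    have lm: "mors A (map l bs) \<and> map (fhm F) (map l bs) = bs" if bs: "mors B bs" for bs
    proof -
      obtain T S where TS: "pmors B T bs S" "bs \<noteq> []" using bs by (auto simp: mors_pmors)
      then have "\<forall>b\<in>set bs. fhm F (l b) = b" using l by (auto simp: pmors_def)
      then show ?thesis using lp[OF TS(1)] TS(2) by (auto simp: mors_pmors map_idI)
    qed
    have bmu: "mu B bs = fmor F (mu_mor A (map l bs))" if "mors B bs" for bs
      using mu lm[OF that] by metis
    have mE': "mor B ?E'" using mor[OF E(1)] by (simp add: fhm_def)
    have "is_strict_unit B (fobj F X) (?f X X 0 ?e)"
      unfolding is_strict_unit_def
    proof (intro conjI allI impI)
      show "?f X X 0 ?e \<in> Hom B (fobj F X) (fobj F X) 0" using mE' by simp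
      have "mors B [?E']" using mE' by (simp add: mors_pmors)
      from bmu[OF this] show "mu B [?E'] = 0" using E(2) X by (simp add: lE mu_mor_def zero del: fhm_sel)
    next
      fix a assume a: "mor B a \<and> tgt a = fobj F X"
      have "mors B [?E', a]" using mE' a by (simp add: mors_pmors)
      from bmu[OF this] have 1: "mu B [?E', a] = fmor F (mu_mor A [?E, l a])" by (simp add: lE)
      have la: "mor A (l a)" "tgt (l a) = X" "fhm F (l a) = a" using l a sX by (auto simp: lends)
      have "mu A [?E, l a] = ksign (deg (l a)) (val (l a))" by (rule ksign_flip[OF U(1)[OF la(1,2)]])
      then have "mu_mor A [?E, l a] = HMor (src (l a)) (tgt (l a)) (deg (l a)) (ksign (deg (l a)) (val (l a)))"
        using la(2) by (simp add: mu_mor_def)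
      then have "mu B [?E', a] = ksign (deg (l a)) (fmor F (l a))"
        using 1 ksg[of "src (l a)" "tgt (l a)" "val (l a)" "deg (l a)" "deg (l a)"] la(1) by (simp add: mor_def)
      also have "fmor F (l a) = val a" using arg_cong[OF la(3), of val] by simp
      finally show "ksign (deg a) (mu B [?E', a]) = val a" by (simp add: ksign_ksign lends)
    next
      fix a assume a: "mor B a \<and> src a = fobj F X"
      have "mors B [a, ?E']" using mE' a by (simp add: mors_pmors)
      from bmu[OF this] have 1: "mu B [a, ?E'] = fmor F (mu_mor A [l a, ?E])" by (simp add: lE)
      have la: "mor A (l a)" "src (l a) = X" "fhm F (l a) = a" using l a sX by (auto simp: lends)
      have "mu_mor A [l a, ?E] = l a" using U(2)[OF la(1,2)] la(2) by (cases "l a") (simp add: mu_mor_def)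
      moreover have "fmor F (l a) = val a" using arg_cong[OF la(3), of val] by simp
      ultimately show "mu B [a, ?E'] = val a" using 1 by simp
    next
      fix as bs assume h: "mors B (as @ ?E' # bs) \<and> 2 \<le> length as + length bs"
      then have m: "mors A (map l as @ ?E # map l bs)" using lm[of "as @ ?E' # bs"] by (simp add: lE)
      then have z: "mu A (map l as @ ?E # map l bs) = 0" using h by (intro U(3)) auto
      have "mor A (mu_mor A (map l as @ ?E # map l bs))" by (rule A.mu_closed[OF m])
      then have "fmor F (mu_mor A (map l as @ ?E # map l bs)) = 0" unfolding mu_mor_def z by (intro zero) simp_all
      then show "mu B (as @ ?E' # bs) = 0" using bmu[of "as @ ?E' # bs"] h by (simp add: lE)
    qed
    then show ?thesis by (simp add: B.strict_unit_eq obj[OF X])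
  qed
  have func: "ainf_functor A B F"
    unfolding ainf_functor_def using A B obj mor add scl mu unit by blast
  have mu1: "mu B [HMor (fobj F X) (fobj F Y) p (?f X Y p a)] = ?f X Y (p + 1) (mu A [HMor X Y p a])"
    if "X \<in> Obj A" "Y \<in> Obj A" "a \<in> Hom A X Y p" for X Y p a
    using mu[of "[HMor X Y p a]"] that by (simp add: mors_pmors mu_mor_def fhm_def algebra_simps)
  have cocyc: "?f X Y p ` cocycles A X Y p = cocycles B (fobj F X) (fobj F Y) p"
    if o: "X \<in> Obj A" "Y \<in> Obj A" for X Y p
  proof (intro equalityI subsetI)
    fix b assume "b \<in> ?f X Y p ` cocycles A X Y p"
    then obtain a where a: "b = ?f X Y p a" "a \<in> Hom A X Y p" "mu A [HMor X Y p a] = 0" by (auto simp: cocycles_def)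
    show "b \<in> cocycles B (fobj F X) (fobj F Y) p"
      using a mu1[OF o a(2)] hom[OF o a(2)] zero[OF o] by (simp add: cocycles_def)
  next
    fix b assume b: "b \<in> cocycles B (fobj F X) (fobj F Y) p"
    then obtain a where a: "b = ?f X Y p a" "a \<in> Hom A X Y p"
      using bij[OF o, of p] by (auto simp: cocycles_def bij_betw_def)
    have "mu A [HMor X Y p a] \<in> Hom A X Y (p + 1)" by (rule A.mu_in_Hom[of Y _ X]) (use o a in auto)
    moreover have "?f X Y (p + 1) (mu A [HMor X Y p a]) = ?f X Y (p + 1) 0"
      using mu1[OF o a(2)] b a(1) zero[OF o] by (simp add: cocycles_def)
    ultimately have "mu A [HMor X Y p a] = 0"
      using bij[OF o, of "p + 1"] A.Hom_0[OF o] unfolding bij_betw_def inj_on_def by blast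
    then show "b \<in> ?f X Y p ` cocycles A X Y p" using a by (auto simp: cocycles_def)
  qed
  have cob: "coboundaries B (fobj F X) (fobj F Y) p = ?f X Y p ` coboundaries A X Y p"
    if o: "X \<in> Obj A" "Y \<in> Obj A" for X Y p
  proof -
    have "coboundaries B (fobj F X) (fobj F Y) p =
        (\<lambda>c. mu B [HMor (fobj F X) (fobj F Y) (p - 1) c]) ` ?f X Y (p - 1) ` Hom A X Y (p - 1)"
      using bij[OF o, of "p - 1"] by (simp add: coboundaries_def bij_betw_def)
    also have "\<dots> = ?f X Y p ` coboundaries A X Y p"
      using mu1[OF o, of _ "p - 1"] by (force simp: coboundaries_def image_image)
    finally show ?thesis .
  qed
  have cls: "coh_class B (fobj F X) (fobj F Y) p (?f X Y p a) = ?f X Y p ` coh_class A X Y p a"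
    if o: "X \<in> Obj A" "Y \<in> Obj A" "a \<in> Hom A X Y p" for X Y p a
    using add[OF o] A.cob_Hom[OF o(1,2)] by (force simp: coh_class_def cob[OF o(1,2)] image_image)
  have clsHom: "coh_class A X Y p a \<subseteq> Hom A X Y p" if "X \<in> Obj A" "Y \<in> Obj A" "a \<in> cocycles A X Y p" for X Y p a
    using A.coh_class_cocycles[OF that] by (auto simp: cocycles_def)
  let ?H = "coh_functor B F"
  have Hobj: "fobj ?H = fobj F" by (simp add: coh_functor_def)
  have Hmor: "fmor ?H (HMor X Y p (coh_class A X Y p a)) = coh_class B (fobj F X) (fobj F Y) p (?f X Y p a)"
    if o: "X \<in> Obj A" "Y \<in> Obj A" "a \<in> cocycles A X Y p" for X Y p a
  proof -
    have aH: "a \<in> Hom A X Y p" using o by (simp add: cocycles_def)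
    have "coh_class B (fobj F X) (fobj F Y) p (?f X Y p a') = coh_class B (fobj F X) (fobj F Y) p (?f X Y p a)"
      if a': "a' \<in> coh_class A X Y p a" for a'
    proof -
      have "coh_class A X Y p a' = coh_class A X Y p a"
        by (rule A.coh_class_cong[OF o(1,2) A.coh_class_diff[OF a']])
      moreover have "a' \<in> Hom A X Y p" using clsHom[OF o] a' by blast
      ultimately show ?thesis using cls[OF o(1,2)] aH by simp
    qed
    note key = this
    have "fmor ?H (HMor X Y p (coh_class A X Y p a)) =
        (\<Union>a'\<in>coh_class A X Y p a. coh_class B (fobj F X) (fobj F Y) p (?f X Y p a'))"
      by (simp add: coh_functor_def)
    also have "\<dots> = (\<Union>a'\<in>coh_class A X Y p a. coh_class B (fobj F X) (fobj F Y) p (?f X Y p a))"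
      by (intro SUP_cong refl key)
    also have "\<dots> = coh_class B (fobj F X) (fobj F Y) p (?f X Y p a)"
      using A.coh_class_self[OF o(1,2), of a p] by blast
    finally show ?thesis .
  qed
  have Hcoc: "?f X Y p a \<in> cocycles B (fobj F X) (fobj F Y) p" if "X \<in> Obj A" "Y \<in> Obj A" "a \<in> cocycles A X Y p" for X Y p a
    using cocyc[OF that(1,2), of p] that(3) by blast
  have "graded_equivalence (coh_cat A) (coh_cat B) ?H"
  proof (rule graded_equivalenceI)
    show "graded_functor (coh_cat A) (coh_cat B) ?H"
      unfolding graded_functor_def
    proof (intro conjI ballI allI impI)
      fix X assume "X \<in> gobj (coh_cat A)"
      then show "fobj ?H X \<in> gobj (coh_cat B)" using obj by (simp add: Hobj A.coh_cat_sel B.coh_cat_sel)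
    next
      fix f assume "gmor (coh_cat A) f"
      then obtain X Y p a where f: "f = HMor X Y p (coh_class A X Y p a)" "X \<in> Obj A" "Y \<in> Obj A" "a \<in> cocycles A X Y p"
        using A.gmor_coh by blast
      then show "gmor (coh_cat B) (fhm ?H f)"
        using Hcoc[OF f(2-4)] obj by (auto simp: B.gmor_coh fhm_def Hobj Hmor)
    next
      fix g f assume gf: "gmor (coh_cat A) g \<and> gmor (coh_cat A) f \<and> src g = tgt f"
      obtain Y Z q b where g: "g = HMor Y Z q (coh_class A Y Z q b)" "Y \<in> Obj A" "Z \<in> Obj A" "b \<in> cocycles A Y Z q"
        using gf A.gmor_coh by blast
      obtain X p a where f: "f = HMor X Y p (coh_class A X Y p a)" "X \<in> Obj A" "a \<in> cocycles A X Y p"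
        using gf A.gmor_coh g by auto
      have ab: "a \<in> Hom A X Y p" "b \<in> Hom A Y Z q" using f g by (auto simp: cocycles_def)
      have m: "mors A [HMor Y Z q b, HMor X Y p a]" using f g ab by (simp add: mors_pmors)
      have mH: "mu A [HMor Y Z q b, HMor X Y p a] \<in> Hom A X Z (q + p)"
        by (rule A.mu_in_Hom[of Z _ X]) (use f g ab in auto)
      have "fmor ?H (gcomp_mor (coh_cat A) g f) =
          fmor ?H (HMor X Z (q + p) (coh_class A X Z (q + p) (ksign p (mu A [HMor Y Z q b, HMor X Y p a]))))"
        unfolding gcomp_mor_def g(1) f(1) A.coh_gcomp[OF f(2) g(2,3,4) f(3)] by simp
      also have "\<dots> = coh_class B (fobj F X) (fobj F Z) (q + p) (?f X Z (q + p) (ksign p (mu A [HMor Y Z q b, HMor X Y p a])))"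
        by (intro Hmor A.ksign_cocycle A.mu2_cocycle f g)
      also have "?f X Z (q + p) (ksign p (mu A [HMor Y Z q b, HMor X Y p a])) =
          ksign p (mu B [HMor (fobj F Y) (fobj F Z) q (?f Y Z q b), HMor (fobj F X) (fobj F Y) p (?f X Y p a)])"
        using mu[OF m] by (simp add: ksg[OF f(2) g(3) mH] mu_mor_def fhm_def)
      also have "coh_class B (fobj F X) (fobj F Z) (q + p) \<dots> = gcomp (coh_cat B) (fhm ?H g) (fhm ?H f)"
        using B.coh_gcomp[OF obj[OF f(2)] obj[OF g(2)] obj[OF g(3)] Hcoc[OF g(2-4)] Hcoc[OF f(2) g(2) f(3)]]
        by (simp add: fhm_def g(1) f(1) Hobj Hmor[OF g(2-4)] Hmor[OF f(2) g(2) f(3)])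
      finally show "fmor ?H (gcomp_mor (coh_cat A) g f) = gcomp (coh_cat B) (fhm ?H g) (fhm ?H f)" .
    next
      fix X assume "X \<in> gobj (coh_cat A)"
      then have X: "X \<in> Obj A" by (simp add: A.coh_cat_sel)
      show "fmor ?H (HMor X X 0 (gid (coh_cat A) X)) = gid (coh_cat B) (fobj ?H X)"
        using Hmor[OF X X A.unit_cocycle[OF X]] unit[OF X] by (simp add: A.coh_cat_sel B.coh_cat_sel Hobj)
    qed
    show "\<exists>X\<in>gobj (coh_cat A). fobj ?H X = Y" if "Y \<in> gobj (coh_cat B)" for Y
      using surj that by (simp add: A.coh_cat_sel B.coh_cat_sel Hobj)
    show "bij_betw (\<lambda>a. fmor ?H (HMor X Y p a)) (ghom (coh_cat A) X Y p) (ghom (coh_cat B) (fobj ?H X) (fobj ?H Y) p)"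
      if "X \<in> gobj (coh_cat A)" "Y \<in> gobj (coh_cat A)" for X Y p
    proof -
      have o: "X \<in> Obj A" "Y \<in> Obj A" using that by (auto simp: A.coh_cat_sel)
      have im: "fmor ?H (HMor X Y p (coh_class A X Y p a)) = ?f X Y p ` coh_class A X Y p a" if "a \<in> cocycles A X Y p" for a
        using Hmor[OF o that] cls[OF o, of a p] that by (simp add: cocycles_def)
      show ?thesis
        unfolding bij_betw_def
      proof
        show "inj_on (\<lambda>a. fmor ?H (HMor X Y p a)) (ghom (coh_cat A) X Y p)"
        proof (rule inj_onI)
          fix \<alpha> \<beta> assume ab: "\<alpha> \<in> ghom (coh_cat A) X Y p" "\<beta> \<in> ghom (coh_cat A) X Y p"
            "fmor ?H (HMor X Y p \<alpha>) = fmor ?H (HMor X Y p \<beta>)"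
          then have "?f X Y p ` \<alpha> = ?f X Y p ` \<beta>" using im by (auto simp: A.coh_cat_sel)
          moreover have "\<alpha> \<subseteq> Hom A X Y p" "\<beta> \<subseteq> Hom A X Y p" using ab clsHom[OF o] by (auto simp: A.coh_cat_sel)
          ultimately show "\<alpha> = \<beta>" using bij_betw_imp_inj_on[OF bij[OF o, of p]] inj_on_image_eq_iff by blast
        qed
        show "(\<lambda>a. fmor ?H (HMor X Y p a)) ` ghom (coh_cat A) X Y p = ghom (coh_cat B) (fobj ?H X) (fobj ?H Y) p"
          unfolding A.coh_cat_sel B.coh_cat_sel Hobj cocyc[OF o, of p, symmetric] image_image
          by (rule image_cong) (auto simp: Hmor[OF o])
      qed
    qed
  qed (use A.coh_comp_closed A.coh_id B.coh_id B.coh_idl B.coh_idr in \<open>auto simp: A.coh_cat_sel(1) B.coh_cat_sel(1)\<close>)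
  then show ?thesis using func by (simp add: quasi_equivalence_def)
qed

section \<open>The shift actions\<close>

lemma ex_map: "ex N en (map g fs) j \<Phi> = ex (\<lambda>f. N (g f)) (\<lambda>f. en (g f)) fs j \<Phi>"
  by (induction fs arbitrary: j \<Phi>) auto

lemma ex_cong_en:
  assumes "\<And>f j. f \<in> set fs \<Longrightarrow> N f j = N' f j"
    and "\<And>f j k. f \<in> set fs \<Longrightarrow> k \<in> N f j \<Longrightarrow> en f j k = en' f j k"
  shows "ex N en fs j \<Phi> = ex N' en' fs j \<Phi>"
  using assms
proof (induction fs arbitrary: j \<Phi>)
  case (Cons f fs)
  have "ex N en fs k (\<lambda>i E. \<Phi> i (en' f j k # E)) = ex N' en' fs k (\<lambda>i E. \<Phi> i (en' f j k # E))" for k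
    using Cons.prems by (intro Cons.IH) auto
  then show ?case using Cons.prems by (auto intro!: sum.cong)
qed simp

lemma ins_map:
  "(\<And>f. f \<in> set fs \<Longrightarrow> sr' (k f) = h (sr f)) \<Longrightarrow>
    ins sr' (h T) (map k fs) ns = map (map_sum h k) (ins sr T fs ns)"
  by (induction fs arbitrary: T ns) auto

lemma path_map:
  "path sr tg T fs S \<Longrightarrow> (\<And>f. f \<in> set fs \<Longrightarrow> sr' (k f) = h (sr f)) \<Longrightarrow>
    (\<And>f. f \<in> set fs \<Longrightarrow> tg' (k f) = h (tg f)) \<Longrightarrow> path sr' tg' (h T) (map k fs) (h S)"
  by (induction fs arbitrary: T) auto

lemma sum_words_map:
  assumes "path sr tg T fs S" "\<And>f. f \<in> set fs \<Longrightarrow> sr' (k f) = h (sr f)" "\<And>f. f \<in> set fs \<Longrightarrow> tg' (k f) = h (tg f)"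
  shows "(\<Sum>w\<in>words sr' tg' (h T) (map k fs) (h S) L. \<Phi> w) = (\<Sum>w\<in>words sr tg T fs S L. \<Phi> (map (map_sum h k) w))"
proof -
  have "(\<Sum>w\<in>words sr' tg' (h T) (map k fs) (h S) L. \<Phi> w) = (\<Sum>ns\<in>box (length fs) L. \<Phi> (ins sr' (h T) (map k fs) ns))"
    using sum_box_words[OF path_map[of sr tg T fs S sr' k h tg', OF assms], where \<Phi> = \<Phi> and L = L] by simp
  also have "\<dots> = (\<Sum>ns\<in>box (length fs) L. \<Phi> (map (map_sum h k) (ins sr T fs ns)))"
    using ins_map[of fs sr' k h sr T] assms(2) by simp
  also have "\<dots> = (\<Sum>w\<in>words sr tg T fs S L. \<Phi> (map (map_sum h k) w))"
    by (rule sum_box_words[OF assms(1)])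
  finally show ?thesis .
qed

text \<open>The effect of the n-th power of \<sigma> on an emitted letter: shift differences are
  unchanged, and the morphism is multiplied by the sign of n times its shift difference.\<close>

definition twist_entry :: "int \<Rightarrow> int \<times> ('o, 'm::ab_group_add) hmor \<Rightarrow> int \<times> ('o, 'm) hmor"
  where "twist_entry n x = (fst x, HMor (src (snd x)) (tgt (snd x)) (deg (snd x)) (ksign (n * fst x) (val (snd x))))"

lemma sexp_twist: "sexp (map (twist_entry n) E) = sexp E"
  by (induction E) (auto simp: twist_entry_def comp_def)

lemma shift_ZZ_sel: "fobj (shift_ZZ n) X = map (\<lambda>(X, p). (X, p + n)) X"
  "fmor (shift_ZZ n) f j i = (if j < length (tgt f) \<and> i < length (src f)
       then ksign (n * (snd (src f ! i) - snd (tgt f ! j))) (val f j i) else val f j i)"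
  by (simp_all add: shift_ZZ_def)

lemma length_shift [simp]: "length (fobj (shift_ZZ n) X) = length X"
  by (simp add: shift_ZZ_sel)

lemma shift_ZZ_nth: "i < length X \<Longrightarrow> fobj (shift_ZZ n) X ! i = (fst (X ! i), snd (X ! i) + n)"
  by (simp add: shift_ZZ_sel case_prod_beta)

lemma tw_diff_shift: "tw_diff (fobj (shift_Tw n) T) = fhm (shift_ZZ n) (tw_diff T)"
  by (simp add: shift_Tw_def Let_def tw_diff_def fhm_def)

lemma fst_shift_Tw:
  fixes T :: "('o, 'm::ab_group_add) twc"
  shows "fst (fobj (shift_Tw n) T) =
    fobj (shift_ZZ n :: (('o \<times> int) list, nat \<Rightarrow> nat \<Rightarrow> 'm, ('o \<times> int) list, nat \<Rightarrow> nat \<Rightarrow> 'm) func) (fst T)"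
  by (simp add: shift_Tw_def Let_def shift_ZZ_sel)

lemma untwist_shift: "untwist (fhm (shift_Tw n) f) = fhm (shift_ZZ n) (untwist f)"
  by (simp add: untwist_def fhm_def fst_shift_Tw) (simp add: shift_Tw_def untwist_def)

lemma fmor_shift_Tw: "fmor (shift_Tw n) f = fmor (shift_ZZ n) (untwist f)"
  by (simp add: shift_Tw_def)

lemma strictly_lower_triangular_cong:
  "(\<And>j i. \<delta>' j i = 0 \<longleftrightarrow> \<delta> j i = 0) \<Longrightarrow> strictly_lower_triangular n \<delta>' \<longleftrightarrow> strictly_lower_triangular n \<delta>"
  by (simp add: strictly_lower_triangular_def)

context strict_action
begin

lemma act_sum:
  "X \<in> Obj B \<Longrightarrow> Y \<in> Obj B \<Longrightarrow> (\<And>s. s \<in> S \<Longrightarrow> f s \<in> Hom B X Y p) \<Longrightarrow>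
    fmor (\<rho> g) (HMor X Y p (sum f S)) = (\<Sum>s\<in>S. fmor (\<rho> g) (HMor X Y p (f s)))"
  by (induction S rule: infinite_finite_induct) (auto simp: act_zero act_plus Hom_sum)

end

context ainf_category
begin

text \<open>The signs are pulled out of the letters one at a time; \<open>us\<close> holds the
  letters that have been treated already.\<close>

lemma mu_twist_entries:
  "mors A (us @ map snd E) \<Longrightarrow>
    mu A (us @ map snd (map (twist_entry n) E)) = ksign (n * (\<Sum>x\<leftarrow>E. fst x)) (mu A (us @ map snd E))"
proof (induction E arbitrary: us)
  case (Cons x E)
  let ?x = "snd x"
  let ?x' = "HMor (src ?x) (tgt ?x) (deg ?x) (ksign (n * fst x) (val ?x))"
  have m: "mors A (us @ ?x # map snd E)" using Cons.prems by simp
  have x: "HMor (src ?x) (tgt ?x) (deg ?x) (val ?x) = ?x" by simp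
  have "mor A ?x" using m by (auto simp: mors_pmors pmors_append)
  then have "ksign (n * fst x) (val ?x) \<in> Hom A (src ?x) (tgt ?x) (deg ?x)" by (intro Hom_ksign) (auto simp: mor_def)
  from mors_change_val[OF m this] have m': "mors A ((us @ [?x']) @ map snd E)" by simp
  have "mu A (us @ ?x' # map snd E) = ksign (n * fst x) (mu A (us @ ?x # map snd E))"
    using mu_ksign[of us "src ?x" "tgt ?x" "deg ?x" "val ?x" "map snd E"] m x by simp
  then show ?case using Cons.IH[OF m'] by (simp add: twist_entry_def ksign_ksign algebra_simps)
qed simp

text \<open>Along a run the shift differences add up to the difference of the shifts at the two
  ends, so the signs of the letters multiply to the sign of the composed entry. The exponent
  \<open>sexp\<close> itself is invariant under shifting.\<close>

lemma shift_ZZ_mu: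
  assumes "mors (ZZ A) fs"
  shows "fmor (shift_ZZ n) (mu_mor (ZZ A) fs) = mu (ZZ A) (map (fhm (shift_ZZ n)) fs)"
proof (intro ext)
  fix j i
  obtain T S where TS: "pmors (ZZ A) T fs S" "fs \<noteq> []" using assms by (auto simp: mors_pmors)
  note ends = pmors_ends[OF TS]
  have N: "Nz (fhm (shift_ZZ n) f) = Nz f" for f :: "(('o \<times> int) list, nat \<Rightarrow> nat \<Rightarrow> 'm) hmor"
    by (intro ext) (simp add: Nz_def)
  have "mu (ZZ A) (map (fhm (shift_ZZ n)) fs) j i = ex Nz (\<lambda>f. ez (fhm (shift_ZZ n) f)) fs j (smu A i)"
    by (simp add: mu_ZZ ex_map N)
  also have "\<dots> = ex Nz (\<lambda>f j k. twist_entry n (ez f j k)) fs j (smu A i)"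
    by (rule ex_cong_en)
       (auto simp: Nz_def ez_def entry_def twist_entry_def shift_ZZ_nth shift_ZZ_sel(2) split: if_splits)
  also have "\<dots> = ex Nz ez fs j (\<lambda>i' E. smu A i i' (map (twist_entry n) E))"
    by (rule ex_proj[symmetric])
  also have "\<dots> = ex Nz ez fs j (\<lambda>i' E. ksign (n * (snd (S ! i) - snd (T ! j))) (smu A i i' E))"
  proof (rule ex_cong)
    fix i' E assume r: "run Nz ez fs j i' E"
    have "mors A ([] @ map snd E)" using run_ZZ_mors[OF assms r] by simp
    from mu_twist_entries[OF this, of n] show "smu A i i' (map (twist_entry n) E) = ksign (n * (snd (S ! i) - snd (T ! j))) (smu A i i' E)"
      using run_ZZ[OF TS(1) r] TS(2) by (auto simp: smu_def sexp_twist ksign_ksign add.commute)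
  qed
  also have "\<dots> = ksign (n * (snd (S ! i) - snd (T ! j))) (mu (ZZ A) fs j i)"
    by (simp add: mu_ZZ ex_ksign)
  finally show "fmor (shift_ZZ n) (mu_mor (ZZ A) fs) j i = mu (ZZ A) (map (fhm (shift_ZZ n)) fs) j i"
    using ends mu_ZZ_outside[OF TS, of j i] by (auto simp: shift_ZZ_sel(2))
qed

lemma strict_action_shift_ZZ: "strict_action (ZZ A) shift_ZZ"
proof (intro strict_action.intro ainf_category_ZZ strict_action_axioms.intro)
  show "shift_ZZ 0 = func_id" by (rule shift_ZZ_0)
  show "\<And>g h. shift_ZZ (g + h) = func_comp (shift_ZZ g) (shift_ZZ h)" by (rule shift_ZZ_add)
  have obj: "fobj (shift_ZZ g :: (('o \<times> int) list, nat \<Rightarrow> nat \<Rightarrow> 'm, ('o \<times> int) list, nat \<Rightarrow> nat \<Rightarrow> 'm) func) X \<in> Obj (ZZ A)" if "X \<in> Obj (ZZ A)" for X g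
    using that by (auto simp: ZZ_sel shift_ZZ_sel)
  show "fobj (shift_ZZ g :: (('o \<times> int) list, nat \<Rightarrow> nat \<Rightarrow> 'm, ('o \<times> int) list, nat \<Rightarrow> nat \<Rightarrow> 'm) func) X \<in> Obj (ZZ A)"
    if "X \<in> Obj (ZZ A)" for X g
    by (rule obj[OF that])
  show "mor (ZZ A) (fhm (shift_ZZ g) f)" if f: "mor (ZZ A) f" for f g
  proof -
    have o: "fst (src f ! i) \<in> Obj A" if "i < length (src f)" for i using f that by (auto simp: mor_def ZZ_sel)
    have o': "fst (tgt f ! i) \<in> Obj A" if "i < length (tgt f)" for i using f that by (auto simp: mor_def ZZ_sel)
    have d: "deg f - (a + g) + (b + g) = deg f - a + b" for a b by simp
    have "fmor (shift_ZZ g) f \<in> Hom (ZZ A) (fobj (shift_ZZ g) (src f)) (fobj (shift_ZZ g) (tgt f)) (deg f)"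
      using f o o' by (auto simp: ZZ_sel(2) mor_def shift_ZZ_nth shift_ZZ_sel(2) d intro!: Hom_ksign)
    then show ?thesis using f obj by (simp add: mor_def)
  qed
  show "\<And>X Y a p b g. fmor (shift_ZZ g) (HMor X Y p (a + b)) = fmor (shift_ZZ g) (HMor X Y p a) + fmor (shift_ZZ g) (HMor X Y p b)"
    by (auto simp: fun_eq_iff shift_ZZ_sel(2) ksign_plus)
  show "\<And>X Y a p g c. fmor (shift_ZZ g) (HMor X Y p (scl (ZZ A) c a)) = scl (ZZ A) c (fmor (shift_ZZ g) (HMor X Y p a))"
    by (auto simp: fun_eq_iff shift_ZZ_sel(2) ZZ_sel(3) ksign_def)
  show "\<And>as g. mors (ZZ A) as \<Longrightarrow> fmor (shift_ZZ g) (mu_mor (ZZ A) as) = mu (ZZ A) (map (fhm (shift_ZZ g)) as)"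
    by (rule shift_ZZ_mu)
qed

interpretation Z: strict_action "ZZ A" shift_ZZ by (rule strict_action_shift_ZZ)

lemma Tw_objI:
  assumes "mor (ZZ A) (tw_diff T)" "strictly_lower_triangular (length (fst T)) (snd T)"
    and "\<forall>\<^sub>F L in sequentially. (\<Sum>d\<in>{1..L}. mu (ZZ A) (replicate d (tw_diff T))) = 0"
  shows "T \<in> Obj (Tw A)"
proof -
  have "\<forall>\<^sub>F L::nat in sequentially. Sum_any (\<lambda>d. if d > 0 then mu (ZZ A) (replicate d (tw_diff T)) else 0) = 0"
    using Maurer_Cartan_eventually[OF assms(1,2)] assms(3) by eventually_elim (rule trans)
  then show ?thesis using assms(1,2) by (simp add: Tw_sel(1))
qed

lemma mu_mor_diffs:
  assumes "0 < d"
  shows "mu_mor (ZZ A) (replicate d (tw_diff T)) = HMor (fst T) (fst T) 2 (mu (ZZ A) (replicate d (tw_diff T)))"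
  using assms by (simp add: mu_mor_def sum_list_replicate)

lemma mors_diffs: "mor (ZZ A) (tw_diff T) \<Longrightarrow> 0 < d \<Longrightarrow> mors (ZZ A) (replicate d (tw_diff T))"
proof -
  assume m: "mor (ZZ A) (tw_diff T)" and d: "0 < d"
  have "pmors (ZZ A) (fst T) (replicate d (tw_diff T)) (fst T)" using m by (induction d) auto
  then show ?thesis using d by (auto simp: mors_pmors)
qed

text \<open>Signs do not affect which entries vanish, so triangularity persists, and the
  Maurer--Cartan equation is transported because the shift commutes with compositions and
  sums.\<close>

lemma shift_Tw_obj:
  assumes T: "T \<in> Obj (Tw A)"
  shows "fobj (shift_Tw n) T \<in> Obj (Tw A)"
proof (rule Tw_objI)
  have m: "mor (ZZ A) (tw_diff T)" and s: "strictly_lower_triangular (length (fst T)) (snd T)"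
    using T by (auto simp: Tw_sel(1))
  have o: "fst T \<in> Obj (ZZ A)" using m by (simp add: mor_def)
  show "mor (ZZ A) (tw_diff (fobj (shift_Tw n) T))" unfolding tw_diff_shift by (rule Z.act_mor[OF m])
  have "snd (fobj (shift_Tw n) T) = fmor (shift_ZZ n) (tw_diff T)" by (simp add: shift_Tw_def Let_def)
  then have "snd (fobj (shift_Tw n) T) j i = 0 \<longleftrightarrow> snd T j i = 0" for j i
    by (simp add: shift_ZZ_sel(2))
  then show "strictly_lower_triangular (length (fst (fobj (shift_Tw n) T))) (snd (fobj (shift_Tw n) T))"
    using s strictly_lower_triangular_cong[of "snd (fobj (shift_Tw n) T)" "snd T"] by (simp add: fst_shift_Tw)
  show "\<forall>\<^sub>F L in sequentially. (\<Sum>d\<in>{1..L}. mu (ZZ A) (replicate d (tw_diff (fobj (shift_Tw n) T)))) = 0"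
    using Maurer_Cartan_sum[OF T]
  proof eventually_elim
    case (elim L)
    have "mu (ZZ A) (replicate d (tw_diff T)) \<in> Hom (ZZ A) (fst T) (fst T) 2" if "d \<in> {1..L}" for d
      using Z.mu_closed[OF mors_diffs[OF m, of d]] mu_mor_diffs[of d T] that by simp
    then have "(\<Sum>d\<in>{1..L}. fmor (shift_ZZ n) (HMor (fst T) (fst T) 2 (mu (ZZ A) (replicate d (tw_diff T))))) =
        fmor (shift_ZZ n) (HMor (fst T) (fst T) 2 0)"
      unfolding elim[symmetric] by (intro Z.act_sum[symmetric] o)
    moreover have "mu (ZZ A) (replicate d (tw_diff (fobj (shift_Tw n) T))) =
        fmor (shift_ZZ n) (HMor (fst T) (fst T) 2 (mu (ZZ A) (replicate d (tw_diff T))))" if "d \<in> {1..L}" for d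
      using Z.act_mu[OF mors_diffs[OF m, of d], of n] mu_mor_diffs[of d T] that by (simp add: tw_diff_shift map_replicate)
    ultimately show ?case using o by (simp add: Z.act_zero)
  qed
qed

text \<open>Shifting every letter, inserted differentials included, matches the words of a string
  with the words of the shifted string, so strictness on \<int>A applies word by word.\<close>

lemma shift_Tw_mu:
  assumes "mors (Tw A) fs"
  shows "fmor (shift_Tw n) (mu_mor (Tw A) fs) = mu (Tw A) (map (fhm (shift_Tw n)) fs)"
proof -
  obtain T S where TS: "pmors (Tw A) T fs S" "fs \<noteq> []" using assms by (auto simp: mors_pmors)
  have obj: "T \<in> Obj (Tw A)" "S \<in> Obj (Tw A)" using pmors_obj[OF TS] by auto
  have o: "fst T \<in> Obj (ZZ A)" "fst S \<in> Obj (ZZ A)" using obj by (auto intro: Tw_obj_ZZ)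
  let ?p = "(\<Sum>a\<leftarrow>fs. deg a) + 2 - int (length fs)"
  let ?k = "fhm (shift_Tw n)" and ?h = "fobj (shift_Tw n)"
  have k: "mor (Tw A) (?k f)" if "mor (Tw A) f" for f
    using Z.act_mor[OF mor_untwist[OF that], of n] that shift_Tw_obj untwist_shift[of n f, symmetric]
    by (auto simp: mor_def Tw_sel(2))
  have "pmors (Tw A) T fs S \<Longrightarrow> pmors (Tw A) (?h T) (map ?k fs) (?h S)" for T fs
    by (induction fs arbitrary: T) (auto simp: k)
  then have TS': "pmors (Tw A) (?h T) (map ?k fs) (?h S)" using TS by blast
  have ne: "map ?k fs \<noteq> []" using TS by simp
  have p: "path src tgt T fs S" using TS by (simp add: pmors_def)
  have rl: "map rl (map (map_sum ?h ?k) w) = map (fhm (shift_ZZ n)) (map rl w)" for w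
    by (induction w) (auto simp: tw_diff_shift untwist_shift split: sum.splits)
  have "\<forall>\<^sub>F L::nat in sequentially. mu (Tw A) (map ?k fs) = fmor (shift_ZZ n) (HMor (fst S) (fst T) ?p (mu (Tw A) fs))"
    using mu_Tw_words[OF TS] mu_Tw_words[OF TS' ne]
  proof eventually_elim
    case (elim L)
    have w: "mu (ZZ A) (map rl w) \<in> Hom (ZZ A) (fst S) (fst T) ?p \<and>
        fmor (shift_ZZ n) (HMor (fst S) (fst T) ?p (mu (ZZ A) (map rl w))) = mu (ZZ A) (map (fhm (shift_ZZ n)) (map rl w))"
      if w: "w \<in> words src tgt T fs S L" for w
    proof -
      have pw: "pmors (ZZ A) (fst T) (map rl w) (fst S)" "map rl w \<noteq> []"
        using words_pmors[OF w TS(1) obj(1)] words_ne[OF w TS(2)] by auto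
      then have m: "mors (ZZ A) (map rl w)" by (auto simp: mors_pmors)
      have "rights w = fs" using w by (simp add: words_def)
      then have mm: "mu_mor (ZZ A) (map rl w) = HMor (fst S) (fst T) ?p (mu (ZZ A) (map rl w))"
        using pmors_ends[OF pw] wpath_degs(2)[of w] by (simp add: mu_mor_def)
      show ?thesis using Z.mu_closed[OF m] Z.act_mu[OF m, of n] unfolding mm by simp
    qed
    have "(\<Sum>w\<in>words src tgt (?h T) (map ?k fs) (?h S) L. mu (ZZ A) (map rl w)) =
      (\<Sum>w\<in>words src tgt T fs S L. mu (ZZ A) (map rl (map (map_sum ?h ?k) w)))"
      by (rule sum_words_map[OF p]) auto
    also have "\<dots> = (\<Sum>w\<in>words src tgt T fs S L. fmor (shift_ZZ n) (HMor (fst S) (fst T) ?p (mu (ZZ A) (map rl w))))"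
      unfolding rl using w by (intro sum.cong refl) simp
    also have "\<dots> = fmor (shift_ZZ n) (HMor (fst S) (fst T) ?p (\<Sum>w\<in>words src tgt T fs S L. mu (ZZ A) (map rl w)))"
      using w by (intro Z.act_sum[symmetric] o) auto
    finally show ?case unfolding elim .
  qed
  then show ?thesis using pmors_ends[OF TS] by (simp add: fmor_shift_Tw untwist_def)
qed

lemma strict_action_shift_Tw: "strict_action (Tw A) shift_Tw"
proof (intro strict_action.intro ainf_category_Tw strict_action_axioms.intro)
  show "shift_Tw 0 = func_id" by (rule shift_Tw_0)
  show "\<And>g h. shift_Tw (g + h) = func_comp (shift_Tw g) (shift_Tw h)" by (rule shift_Tw_add)
  show "\<And>X g. X \<in> Obj (Tw A) \<Longrightarrow> fobj (shift_Tw g) X \<in> Obj (Tw A)" by (rule shift_Tw_obj)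
  show "mor (Tw A) (fhm (shift_Tw g) f)" if "mor (Tw A) f" for f g
    using Z.act_mor[OF mor_untwist[OF that], of g] that shift_Tw_obj untwist_shift[of g f, symmetric]
    by (auto simp: mor_def Tw_sel(2))
  show "fmor (shift_Tw g) (HMor X Y p (a + b)) = fmor (shift_Tw g) (HMor X Y p a) + fmor (shift_Tw g) (HMor X Y p b)"
    if "X \<in> Obj (Tw A)" "Y \<in> Obj (Tw A)" "a \<in> Hom (Tw A) X Y p" "b \<in> Hom (Tw A) X Y p" for X Y p a b g
    using that by (auto simp: fmor_shift_Tw untwist_HMor Tw_sel(2) intro!: Z.act_plus Tw_obj_ZZ)
  show "fmor (shift_Tw g) (HMor X Y p (scl (Tw A) c a)) = scl (Tw A) c (fmor (shift_Tw g) (HMor X Y p a))"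
    if "X \<in> Obj (Tw A)" "Y \<in> Obj (Tw A)" "a \<in> Hom (Tw A) X Y p" for X Y p a g c
    using that by (auto simp: fmor_shift_Tw untwist_HMor Tw_sel(2,3) intro!: Z.act_scl Tw_obj_ZZ)
  show "\<And>as g. mors (Tw A) as \<Longrightarrow> fmor (shift_Tw g) (mu_mor (Tw A) as) = mu (Tw A) (map (fhm (shift_Tw g)) as)"
    by (rule shift_Tw_mu)
qed

end

section \<open>Matrices over a skew group category\<close>

text \<open>A state consists of the index of a summand and the sum of the group elements read so
  far.\<close>

definition N2 :: "'g::group_add set \<Rightarrow> (('o \<times> int) list, nat \<Rightarrow> nat \<Rightarrow> ('g \<Rightarrow>\<^sub>0 'm::ab_group_add)) hmor \<Rightarrow> nat \<times> 'g \<Rightarrow> (nat \<times> 'g) set"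
  where "N2 K f s = Nz f (fst s) \<times> (+) (snd s) ` K"

text \<open>The first component records the shift difference and the reduced degree of the matrix
  entry, which are all that the outer sign depends on. The sign can then be computed without looking
  at the emitted morphism, so that expansions over Tw(A) and over \<int>A become comparable.\<close>

definition e2 :: "('g::group_add \<Rightarrow> ('o, 'm::ab_group_add, 'o, 'm) func) \<Rightarrow>
    (('o \<times> int) list, nat \<Rightarrow> nat \<Rightarrow> ('g \<Rightarrow>\<^sub>0 'm)) hmor \<Rightarrow> nat \<times> 'g \<Rightarrow> nat \<times> 'g \<Rightarrow> (int \<times> int) \<times> ('o, 'm) hmor"
  where "e2 \<rho> f s t = ((snd (src f ! fst t) - snd (tgt f ! fst s), deg f - snd (src f ! fst t) + snd (tgt f ! fst s) - 1),
    fhm (\<rho> (snd s)) (component \<rho> (entry f (fst s) (fst t)) (- snd s + snd t)))"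

primrec sx :: "(int \<times> int) list \<Rightarrow> int" where
  "sx [] = 0"
| "sx (x # E) = (\<Sum>y\<leftarrow>E. fst y) * snd x + sx E"

lemma sexp_sx: "sexp E = sx (map (\<lambda>x. (fst x, rdeg (snd x))) E)"
  by (induction E) (auto simp: comp_def)

lemma finite_N2: "finite K \<Longrightarrow> finite (N2 K f s)"
  by (simp add: N2_def)

lemma run_entries:
  "run N en fs j i E \<Longrightarrow> e \<in> set E \<Longrightarrow> \<exists>f\<in>set fs. \<exists>j k. e = en f j k"
proof (induction fs arbitrary: j E)
  case (Cons f fs)
  then obtain k E' where k: "E = en f j k # E'" "run N en fs k i E'" by auto
  show ?case
  proof (cases "e = en f j k")
    case False
    then have "e \<in> set E'" using Cons.prems(2) k(1) by simp
    from Cons.IH[OF k(2) this] show ?thesis by auto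
  qed auto
qed simp

context strict_action
begin

text \<open>The expansion of a matrix product along summands, followed by the expansion of each
  product along group elements, merged into one automaton by \<open>ex_ex\<close>. Only the exponent
  \<open>sx\<close> of the outer shifts remains, because the skew category contributes no
  sign.\<close>

lemma lookup_mu_ZZ_skew:
  assumes m: "mors (ZZ SK) fs" and K: "finite K" "\<And>f j i. f \<in> set fs \<Longrightarrow> Poly_Mapping.keys (val f j i) \<subseteq> K"
  shows "Poly_Mapping.lookup (mu (ZZ SK) fs j i) g = ex (N2 K) (e2 \<rho>) fs (j, 0)
    (\<lambda>t Z. if t = (i, g) then ksign (sx (map fst Z)) (mu B (map snd Z)) else 0)"
proof -
  interpret S: ainf_category SK by (rule ainf_category_skew)
  define em where "em e h h' = fhm (\<rho> h) (component \<rho> (snd e) (- h + h'))" for e :: "int \<times> ('o, 'g \<Rightarrow>\<^sub>0 'm) hmor" and h h'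
  define \<Phi> :: "nat \<times> 'g \<Rightarrow> ((int \<times> ('o, 'g \<Rightarrow>\<^sub>0 'm) hmor) \<times> ('o, 'm) hmor) list \<Rightarrow> 'm"
    where "\<Phi> = (\<lambda>(i', g') Zp. if (i', g') = (i, g) then ksign (sexp (map fst Zp)) (mu B (map snd Zp)) else 0)"
  define \<Psi> where "\<Psi> t Z = (if t = (i, g) then ksign (sx (map fst Z)) (mu B (map snd Z)) else 0)"
    for t :: "nat \<times> 'g" and Z :: "((int \<times> int) \<times> ('o, 'm) hmor) list"
  define q where "q = (\<lambda>(x :: int \<times> ('o, 'g \<Rightarrow>\<^sub>0 'm) hmor, y :: ('o, 'm) hmor). ((fst x, rdeg (snd x)), y))"
  have "Poly_Mapping.lookup (mu (ZZ SK) fs j i) g = ex Nz ez fs j (\<lambda>i' E. Poly_Mapping.lookup (smu SK i i' E) g)"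
    unfolding mu_ZZ by (rule ex_additive) (auto simp: lookup_add)
  also have "\<dots> = ex Nz ez fs j (\<lambda>i' E. ex (\<lambda>_ h. (+) h ` K) em E 0 (\<lambda>g' E'. \<Phi> (i', g') (zip E E')))"
  proof (rule ex_cong)
    fix i' E assume r: "run Nz ez fs j i' E"
    have mE: "mors SK (map snd E)" by (rule S.run_ZZ_mors[OF m r])
    then obtain T S' where TS: "pmors SK T (map snd E) S'" by (auto simp: mors_pmors)
    have keys: "Poly_Mapping.keys (val f) \<subseteq> K" if "f \<in> set (map snd E)" for f
      using that run_entries[OF r] K(2) by (fastforce simp: ez_def)
    have "Poly_Mapping.lookup (mu SK (map snd E)) g = ex (Nf K) es (map snd E) 0 (smu B g)"
      by (rule lookup_mu_skew_Nf[OF mE K(1) keys])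
    also have "\<dots> = ex (Nf K) es (map snd E) 0 (\<lambda>g' E'. (\<lambda>g' E'. if g' = g then mu B E' else 0) g' (map snd E'))"
    proof (rule ex_cong)
      fix g' E' assume "run (Nf K) es (map snd E) 0 g' E'"
      from run_skew[OF TS this] have "sexp E' = 0" by (intro sexp_zero) auto
      then show "smu B g g' E' = (if g' = g then mu B (map snd E') else 0)" by (simp add: smu_def)
    qed
    also have "\<dots> = ex (\<lambda>_ h. (+) h ` K) em E 0 (\<lambda>g' E'. if g' = g then mu B E' else 0)"
      using ex_proj[where q = snd and \<Phi> = "\<lambda>g' E'. if g' = g then mu B E' else 0" and N = "\<lambda>_ h. (+) h ` K"
          and en = "\<lambda>e. es (snd e)" and fs = E and j = 0] by (simp add: ex_map em_def[abs_def])
    finally have eq: "Poly_Mapping.lookup (mu SK (map snd E)) g = ex (\<lambda>_ h. (+) h ` K) em E 0 (\<lambda>g' E'. if g' = g then mu B E' else 0)" .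
    have "Poly_Mapping.lookup (smu SK i i' E) g = (if i' = i then ksign (sexp E) (ex (\<lambda>_ h. (+) h ` K) em E 0 (\<lambda>g' E'. if g' = g then mu B E' else 0)) else 0)"
      by (simp add: smu_def lookup_ksign eq)
    also have "\<dots> = ex (\<lambda>_ h. (+) h ` K) em E 0 (\<lambda>g' E'. if i' = i then ksign (sexp E) (if g' = g then mu B E' else 0) else 0)"
      by (simp add: ex_ksign)
    also have "\<dots> = ex (\<lambda>_ h. (+) h ` K) em E 0 (\<lambda>g' E'. \<Phi> (i', g') (zip E E'))"
      by (rule ex_cong) (auto simp: \<Phi>_def dest: run_length)
    finally show "Poly_Mapping.lookup (smu SK i i' E) g = ex (\<lambda>_ h. (+) h ` K) em E 0 (\<lambda>g' E'. \<Phi> (i', g') (zip E E'))" .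
  qed
  also have "\<dots> = ex (\<lambda>f (j, h). Sigma (Nz f j) (\<lambda>k. (+) h ` K)) (\<lambda>f (j, h) (k, h'). (ez f j k, em (ez f j k) h h')) fs (j, 0) \<Phi>"
    by (rule ex_ex) (simp_all add: K)
  also have "\<dots> = ex (\<lambda>f (j, h). Sigma (Nz f j) (\<lambda>k. (+) h ` K)) (\<lambda>f (j, h) (k, h'). (ez f j k, em (ez f j k) h h')) fs (j, 0)
      (\<lambda>t Z. \<Psi> t (map q Z))"
    by (rule ex_cong) (auto simp: \<Phi>_def \<Psi>_def q_def sexp_sx comp_def case_prod_beta)
  also have "\<dots> = ex (\<lambda>f (j, h). Sigma (Nz f j) (\<lambda>k. (+) h ` K)) (\<lambda>f s t. q ((\<lambda>(j, h) (k, h'). (ez f j k, em (ez f j k) h h')) s t)) fs (j, 0) \<Psi>"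
    by (rule ex_proj)
  also have "(\<lambda>f (j, h). Sigma (Nz f j) (\<lambda>k. (+) h ` K)) = N2 K" by (auto simp: N2_def fun_eq_iff)
  also have "(\<lambda>f s t. q ((\<lambda>(j, h) (k, h'). (ez f j k, em (ez f j k) h h')) s t)) = e2 \<rho>"
    by (auto simp: fun_eq_iff e2_def q_def em_def ez_def)
  finally show ?thesis unfolding \<Psi>_def .
qed

lemma run2:
  assumes "pmors (ZZ SK) T fs S" "run (N2 K) (e2 \<rho>) fs s t Z" "fst s < length T"
  shows "fst t < length S \<and> pmors B (fobj (\<rho> (snd s)) (fst (T ! fst s))) (map snd Z) (fobj (\<rho> (snd t)) (fst (S ! fst t)))"
  using assms
proof (induction fs arbitrary: T s Z)
  case (Cons f fs)
  then obtain u Z' where u: "u \<in> N2 K f s" "Z = e2 \<rho> f s u # Z'" "run (N2 K) (e2 \<rho>) fs u t Z'" by auto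
  have f: "mor (ZZ SK) f" "tgt f = T" "pmors (ZZ SK) (src f) fs S" using Cons.prems by auto
  have u1: "fst u < length (src f)" "fst s < length (tgt f)" using u(1) by (auto simp: N2_def Nz_def split: if_splits)
  have "mor SK (entry f (fst s) (fst u))" using f u1 by (auto simp: mor_def ZZ_sel)
  then have "mor B (component \<rho> (entry f (fst s) (fst u)) g)" for g
    by (auto simp: mor_def skew_sel intro: act_obj)
  with Cons.IH[OF f(3) u(3) u1(1)] f(2) show ?case by (auto simp: u(2) e2_def act_mor fobj_fobj)
qed auto

lemma finite_keys_ZZ:
  assumes "mor (ZZ SK) f"
  shows "finite (\<Union>j i. Poly_Mapping.keys (val f j i))"
proof -
  have "(\<Union>j i. Poly_Mapping.keys (val f j i)) \<subseteq> (\<Union>j<length (tgt f). \<Union>i<length (src f). Poly_Mapping.keys (val f j i))"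
  proof
    fix g assume "g \<in> (\<Union>j i. Poly_Mapping.keys (val f j i))"
    then obtain j i where ji: "g \<in> Poly_Mapping.keys (val f j i)" by auto
    have "j < length (tgt f) \<and> i < length (src f)"
    proof (rule ccontr)
      assume "\<not> (j < length (tgt f) \<and> i < length (src f))"
      then have "val f j i = 0" using assms by (auto simp: mor_def ZZ_sel(2))
      then show False using ji by simp
    qed
    then show "g \<in> (\<Union>j<length (tgt f). \<Union>i<length (src f). Poly_Mapping.keys (val f j i))" using ji by auto
  qed
  then show ?thesis by (rule finite_subset) auto
qed

end

section \<open>Diagonal differentials\<close>

text \<open>
  The objects of \<open>\<int>(Tw(A) * \<int>)\<close> are lists of pairs of a twisted complex and a shift. Forgetting the
  differentials of these complexes gives \<open>kap\<close>, and \<open>dD Y\<close> is the diagonal matrix of these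
  differentials.
\<close>

definition kap :: "((('o, 'm) twc \<times> int) list, 'n) hmor \<Rightarrow> ((('o \<times> int) list \<times> int) list, 'n) hmor"
  where "kap f = HMor (map (apfst fst) (src f)) (map (apfst fst) (tgt f)) (deg f) (val f)"

definition dmat :: "(('o, 'm::ab_group_add) twc \<times> int) list \<Rightarrow> nat \<Rightarrow> nat \<Rightarrow> (int \<Rightarrow>\<^sub>0 (nat \<Rightarrow> nat \<Rightarrow> 'm))"
  where "dmat Y j i = (if j = i \<and> i < length Y then Poly_Mapping.single 0 (snd (fst (Y ! i))) else 0)"

definition dD :: "(('o, 'm::ab_group_add) twc \<times> int) list \<Rightarrow>
    ((('o, 'm) twc \<times> int) list, nat \<Rightarrow> nat \<Rightarrow> (int \<Rightarrow>\<^sub>0 (nat \<Rightarrow> nat \<Rightarrow> 'm))) hmor"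
  where "dD Y = HMor Y Y 1 (dmat Y)"

abbreviation rD :: "(('o, 'm::ab_group_add) twc \<times> int) list +
     ((('o, 'm) twc \<times> int) list, nat \<Rightarrow> nat \<Rightarrow> (int \<Rightarrow>\<^sub>0 (nat \<Rightarrow> nat \<Rightarrow> 'm))) hmor \<Rightarrow>
     ((('o, 'm) twc \<times> int) list, nat \<Rightarrow> nat \<Rightarrow> (int \<Rightarrow>\<^sub>0 (nat \<Rightarrow> nat \<Rightarrow> 'm))) hmor"
  where "rD \<equiv> case_sum dD id"

lemma kap_sel [simp]: "src (kap f) = map (apfst fst) (src f)" "tgt (kap f) = map (apfst fst) (tgt f)"
  "deg (kap f) = deg f" "val (kap f) = val f"
  by (simp_all add: kap_def)

lemma dD_sel [simp]: "src (dD Y) = Y" "tgt (dD Y) = Y" "deg (dD Y) = 1" "val (dD Y) = dmat Y"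
  by (simp_all add: dD_def)

abbreviation eZ :: "((('o \<times> int) list \<times> int) list, nat \<Rightarrow> nat \<Rightarrow> (int \<Rightarrow>\<^sub>0 (nat \<Rightarrow> nat \<Rightarrow> 'm::ab_group_add))) hmor \<Rightarrow>
    nat \<times> int \<Rightarrow> nat \<times> int \<Rightarrow> (int \<times> int) \<times> (('o \<times> int) list, nat \<Rightarrow> nat \<Rightarrow> 'm) hmor"
  where "eZ \<equiv> e2 shift_ZZ"

abbreviation eT :: "((('o, 'm::ab_group_add) twc \<times> int) list, nat \<Rightarrow> nat \<Rightarrow> (int \<Rightarrow>\<^sub>0 (nat \<Rightarrow> nat \<Rightarrow> 'm))) hmor \<Rightarrow>
    nat \<times> int \<Rightarrow> nat \<times> int \<Rightarrow> (int \<times> int) \<times> (('o, 'm) twc, nat \<Rightarrow> nat \<Rightarrow> 'm) hmor"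
  where "eT \<equiv> e2 shift_Tw"

lemma untwist_component:
  "untwist (component shift_Tw f g) = component shift_ZZ (HMor (fst (src f)) (fst (tgt f)) (deg f) (val f)) g"
  by (simp add: untwist_def component_def fst_shift_Tw)

lemma e2_kap:
  assumes "fst s < length (tgt f)" "fst t < length (src f)"
  shows "eZ (kap f) s t = apsnd untwist (eT f s t)"
proof -
  let ?e = "entry f (fst s) (fst t)"
  have "HMor (fst (src ?e)) (fst (tgt ?e)) (deg ?e) (val ?e) = entry (kap f) (fst s) (fst t)"
    using assms by (simp add: entry_def)
  then show ?thesis using assms unfolding e2_def by (simp only: untwist_shift untwist_component apsnd_conv) simp
qed

lemma N2_kap: "N2 K (kap f) s = N2 K f s"
  by (simp add: N2_def Nz_def)

lemma fmor_shift_ZZ_zero: "fmor (shift_ZZ n) (HMor X Y p (0 :: nat \<Rightarrow> nat \<Rightarrow> 'm::ab_group_add)) = 0"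
  by (auto simp: fun_eq_iff shift_ZZ_sel(2))

text \<open>Reading D in the state \<open>(j, h)\<close> leaves the state unchanged and emits the
  differential of the shifted summand. The recorded pair (0, 0) shows that it has no influence on
  the outer sign, so D behaves exactly like an insertion in the inner composition of Tw(A).\<close>

lemma eZ_dD_diag:
  assumes "j < length Y"
  shows "eZ (kap (dD Y)) (j, h) (j, h) = ((0, 0), tw_diff (fobj (shift_Tw h) (fst (Y ! j))))"
proof -
  have "component shift_ZZ (entry (kap (dD Y)) j j) 0 = tw_diff (fst (Y ! j))"
    using assms by (simp add: component_def entry_def dmat_def tw_diff_def shift_ZZ_0)
  then show ?thesis using assms by (simp add: e2_def tw_diff_shift)
qed

lemma eZ_dD_off:
  assumes "(k, h') \<noteq> (j, h)"
  shows "val (snd (eZ (kap (dD Y)) (j, h) (k, h'))) = 0"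
proof -
  have "Poly_Mapping.lookup (dmat Y j k) (- h + h') = 0"
    using assms by (auto simp: dmat_def lookup_single when_def)
  then show ?thesis by (simp add: e2_def component_def fmor_shift_ZZ_zero)
qed

definition nullZ :: "((int \<times> int) \<times> ('a, 'b::zero) hmor) list \<Rightarrow> bool"
  where "nullZ Z \<longleftrightarrow> (\<exists>z\<in>set Z. val (snd z) = 0)"

lemma nullZ_Cons: "val (snd z) = 0 \<or> nullZ Z \<Longrightarrow> nullZ (z # Z)"
  by (auto simp: nullZ_def)

lemma nullZ_append: "nullZ Z \<Longrightarrow> nullZ (Z' @ Z)"
  by (auto simp: nullZ_def)

text \<open>Any transition of D that changes the state emits a zero letter and is discarded by
  \<open>null\<close>. The set \<open>K\<close> has to contain 0 for the remaining transition to
  exist.\<close>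

lemma ex_dD:
  assumes K: "finite K" "0 \<in> K" and j: "j < length Y"
    and null: "\<And>t Z. run (N2 K) eZ (kap (dD Y) # fs) (j, h) t Z \<Longrightarrow> nullZ Z \<Longrightarrow> \<Phi> t Z = 0"
  shows "ex (N2 K) eZ (kap (dD Y) # fs) (j, h) \<Phi> =
    ex (N2 K) eZ fs (j, h) (\<lambda>t Z. \<Phi> t (((0, 0), tw_diff (fobj (shift_Tw h) (fst (Y ! j)))) # Z))"
proof -
  let ?F = "\<lambda>u. ex (N2 K) eZ fs u (\<lambda>t Z. \<Phi> t (eZ (kap (dD Y)) (j, h) u # Z))"
  have "(\<Sum>u\<in>N2 K (kap (dD Y)) (j, h). ?F u) = (\<Sum>u\<in>{(j, h)}. ?F u)"
  proof (rule sum.mono_neutral_right)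
    show "\<forall>u\<in>N2 K (kap (dD Y)) (j, h) - {(j, h)}. ?F u = 0"
    proof
      fix u assume u: "u \<in> N2 K (kap (dD Y)) (j, h) - {(j, h)}"
      then have z: "val (snd (eZ (kap (dD Y)) (j, h) u)) = 0" using eZ_dD_off[of "fst u" "snd u" j h Y] by simp
      show "?F u = 0" by (rule ex_zero_cong, rule null) (use u z in \<open>auto intro: nullZ_Cons\<close>)
    qed
    show "{(j, h)} \<subseteq> N2 K (kap (dD Y)) (j, h)" using j K(2) by (force simp: N2_def Nz_def)
  qed (simp add: finite_N2 K)
  then show ?thesis using eZ_dD_diag[OF j] by simp
qed

lemma run_dD:
  assumes "0 \<in> K" "j < length Y" "run (N2 K) eZ fs (j, h) t Z"
  shows "run (N2 K) eZ (replicate n (kap (dD Y)) @ fs) (j, h) t (replicate n ((0, 0), tw_diff (fobj (shift_Tw h) (fst (Y ! j)))) @ Z)"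
proof (induction n)
  case (Suc n)
  have "(j, h) \<in> N2 K (kap (dD Y)) (j, h)" using assms by (force simp: N2_def Nz_def)
  then show ?case using Suc eZ_dD_diag[OF assms(2), of h] by (auto intro!: bexI[of _ "(j, h)"])
qed (use assms in simp)

lemma ex_dD_replicate:
  assumes K: "finite K" "0 \<in> K" and j: "j < length Y"
    and null: "\<And>t Z. run (N2 K) eZ (replicate n (kap (dD Y)) @ fs) (j, h) t Z \<Longrightarrow> nullZ Z \<Longrightarrow> \<Phi> t Z = 0"
  shows "ex (N2 K) eZ (replicate n (kap (dD Y)) @ fs) (j, h) \<Phi> =
    ex (N2 K) eZ fs (j, h) (\<lambda>t Z. \<Phi> t (replicate n ((0, 0), tw_diff (fobj (shift_Tw h) (fst (Y ! j)))) @ Z))"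
  using null
proof (induction n arbitrary: \<Phi>)
  case (Suc n)
  let ?d = "((0, 0), tw_diff (fobj (shift_Tw h) (fst (Y ! j))))"
  have "ex (N2 K) eZ (replicate (Suc n) (kap (dD Y)) @ fs) (j, h) \<Phi> =
    ex (N2 K) eZ (replicate n (kap (dD Y)) @ fs) (j, h) (\<lambda>t Z. \<Phi> t (?d # Z))"
    unfolding replicate.simps append_Cons by (rule ex_dD[OF K j Suc.prems[unfolded replicate.simps append_Cons]])
  also have "\<dots> = ex (N2 K) eZ fs (j, h) (\<lambda>t Z. \<Phi> t (?d # replicate n ?d @ Z))"
  proof (rule Suc.IH)
    fix t Z assume r: "run (N2 K) eZ (replicate n (kap (dD Y)) @ fs) (j, h) t Z" "nullZ Z"
    have "run (N2 K) eZ (replicate 1 (kap (dD Y)) @ replicate n (kap (dD Y)) @ fs) (j, h) t (replicate 1 ?d @ Z)"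
      by (rule run_dD[OF K(2) j r(1)])
    then have "run (N2 K) eZ (replicate (Suc n) (kap (dD Y)) @ fs) (j, h) t (?d # Z)" by simp
    then show "\<Phi> t (?d # Z) = 0" using r(2) nullZ_Cons by (intro Suc.prems) blast+
  qed
  finally show ?case by simp
qed simp

text \<open>The counterpart of \<open>ins\<close> for a string emitted by a run over Tw(A): its
  letters are stripped of their twisted complexes, and the inserted differentials carry the neutral
  pair (0, 0).\<close>

primrec insZ :: "('o, 'm) twc \<Rightarrow> ((int \<times> int) \<times> (('o, 'm) twc, nat \<Rightarrow> nat \<Rightarrow> 'm) hmor) list \<Rightarrow> nat list \<Rightarrow>
    ((int \<times> int) \<times> (('o \<times> int) list, nat \<Rightarrow> nat \<Rightarrow> 'm) hmor) list" where
  "insZ T [] = (\<lambda>ns. replicate (hd ns) ((0, 0), tw_diff T))"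
| "insZ T (z # Z) = (\<lambda>ns. replicate (hd ns) ((0, 0), tw_diff T) @ apsnd untwist z # insZ (src (snd z)) Z (tl ns))"

lemma insZ_snd: "map snd (insZ T Z ns) = map rl (ins src T (map snd Z) ns)"
  by (induction Z arbitrary: T ns) auto

lemma insZ_sum: "(\<Sum>y\<leftarrow>map fst (insZ T Z ns). fst y) = (\<Sum>y\<leftarrow>map fst Z. fst y)"
  by (induction Z arbitrary: T ns) (auto simp: sum_list_replicate comp_def)

lemma sx_replicate: "sx (replicate n (0, 0) @ E) = sx E"
  by (induction n) auto

lemma insZ_sx: "sx (map fst (insZ T Z ns)) = sx (map fst Z)"
proof (induction Z arbitrary: T ns)
  case Nil
  then show ?case using sx_replicate[of _ "[]"] by simp
next
  case (Cons z Z)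
  then show ?case using insZ_sum[of "src (snd z)" Z "tl ns"] by (simp add: sx_replicate)
qed

section \<open>Inserting the diagonal differential\<close>

context ainf_category
begin

interpretation ZA: strict_action "ZZ A" shift_ZZ by (rule strict_action_shift_ZZ)
interpretation TA: strict_action "Tw A" shift_Tw by (rule strict_action_shift_Tw)

abbreviation CZ :: "(('o \<times> int) list, int \<Rightarrow>\<^sub>0 (nat \<Rightarrow> nat \<Rightarrow> 'm), 'k) ainf" where "CZ \<equiv> skew (ZZ A) shift_ZZ"
abbreviation CT :: "(('o, 'm) twc, int \<Rightarrow>\<^sub>0 (nat \<Rightarrow> nat \<Rightarrow> 'm), 'k) ainf" where "CT \<equiv> skew (Tw A) shift_Tw"

interpretation CZ: ainf_category CZ by (rule ZA.ainf_category_skew)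
interpretation CT: ainf_category CT by (rule TA.ainf_category_skew)
interpretation ZCZ: ainf_category "ZZ CZ" by (rule CZ.ainf_category_ZZ)
interpretation ZCT: ainf_category "ZZ CT" by (rule CT.ainf_category_ZZ)

text \<open>Morphism spaces of twisted complexes ignore the differentials, so the two skew
  categories have the same morphisms and differ only in their compositions.\<close>

lemma Hom_CT: "Hom CT T T' p = Hom CZ (fst T) (fst T') p"
  by (auto simp: ZA.skew_sel(2) TA.skew_sel(2) Tw_sel(2) fst_shift_Tw)

lemma Obj_ZZ_kap: "Y \<in> Obj (ZZ CT) \<Longrightarrow> map (apfst fst) Y \<in> Obj (ZZ CZ)"
  unfolding ZZ_sel(1)[of CZ] ZZ_sel(1)[of CT] ZA.skew_sel(1) TA.skew_sel(1) by (auto dest: Tw_obj_ZZ)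

lemma mor_kap: "mor (ZZ CT) f \<Longrightarrow> mor (ZZ CZ) (kap f)"
  using Obj_ZZ_kap[of "src f"] Obj_ZZ_kap[of "tgt f"] unfolding mor_def ZZ_sel(2) Hom_CT kap_sel
  by (simp only: length_map nth_map apfst_conv fst_apfst snd_apfst simp_thms cong: if_cong) auto

lemma mor_dD:
  assumes "Y \<in> Obj (ZZ CT)"
  shows "mor (ZZ CT) (dD Y)"
proof -
  have o: "fst (Y ! i) \<in> Obj (Tw A)" if "i < length Y" for i using assms that by (auto simp: ZZ_sel(1) TA.skew_sel(1))
  have "snd (fst (Y ! i)) \<in> Hom (ZZ A) (fst (fst (Y ! i))) (fst (fst (Y ! i))) 1" if "i < length Y" for i
    using o[OF that] by (simp add: Tw_sel(1) mor_def)
  then have "Poly_Mapping.single 0 (snd (fst (Y ! i))) \<in> Hom CT (fst (Y ! i)) (fst (Y ! i)) 1" if "i < length Y" for i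
    using o[OF that] that
    by (auto simp: TA.skew_sel(2) lookup_single when_def Tw_sel(2) intro!: ZA.Hom_0 Tw_obj_ZZ shift_Tw_obj)
  then have "dmat Y \<in> Hom (ZZ CT) Y Y 1"
    using o by (auto simp: ZZ_sel(2) dmat_def intro!: CT.Hom_0 simp: TA.skew_sel(1))
  then show ?thesis using assms by (simp add: mor_def)
qed

lemma pmors_kap: "pmors (ZZ CT) T fs S \<Longrightarrow> pmors (ZZ CZ) (map (apfst fst) T) (map kap fs) (map (apfst fst) S)"
  by (induction fs arbitrary: T) (auto simp: mor_kap)

lemma pmors_rD:
  "wpath src tgt Y v S \<Longrightarrow> pmors (ZZ CT) Y (rights v) S \<Longrightarrow> Y \<in> Obj (ZZ CT) \<Longrightarrow> pmors (ZZ CT) Y (map rD v) S"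
proof (induction v arbitrary: Y)
  case (Cons x v)
  show ?case
  proof (cases x)
    case (Inl U)
    then show ?thesis using Cons mor_dD[of Y] by auto
  next
    case (Inr f)
    then have "mor (ZZ CT) f" using Cons.prems by simp
    then have "src f \<in> Obj (ZZ CT)" by (simp add: mor_def)
    then show ?thesis using Inr Cons.IH[of "src f"] Cons.prems by simp
  qed
qed simp

text \<open>Copies of D inserted at an object become as many copies of the differential of the
  summand through which the run passes there. The words over the summands vary from run to run, but
  the multiplicities \<open>ns\<close> do not; this is why the insertions are indexed by
  multiplicities.\<close>

lemma ex_insert:
  fixes Y S :: "(('o, 'm) twc \<times> int) list"
  assumes K: "finite K" "0 \<in> K" and p: "path src tgt Y x S" and l: "length ns = Suc (length x)" and j: "j < length Y"
    and null: "\<And>t Z. run (N2 K) eZ (map (\<lambda>l. kap (rD l)) (ins src Y x ns)) (j, h) t Z \<Longrightarrow> nullZ Z \<Longrightarrow> \<Phi> t Z = 0"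
  shows "ex (N2 K) eZ (map (\<lambda>l. kap (rD l)) (ins src Y x ns)) (j, h) \<Phi> =
    ex (N2 K) eT x (j, h) (\<lambda>t Z. \<Phi> t (insZ (fobj (shift_Tw h) (fst (Y ! j))) Z ns))"
  using p l j null
proof (induction x arbitrary: Y ns j h \<Phi>)
  case Nil
  then show ?case using ex_dD_replicate[OF K Nil(3), of "hd ns" "[]" h \<Phi>] by (simp add: map_replicate_const map_replicate)
next
  case (Cons f x)
  obtain n ms where ns: "ns = n # ms" "length ms = Suc (length x)" using Cons.prems(2) by (cases ns) auto
  have f: "tgt f = Y" "path src tgt (src f) x S" using Cons.prems(1) by auto
  let ?r = "\<lambda>l. kap (rD l)"
  let ?d = "((0, 0), tw_diff (fobj (shift_Tw h) (fst (Y ! j))))"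
  let ?L = "kap f # map ?r (ins src (src f) x ms)"
  have eq: "map ?r (ins src Y (f # x) ns) = replicate n (kap (dD Y)) @ ?L"
    by (simp add: ns map_replicate)
  have "ex (N2 K) eZ (map ?r (ins src Y (f # x) ns)) (j, h) \<Phi> = ex (N2 K) eZ ?L (j, h) (\<lambda>t Z. \<Phi> t (replicate n ?d @ Z))"
    unfolding eq by (rule ex_dD_replicate[OF K Cons.prems(3) Cons.prems(4)[unfolded eq]])
  also have "\<dots> = (\<Sum>u\<in>N2 K f (j, h). ex (N2 K) eZ (map ?r (ins src (src f) x ms)) u
      (\<lambda>t Z. \<Phi> t (replicate n ?d @ eZ (kap f) (j, h) u # Z)))"
    by (simp add: N2_kap)
  also have "\<dots> = (\<Sum>u\<in>N2 K f (j, h). ex (N2 K) eT x u (\<lambda>t Z. \<Phi> t (insZ (fobj (shift_Tw h) (fst (Y ! j))) (eT f (j, h) u # Z) ns)))"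
  proof (rule sum.cong[OF refl])
    fix u assume u: "u \<in> N2 K f (j, h)"
    obtain k h' where kh: "u = (k, h')" by (cases u)
    have k: "k < length (src f)" using u kh by (auto simp: N2_def Nz_def split: if_splits)
    have "ex (N2 K) eZ (map ?r (ins src (src f) x ms)) (k, h') (\<lambda>t Z. \<Phi> t (replicate n ?d @ eZ (kap f) (j, h) (k, h') # Z)) =
      ex (N2 K) eT x (k, h') (\<lambda>t Z. \<Phi> t (replicate n ?d @ eZ (kap f) (j, h) (k, h') # insZ (fobj (shift_Tw h') (fst (src f ! k))) Z ms))"
    proof (rule Cons.IH[OF f(2) ns(2) k])
      fix t Z assume r: "run (N2 K) eZ (map ?r (ins src (src f) x ms)) (k, h') t Z" "nullZ Z"
      have "run (N2 K) eZ ?L (j, h) t (eZ (kap f) (j, h) (k, h') # Z)" using r(1) u kh by (auto simp: N2_kap)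
      then have "run (N2 K) eZ (replicate n (kap (dD Y)) @ ?L) (j, h) t (replicate n ?d @ eZ (kap f) (j, h) (k, h') # Z)"
        by (rule run_dD[OF K(2) Cons.prems(3)])
      then show "\<Phi> t (replicate n ?d @ eZ (kap f) (j, h) (k, h') # Z) = 0"
        using r(2) by (intro Cons.prems(4)) (simp_all only: eq nullZ_append nullZ_Cons simp_thms)
    qed
    moreover have "eZ (kap f) (j, h) (k, h') = apsnd untwist (eT f (j, h) (k, h'))"
      using e2_kap[of "(j, h)" f "(k, h')"] k Cons.prems(3) f by simp
    moreover have "src (snd (eT f (j, h) (k, h'))) = fobj (shift_Tw h') (fst (src f ! k))"
      by (simp add: e2_def component_def TA.fobj_fobj)
    ultimately show "ex (N2 K) eZ (map ?r (ins src (src f) x ms)) u (\<lambda>t Z. \<Phi> t (replicate n ?d @ eZ (kap f) (j, h) u # Z)) =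
      ex (N2 K) eT x u (\<lambda>t Z. \<Phi> t (insZ (fobj (shift_Tw h) (fst (Y ! j))) (eT f (j, h) u # Z) ns))"
      unfolding kh by (simp add: ns)
  qed
  finally show ?case by simp
qed

lemma keys_rD:
  assumes "finite (set x)" "\<And>f. f \<in> set x \<Longrightarrow> mor (ZZ CT) f"
  shows "\<exists>K. finite K \<and> 0 \<in> K \<and> (\<forall>f\<in>set x. \<forall>j i. Poly_Mapping.keys (val f j i) \<subseteq> K)"
proof -
  have "finite (\<Union>f\<in>set x. \<Union>j i. Poly_Mapping.keys (val f j i))"
    using TA.finite_keys_ZZ assms by auto
  then show ?thesis
    by (intro exI[of _ "insert 0 (\<Union>f\<in>set x. \<Union>j i. Poly_Mapping.keys (val f j i))"]) auto
qed

text \<open>The right side is the part with multiplicities \<open>ns\<close> of a composition over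
  Tw(A) * \<int>. The string \<open>x\<close> may be empty as long as something is inserted; that
  case describes the powers of D.\<close>

lemma lookup_mu_insert:
  assumes x: "pmors (ZZ CT) Y x S" "Y \<in> Obj (ZZ CT)" and ns: "length ns = Suc (length x)" "ins src Y x ns \<noteq> []"
    and K: "finite K" "0 \<in> K" "\<And>f j i. f \<in> set x \<Longrightarrow> Poly_Mapping.keys (val f j i) \<subseteq> K" and j: "j < length Y"
  shows "Poly_Mapping.lookup (mu (ZZ CZ) (map (\<lambda>l. kap (rD l)) (ins src Y x ns)) j i) g =
    ex (N2 K) eT x (j, 0) (\<lambda>t Z. if t = (i, g) then ksign (sx (map fst Z))
      (mu (ZZ A) (map rl (ins src (fst (Y ! j)) (map snd Z) ns))) else 0)"
proof -
  let ?fs = "map (\<lambda>l. kap (rD l)) (ins src Y x ns)"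
  have p: "path src tgt Y x S" using x(1) by (simp add: pmors_def)
  note I = ins_words[OF p ns(1)]
  have "pmors (ZZ CT) Y (map rD (ins src Y x ns)) S" by (rule pmors_rD) (use I x in auto)
  from pmors_kap[OF this] have P: "pmors (ZZ CZ) (map (apfst fst) Y) ?fs (map (apfst fst) S)" by (simp add: comp_def)
  have m: "mors (ZZ CZ) ?fs" using P ns(2) by (auto simp: mors_pmors)
  have kD: "Poly_Mapping.keys (dmat Y' j i) \<subseteq> K" for Y' :: "(('o, 'm) twc \<times> int) list" and j i
    using K(2) by (auto simp: dmat_def split: if_splits)
  have letters: "l \<in> set (ins src Y x ns) \<Longrightarrow> \<exists>Y'. l = Inl Y' \<or> (\<exists>f\<in>set x. l = Inr f)" for l Y ns
    by (induction x arbitrary: Y ns) (auto split: if_splits)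
  have keys: "Poly_Mapping.keys (val f j i) \<subseteq> K" if f: "f \<in> set ?fs" for f j i
  proof -
    obtain l where l: "l \<in> set (ins src Y x ns)" "f = kap (rD l)" using f by auto
    from letters[OF l(1)] consider Y' where "l = Inl Y'" | f' where "f' \<in> set x" "l = Inr f'" by blast
    then show ?thesis
    proof cases
      case 1
      then show ?thesis using l(2) kD[of Y' j i] by simp
    next
      case 2
      then show ?thesis using l(2) K(3)[of f' j i] by simp
    qed
  qed
  let ?\<Phi> = "\<lambda>t Z. if t = (i, g) then ksign (sx (map fst Z)) (mu (ZZ A) (map snd Z)) else 0"
  have "Poly_Mapping.lookup (mu (ZZ CZ) ?fs j i) g = ex (N2 K) eZ ?fs (j, 0) ?\<Phi>"
    by (rule ZA.lookup_mu_ZZ_skew[OF m K(1) keys])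
  also have "\<dots> = ex (N2 K) eT x (j, 0) (\<lambda>t Z. ?\<Phi> t (insZ (fobj (shift_Tw 0) (fst (Y ! j))) Z ns))"
  proof (rule ex_insert[OF K(1,2) p ns(1) j])
    fix t Z assume r: "run (N2 K) eZ ?fs (j, 0) t Z" "nullZ Z"
    have "\<exists>U V. pmors (ZZ A) U (map snd Z) V"
      using ZA.run2[OF P r(1)] j by auto
    moreover have "Z \<noteq> []" using r(2) by (auto simp: nullZ_def)
    ultimately have "mors (ZZ A) (map snd Z)" by (auto simp: mors_pmors)
    moreover obtain z where "z \<in> set Z" "val (snd z) = 0" using r(2) unfolding nullZ_def by blast
    ultimately have "mu (ZZ A) (map snd Z) = 0" by (intro ZA.mu_zero_entry[of _ "snd z"]) auto
    then show "?\<Phi> t Z = 0" by simp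
  qed
  finally show ?thesis unfolding insZ_sx insZ_snd TA.fobj_0 .
qed

text \<open>Each composition in Tw(A) on a run is expanded into insertions of the differentials of
  the summands, and by \<open>lookup_mu_insert\<close> these amount to insertions of D into the
  string \<open>x\<close> of matrices.\<close>

lemma mu_ZZ_CT_words:
  assumes x: "pmors (ZZ CT) Y x S" "x \<noteq> []"
  shows "\<forall>\<^sub>F L in sequentially. mu (ZZ CT) x = (\<Sum>v\<in>words src tgt Y x S L. mu (ZZ CZ) (map (\<lambda>l. kap (rD l)) v))"
proof -
  have Yo: "Y \<in> Obj (ZZ CT)" using pmors_obj[OF x] by simp
  have p: "path src tgt Y x S" using x(1) by (simp add: pmors_def)
  have m: "mors (ZZ CT) x" using x by (auto simp: mors_pmors)
  obtain K where K: "finite K" "0 \<in> K" "\<And>f j i. f \<in> set x \<Longrightarrow> Poly_Mapping.keys (val f j i) \<subseteq> K"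
    using keys_rD[of x] x(1) by (auto simp: pmors_def)
  let ?R = "\<lambda>j. {(t, Z). run (N2 K) eT x (j, 0) t Z}"
  have finR: "finite (?R j)" for j by (rule finite_run) (simp add: finite_N2 K)
  \<comment> \<open>The bound for the insertions depends on the string that a run emits. There are
    finitely many rows and finitely many runs, so one \<open>L\<close> suits them all.\<close>
  have "\<forall>\<^sub>F L in sequentially. \<forall>j\<in>{..<length Y}. \<forall>y\<in>?R j. mu (Tw A) (map snd (snd y)) =
      (\<Sum>ns\<in>box (length x) L. mu (ZZ A) (map rl (ins src (fst (Y ! j)) (map snd (snd y)) ns)))"
  proof (intro eventually_ball_finite finite_lessThan finR ballI)
    fix j y assume j: "j \<in> {..<length Y}" and y: "y \<in> ?R j"
    obtain t Z where tZ: "y = (t, Z)" "run (N2 K) eT x (j, 0) t Z" using y by auto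
    let ?S = "fobj (shift_Tw (snd t)) (fst (S ! fst t))"
    have pZ: "pmors (Tw A) (fst (Y ! j)) (map snd Z) ?S" using TA.run2[OF x(1) tZ(2)] j by simp
    have ne: "map snd Z \<noteq> []" "length (map snd Z) = length x" using run_length[OF tZ(2)] x(2) by auto
    have "path src tgt (fst (Y ! j)) (map snd Z) ?S" using pZ by (simp add: pmors_def)
    from sum_box_words[OF this] ne(2)
    have "(\<Sum>ns\<in>box (length x) L. mu (ZZ A) (map rl (ins src (fst (Y ! j)) (map snd Z) ns))) =
       (\<Sum>w\<in>words src tgt (fst (Y ! j)) (map snd Z) ?S L. mu (ZZ A) (map rl w))" for L
      by simp
    then show "\<forall>\<^sub>F L in sequentially. mu (Tw A) (map snd (snd y)) =
      (\<Sum>ns\<in>box (length x) L. mu (ZZ A) (map rl (ins src (fst (Y ! j)) (map snd (snd y)) ns)))"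
      using mu_Tw_words[OF pZ ne(1)] by (simp add: tZ(1))
  qed
  then show ?thesis
  proof eventually_elim
    case (elim L)
    have ins_ne: "ins src Y x ns \<noteq> []" for ns using x(2) by (cases x) auto
    have "mu (ZZ CT) x j i = (\<Sum>ns\<in>box (length x) L. mu (ZZ CZ) (map (\<lambda>l. kap (rD l)) (ins src Y x ns)) j i)" for j i
    proof (cases "j < length Y")
      case True
      show ?thesis
      proof (rule poly_mapping_eqI)
        fix g
        have "Poly_Mapping.lookup (mu (ZZ CT) x j i) g = ex (N2 K) eT x (j, 0)
            (\<lambda>t Z. if t = (i, g) then ksign (sx (map fst Z)) (mu (Tw A) (map snd Z)) else 0)"
          by (rule TA.lookup_mu_ZZ_skew[OF m K(1,3)])
        also have "\<dots> = ex (N2 K) eT x (j, 0) (\<lambda>t Z. \<Sum>ns\<in>box (length x) L. if t = (i, g) then ksign (sx (map fst Z))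
            (mu (ZZ A) (map rl (ins src (fst (Y ! j)) (map snd Z) ns))) else 0)"
        proof (rule ex_cong)
          fix t Z assume "run (N2 K) eT x (j, 0) t Z"
          then have tZ: "(t, Z) \<in> ?R j" by simp
          from elim True have "\<forall>y\<in>?R j. mu (Tw A) (map snd (snd y)) =
            (\<Sum>ns\<in>box (length x) L. mu (ZZ A) (map rl (ins src (fst (Y ! j)) (map snd (snd y)) ns)))" by blast
          from bspec[OF this tZ] have "mu (Tw A) (map snd Z) = (\<Sum>ns\<in>box (length x) L. mu (ZZ A) (map rl (ins src (fst (Y ! j)) (map snd Z) ns)))"
            by simp
          then show "(if t = (i, g) then ksign (sx (map fst Z)) (mu (Tw A) (map snd Z)) else 0) =
            (\<Sum>ns\<in>box (length x) L. if t = (i, g) then ksign (sx (map fst Z))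
            (mu (ZZ A) (map rl (ins src (fst (Y ! j)) (map snd Z) ns))) else 0)"
            by (simp add: ksign_sum)
        qed
        also have "\<dots> = (\<Sum>ns\<in>box (length x) L. Poly_Mapping.lookup (mu (ZZ CZ) (map (\<lambda>l. kap (rD l)) (ins src Y x ns)) j i) g)"
          unfolding ex_sum
          by (intro sum.cong refl lookup_mu_insert[OF x(1) Yo _ ins_ne K True, symmetric]) (simp add: box_def)
        finally show "Poly_Mapping.lookup (mu (ZZ CT) x j i) g =
          Poly_Mapping.lookup (\<Sum>ns\<in>box (length x) L. mu (ZZ CZ) (map (\<lambda>l. kap (rD l)) (ins src Y x ns)) j i) g"
          by (simp add: lookup_sum)
      qed
    next
      case False
      have "mu (ZZ CZ) (map (\<lambda>l. kap (rD l)) (ins src Y x ns)) j i = 0" if "ns \<in> box (length x) L" for ns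
      proof -
        note I = ins_words[OF p, of ns]
        have "pmors (ZZ CT) Y (map rD (ins src Y x ns)) S" by (rule pmors_rD) (use I x Yo that in \<open>auto simp: box_def\<close>)
        from pmors_kap[OF this] have P: "pmors (ZZ CZ) (map (apfst fst) Y) (map (\<lambda>l. kap (rD l)) (ins src Y x ns)) (map (apfst fst) S)"
          by (simp add: comp_def)
        show ?thesis by (rule CZ.mu_ZZ_outside[OF P]) (use False ins_ne in auto)
      qed
      then show ?thesis using CT.mu_ZZ_outside[OF x(1,2)] False by simp
    qed
    then have "mu (ZZ CT) x = (\<Sum>ns\<in>box (length x) L. mu (ZZ CZ) (map (\<lambda>l. kap (rD l)) (ins src Y x ns)))"
      by (simp add: fun_eq_iff sum_fun_eval)
    then show ?case by (simp add: sum_box_words[OF p, where L = L and \<Phi> = "\<lambda>v. mu (ZZ CZ) (map (\<lambda>l. kap (rD l)) v)"])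
  qed
qed

text \<open>The powers of D are diagonal, with the powers of the differentials of the summands on
  the diagonal: this is \<open>lookup_mu_insert\<close> for the empty string. So the sum vanishes by
  the Maurer--Cartan equation of each summand.\<close>

lemma sum_mu_dD:
  assumes Y: "Y \<in> Obj (ZZ CT)"
  shows "\<forall>\<^sub>F L in sequentially. (\<Sum>q\<in>{1..L}. mu (ZZ CZ) (replicate q (kap (dD Y)))) = 0"
proof -
  have o: "fst (Y ! j) \<in> Obj (Tw A)" if "j < length Y" for j using Y that by (auto simp: ZZ_sel(1) TA.skew_sel(1))
  have "\<forall>\<^sub>F L in sequentially. \<forall>j\<in>{..<length Y}. (\<Sum>d\<in>{1..L}. mu (ZZ A) (replicate d (tw_diff (fst (Y ! j))))) = 0"
    using Maurer_Cartan_sum o by (intro eventually_ball_finite) auto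
  then show ?thesis
  proof eventually_elim
    case (elim L)
    have "(\<Sum>q\<in>{1..L}. mu (ZZ CZ) (replicate q (kap (dD Y))) j i) = 0" for j i
    proof (cases "j < length Y")
      case True
      show ?thesis
      proof (rule poly_mapping_eqI)
        fix g
        have "Poly_Mapping.lookup (mu (ZZ CZ) (replicate q (kap (dD Y))) j i) g =
          (if (j, 0) = (i, g) then mu (ZZ A) (replicate q (tw_diff (fst (Y ! j)))) else 0)" if "q \<in> {1..L}" for q
          using lookup_mu_insert[of Y "[]" Y "[q]" "{0}" j i g] Y True that
          by (simp add: map_replicate)
        then have "(\<Sum>q\<in>{1..L}. Poly_Mapping.lookup (mu (ZZ CZ) (replicate q (kap (dD Y))) j i) g) =
          (\<Sum>q\<in>{1..L}. if (j, 0) = (i, g) then mu (ZZ A) (replicate q (tw_diff (fst (Y ! j)))) else 0)"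
          by (intro sum.cong) auto
        also have "\<dots> = 0"
        proof (cases "(j, 0) = (i, g)")
          case c: True
          from elim True have "(\<Sum>d\<in>{1..L}. mu (ZZ A) (replicate d (tw_diff (fst (Y ! j))))) = 0" by blast
          then show ?thesis using c by simp
        next
          case False
          then show ?thesis by (intro sum.neutral) auto
        qed
        finally show "Poly_Mapping.lookup (\<Sum>q\<in>{1..L}. mu (ZZ CZ) (replicate q (kap (dD Y))) j i) g = Poly_Mapping.lookup 0 g"
          by (simp add: lookup_sum)
      qed
    next
      case False
      have "mu (ZZ CZ) (replicate q (kap (dD Y))) j i = 0" if "q \<in> {1..L}" for q
      proof (rule CZ.mu_ZZ_outside)
        have "pmors (ZZ CT) Y (replicate q (dD Y)) Y" using mor_dD[OF Y] by (induction q) auto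
        from pmors_kap[OF this] show "pmors (ZZ CZ) (map (apfst fst) Y) (replicate q (kap (dD Y))) (map (apfst fst) Y)"
          by (simp add: map_replicate)
      qed (use False that in auto)
      then show ?thesis by simp
    qed
    then show ?case by (simp add: fun_eq_iff sum_fun_eval)
  qed
qed

end

section \<open>Splitting twisted complexes into their summands\<close>

text \<open>
  An object \<open>(T, p)\<close> of \<open>Y\<close> is split into the shifted summands of the twisted complex \<open>T\<close>, except
  when \<open>T\<close> has zero differential, in which case it is kept whole; the exception makes the functor
  below surjective on objects. An element \<open>(i, bs)\<close> of \<open>pos Y\<close> stands for the summands \<open>bs\<close> of the
  \<open>i\<close>-th object.
\<close>

definition pos :: "(('o, 'm::ab_group_add) twc \<times> int) list \<Rightarrow> (nat \<times> nat list) list"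
  where "pos Y = concat (map (\<lambda>i. if snd (fst (Y ! i)) = 0 then [(i, [0..<length (fst (fst (Y ! i)))])]
    else map (\<lambda>b. (i, [b])) [0..<length (fst (fst (Y ! i)))]) [0..<length Y])"

definition bobj :: "(('o, 'm::ab_group_add) twc \<times> int) list \<Rightarrow> (('o \<times> int) list \<times> int) list"
  where "bobj Y = map (\<lambda>(i, bs). (map (\<lambda>b. fst (fst (Y ! i)) ! b) bs, snd (Y ! i))) (pos Y)"

definition bmat :: "nat list \<Rightarrow> nat list \<Rightarrow> (nat \<Rightarrow> nat \<Rightarrow> 'm::zero) \<Rightarrow> nat \<Rightarrow> nat \<Rightarrow> 'm"
  where "bmat bs' bs M = (\<lambda>B' B. if B' < length bs' \<and> B < length bs then M (bs' ! B') (bs ! B) else 0)"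

definition bval :: "(('o, 'm::ab_group_add) twc \<times> int) list \<Rightarrow> (('o, 'm) twc \<times> int) list \<Rightarrow>
    (nat \<Rightarrow> nat \<Rightarrow> (int \<Rightarrow>\<^sub>0 (nat \<Rightarrow> nat \<Rightarrow> 'm))) \<Rightarrow> nat \<Rightarrow> nat \<Rightarrow> (int \<Rightarrow>\<^sub>0 (nat \<Rightarrow> nat \<Rightarrow> 'm))"
  where "bval Y' Y m = (\<lambda>J I. if J < length (pos Y') \<and> I < length (pos Y)
    then Poly_Mapping.map (bmat (snd (pos Y' ! J)) (snd (pos Y ! I))) (m (fst (pos Y' ! J)) (fst (pos Y ! I))) else 0)"

text \<open>Like \<open>kap\<close>, but with the matrix cut into the blocks given by
  \<open>pos\<close>. The entries over \<open>A\<close> are regrouped and not changed.\<close>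

definition bet :: "((('o, 'm::ab_group_add) twc \<times> int) list, nat \<Rightarrow> nat \<Rightarrow> (int \<Rightarrow>\<^sub>0 (nat \<Rightarrow> nat \<Rightarrow> 'm))) hmor \<Rightarrow>
    ((('o \<times> int) list \<times> int) list, nat \<Rightarrow> nat \<Rightarrow> (int \<Rightarrow>\<^sub>0 (nat \<Rightarrow> nat \<Rightarrow> 'm))) hmor"
  where "bet f = HMor (bobj (src f)) (bobj (tgt f)) (deg f) (bval (tgt f) (src f) (val f))"

lemma bet_sel [simp]: "src (bet f) = bobj (src f)" "tgt (bet f) = bobj (tgt f)" "deg (bet f) = deg f"
  "val (bet f) = bval (tgt f) (src f) (val f)"
  by (simp_all add: bet_def)

lemma bmat_zero: "bmat bs' bs 0 = 0"
  by (auto simp: bmat_def fun_eq_iff)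

lemma lookup_bval:
  "J < length (pos Y') \<Longrightarrow> I < length (pos Y) \<Longrightarrow> Poly_Mapping.lookup (bval Y' Y m J I) g =
    bmat (snd (pos Y' ! J)) (snd (pos Y ! I)) (Poly_Mapping.lookup (m (fst (pos Y' ! J)) (fst (pos Y ! I))) g)"
  unfolding bval_def by (simp add: lookup_map_0 bmat_zero)

lemma bval_outside: "\<not> (J < length (pos Y') \<and> I < length (pos Y)) \<Longrightarrow> bval Y' Y m J I = 0"
  unfolding bval_def by (rule if_not_P)

lemma bval_eqI:
  assumes "\<And>J I. \<not> (J < length (pos Y') \<and> I < length (pos Y)) \<Longrightarrow> h J I = 0"
    and "\<And>J I g. J < length (pos Y') \<Longrightarrow> I < length (pos Y) \<Longrightarrow> Poly_Mapping.lookup (h J I) g =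
      bmat (snd (pos Y' ! J)) (snd (pos Y ! I)) (Poly_Mapping.lookup (m (fst (pos Y' ! J)) (fst (pos Y ! I))) g)"
  shows "h = bval Y' Y m"
proof (intro ext)
  fix J I
  show "h J I = bval Y' Y m J I"
  proof (cases "J < length (pos Y') \<and> I < length (pos Y)")
    case True
    then show ?thesis using assms(2) by (intro poly_mapping_eqI) (simp add: lookup_bval)
  next
    case False
    then show ?thesis using assms(1) by (simp add: bval_outside)
  qed
qed

lemma bval_add: "bval Y' Y (m + m') = bval Y' Y m + bval Y' Y m'"
  by (rule bval_eqI[symmetric]) (auto simp: bval_outside lookup_add lookup_bval bmat_def fun_eq_iff)

lemma bval_zero: "bval Y' Y 0 = 0"
  by (rule bval_eqI[symmetric]) (auto simp: bmat_zero)

lemma bval_sum: "bval Y' Y (sum f S) = (\<Sum>s\<in>S. bval Y' Y (f s))"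
  by (induction S rule: infinite_finite_induct) (simp_all only: sum.infinite sum.empty sum.insert bval_zero bval_add simp_thms)

lemma pos_nth:
  assumes "I < length (pos Y)"
  shows "fst (pos Y ! I) < length Y"
    and "b \<in> set (snd (pos Y ! I)) \<Longrightarrow> b < length (fst (fst (Y ! fst (pos Y ! I))))"
    and "snd (fst (Y ! fst (pos Y ! I))) \<noteq> 0 \<Longrightarrow> \<exists>b. snd (pos Y ! I) = [b]"
proof -
  have "pos Y ! I \<in> set (pos Y)" using assms by simp
  then obtain i where i: "i < length Y" "pos Y ! I \<in> set (if snd (fst (Y ! i)) = 0 then [(i, [0..<length (fst (fst (Y ! i)))])]
    else map (\<lambda>b. (i, [b])) [0..<length (fst (fst (Y ! i)))])"
    unfolding pos_def by auto
  then show "fst (pos Y ! I) < length Y"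
    "b \<in> set (snd (pos Y ! I)) \<Longrightarrow> b < length (fst (fst (Y ! fst (pos Y ! I))))"
    "snd (fst (Y ! fst (pos Y ! I))) \<noteq> 0 \<Longrightarrow> \<exists>b. snd (pos Y ! I) = [b]"
    by (auto split: if_splits)
qed

lemma length_bobj [simp]: "length (bobj Y) = length (pos Y)"
  by (simp add: bobj_def)

lemma bobj_nth: "I < length (pos Y) \<Longrightarrow>
    bobj Y ! I = (map (\<lambda>b. fst (fst (Y ! fst (pos Y ! I))) ! b) (snd (pos Y ! I)), snd (Y ! fst (pos Y ! I)))"
  by (simp add: bobj_def case_prod_beta)

text \<open>\<open>pdom\<close> and \<open>cdom\<close> are two numberings of the same summands over
  \<open>A\<close>: by block and position in the block, and by object of \<open>Y\<close> and
  summand of that object. \<open>pmap\<close> translates the first into the second.\<close>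

definition pdom :: "(('o, 'm::ab_group_add) twc \<times> int) list \<Rightarrow> (nat \<times> nat) set"
  where "pdom Y = {(J, B). J < length (pos Y) \<and> B < length (snd (pos Y ! J))}"

definition cdom :: "(('o, 'm::ab_group_add) twc \<times> int) list \<Rightarrow> (nat \<times> nat) set"
  where "cdom Y = {(i, b). i < length Y \<and> b < length (fst (fst (Y ! i)))}"

definition pmap :: "(('o, 'm::ab_group_add) twc \<times> int) list \<Rightarrow> nat \<times> nat \<Rightarrow> nat \<times> nat"
  where "pmap Y = (\<lambda>(J, B). (fst (pos Y ! J), snd (pos Y ! J) ! B))"

lemma distinct_concat_disjoint:
  "distinct (concat ls) \<Longrightarrow> I < length ls \<Longrightarrow> J < length ls \<Longrightarrow> x \<in> set (ls ! I) \<Longrightarrow> x \<in> set (ls ! J) \<Longrightarrow> I = J"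
proof (induction ls arbitrary: I J)
  case (Cons l ls)
  have dis: "set l \<inter> (\<Union>y\<in>set ls. set y) = {}" and d: "distinct (concat ls)" using Cons.prems(1) by auto
  show ?case
  proof (cases I)
    case 0
    show ?thesis
    proof (cases J)
      case (Suc J')
      then have "ls ! J' \<in> set ls" "x \<in> set (ls ! J')" using Cons.prems by auto
      then show ?thesis using dis 0 Cons.prems(4) by auto
    qed (use 0 in simp)
  next
    case (Suc I')
    have I': "ls ! I' \<in> set ls" "x \<in> set (ls ! I')" "I' < length ls" using Suc Cons.prems by auto
    show ?thesis
    proof (cases J)
      case 0
      then have "x \<in> set l" using Cons.prems(5) by simp
      then show ?thesis using dis I'(1,2) by blast
    next
      case (Suc J')
      then show ?thesis using Cons.IH[OF d I'(3), of J'] I'(2) \<open>I = Suc I'\<close> Cons.prems by simp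
    qed
  qed
qed simp

lemma bij_betw_concat:
  assumes "distinct (concat ls)"
  shows "bij_betw (\<lambda>(I, B). ls ! I ! B) {(I, B). I < length ls \<and> B < length (ls ! I)} (set (concat ls))"
proof (rule bij_betw_imageI)
  have d: "distinct (ls ! I)" if "I < length ls" for I using assms that by (auto simp: distinct_concat_iff)
  show "inj_on (\<lambda>(I, B). ls ! I ! B) {(I, B). I < length ls \<and> B < length (ls ! I)}"
  proof (rule inj_onI)
    fix x y assume x: "x \<in> {(I, B). I < length ls \<and> B < length (ls ! I)}" and y: "y \<in> {(I, B). I < length ls \<and> B < length (ls ! I)}"
      and e: "(case x of (I, B) \<Rightarrow> ls ! I ! B) = (case y of (I, B) \<Rightarrow> ls ! I ! B)"
    obtain I B I' B' where xy: "x = (I, B)" "y = (I', B')" by (cases x, cases y)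
    have b: "I < length ls" "B < length (ls ! I)" "I' < length ls" "B' < length (ls ! I')" and eq: "ls ! I ! B = ls ! I' ! B'"
      using x y e xy by auto
    have "ls ! I ! B \<in> set (ls ! I)" by (rule nth_mem[OF b(2)])
    moreover have "ls ! I ! B \<in> set (ls ! I')" unfolding eq by (rule nth_mem[OF b(4)])
    ultimately have "I = I'" using distinct_concat_disjoint[OF assms b(1,3)] by blast
    then show "x = y" using d[OF b(1)] b eq xy by (simp add: nth_eq_iff_index_eq)
  qed
  show "(\<lambda>(I, B). ls ! I ! B) ` {(I, B). I < length ls \<and> B < length (ls ! I)} = set (concat ls)"
  proof (intro equalityI subsetI)
    fix z assume "z \<in> set (concat ls)"
    then obtain l where "l \<in> set ls" "z \<in> set l" by auto
    then obtain I B where "I < length ls" "l = ls ! I" "B < length l" "z = l ! B" by (metis in_set_conv_nth)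
    then show "z \<in> (\<lambda>(I, B). ls ! I ! B) ` {(I, B). I < length ls \<and> B < length (ls ! I)}"
      by (intro image_eqI[of _ _ "(I, B)"]) auto
  next
    fix z assume "z \<in> (\<lambda>(I, B). ls ! I ! B) ` {(I, B). I < length ls \<and> B < length (ls ! I)}"
    then obtain I B where IB: "z = ls ! I ! B" "I < length ls" "B < length (ls ! I)" by auto
    have "ls ! I \<in> set ls" "z \<in> set (ls ! I)" using IB by auto
    then show "z \<in> set (concat ls)" by (simp only: set_concat) (rule UN_I)
  qed
qed

text \<open>Whether an object is split or kept whole, its blocks concatenate to the full list of its
  summands. The flattened list of blocks therefore enumerates all summands without
  repetition.\<close>

lemma bij_pmap: "bij_betw (pmap Y) (pdom Y) (cdom Y)"
proof -
  let ?h = "\<lambda>(i, bs). map (Pair i) bs"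
  let ?ls = "map ?h (pos Y)"
  have block: "concat (map ?h (if snd (fst (Y ! i)) = 0 then [(i, [0..<length (fst (fst (Y ! i)))])]
    else map (\<lambda>b. (i, [b])) [0..<length (fst (fst (Y ! i)))])) = map (Pair i) [0..<length (fst (fst (Y ! i)))]" for i
  proof -
    have "concat (map ?h (map (\<lambda>b. (i, [b])) xs)) = map (Pair i) xs" for xs by (induction xs) auto
    from this[of "[0..<length (fst (fst (Y ! i)))]"] show ?thesis by (cases "snd (fst (Y ! i)) = 0") (simp_all only: simp_thms if_True if_False list.map concat.simps prod.case append_Nil2)
  qed
  have cc: "concat (map ?h (concat (map f xs))) = concat (map (\<lambda>i. concat (map ?h (f i))) xs)" for f and xs :: "nat list"
    by (induction xs) auto
  have flat: "concat ?ls = concat (map (\<lambda>i. map (Pair i) [0..<length (fst (fst (Y ! i)))]) [0..<length Y])"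
    unfolding pos_def cc block ..
  have "distinct (concat (map (\<lambda>i. map (Pair i) [0..<f i]) xs))" if "distinct xs" for xs and f :: "nat \<Rightarrow> nat"
    using that by (induction xs) (auto simp: distinct_map inj_on_def)
  then have "distinct (concat ?ls)" unfolding flat by simp
  from bij_betw_concat[OF this]
  have "bij_betw (\<lambda>(I, B). ?ls ! I ! B) {(I, B). I < length ?ls \<and> B < length (?ls ! I)} (set (concat ?ls))" .
  moreover have "set (concat ?ls) = cdom Y" unfolding flat by (auto simp: cdom_def)
  moreover have "{(I, B). I < length ?ls \<and> B < length (?ls ! I)} = pdom Y"
    by (auto simp: pdom_def case_prod_beta)
  moreover have "(case x of (I, B) \<Rightarrow> ?ls ! I ! B) = pmap Y x" if "x \<in> pdom Y" for x
    using that by (auto simp: pdom_def pmap_def case_prod_beta)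
  ultimately show ?thesis using bij_betw_cong[of "pdom Y" "\<lambda>(I, B). ?ls ! I ! B" "pmap Y" "cdom Y"] by (simp only:)
qed

text \<open>\<open>pmap\<close> on the states of the fully expanded automaton, with the group
  element carried along.\<close>

definition psi :: "(('o, 'm::ab_group_add) twc \<times> int) list \<Rightarrow> (nat \<times> int) \<times> nat \<Rightarrow> (nat \<times> int) \<times> nat"
  where "psi Y = (\<lambda>((J, h), B). ((fst (pos Y ! J), h), snd (pos Y ! J) ! B))"

definition vstate :: "(('o, 'm::ab_group_add) twc \<times> int) list \<Rightarrow> (nat \<times> int) \<times> nat \<Rightarrow> bool"
  where "vstate Y = (\<lambda>((J, h), B). (J, B) \<in> pdom Y)"

lemma psi_inj: "vstate Y s \<Longrightarrow> vstate Y t \<Longrightarrow> psi Y s = psi Y t \<Longrightarrow> s = t"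
proof -
  assume v: "vstate Y s" "vstate Y t" and e: "psi Y s = psi Y t"
  obtain J h B I k C where st: "s = ((J, h), B)" "t = ((I, k), C)" by (metis surj_pair)
  have "(J, B) = (I, C)"
    by (rule inj_onD[OF bij_betw_imp_inj_on[OF bij_pmap[of Y]]]) (use v e in \<open>simp_all add: st psi_def vstate_def pmap_def\<close>)
  then show "s = t" using e by (simp add: st psi_def)
qed

text \<open>The third coordinate of a state is the summand inside the current object of \<int>A, so
  that runs with \<open>N3\<close> and \<open>e3\<close> expand compositions over \<int>A * \<int>
  down to \<open>A\<close>.\<close>

definition N3 :: "int set \<Rightarrow> ((('o \<times> int) list \<times> int) list, nat \<Rightarrow> nat \<Rightarrow> (int \<Rightarrow>\<^sub>0 (nat \<Rightarrow> nat \<Rightarrow> 'm::ab_group_add))) hmor \<Rightarrow>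
    (nat \<times> int) \<times> nat \<Rightarrow> ((nat \<times> int) \<times> nat) set"
  where "N3 K f s = Sigma (N2 K f (fst s)) (\<lambda>t. Nz (snd (eZ f (fst s) t)) (snd s))"

definition e3 :: "((('o \<times> int) list \<times> int) list, nat \<Rightarrow> nat \<Rightarrow> (int \<Rightarrow>\<^sub>0 (nat \<Rightarrow> nat \<Rightarrow> 'm::ab_group_add))) hmor \<Rightarrow>
    (nat \<times> int) \<times> nat \<Rightarrow> (nat \<times> int) \<times> nat \<Rightarrow> (int \<times> int) \<times> int \<times> ('o, 'm) hmor"
  where "e3 f s t = (fst (eZ f (fst s) (fst t)), ez (snd (eZ f (fst s) (fst t))) (snd s) (snd t))"

lemma eZ_lengths:
  "length (src (snd (eZ f s t))) = length (fst (src f ! fst t))"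
  "length (tgt (snd (eZ f s t))) = length (fst (tgt f ! fst s))"
  by (simp_all add: e2_def component_def)

lemma N3_iff: "((k, h'), c) \<in> N3 K f ((j, h), b) \<longleftrightarrow> j < length (tgt f) \<and> k < length (src f) \<and> h' \<in> (+) h ` K \<and>
    b < length (fst (tgt f ! j)) \<and> c < length (fst (src f ! k))"
  by (auto simp: N3_def N2_def Nz_def eZ_lengths split: if_splits)

text \<open>Every part of a split object keeps the outer shift of the object, so the emitted letters
  and both sign contributions are the same before and after splitting.\<close>

lemma e3_bet:
  assumes "vstate (tgt f) s" "vstate (src f) t"
  shows "e3 (bet f) s t = e3 (kap f) (psi (tgt f) s) (psi (src f) t)"
proof -
  obtain J h B where s: "s = ((J, h), B)" by (metis surj_pair)
  obtain I h' C where t: "t = ((I, h'), C)" by (metis surj_pair)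
  have J: "J < length (pos (tgt f))" "B < length (snd (pos (tgt f) ! J))" using assms(1) by (auto simp: s vstate_def pdom_def)
  have I: "I < length (pos (src f))" "C < length (snd (pos (src f) ! I))" using assms(2) by (auto simp: t vstate_def pdom_def)
  note pJ = pos_nth(1)[OF J(1)] pos_nth(2)[OF J(1) nth_mem[OF J(2)]]
  note pI = pos_nth(1)[OF I(1)] pos_nth(2)[OF I(1) nth_mem[OF I(2)]]
  show ?thesis
    using J I pJ pI
    by (simp add: s t psi_def e3_def e2_def ez_def component_def entry_def bobj_nth shift_ZZ_nth shift_ZZ_sel(2)
        lookup_bval bmat_def)
qed

lemma bij_psi_N3:
  assumes "vstate (tgt f) s"
  shows "bij_betw (psi (src f)) (N3 K (bet f) s) (N3 K (kap f) (psi (tgt f) s))"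
    and "t \<in> N3 K (bet f) s \<Longrightarrow> vstate (src f) t"
proof -
  obtain J h B where s: "s = ((J, h), B)" by (metis surj_pair)
  have J: "J < length (pos (tgt f))" "B < length (snd (pos (tgt f) ! J))" using assms by (auto simp: s vstate_def pdom_def)
  note pJ = pos_nth(1)[OF J(1)] pos_nth(2)[OF J(1) nth_mem[OF J(2)]]
  have N: "N3 K (bet f) s = {((I, h'), C). (I, C) \<in> pdom (src f) \<and> h' \<in> (+) h ` K}"
    using J by (auto simp: s N3_iff pdom_def bobj_nth)
  have N': "N3 K (kap f) (psi (tgt f) s) = {((i, h'), c). (i, c) \<in> cdom (src f) \<and> h' \<in> (+) h ` K}"
    using pJ by (auto simp: s psi_def N3_iff cdom_def)
  show v: "t \<in> N3 K (bet f) s \<Longrightarrow> vstate (src f) t" for t by (auto simp: N vstate_def)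
  show "bij_betw (psi (src f)) (N3 K (bet f) s) (N3 K (kap f) (psi (tgt f) s))"
  proof (rule bij_betw_imageI)
    show "inj_on (psi (src f)) (N3 K (bet f) s)" using v psi_inj by (intro inj_onI) blast
    show "psi (src f) ` N3 K (bet f) s = N3 K (kap f) (psi (tgt f) s)"
    proof (intro equalityI subsetI)
      fix y assume "y \<in> psi (src f) ` N3 K (bet f) s"
      then obtain I h' C where y: "y = psi (src f) ((I, h'), C)" "(I, C) \<in> pdom (src f)" "h' \<in> (+) h ` K" by (auto simp: N)
      have "pmap (src f) (I, C) \<in> cdom (src f)" using bij_betw_apply[OF bij_pmap y(2)] .
      then show "y \<in> N3 K (kap f) (psi (tgt f) s)" unfolding N' using y(1,3) by (auto simp: psi_def pmap_def)
    next
      fix y assume "y \<in> N3 K (kap f) (psi (tgt f) s)"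
      then obtain i h' c where y: "y = ((i, h'), c)" "(i, c) \<in> cdom (src f)" "h' \<in> (+) h ` K" by (auto simp: N')
      obtain x where x: "x \<in> pdom (src f)" "pmap (src f) x = (i, c)"
        using bij_betw_imp_surj_on[OF bij_pmap[of "src f"]] y(2) by (metis imageE)
      obtain I C where IC: "x = (I, C)" by (cases x)
      have "y = psi (src f) ((I, h'), C)" using x(2) IC y(1) by (simp add: psi_def pmap_def)
      moreover have "((I, h'), C) \<in> N3 K (bet f) s" using x(1) IC y(3) by (auto simp: N)
      ultimately show "y \<in> psi (src f) ` N3 K (bet f) s" by (rule image_eqI)
    qed
  qed
qed

lemma run_bet_valid:
  "path src tgt T fs S \<Longrightarrow> vstate T s \<Longrightarrow> run (N3 K) e3 (map bet fs) s t Z \<Longrightarrow> vstate S t"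
proof (induction fs arbitrary: T s Z)
  case (Cons f fs)
  then obtain u Z' where u: "u \<in> N3 K (bet f) s" "run (N3 K) e3 (map bet fs) u t Z'" by auto
  have "vstate (src f) u" using bij_psi_N3(2)[OF _ u(1)] Cons.prems by simp
  then show ?case using Cons.IH[OF _ _ u(2), of "src f"] Cons.prems(1) by simp
qed simp

section \<open>Compatibility of splitting with compositions\<close>

context ainf_category
begin

interpretation ZA: strict_action "ZZ A" shift_ZZ by (rule strict_action_shift_ZZ)
interpretation TA: strict_action "Tw A" shift_Tw by (rule strict_action_shift_Tw)
interpretation CZ: ainf_category CZ by (rule ZA.ainf_category_skew)
interpretation CT: ainf_category CT by (rule TA.ainf_category_skew)
interpretation ZCZ: ainf_category "ZZ CZ" by (rule CZ.ainf_category_ZZ)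
interpretation ZCT: ainf_category "ZZ CT" by (rule CT.ainf_category_ZZ)

text \<open>A second use of \<open>ex_ex\<close>: the compositions in \<int>A that occur in
  \<open>lookup_mu_ZZ_skew\<close> are expanded as well, which adds the exponent \<open>sexp\<close>
  of the inner shifts.\<close>

lemma lookup_mu_flat:
  assumes m: "mors (ZZ CZ) fs" and K: "finite K" "\<And>f j i. f \<in> set fs \<Longrightarrow> Poly_Mapping.keys (val f j i) \<subseteq> K"
  shows "Poly_Mapping.lookup (mu (ZZ CZ) fs j i) g b' b = ex (N3 K) e3 fs ((j, 0), b')
    (\<lambda>t Z. if t = ((i, g), b) then ksign (sx (map fst Z) + sexp (map snd Z)) (mu A (map snd (map snd Z))) else 0)"
proof -
  define \<Psi> where "\<Psi> t Z = (if t = ((i, g), b) then ksign (sx (map fst Z) + sexp (map snd Z)) (mu A (map snd (map snd Z))) else 0)"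
    for t :: "(nat \<times> int) \<times> nat" and Z :: "((int \<times> int) \<times> int \<times> ('o, 'm) hmor) list"
  define q where "q = (\<lambda>(x :: (int \<times> int) \<times> (('o \<times> int) list, nat \<Rightarrow> nat \<Rightarrow> 'm) hmor, y :: int \<times> ('o, 'm) hmor). (fst x, y))"
  let ?N = "\<lambda>f (s, c). Sigma (N2 K f s) (\<lambda>t. Nz (snd (eZ f s t)) c)"
  let ?e = "\<lambda>f (s, c) (t, c'). (eZ f s t, ez (snd (eZ f s t)) c c')"
  have "Poly_Mapping.lookup (mu (ZZ CZ) fs j i) g b' b = ex (N2 K) eZ fs (j, 0)
    (\<lambda>t Z. if t = (i, g) then ksign (sx (map fst Z)) (mu (ZZ A) (map snd Z)) else 0) b' b"
    using ZA.lookup_mu_ZZ_skew[OF m K, of j i g] by simp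
  also have "\<dots> = ex (N2 K) eZ fs (j, 0)
    (\<lambda>t Z. (if t = (i, g) then ksign (sx (map fst Z)) (mu (ZZ A) (map snd Z)) else 0) b' b)"
    by (rule ex_additive[where h = "\<lambda>M. M b' b"]) auto
  also have "\<dots> = ex (N2 K) eZ fs (j, 0) (\<lambda>t Z. ex (\<lambda>e. Nz (snd e)) (\<lambda>e. ez (snd e)) Z b' (\<lambda>c E. \<Psi> (t, c) (map q (zip Z E))))"
  proof (rule ex_cong)
    fix t Z
    have "(if t = (i, g) then ksign (sx (map fst Z)) (mu (ZZ A) (map snd Z)) else 0) b' b =
      (if t = (i, g) then ksign (sx (map fst Z)) (ex (\<lambda>e. Nz (snd e)) (\<lambda>e. ez (snd e)) Z b' (smu A b)) else 0)"
      by (simp add: ksign_apply mu_ZZ ex_map)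
    also have "\<dots> = ex (\<lambda>e. Nz (snd e)) (\<lambda>e. ez (snd e)) Z b' (\<lambda>c E. if t = (i, g) then ksign (sx (map fst Z)) (smu A b c E) else 0)"
      by (simp add: ex_ksign)
    also have "\<dots> = ex (\<lambda>e. Nz (snd e)) (\<lambda>e. ez (snd e)) Z b' (\<lambda>c E. \<Psi> (t, c) (map q (zip Z E)))"
    proof (rule ex_cong)
      fix c E assume r: "run (\<lambda>e. Nz (snd e)) (\<lambda>e. ez (snd e)) Z b' c E"
      have "length Z = length E" using run_length[OF r] by simp
      then have "map fst (map q (zip Z E)) = map fst Z" "map snd (map q (zip Z E)) = E"
        by (induction Z E rule: list_induct2) (auto simp: q_def)
      then show "(if t = (i, g) then ksign (sx (map fst Z)) (smu A b c E) else 0) = \<Psi> (t, c) (map q (zip Z E))"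
        by (simp only: \<Psi>_def) (auto simp: smu_def ksign_ksign)
    qed
    finally show "(if t = (i, g) then ksign (sx (map fst Z)) (mu (ZZ A) (map snd Z)) else 0) b' b =
      ex (\<lambda>e. Nz (snd e)) (\<lambda>e. ez (snd e)) Z b' (\<lambda>c E. \<Psi> (t, c) (map q (zip Z E)))" .
  qed
  also have "\<dots> = ex ?N ?e fs ((j, 0), b') (\<lambda>t Z. \<Psi> t (map q Z))"
    by (rule ex_ex) (simp_all add: finite_N2 K)
  also have "\<dots> = ex ?N (\<lambda>f s t. q (?e f s t)) fs ((j, 0), b') \<Psi>"
    by (rule ex_proj)
  also have "?N = N3 K" by (auto simp: N3_def fun_eq_iff)
  also have "(\<lambda>f s t. q (?e f s t)) = e3" by (auto simp: fun_eq_iff e3_def q_def)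
  finally show ?thesis unfolding \<Psi>_def .
qed

lemma Obj_bobj:
  assumes "Y \<in> Obj (ZZ CT)"
  shows "bobj Y \<in> Obj (ZZ CZ)"
proof -
  have "fst (bobj Y ! I) \<in> Obj (ZZ A)" if I: "I < length (pos Y)" for I
  proof -
    have "fst (Y ! fst (pos Y ! I)) \<in> Obj (Tw A)"
      using assms pos_nth(1)[OF I] by (simp add: ZZ_sel(1) TA.skew_sel(1))
    then have "fst (fst (Y ! fst (pos Y ! I))) \<in> Obj (ZZ A)" by (rule Tw_obj_ZZ)
    then have o: "\<forall>b<length (fst (fst (Y ! fst (pos Y ! I)))). fst (fst (fst (Y ! fst (pos Y ! I))) ! b) \<in> Obj A"
      by (simp add: ZZ_sel(1))
    show ?thesis unfolding bobj_nth[OF I] fst_conv ZZ_sel(1) using o pos_nth(2)[OF I] by auto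
  qed
  then have "\<forall>x\<in>set (bobj Y). fst x \<in> Obj (ZZ A)" unfolding all_set_conv_all_nth length_bobj by blast
  then show ?thesis unfolding ZZ_sel(1)[of CZ] ZA.skew_sel(1) by simp
qed

lemma Hom_ZZ_CT_iff:
  "m \<in> Hom (ZZ CT) Y Y' p \<longleftrightarrow> (\<forall>j i. if j < length Y' \<and> i < length Y then
    (\<forall>g b' b. if b' < length (fst (fst (Y' ! j))) \<and> b < length (fst (fst (Y ! i)))
      then Poly_Mapping.lookup (m j i) g b' b \<in> Hom A (fst (fst (fst (Y ! i)) ! b)) (fst (fst (fst (Y' ! j)) ! b'))
        (p - snd (Y ! i) + snd (Y' ! j) - (snd (fst (fst (Y ! i)) ! b) + g) + snd (fst (fst (Y' ! j)) ! b'))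
      else Poly_Mapping.lookup (m j i) g b' b = 0) else m j i = 0)"
proof -
  have "Poly_Mapping.lookup (m j i) g \<in> Hom (Tw A) (fobj (shift_Tw g) (fst (Y ! i))) (fst (Y' ! j)) q \<longleftrightarrow>
    (\<forall>b' b. if b' < length (fst (fst (Y' ! j))) \<and> b < length (fst (fst (Y ! i)))
      then Poly_Mapping.lookup (m j i) g b' b \<in> Hom A (fst (fst (fst (Y ! i)) ! b)) (fst (fst (fst (Y' ! j)) ! b'))
        (q - (snd (fst (fst (Y ! i)) ! b) + g) + snd (fst (fst (Y' ! j)) ! b'))
      else Poly_Mapping.lookup (m j i) g b' b = 0)" for j i g q
    by (simp add: Tw_sel(2) ZZ_sel(2) fst_shift_Tw shift_ZZ_nth cong: if_cong)
  then show ?thesis by (simp add: ZZ_sel(2)[of _ CT] TA.skew_sel(2) cong: if_cong)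
qed

lemma Hom_ZZ_CZ_iff:
  "m \<in> Hom (ZZ CZ) Y Y' p \<longleftrightarrow> (\<forall>j i. if j < length Y' \<and> i < length Y then
    (\<forall>g b' b. if b' < length (fst (Y' ! j)) \<and> b < length (fst (Y ! i))
      then Poly_Mapping.lookup (m j i) g b' b \<in> Hom A (fst (fst (Y ! i) ! b)) (fst (fst (Y' ! j) ! b'))
        (p - snd (Y ! i) + snd (Y' ! j) - (snd (fst (Y ! i) ! b) + g) + snd (fst (Y' ! j) ! b'))
      else Poly_Mapping.lookup (m j i) g b' b = 0) else m j i = 0)"
proof -
  have "Poly_Mapping.lookup (m j i) g \<in> Hom (ZZ A) (fobj (shift_ZZ g :: (('o \<times> int) list, nat \<Rightarrow> nat \<Rightarrow> 'm, ('o \<times> int) list, nat \<Rightarrow> nat \<Rightarrow> 'm) func) (fst (Y ! i))) (fst (Y' ! j)) q \<longleftrightarrow>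
    (\<forall>b' b. if b' < length (fst (Y' ! j)) \<and> b < length (fst (Y ! i))
      then Poly_Mapping.lookup (m j i) g b' b \<in> Hom A (fst (fst (Y ! i) ! b)) (fst (fst (Y' ! j) ! b'))
        (q - (snd (fst (Y ! i) ! b) + g) + snd (fst (Y' ! j) ! b'))
      else Poly_Mapping.lookup (m j i) g b' b = 0)" for j i g q
    by (simp add: ZZ_sel(2) shift_ZZ_nth cong: if_cong)
  then show ?thesis by (simp add: ZZ_sel(2)[of _ CZ] ZA.skew_sel(2) cong: if_cong)
qed

lemma bval_Hom:
  assumes m: "m \<in> Hom (ZZ CT) Y Y' p"
  shows "bval Y' Y m \<in> Hom (ZZ CZ) (bobj Y) (bobj Y') p"
  unfolding Hom_ZZ_CZ_iff
proof (intro allI)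
  fix J I
  show "if J < length (bobj Y') \<and> I < length (bobj Y) then
    (\<forall>g b' b. if b' < length (fst (bobj Y' ! J)) \<and> b < length (fst (bobj Y ! I))
      then Poly_Mapping.lookup (bval Y' Y m J I) g b' b \<in> Hom A (fst (fst (bobj Y ! I) ! b)) (fst (fst (bobj Y' ! J) ! b'))
        (p - snd (bobj Y ! I) + snd (bobj Y' ! J) - (snd (fst (bobj Y ! I) ! b) + g) + snd (fst (bobj Y' ! J) ! b'))
      else Poly_Mapping.lookup (bval Y' Y m J I) g b' b = 0) else bval Y' Y m J I = 0"
  proof (cases "J < length (bobj Y') \<and> I < length (bobj Y)")
    case True
    then have JI: "J < length (pos Y')" "I < length (pos Y)" by auto
    let ?j = "fst (pos Y' ! J)" and ?i = "fst (pos Y ! I)"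
    have ji: "?j < length Y'" "?i < length Y" using pos_nth(1) JI by auto
    have "if b' < length (fst (bobj Y' ! J)) \<and> b < length (fst (bobj Y ! I))
      then Poly_Mapping.lookup (bval Y' Y m J I) g b' b \<in> Hom A (fst (fst (bobj Y ! I) ! b)) (fst (fst (bobj Y' ! J) ! b'))
        (p - snd (bobj Y ! I) + snd (bobj Y' ! J) - (snd (fst (bobj Y ! I) ! b) + g) + snd (fst (bobj Y' ! J) ! b'))
      else Poly_Mapping.lookup (bval Y' Y m J I) g b' b = 0" for g b' b
    proof (cases "b' < length (snd (pos Y' ! J)) \<and> b < length (snd (pos Y ! I))")
      case b: True
      let ?c' = "snd (pos Y' ! J) ! b'" and ?c = "snd (pos Y ! I) ! b"
      have c: "?c' < length (fst (fst (Y' ! ?j)))" "?c < length (fst (fst (Y ! ?i)))"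
        using pos_nth(2)[OF JI(1)] pos_nth(2)[OF JI(2)] b by auto
      have "Poly_Mapping.lookup (m ?j ?i) g ?c' ?c \<in> Hom A (fst (fst (fst (Y ! ?i)) ! ?c)) (fst (fst (fst (Y' ! ?j)) ! ?c'))
        (p - snd (Y ! ?i) + snd (Y' ! ?j) - (snd (fst (fst (Y ! ?i)) ! ?c) + g) + snd (fst (fst (Y' ! ?j)) ! ?c'))"
        using m[unfolded Hom_ZZ_CT_iff, rule_format, of ?j ?i] ji c by auto
      then show ?thesis using b by (simp add: bobj_nth JI lookup_bval bmat_def)
    next
      case False
      then show ?thesis by (auto simp: bobj_nth JI lookup_bval bmat_def)
    qed
    then show ?thesis using True by simp
  next
    case False
    then show ?thesis by (auto simp: bval_outside)
  qed
qed

lemma mor_bet: "mor (ZZ CT) f \<Longrightarrow> mor (ZZ CZ) (bet f)"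
  using Obj_bobj[of "src f"] Obj_bobj[of "tgt f"] bval_Hom[of "val f" "src f" "tgt f" "deg f"]
  unfolding mor_def bet_sel by blast

lemma pmors_bet: "pmors (ZZ CT) T fs S \<Longrightarrow> pmors (ZZ CZ) (bobj T) (map bet fs) (bobj S)"
  by (induction fs arbitrary: T) (auto simp: mor_bet)

text \<open>Each pair of summands over \<open>A\<close> lies in exactly one pair of blocks by
  \<open>bij_pmap\<close>, so a matrix can be recovered from its blocks entry by entry.\<close>

lemma bval_bij:
  "bij_betw (bval Y' Y) (Hom (ZZ CT) Y Y' p) (Hom (ZZ CZ) (bobj Y) (bobj Y') p)"
proof (rule bij_betw_imageI)
  define iv where "iv Y x = inv_into (pdom Y) (pmap Y) x" for Y :: "(('o, 'm) twc \<times> int) list" and x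
  have iv: "iv Y x \<in> pdom Y" "pmap Y (iv Y x) = x" if "x \<in> cdom Y" for Y x
    using bij_betw_imp_surj_on[OF bij_pmap[of Y]] that unfolding iv_def by (auto intro: inv_into_into f_inv_into_f)
  have iv2: "iv Y (pmap Y x) = x" if "x \<in> pdom Y" for Y x
    using bij_betw_imp_inj_on[OF bij_pmap[of Y]] that unfolding iv_def by (rule inv_into_f_f)
  have entry: "Poly_Mapping.lookup (m j i) g b' b =
      Poly_Mapping.lookup (bval Y' Y m (fst (iv Y' (j, b'))) (fst (iv Y (i, b)))) g (snd (iv Y' (j, b'))) (snd (iv Y (i, b)))"
    if "(j, b') \<in> cdom Y'" "(i, b) \<in> cdom Y" for m j i g b' b
  proof -
    obtain J B' I B where e: "iv Y' (j, b') = (J, B')" "iv Y (i, b) = (I, B)" by fastforce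
    have p: "(J, B') \<in> pdom Y'" "(I, B) \<in> pdom Y" "pmap Y' (J, B') = (j, b')" "pmap Y (I, B) = (i, b)"
      using iv[OF that(1)] iv[OF that(2)] e by auto
    then show ?thesis unfolding e fst_conv snd_conv by (simp add: pdom_def lookup_bval bmat_def pmap_def)
  qed
  show "inj_on (bval Y' Y) (Hom (ZZ CT) Y Y' p)"
  proof (rule inj_onI)
    fix m m' assume m: "m \<in> Hom (ZZ CT) Y Y' p" "m' \<in> Hom (ZZ CT) Y Y' p" and eq: "bval Y' Y m = bval Y' Y m'"
    show "m = m'"
    proof (intro ext)
      fix j i
      show "m j i = m' j i"
      proof (cases "j < length Y' \<and> i < length Y")
        case True
        show ?thesis
        proof (rule poly_mapping_eqI, intro ext)
          fix g b' b
          show "Poly_Mapping.lookup (m j i) g b' b = Poly_Mapping.lookup (m' j i) g b' b"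
          proof (cases "b' < length (fst (fst (Y' ! j))) \<and> b < length (fst (fst (Y ! i)))")
            case b: True
            then have c: "(j, b') \<in> cdom Y'" "(i, b) \<in> cdom Y" using True by (auto simp: cdom_def)
            show ?thesis unfolding entry[OF c, of m] entry[OF c, of m'] eq ..
          next
            case False
            have "Poly_Mapping.lookup (n j i) g b' b = 0" if "n \<in> Hom (ZZ CT) Y Y' p" for n
              using that[unfolded Hom_ZZ_CT_iff, rule_format, of j i] True False by auto
            then show ?thesis using m by simp
          qed
        qed
      next
        case False
        have "n j i = 0" if "n \<in> Hom (ZZ CT) Y Y' p" for n
          using that[unfolded Hom_ZZ_CT_iff, rule_format, of j i] False by auto
        from this[OF m(1)] this[OF m(2)] show ?thesis by (simp only:)
      qed
    qed
  qed
  show "bval Y' Y ` Hom (ZZ CT) Y Y' p = Hom (ZZ CZ) (bobj Y) (bobj Y') p"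
  proof (intro equalityI subsetI)
    fix h assume h: "h \<in> Hom (ZZ CZ) (bobj Y) (bobj Y') p"
    define r where "r j i = (\<lambda>g b' b. if (j, b') \<in> cdom Y' \<and> (i, b) \<in> cdom Y
      then Poly_Mapping.lookup (h (fst (iv Y' (j, b'))) (fst (iv Y (i, b)))) g (snd (iv Y' (j, b'))) (snd (iv Y (i, b))) else 0)" for j i
    \<comment> \<open>The reassembled entry must have finite support in the group element; its
      support is contained in the union of the supports of the finitely many blocks.\<close>
    have fin: "finite {g. r j i g \<noteq> 0}" for j i
    proof (rule finite_subset)
      show "{g. r j i g \<noteq> 0} \<subseteq> (\<Union>J<length (pos Y'). \<Union>I<length (pos Y). Poly_Mapping.keys (h J I))"
      proof
        fix g assume "g \<in> {g. r j i g \<noteq> 0}"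
        then obtain b' b where "r j i g b' b \<noteq> 0" by (auto simp: fun_eq_iff)
        then have c: "(j, b') \<in> cdom Y'" "(i, b) \<in> cdom Y"
          and n: "Poly_Mapping.lookup (h (fst (iv Y' (j, b'))) (fst (iv Y (i, b)))) g (snd (iv Y' (j, b'))) (snd (iv Y (i, b))) \<noteq> 0"
          by (auto simp: r_def split: if_splits)
        have "fst (iv Y' (j, b')) < length (pos Y')" "fst (iv Y (i, b)) < length (pos Y)"
          using iv(1)[OF c(1)] iv(1)[OF c(2)] by (auto simp: pdom_def)
        moreover have "g \<in> Poly_Mapping.keys (h (fst (iv Y' (j, b'))) (fst (iv Y (i, b))))"
        proof (rule ccontr)
          assume "g \<notin> Poly_Mapping.keys (h (fst (iv Y' (j, b'))) (fst (iv Y (i, b))))"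
          then have "Poly_Mapping.lookup (h (fst (iv Y' (j, b'))) (fst (iv Y (i, b)))) g = 0" by (simp add: in_keys_iff)
          then show False using n by simp
        qed
        ultimately show "g \<in> (\<Union>J<length (pos Y'). \<Union>I<length (pos Y). Poly_Mapping.keys (h J I))" by blast
      qed
    qed auto
    define m where "m j i = Abs_poly_mapping (r j i)" for j i
    have lm: "Poly_Mapping.lookup (m j i) = r j i" for j i
      unfolding m_def using fin by (intro lookup_Abs_poly_mapping)
    have "h = bval Y' Y m"
    proof (rule bval_eqI)
      show "h J I = 0" if "\<not> (J < length (pos Y') \<and> I < length (pos Y))" for J I
        using h[unfolded Hom_ZZ_CZ_iff, rule_format, of J I] that by auto
      fix J I g assume JI: "J < length (pos Y')" "I < length (pos Y)"
      show "Poly_Mapping.lookup (h J I) g = bmat (snd (pos Y' ! J)) (snd (pos Y ! I)) (Poly_Mapping.lookup (m (fst (pos Y' ! J)) (fst (pos Y ! I))) g)"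
      proof (intro ext)
        fix B' B
        show "Poly_Mapping.lookup (h J I) g B' B = bmat (snd (pos Y' ! J)) (snd (pos Y ! I)) (Poly_Mapping.lookup (m (fst (pos Y' ! J)) (fst (pos Y ! I))) g) B' B"
        proof (cases "B' < length (snd (pos Y' ! J)) \<and> B < length (snd (pos Y ! I))")
          case True
          then have p: "(J, B') \<in> pdom Y'" "(I, B) \<in> pdom Y" using JI by (auto simp: pdom_def)
          have c: "pmap Y' (J, B') \<in> cdom Y'" "pmap Y (I, B) \<in> cdom Y" using p bij_betw_apply[OF bij_pmap] by auto
          have "r (fst (pos Y' ! J)) (fst (pos Y ! I)) g (snd (pos Y' ! J) ! B') (snd (pos Y ! I) ! B) = Poly_Mapping.lookup (h J I) g B' B"
            using c iv2[OF p(1)] iv2[OF p(2)] by (simp add: r_def pmap_def)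
          then show ?thesis using True by (simp add: bmat_def lm)
        next
          case False
          then have "Poly_Mapping.lookup (h J I) g B' B = 0"
            using h[unfolded Hom_ZZ_CZ_iff, rule_format, of J I] JI by (auto simp: bobj_nth)
          then show ?thesis using False by (auto simp: bmat_def)
        qed
      qed
    qed
    moreover have "m \<in> Hom (ZZ CT) Y Y' p"
      unfolding Hom_ZZ_CT_iff
    proof (intro allI)
      fix j i
      show "if j < length Y' \<and> i < length Y then
        (\<forall>g b' b. if b' < length (fst (fst (Y' ! j))) \<and> b < length (fst (fst (Y ! i)))
          then Poly_Mapping.lookup (m j i) g b' b \<in> Hom A (fst (fst (fst (Y ! i)) ! b)) (fst (fst (fst (Y' ! j)) ! b'))
            (p - snd (Y ! i) + snd (Y' ! j) - (snd (fst (fst (Y ! i)) ! b) + g) + snd (fst (fst (Y' ! j)) ! b'))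
          else Poly_Mapping.lookup (m j i) g b' b = 0) else m j i = 0"
      proof (cases "j < length Y' \<and> i < length Y")
        case True
        have "if b' < length (fst (fst (Y' ! j))) \<and> b < length (fst (fst (Y ! i)))
          then Poly_Mapping.lookup (m j i) g b' b \<in> Hom A (fst (fst (fst (Y ! i)) ! b)) (fst (fst (fst (Y' ! j)) ! b'))
            (p - snd (Y ! i) + snd (Y' ! j) - (snd (fst (fst (Y ! i)) ! b) + g) + snd (fst (fst (Y' ! j)) ! b'))
          else Poly_Mapping.lookup (m j i) g b' b = 0" for g b' b
        proof (cases "b' < length (fst (fst (Y' ! j))) \<and> b < length (fst (fst (Y ! i)))")
          case b: True
          then have c: "(j, b') \<in> cdom Y'" "(i, b) \<in> cdom Y" using True by (auto simp: cdom_def)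
          obtain J B' I B where e: "iv Y' (j, b') = (J, B')" "iv Y (i, b) = (I, B)" by fastforce
          have q: "(J, B') \<in> pdom Y'" "(I, B) \<in> pdom Y" "pmap Y' (J, B') = (j, b')" "pmap Y (I, B) = (i, b)"
            using iv[OF c(1)] iv[OF c(2)] e by auto
          then have JI: "J < length (pos Y')" "I < length (pos Y)" "B' < length (snd (pos Y' ! J))" "B < length (snd (pos Y ! I))"
            by (auto simp: pdom_def)
          have "Poly_Mapping.lookup (h J I) g B' B \<in> Hom A (fst (fst (bobj Y ! I) ! B)) (fst (fst (bobj Y' ! J) ! B'))
            (p - snd (bobj Y ! I) + snd (bobj Y' ! J) - (snd (fst (bobj Y ! I) ! B) + g) + snd (fst (bobj Y' ! J) ! B'))"
          proof -
            from h[unfolded Hom_ZZ_CZ_iff, rule_format, of J I] JI(1,2)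
            have "\<forall>g b' b. if b' < length (fst (bobj Y' ! J)) \<and> b < length (fst (bobj Y ! I))
              then Poly_Mapping.lookup (h J I) g b' b \<in> Hom A (fst (fst (bobj Y ! I) ! b)) (fst (fst (bobj Y' ! J) ! b'))
                (p - snd (bobj Y ! I) + snd (bobj Y' ! J) - (snd (fst (bobj Y ! I) ! b) + g) + snd (fst (bobj Y' ! J) ! b'))
              else Poly_Mapping.lookup (h J I) g b' b = 0" by simp
            from this[rule_format, of B' B g] JI show ?thesis by (simp add: bobj_nth)
          qed
          then have "Poly_Mapping.lookup (h J I) g B' B \<in> Hom A (fst (fst (fst (Y ! i)) ! b)) (fst (fst (fst (Y' ! j)) ! b'))
            (p - snd (Y ! i) + snd (Y' ! j) - (snd (fst (fst (Y ! i)) ! b) + g) + snd (fst (fst (Y' ! j)) ! b'))"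
            using JI q(3,4) by (simp add: bobj_nth pmap_def)
          then show ?thesis using b c e by (simp add: lm r_def)
        next
          case False
          then show ?thesis by (auto simp: lm r_def cdom_def)
        qed
        then show ?thesis using True by simp
      next
        case False
        then have "r j i = (\<lambda>_. 0)" by (auto simp: r_def cdom_def fun_eq_iff)
        then have "m j i = 0" by (intro poly_mapping_eqI) (simp add: lm)
        then show ?thesis using False by auto
      qed
    qed
    ultimately show "h \<in> bval Y' Y ` Hom (ZZ CT) Y Y' p" by blast
  qed (auto intro: bval_Hom)
qed

text \<open>Splitting merely renames the states of the full expansion, so \<open>ex_reindex\<close>
  with \<open>psi\<close> matches the runs before and after. Hence splitting commutes with
  compositions over \<int>A * \<int>.\<close>

lemma mu_bet:
  assumes x: "pmors (ZZ CT) T x S" "x \<noteq> []"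
  shows "mu (ZZ CZ) (map bet x) = bval T S (mu (ZZ CZ) (map kap x))"
proof (rule bval_eqI)
  have P: "pmors (ZZ CZ) (bobj T) (map bet x) (bobj S)" by (rule pmors_bet[OF x(1)])
  have Pk: "pmors (ZZ CZ) (map (apfst fst) T) (map kap x) (map (apfst fst) S)" by (rule pmors_kap[OF x(1)])
  have m: "mors (ZZ CZ) (map bet x)" "mors (ZZ CZ) (map kap x)" using P Pk x(2) by (auto simp: mors_pmors)
  have p: "path src tgt T x S" using x(1) by (simp add: pmors_def)
  show "mu (ZZ CZ) (map bet x) J I = 0" if "\<not> (J < length (pos T) \<and> I < length (pos S))" for J I
    by (rule CZ.mu_ZZ_outside[OF P]) (use that x(2) in auto)
  obtain K where K: "finite K" "0 \<in> K" "\<And>f j i. f \<in> set x \<Longrightarrow> Poly_Mapping.keys (val f j i) \<subseteq> K"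
    using keys_rD[of x] x(1) by (auto simp: pmors_def)
  have "Poly_Mapping.keys (bval Y' Y n J I) \<subseteq> K"
    if "\<And>j i. Poly_Mapping.keys (n j i) \<subseteq> K" for Y' Y :: "(('o, 'm) twc \<times> int) list" and n J I
  proof
    fix g assume g: "g \<in> Poly_Mapping.keys (bval Y' Y n J I)"
    show "g \<in> K"
    proof (rule ccontr)
      assume "g \<notin> K"
      then have "Poly_Mapping.lookup (n j i) g = 0" for j i using that[of j i] by (meson in_keys_iff subsetD)
      then have "Poly_Mapping.lookup (bval Y' Y n J I) g = 0"
        using bmat_zero lookup_bval bval_outside by (metis lookup_zero)
      then show False using g by (simp add: in_keys_iff)
    qed
  qed
  note kb = this
  have Kb: "Poly_Mapping.keys (val f J I) \<subseteq> K" if f: "f \<in> set (map bet x)" for f J I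
  proof -
    obtain f' where "f' \<in> set x" "f = bet f'" using f by auto
    then show ?thesis using kb[OF K(3)] by simp
  qed
  have Kk: "Poly_Mapping.keys (val f J I) \<subseteq> K" if f: "f \<in> set (map kap x)" for f J I
  proof -
    obtain f' where "f' \<in> set x" "f = kap f'" using f by auto
    then show ?thesis using K(3)[of f' J I] by simp
  qed
  fix J I g assume JI: "J < length (pos T)" "I < length (pos S)"
  show "Poly_Mapping.lookup (mu (ZZ CZ) (map bet x) J I) g =
    bmat (snd (pos T ! J)) (snd (pos S ! I)) (Poly_Mapping.lookup (mu (ZZ CZ) (map kap x) (fst (pos T ! J)) (fst (pos S ! I))) g)"
  proof (intro ext)
    fix B' B
    show "Poly_Mapping.lookup (mu (ZZ CZ) (map bet x) J I) g B' B =
      bmat (snd (pos T ! J)) (snd (pos S ! I)) (Poly_Mapping.lookup (mu (ZZ CZ) (map kap x) (fst (pos T ! J)) (fst (pos S ! I))) g) B' B"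
    proof (cases "B' < length (snd (pos T ! J)) \<and> B < length (snd (pos S ! I))")
      case True
      have v: "vstate T ((J, 0), B')" "vstate S ((I, g), B)" using JI True by (auto simp: vstate_def pdom_def)
      define V where "V Z = ksign (sx (map fst Z) + sexp (map snd Z)) (mu A (map snd (map snd Z)))"
        for Z :: "((int \<times> int) \<times> int \<times> ('o, 'm) hmor) list"
      have "Poly_Mapping.lookup (mu (ZZ CZ) (map bet x) J I) g B' B =
        ex (N3 K) e3 (map bet x) ((J, 0), B') (\<lambda>t Z. if t = ((I, g), B) then V Z else 0)"
        unfolding V_def by (rule lookup_mu_flat[OF m(1) K(1) Kb])
      \<comment> \<open>Before the states are renamed, the condition on the final state has to be
        expressed through \<open>psi\<close>; this is possible because \<open>psi\<close> is
        injective on valid states.\<close>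
      also have "\<dots> = ex (N3 K) e3 (map bet x) ((J, 0), B') (\<lambda>t Z. if psi S t = psi S ((I, g), B) then V Z else 0)"
      proof (rule ex_cong)
        fix t Z assume "run (N3 K) e3 (map bet x) ((J, 0), B') t Z"
        then have "vstate S t" by (rule run_bet_valid[OF p v(1)])
        then show "(if t = ((I, g), B) then V Z else 0) = (if psi S t = psi S ((I, g), B) then V Z else 0)"
          using psi_inj[OF _ v(2)] by auto
      qed
      also have "\<dots> = ex (\<lambda>f. N3 K (kap f)) (\<lambda>f. e3 (kap f)) x (psi T ((J, 0), B')) (\<lambda>t Z. if t = psi S ((I, g), B) then V Z else 0)"
      proof (rule ex_reindex[where valid = vstate and sr = src and tg = tgt and T = T and S = S, OF p v(1)])
        fix f :: "((('o, 'm) twc \<times> int) list, nat \<Rightarrow> nat \<Rightarrow> (int \<Rightarrow>\<^sub>0 (nat \<Rightarrow> nat \<Rightarrow> 'm))) hmor" and s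
        assume s: "vstate (tgt f) s"
        show "bij_betw (psi (src f)) (N3 K (bet f) s) (N3 K (kap f) (psi (tgt f) s)) \<and>
          (\<forall>k\<in>N3 K (bet f) s. vstate (src f) k \<and> e3 (bet f) s k = e3 (kap f) (psi (tgt f) s) (psi (src f) k))"
          using bij_psi_N3[OF s] e3_bet[OF s] by blast
      qed
      also have "\<dots> = ex (N3 K) e3 (map kap x) ((fst (pos T ! J), 0), snd (pos T ! J) ! B')
          (\<lambda>t Z. if t = ((fst (pos S ! I), g), snd (pos S ! I) ! B) then V Z else 0)"
        by (simp add: ex_map psi_def)
      also have "\<dots> = Poly_Mapping.lookup (mu (ZZ CZ) (map kap x) (fst (pos T ! J)) (fst (pos S ! I))) g (snd (pos T ! J) ! B') (snd (pos S ! I) ! B)"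
        unfolding V_def by (rule lookup_mu_flat[OF m(2) K(1) Kk, symmetric])
      finally show ?thesis using True by (simp add: bmat_def)
    next
      case False
      have "mor (ZZ CZ) (mu_mor (ZZ CZ) (map bet x))" by (rule ZCZ.mu_closed[OF m(1)])
      then have "mu (ZZ CZ) (map bet x) \<in> Hom (ZZ CZ) (bobj S) (bobj T) (deg (mu_mor (ZZ CZ) (map bet x)))"
        using pmors_ends[OF P] x(2) by (simp add: mor_def)
      from this[unfolded Hom_ZZ_CZ_iff, rule_format, of J I]
      have "Poly_Mapping.lookup (mu (ZZ CZ) (map bet x) J I) g B' B = 0"
        using JI False by (auto simp: bobj_nth)
      then show ?thesis using False by (auto simp: bmat_def)
    qed
  qed
qed

end

section \<open>The quasi-equivalence\<close>

type_synonym 'm mats = "int \<Rightarrow>\<^sub>0 (nat \<Rightarrow> nat \<Rightarrow> 'm)"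

type_synonym ('o, 'm) ttwc = "(('o, 'm) twc, 'm mats) twc"

definition Fo :: "('o, 'm::ab_group_add) ttwc \<Rightarrow> (('o \<times> int) list, 'm mats) twc"
  where "Fo T = (bobj (fst T), bval (fst T) (fst T) (snd T + dmat (fst T)))"

definition nu :: "(('o, 'm::ab_group_add) ttwc, nat \<Rightarrow> nat \<Rightarrow> 'm mats,
    (('o \<times> int) list, 'm mats) twc, nat \<Rightarrow> nat \<Rightarrow> 'm mats) func"
  where "nu = \<lparr>fobj = Fo, fmor = (\<lambda>f. bval (fst (tgt f)) (fst (src f)) (val f))\<rparr>"

text \<open>
  In a word over \<open>T + (T + f)\<close>, the letters \<open>Inl T\<close> and \<open>Inr (Inl T)\<close> stand for the internal
  differential of the summands of \<open>T\<close> and for the differential of \<open>T\<close> itself; \<open>collapse\<close> replaces both by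
  the differential of \<open>Fo T\<close>, which is their sum.
\<close>

abbreviation r3 :: "('o, 'm::ab_group_add) ttwc + (('o, 'm) ttwc + (('o, 'm) ttwc, nat \<Rightarrow> nat \<Rightarrow> 'm mats) hmor) \<Rightarrow>
    ((('o, 'm) twc \<times> int) list, nat \<Rightarrow> nat \<Rightarrow> 'm mats) hmor"
  where "r3 \<equiv> case_sum (\<lambda>T. dD (fst T)) rl"

abbreviation rF :: "('o, 'm::ab_group_add) ttwc + (('o, 'm) ttwc, nat \<Rightarrow> nat \<Rightarrow> 'm mats) hmor \<Rightarrow>
    ((('o \<times> int) list \<times> int) list, nat \<Rightarrow> nat \<Rightarrow> 'm mats) hmor"
  where "rF \<equiv> case_sum (\<lambda>T. tw_diff (Fo T)) (\<lambda>f. bet (untwist f))"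

abbreviation collapse :: "'a + ('a + 'b) \<Rightarrow> 'a + 'b"
  where "collapse \<equiv> case_sum Inl id"

abbreviation wpath2 :: "('l \<Rightarrow> 'o) \<Rightarrow> ('l \<Rightarrow> 'o) \<Rightarrow> 'o \<Rightarrow> ('o + ('o + 'l)) list \<Rightarrow> 'o \<Rightarrow> bool"
  where "wpath2 sr tg \<equiv> wpath (case_sum id sr) (case_sum id tg)"

lemma wpath_collapse: "wpath sr tg T (map collapse v) S \<longleftrightarrow> wpath2 sr tg T v S"
  by (induction v arbitrary: T) (auto split: sum.splits)

lemma rights_collapse: "rights (map collapse v) = rights (rights v)"
  by (induction v) (auto split: sum.splits)

lemma wpath_map_Inr: "wpath sr tg T (map Inr w) S \<longleftrightarrow> path sr tg T w S"
  by (induction w arbitrary: T) auto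

lemma rights_map_Inr [simp]: "rights (map Inr w) = w"
  by (induction w) auto

lemma fhm_nu [simp]: "untwist (fhm nu f) = bet (untwist f)" "fobj nu = Fo" "src (fhm nu f) = Fo (src f)" "tgt (fhm nu f) = Fo (tgt f)"
  by (simp_all add: fhm_def nu_def untwist_def bet_def Fo_def)

lemma fst_Fo [simp]: "fst (Fo T) = bobj (fst T)"
  by (simp add: Fo_def)

lemma snd_Fo: "snd (Fo T) = bval (fst T) (fst T) (snd T) + bval (fst T) (fst T) (dmat (fst T))"
  unfolding Fo_def snd_conv by (rule bval_add)

lemma sum_words_Nil:
  "(\<Sum>w\<in>words sr tg T [] T L - {[]}. \<Phi> w) = (\<Sum>d\<in>{1..L}. \<Phi> (replicate d (Inl T)))"
proof (rule sum.reindex_bij_witness[where i = "\<lambda>d. replicate d (Inl T)" and j = length])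
  fix w assume "w \<in> words sr tg T [] T L - {[]}"
  then have w: "rights w = []" "wpath sr tg T w T" "length w \<le> L" "w \<noteq> []" by (auto simp: words_def)
  then show "replicate (length w) (Inl T) = w" using wpath_rights_Nil[OF w(2,1)] by simp
  then show "\<Phi> (replicate (length w) (Inl T)) = \<Phi> w" by simp
  show "length w \<in> {1..L}" using w by (cases w) auto
next
  fix d assume "d \<in> {1..L}"
  then show "replicate d (Inl T) \<in> words sr tg T [] T L - {[]}"
    using wpath_replicate[of sr tg T d] by (cases d) (auto simp: words_def)
qed simp

lemma bval_0_entry: "m (fst (pos Y' ! J)) (fst (pos Y ! I)) = 0 \<Longrightarrow> bval Y' Y m J I = 0"
proof (cases "J < length (pos Y') \<and> I < length (pos Y)")
  case True
  assume "m (fst (pos Y' ! J)) (fst (pos Y ! I)) = 0"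
  then show ?thesis using True by (intro poly_mapping_eqI) (simp add: lookup_bval bmat_zero)
qed (rule bval_outside)

text \<open>An object with nonzero differential is split into single summands, so the nonzero
  entries of the split D connect one-element blocks of the same object and are entries of that
  object's differential. This lets the rank of the object be used for its blocks.\<close>

lemma bval_dmat_nonzero:
  assumes "bval Y Y (dmat Y) J I \<noteq> 0"
  shows "\<exists>i b' b. J < length (pos Y) \<and> I < length (pos Y) \<and> i < length Y \<and> pos Y ! J = (i, [b']) \<and> pos Y ! I = (i, [b]) \<and>
    b < length (fst (fst (Y ! i))) \<and> snd (fst (Y ! i)) \<noteq> 0 \<and> snd (fst (Y ! i)) b' b \<noteq> 0"
proof -
  have JI: "J < length (pos Y)" "I < length (pos Y)" using assms bval_outside[of J Y I Y "dmat Y"] by auto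
  let ?i = "fst (pos Y ! I)"
  have "dmat Y (fst (pos Y ! J)) ?i \<noteq> 0" using assms bval_0_entry[of "dmat Y" Y J Y I] by blast
  then have i: "fst (pos Y ! J) = ?i" "?i < length Y" by (auto simp: dmat_def split: if_splits)
  obtain g where "Poly_Mapping.lookup (bval Y Y (dmat Y) J I) g \<noteq> 0" using assms by (metis poly_mapping_eqI lookup_zero)
  then obtain B' B where n: "bmat (snd (pos Y ! J)) (snd (pos Y ! I)) (Poly_Mapping.lookup (dmat Y ?i ?i) g) B' B \<noteq> 0"
    unfolding lookup_bval[OF JI] i(1) by (auto simp: fun_eq_iff)
  then have B: "B' < length (snd (pos Y ! J))" "B < length (snd (pos Y ! I))"
    and "Poly_Mapping.lookup (dmat Y ?i ?i) g (snd (pos Y ! J) ! B') (snd (pos Y ! I) ! B) \<noteq> 0"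
    by (auto simp: bmat_def split: if_splits)
  then have d: "snd (fst (Y ! ?i)) (snd (pos Y ! J) ! B') (snd (pos Y ! I) ! B) \<noteq> 0"
    using i(2) by (auto simp: dmat_def lookup_single when_def split: if_splits)
  then have n0: "snd (fst (Y ! ?i)) \<noteq> 0" by (metis zero_fun_apply)
  obtain b' b where b: "snd (pos Y ! J) = [b']" "snd (pos Y ! I) = [b]"
    using pos_nth(3)[OF JI(1)] pos_nth(3)[OF JI(2)] n0 i(1) by metis
  have "b < length (fst (fst (Y ! ?i)))" using pos_nth(2)[OF JI(2), of b] b by simp
  moreover have "snd (fst (Y ! ?i)) b' b \<noteq> 0" using d B b by simp
  ultimately show ?thesis using JI i b n0
    by (intro exI[of _ ?i] exI[of _ b'] exI[of _ b]) (auto simp: prod_eq_iff)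
qed

text \<open>A common rank for the split \<delta> and the split D separately, and not just for their
  sum, because words that mix the two letters have to vanish as well.\<close>

definition ranked :: "('o, 'm::ab_group_add) ttwc \<Rightarrow> nat \<Rightarrow> (nat \<Rightarrow> nat) \<Rightarrow> bool"
  where "ranked T N R \<longleftrightarrow> (\<forall>I<length (pos (fst T)). R I < N \<and> (\<forall>J.
    bval (fst T) (fst T) (snd T) J I \<noteq> 0 \<or> bval (fst T) (fst T) (dmat (fst T)) J I \<noteq> 0 \<longrightarrow>
    J < length (pos (fst T)) \<and> R I < R J))"

lemma ranked_exists:
  fixes T :: "('o, 'm::ab_group_add) ttwc"
  assumes T: "strictly_lower_triangular (length (fst T)) (snd T)"
    and Y: "\<And>i. i < length (fst T) \<Longrightarrow> strictly_lower_triangular (length (fst (fst (fst T ! i)))) (snd (fst (fst T ! i)))"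
  shows "\<exists>N R. ranked T N R"
proof -
  define Y' where "Y' = fst T"
  obtain r N0 where r: "\<And>i. i < length Y' \<Longrightarrow> r i < (N0::nat)" "\<And>j i. i < length Y' \<Longrightarrow> snd T j i \<noteq> 0 \<Longrightarrow> r i < r j"
    using strictly_lower_triangular_rank[OF T] unfolding Y'_def by blast
  have "\<forall>i\<in>{..<length Y'}. \<exists>q :: (nat \<Rightarrow> nat) \<times> nat. (\<forall>b<length (fst (fst (Y' ! i))). fst q b < snd q) \<and>
      (\<forall>b' b. b < length (fst (fst (Y' ! i))) \<longrightarrow> snd (fst (Y' ! i)) b' b \<noteq> 0 \<longrightarrow> fst q b < fst q b')"
  proof
    fix i assume "i \<in> {..<length Y'}"
    then obtain s n where "\<forall>b<length (fst (fst (Y' ! i))). s b < (n::nat)"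
      "\<forall>b' b. b < length (fst (fst (Y' ! i))) \<longrightarrow> snd (fst (Y' ! i)) b' b \<noteq> 0 \<longrightarrow> s b < s b'"
      using strictly_lower_triangular_rank[OF Y, of i] unfolding Y'_def by blast
    then show "\<exists>q :: (nat \<Rightarrow> nat) \<times> nat. (\<forall>b<length (fst (fst (Y' ! i))). fst q b < snd q) \<and>
      (\<forall>b' b. b < length (fst (fst (Y' ! i))) \<longrightarrow> snd (fst (Y' ! i)) b' b \<noteq> 0 \<longrightarrow> fst q b < fst q b')"
      by (intro exI[of _ "(s, n)"]) simp
  qed
  from bchoice[OF this] obtain q :: "nat \<Rightarrow> (nat \<Rightarrow> nat) \<times> nat" where
    q: "\<forall>i\<in>{..<length Y'}. (\<forall>b<length (fst (fst (Y' ! i))). fst (q i) b < snd (q i)) \<and>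
      (\<forall>b' b. b < length (fst (fst (Y' ! i))) \<longrightarrow> snd (fst (Y' ! i)) b' b \<noteq> 0 \<longrightarrow> fst (q i) b < fst (q i) b')" by blast
  \<comment> \<open>\<open>M\<close> exceeds all inner ranks, so \<open>R\<close> below orders
    lexicographically: first by the rank of the object with respect to \<delta>, then by the rank of
    the summand with respect to the object's own differential. Blocks kept whole get inner rank
    0.\<close>
  define M where "M = Suc (\<Sum>i<length Y'. snd (q i))"
  define c where "c I = (if snd (fst (Y' ! fst (pos Y' ! I))) = 0 then 0 else fst (q (fst (pos Y' ! I))) (hd (snd (pos Y' ! I))))" for I
  define R where "R I = r (fst (pos Y' ! I)) * M + c I" for I
  have c: "c I < M" if I: "I < length (pos Y')" for I
  proof (cases "snd (fst (Y' ! fst (pos Y' ! I))) = 0")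
    case True
    then have "c I = 0" unfolding c_def by (rule if_P)
    then show ?thesis by (simp add: M_def)
  next
    case False
    let ?i = "fst (pos Y' ! I)"
    obtain b where b: "snd (pos Y' ! I) = [b]" using pos_nth(3)[OF I False] by blast
    have i: "?i < length Y'" "b < length (fst (fst (Y' ! ?i)))" using pos_nth(1,2)[OF I] b by auto
    have "c I = fst (q ?i) b" unfolding c_def if_not_P[OF False] b by simp
    moreover have "fst (q ?i) b < snd (q ?i)" using q i by blast
    moreover have "snd (q ?i) \<le> (\<Sum>i<length Y'. snd (q i))" using i by (intro member_le_sum) auto
    ultimately show ?thesis by (simp add: M_def)
  qed
  have lt: "r i * M + x < r j * M + y" if "r i < r j" "x < M" for i j x y
  proof -
    have "Suc (r i) * M \<le> r j * M" using that(1) by (intro mult_le_mono1) simp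
    then show ?thesis using that(2) by simp
  qed
  have "ranked T (N0 * M) R"
    unfolding ranked_def Y'_def[symmetric]
  proof (intro allI impI conjI)
    fix I assume I: "I < length (pos Y')"
    have i: "fst (pos Y' ! I) < length Y'" by (rule pos_nth(1)[OF I])
    have "Suc (r (fst (pos Y' ! I))) * M \<le> N0 * M" using r(1)[OF i] by (intro mult_le_mono1) simp
    then show "R I < N0 * M" using c[OF I] by (simp add: R_def)
    fix J assume n: "bval Y' Y' (snd T) J I \<noteq> 0 \<or> bval Y' Y' (dmat Y') J I \<noteq> 0"
    show J: "J < length (pos Y')" using n bval_outside[of J Y' I Y'] by blast
    show "R I < R J"
    proof (cases "bval Y' Y' (dmat Y') J I = 0")
      case True
      then have "bval Y' Y' (snd T) J I \<noteq> 0" using n by blast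
      then have "snd T (fst (pos Y' ! J)) (fst (pos Y' ! I)) \<noteq> 0" using bval_0_entry[of "snd T" Y' J Y' I] by blast
      then show ?thesis unfolding R_def using r(2)[OF i] c[OF I] by (intro lt)
    next
      case False
      from bval_dmat_nonzero[OF this] obtain i b' b where b: "i < length Y'" "pos Y' ! J = (i, [b'])" "pos Y' ! I = (i, [b])"
        "b < length (fst (fst (Y' ! i)))" "snd (fst (Y' ! i)) \<noteq> 0" "snd (fst (Y' ! i)) b' b \<noteq> 0" by blast
      have "fst (q i) b < fst (q i) b'" using q b(1,4,6) by blast
      then show ?thesis unfolding R_def c_def b(2,3) fst_conv snd_conv if_not_P[OF b(5)] by simp
    qed
  qed
  then show ?thesis by blast
qed

lemma ranked_mono: "ranked T N R \<Longrightarrow> N \<le> N' \<Longrightarrow> ranked T N' R"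
  unfolding ranked_def by (meson less_le_trans)

lemma ranked_Fo:
  assumes "ranked T N R"
  shows "strictly_lower_triangular (length (fst (Fo T))) (snd (Fo T))"
proof (rule rank_strictly_lower_triangular[where r = R])
  fix J I assume I: "I < length (fst (Fo T))" and n: "snd (Fo T) J I \<noteq> 0"
  have "bval (fst T) (fst T) (snd T) J I \<noteq> 0 \<or> bval (fst T) (fst T) (dmat (fst T)) J I \<noteq> 0"
    using n unfolding snd_Fo plus_fun_apply by (metis add_0)
  then show "J < length (fst (Fo T)) \<and> R I < R J" using assms I unfolding ranked_def fst_Fo length_bobj by blast
qed

lemma map_collapse_Cons_Inl: "{v. map collapse v = Inl T # u} =
    Cons (Inl T) ` {v. map collapse v = u} \<union> Cons (Inr (Inl T)) ` {v. map collapse v = u}"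
proof (intro equalityI subsetI)
  fix v :: "('a + ('a + 'b)) list" assume "v \<in> {v. map collapse v = Inl T # u}"
  then obtain x w where v: "v = x # w" "collapse x = Inl T" "map collapse w = u" by (cases v) auto
  then have "x = Inl T \<or> x = Inr (Inl T)" by (cases x) auto
  then show "v \<in> Cons (Inl T) ` {v. map collapse v = u} \<union> Cons (Inr (Inl T)) ` {v. map collapse v = u}" using v(1,3) by blast
qed auto

lemma map_collapse_Cons_Inr: "{v. map collapse v = Inr f # u} = Cons (Inr (Inr f)) ` {v. map collapse v = u}"
proof (intro equalityI subsetI)
  fix v :: "('a + ('a + 'b)) list" assume "v \<in> {v. map collapse v = Inr f # u}"
  then obtain x w where v: "v = x # w" "collapse x = Inr f" "map collapse w = u" by (cases v) auto
  then have "x = Inr (Inr f)" by (cases x) auto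
  then show "v \<in> Cons (Inr (Inr f)) ` {v. map collapse v = u}" using v(1,3) by blast
qed auto

lemma finite_map_collapse: "finite {v. map collapse v = u}"
proof (induction u)
  case (Cons x u)
  then show ?case by (cases x) (simp_all only: map_collapse_Cons_Inl map_collapse_Cons_Inr finite_Un finite_imageI simp_thms)
qed simp

section \<open>Expanding insertions of \<delta> + D\<close>

context ainf_category
begin

interpretation ZA: strict_action "ZZ A" shift_ZZ by (rule strict_action_shift_ZZ)
interpretation TA: strict_action "Tw A" shift_Tw by (rule strict_action_shift_Tw)
interpretation CZ: ainf_category CZ by (rule ZA.ainf_category_skew)
interpretation CT: ainf_category CT by (rule TA.ainf_category_skew)
interpretation ZCZ: ainf_category "ZZ CZ" by (rule CZ.ainf_category_ZZ)
interpretation ZCT: ainf_category "ZZ CT" by (rule CT.ainf_category_ZZ)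

text \<open>A twisted complex short of its Maurer--Cartan equation. Surjectivity on objects compares
  the Maurer--Cartan sums of \<open>T\<close> and \<open>Fo T\<close> at a moment when the equation
  is known only for \<open>Fo T\<close>.\<close>

definition preT :: "('o, 'm) ttwc \<Rightarrow> bool"
  where "preT T \<longleftrightarrow> mor (ZZ CT) (tw_diff T) \<and> strictly_lower_triangular (length (fst T)) (snd T)"

lemma preT_Tw: "T \<in> Obj (Tw CT) \<Longrightarrow> preT T"
  unfolding preT_def Tw_sel(1) by blast

lemma preT_obj: "preT T \<Longrightarrow> fst T \<in> Obj (ZZ CT)"
  by (auto simp: preT_def mor_def)

lemma preT_ranked: "preT T \<Longrightarrow> \<exists>N R. ranked T N R"
proof (rule ranked_exists)
  assume T: "preT T"
  then show "strictly_lower_triangular (length (fst T)) (snd T)" by (simp add: preT_def)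
  fix i assume "i < length (fst T)"
  then have "fst (fst T ! i) \<in> Obj (Tw A)" using preT_obj[OF T] by (simp add: ZZ_sel(1) TA.skew_sel(1))
  then show "strictly_lower_triangular (length (fst (fst (fst T ! i)))) (snd (fst (fst T ! i)))" unfolding Tw_sel(1) by blast
qed

lemma preT_Fo:
  assumes T: "preT T"
  shows "mor (ZZ CZ) (tw_diff (Fo T))" "strictly_lower_triangular (length (fst (Fo T))) (snd (Fo T))"
proof -
  note Y = preT_obj[OF T]
  have "mor (ZZ CZ) (bet (tw_diff T))" "mor (ZZ CZ) (bet (dD (fst T)))"
    using T mor_dD[OF Y] mor_bet by (auto simp: preT_def)
  then show "mor (ZZ CZ) (tw_diff (Fo T))"
    using Obj_bobj[OF Y] unfolding mor_def tw_diff_sel bet_sel dD_sel fst_Fo snd_Fo by (intro conjI ZCZ.Hom_add) blast+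
  show "strictly_lower_triangular (length (fst (Fo T))) (snd (Fo T))"
    using preT_ranked[OF T] ranked_Fo by blast
qed

lemma pmors_r3:
  assumes "wpath2 src tgt T v S" "preT T" "\<forall>f\<in>set (rights (rights v)). mor (ZZ CT) (untwist f) \<and> preT (src f)"
  shows "pmors (ZZ CT) (fst T) (map r3 v) (fst S)"
  using assms
proof (induction v arbitrary: T)
  case (Cons x v)
  show ?case
  proof (cases x)
    case (Inl U)
    then have "U = T" using Cons.prems(1) by simp
    then show ?thesis using Cons.IH[of T] Cons.prems mor_dD[OF preT_obj[OF Cons.prems(2)]] Inl by simp
  next
    case x: (Inr y)
    show ?thesis
    proof (cases y)
      case (Inl U)
      have "mor (ZZ CT) (tw_diff T)" using Cons.prems(2) by (simp add: preT_def)
      moreover have "U = T" using Cons.prems(1) x Inl by simp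
      ultimately show ?thesis using Cons.IH[of T] Cons.prems x Inl by simp
    next
      case (Inr f)
      then show ?thesis using Cons.IH[of "src f"] Cons.prems x by simp
    qed
  qed
qed simp

lemma pmors_rF:
  assumes "wpath src tgt T u S" "preT T" "\<forall>f\<in>set (rights u). mor (ZZ CT) (untwist f) \<and> preT (src f)"
  shows "pmors (ZZ CZ) (bobj (fst T)) (map rF u) (bobj (fst S))"
  using assms
proof (induction u arbitrary: T)
  case (Cons x u)
  show ?case
  proof (cases x)
    case (Inl U)
    then have "U = T" using Cons.prems(1) by simp
    then show ?thesis using Cons.IH[of T] Cons.prems preT_Fo(1)[OF Cons.prems(2)] Inl by simp
  next
    case (Inr f)
    then show ?thesis using Cons.IH[of "src f"] Cons.prems mor_bet[of "untwist f"] by simp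
  qed
qed simp

text \<open>The differential of \<open>Fo T\<close> is a sum of two letters, so by linearity each of
  its occurrences branches, and the branches are the words that collapse to \<open>u\<close>. The
  letters already expanded are collected in \<open>us\<close>.\<close>

lemma mu_rF:
  assumes "pmors (ZZ CZ) U (us @ map rF u) V" "\<forall>T. Inl T \<in> set u \<longrightarrow> preT T"
  shows "mu (ZZ CZ) (us @ map rF u) = (\<Sum>v\<in>{v. map collapse v = u}. mu (ZZ CZ) (us @ map (\<lambda>l. bet (r3 l)) v))"
  using assms
proof (induction u arbitrary: us)
  case (Cons x u)
  have IH: "mu (ZZ CZ) (us @ y # map rF u) = (\<Sum>v\<in>{v. map collapse v = u}. mu (ZZ CZ) (us @ y # map (\<lambda>l. bet (r3 l)) v))"
    if "pmors (ZZ CZ) U (us @ y # map rF u) V" for y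
    using Cons.IH[of "us @ [y]"] that Cons.prems(2) by simp
  show ?case
  proof (cases x)
    case (Inl T)
    have T: "preT T" using Cons.prems(2) Inl by simp
    let ?Y = "bobj (fst T)"
    let ?a = "bet (tw_diff T)" and ?b = "bet (dD (fst T))"
    have ab: "?a = HMor ?Y ?Y 1 (val ?a)" "?b = HMor ?Y ?Y 1 (val ?b)" by (simp_all add: bet_def)
    have F: "tw_diff (Fo T) = HMor ?Y ?Y 1 (val ?b + val ?a)"
      unfolding tw_diff_def[of "Fo T"] fst_Fo snd_Fo bet_sel tw_diff_sel dD_sel by (simp only: add.commute)
    have mab: "mor (ZZ CZ) ?a" "mor (ZZ CZ) ?b" using T mor_bet mor_dD[OF preT_obj[OF T]] by (auto simp: preT_def)
    have P: "pmors (ZZ CZ) U (us @ ?a # map rF u) V" "pmors (ZZ CZ) U (us @ ?b # map rF u) V"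
      using Cons.prems(1) mab by (auto simp: pmors_append Inl)
    have "mu (ZZ CZ) (us @ map rF (x # u)) = mu (ZZ CZ) (us @ ?b # map rF u) + mu (ZZ CZ) (us @ ?a # map rF u)"
    proof -
      have "mors (ZZ CZ) (us @ HMor ?Y ?Y 1 (val ?b) # map rF u)" "mors (ZZ CZ) (us @ HMor ?Y ?Y 1 (val ?a) # map rF u)"
        using P unfolding ab[symmetric] by (auto simp: mors_pmors)
      from ZCZ.mu_add[OF this] show ?thesis unfolding F[symmetric] ab[symmetric] Inl by simp
    qed
    also have "\<dots> = (\<Sum>v\<in>{v. map collapse v = u}. mu (ZZ CZ) (us @ map (\<lambda>l. bet (r3 l)) (Inl T # v))) +
        (\<Sum>v\<in>{v. map collapse v = u}. mu (ZZ CZ) (us @ map (\<lambda>l. bet (r3 l)) (Inr (Inl T) # v)))"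
      unfolding IH[OF P(1)] IH[OF P(2)] by simp
    also have "\<dots> = (\<Sum>v\<in>Cons (Inl T) ` {v. map collapse v = u}. mu (ZZ CZ) (us @ map (\<lambda>l. bet (r3 l)) v)) +
        (\<Sum>v\<in>Cons (Inr (Inl T)) ` {v. map collapse v = u}. mu (ZZ CZ) (us @ map (\<lambda>l. bet (r3 l)) v))"
      by (simp add: sum.reindex)
    also have "\<dots> = (\<Sum>v\<in>{v. map collapse v = x # u}. mu (ZZ CZ) (us @ map (\<lambda>l. bet (r3 l)) v))"
      unfolding Inl map_collapse_Cons_Inl
      by (rule sum.union_disjoint[symmetric]) (auto intro: finite_map_collapse)
    finally show ?thesis .
  next
    case (Inr f)
    have "mu (ZZ CZ) (us @ map rF (x # u)) = (\<Sum>v\<in>{v. map collapse v = u}. mu (ZZ CZ) (us @ map (\<lambda>l. bet (r3 l)) (Inr (Inr f) # v)))"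
      using IH[of "rF x"] Cons.prems(1) by (simp add: Inr)
    also have "\<dots> = (\<Sum>v\<in>{v. map collapse v = x # u}. mu (ZZ CZ) (us @ map (\<lambda>l. bet (r3 l)) v))"
      unfolding Inr map_collapse_Cons_Inr by (simp add: sum.reindex)
    finally show ?thesis .
  qed
qed simp

text \<open>After collapsing, \<open>words_block\<close> finds a long block of one object. In the
  original word that block mixes the two differentials of the object, and a common rank makes it
  vanish all the same.\<close>

lemma r3_vanish:
  assumes "finite Ob" "\<forall>T\<in>Ob. preT T"
  shows "\<exists>L0. \<forall>v T S. wpath2 src tgt T v S \<and> T \<in> Ob \<and> src ` set (rights (rights v)) \<subseteq> Ob \<and>
    length (rights (rights v)) \<le> d \<and> L0 \<le> length v \<and> mors (ZZ CZ) (map (\<lambda>l. bet (r3 l)) v) \<longrightarrow>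
    mu (ZZ CZ) (map (\<lambda>l. bet (r3 l)) v) = 0"
proof -
  have "\<forall>T\<in>Ob. \<exists>N. \<exists>R. ranked T N R" using assms(2) preT_ranked by blast
  from bchoice[OF this] obtain n where n: "\<forall>T\<in>Ob. \<exists>R. ranked T (n T) R" by blast
  \<comment> \<open>The sum dominates the bound of each object in \<open>Ob\<close>, and the
    successor makes \<open>N\<close> positive, as \<open>words_block\<close> requires.\<close>
  define N where "N = Suc (sum n Ob)"
  have N: "\<exists>R. ranked T N R" if T: "T \<in> Ob" for T
  proof -
    have "n T \<le> N" unfolding N_def using member_le_sum[OF T _ assms(1), of n] by simp
    then show ?thesis using n T ranked_mono by blast
  qed
  show ?thesis
  proof (intro exI[of _ "(d + 1) * N"] allI impI, elim conjE)
    fix v T S assume p: "wpath2 src tgt T v S" and T: "T \<in> Ob" and sb: "src ` set (rights (rights v)) \<subseteq> Ob"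
      and l: "length (rights (rights v)) \<le> d" "(d + 1) * N \<le> length v"
      and m: "mors (ZZ CZ) (map (\<lambda>l. bet (r3 l)) v)"
    have w: "wpath src tgt T (map collapse v) S" using p by (simp only: wpath_collapse)
    have "(length (rights (map collapse v)) + 1) * N \<le> (d + 1) * N"
      unfolding rights_collapse using l(1) by (intro mult_right_mono) auto
    then have le: "(length (rights (map collapse v)) + 1) * N \<le> length (map collapse v)"
      unfolding length_map using l(2) by (rule order_trans)
    have N0: "0 < N" by (simp add: N_def)
    from words_block[OF w N0 le] obtain a U b where c: "map collapse v = a @ replicate N (Inl U) @ b"
      and U': "U \<in> insert T (src ` set (rights (map collapse v)))" by (elim exE conjE)
    have U: "U \<in> Ob" using U' T sb unfolding rights_collapse by auto
    from map_eq_append_conv[THEN iffD1, OF c] obtain a' w' where a': "v = a' @ w'" "replicate N (Inl U) @ b = map collapse w'"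
      by (elim exE conjE)
    from map_eq_append_conv[THEN iffD1, OF a'(2)[symmetric]] obtain D b' where D': "w' = D @ b'" "replicate N (Inl U) = map collapse D"
      by (elim exE conjE)
    have v: "v = a' @ D @ b'" "map collapse D = replicate N (Inl U)" using a'(1) D' by simp_all
    have D: "length D = N" using arg_cong[OF v(2), of length] by simp
    obtain R where R: "ranked U N R" using N[OF U] by blast
    have dl: "x = Inl U \<or> x = Inr (Inl U)" if x: "x \<in> set D" for x
    proof -
      have "collapse x \<in> set (map collapse D)" using x by simp
      then have "collapse x = Inl U" unfolding v(2) by (auto simp: set_replicate_conv_if split: if_splits)
      then show ?thesis by (cases x) auto
    qed
    have "mu (ZZ CZ) (map (\<lambda>l. bet (r3 l)) a' @ map (\<lambda>l. bet (r3 l)) D @ map (\<lambda>l. bet (r3 l)) b') = 0"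
    proof (rule CZ.ZZ_block_zero[where N = N and n = "length (pos (fst U))" and r = R])
      show "mors (ZZ CZ) (map (\<lambda>l. bet (r3 l)) a' @ map (\<lambda>l. bet (r3 l)) D @ map (\<lambda>l. bet (r3 l)) b')"
        using m v(1) by simp
      show "map (\<lambda>l. bet (r3 l)) D \<noteq> []" "N \<le> length (map (\<lambda>l. bet (r3 l)) D)" using D by (auto simp: N_def)
      show "R i < N" if "i < length (pos (fst U))" for i using R that unfolding ranked_def by blast
    next
      fix x assume "x \<in> set (map (\<lambda>l. bet (r3 l)) D)"
      then obtain y where "y \<in> set D" "x = bet (r3 y)" by auto
      then have x: "x = bet (dD (fst U)) \<or> x = bet (tw_diff U)" using dl[of y] by auto
      then show "length (src x) = length (pos (fst U)) \<and> length (tgt x) = length (pos (fst U))" by auto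
      fix j i assume "i < length (pos (fst U))" "val x j i \<noteq> 0"
      then have "bval (fst U) (fst U) (snd U) j i \<noteq> 0 \<or> bval (fst U) (fst U) (dmat (fst U)) j i \<noteq> 0"
        using x by auto
      then show "R i < R j" using R \<open>i < length (pos (fst U))\<close> unfolding ranked_def by blast
    qed
    then show "mu (ZZ CZ) (map (\<lambda>l. bet (r3 l)) v) = 0" unfolding v(1) by simp
  qed
qed

lemma wpath_Inl:
  "wpath src tgt T u S \<Longrightarrow> Inl U \<in> set u \<Longrightarrow> U \<in> insert T (src ` set (rights u))"
proof (induction u arbitrary: T)
  case (Cons x u)
  then show ?case by (cases x) auto
qed simp

text \<open>Both sides are sums over the words \<open>v\<close> with two kinds of inserted letters.
  Grouped by \<open>map collapse v\<close> they give the insertions of \<delta> + D; grouped by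
  \<open>rights v\<close> they give the insertions of \<delta>, each expanded by insertions of D.
  The empty word is removed because \<open>fs\<close> may be empty, in which case the identity
  compares Maurer--Cartan sums.\<close>

lemma Fo_sum:
  assumes T: "preT T" and p: "path src tgt T fs S"
    and fs: "\<forall>f\<in>set fs. mor (ZZ CT) (untwist f) \<and> preT (src f)"
  shows "\<forall>\<^sub>F L in sequentially. (\<Sum>u\<in>words src tgt T fs S L - {[]}. mu (ZZ CZ) (map rF u)) =
    bval (fst T) (fst S) (\<Sum>w\<in>words src tgt T fs S L - {[]}. mu (ZZ CT) (map rl w))"
proof -
  let ?Ob = "insert T (src ` set fs)"
  let ?\<Phi> = "\<lambda>v. mu (ZZ CZ) (map (\<lambda>l. bet (r3 l)) v)"
  have Ob: "finite ?Ob" "\<forall>U\<in>?Ob. preT U" using T fs by auto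
  obtain L0 where L0: "\<forall>v T S. wpath2 src tgt T v S \<and> T \<in> ?Ob \<and> src ` set (rights (rights v)) \<subseteq> ?Ob \<and>
    length (rights (rights v)) \<le> length fs \<and> L0 \<le> length v \<and> mors (ZZ CZ) (map (\<lambda>l. bet (r3 l)) v) \<longrightarrow> ?\<Phi> v = 0"
    using r3_vanish[OF Ob, of "length fs"] by (elim exE)
  have "(\<Sum>u\<in>words src tgt T fs S L - {[]}. mu (ZZ CZ) (map rF u)) =
    bval (fst T) (fst S) (\<Sum>w\<in>words src tgt T fs S L - {[]}. mu (ZZ CT) (map rl w))" if L: "L0 \<le> L" for L
  proof -
    define W where "W = words src tgt T fs S L"
    have W: "rights w = fs" "wpath src tgt T w S" "length w \<le> L" if "w \<in> W" for w
      using that by (auto simp: W_def words_def)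
    \<comment> \<open>\<open>L\<close> bounds what is left of the word when D is deleted, as in the
      sum on the right; \<open>M\<close> bounds the whole word, as the expansion of the inner
      compositions needs.\<close>
    define V where "V M = {v. wpath2 src tgt T v S \<and> rights (rights v) = fs \<and> length (rights v) \<le> L \<and> length v \<le> M \<and> v \<noteq> []}" for M
    have V: "wpath2 src tgt T v S" "rights (rights v) = fs" "length (rights v) \<le> L" "length v \<le> M" "v \<noteq> []" if "v \<in> V M" for v M
      using that by (auto simp: V_def)
    have P: "pmors (ZZ CT) (fst T) (map r3 v) (fst S)" if "wpath2 src tgt T v S" "rights (rights v) = fs" for v
      by (rule pmors_r3[OF that(1) T]) (use that(2) fs in simp)
    have Vmors: "mors (ZZ CZ) (map (\<lambda>l. bet (r3 l)) v)" if "v \<in> V M" for v M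
      using pmors_bet[OF P[OF V(1,2)[OF that]]] V(5)[OF that] by (auto simp: mors_pmors comp_def)
    have \<Phi>: "?\<Phi> v = bval (fst T) (fst S) (mu (ZZ CZ) (map (\<lambda>l. kap (r3 l)) v))"
      if "wpath2 src tgt T v S" "rights (rights v) = fs" "v \<noteq> []" for v
      using mu_bet[OF P[OF that(1,2)]] that(3) by (simp add: comp_def)
    have finV: "finite (V M)" for M
    proof (rule finite_subset)
      show "V M \<subseteq> (\<Union>u\<in>words src tgt T fs S M. {v. map collapse v = u})"
      proof
        fix v assume "v \<in> V M"
        then have "map collapse v \<in> words src tgt T fs S M"
          unfolding words_def mem_Collect_eq wpath_collapse rights_collapse length_map using V by blast
        then show "v \<in> (\<Union>u\<in>words src tgt T fs S M. {v. map collapse v = u})" by blast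
      qed
      show "finite (\<Union>u\<in>words src tgt T fs S M. {v. map collapse v = u})"
        by (intro finite_UN_I finite_words finite_map_collapse)
    qed
    have "\<forall>\<^sub>F M in sequentially. \<forall>w\<in>W - {[]}. mu (ZZ CT) (map rl w) =
      (\<Sum>v\<in>words src tgt (fst T) (map rl w) (fst S) M. mu (ZZ CZ) (map (\<lambda>l. kap (rD l)) v))"
    proof (intro eventually_ball_finite ballI)
      fix w assume w: "w \<in> W - {[]}"
      have "pmors (ZZ CT) (fst T) (map r3 (map Inr w)) (fst S)"
        by (rule P) (use w W in \<open>simp_all add: wpath_map_Inr del: map_map\<close>)
      then have "pmors (ZZ CT) (fst T) (map rl w) (fst S)" by (simp add: comp_def)
      then show "\<forall>\<^sub>F M in sequentially. mu (ZZ CT) (map rl w) =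
        (\<Sum>v\<in>words src tgt (fst T) (map rl w) (fst S) M. mu (ZZ CZ) (map (\<lambda>l. kap (rD l)) v))"
        by (rule mu_ZZ_CT_words) (use w in simp)
    qed (simp add: W_def)
    moreover note sum_mu_dD[OF preT_obj[OF T]] eventually_ge_at_top[of L]
    ultimately have "\<forall>\<^sub>F M in sequentially. (\<forall>w\<in>W - {[]}. mu (ZZ CT) (map rl w) =
      (\<Sum>v\<in>words src tgt (fst T) (map rl w) (fst S) M. mu (ZZ CZ) (map (\<lambda>l. kap (rD l)) v))) \<and>
      (\<Sum>q\<in>{1..M}. mu (ZZ CZ) (replicate q (kap (dD (fst T))))) = 0 \<and> L \<le> M"
      by (intro eventually_conj)
    from eventually_happens'[OF sequentially_bot this] obtain M where
      M: "\<And>w. w \<in> W - {[]} \<Longrightarrow> mu (ZZ CT) (map rl w) =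
      (\<Sum>v\<in>words src tgt (fst T) (map rl w) (fst S) M. mu (ZZ CZ) (map (\<lambda>l. kap (rD l)) v))"
      and M0: "(\<Sum>q\<in>{1..M}. mu (ZZ CZ) (replicate q (kap (dD (fst T))))) = 0" and LM: "L \<le> M" by blast
    have A: "(\<Sum>v\<in>{v \<in> V M. rights v = w}. ?\<Phi> v) = bval (fst T) (fst S) (mu (ZZ CT) (map rl w))" if w: "w \<in> W - {[]}" for w
    proof -
      have w': "w \<in> W" "w \<noteq> []" using w by auto
      have eq: "{v \<in> V M. rights v = w} = words (case_sum id src) (case_sum id tgt) T w S M"
        using W[OF w'(1)] w'(2) by (auto simp: V_def words_def)
      have k: "map (\<lambda>l. kap (rD l)) (map (map_sum fst rl) v) = map (\<lambda>l. kap (r3 l)) v" for v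
        by (auto split: sum.splits)
      have pw: "path (case_sum id src) (case_sum id tgt) T w S" by (rule W(2)[OF w'(1)])
      have "(\<Sum>v\<in>words src tgt (fst T) (map rl w) (fst S) M. mu (ZZ CZ) (map (\<lambda>l. kap (rD l)) v)) =
        (\<Sum>v\<in>words (case_sum id src) (case_sum id tgt) T w S M. mu (ZZ CZ) (map (\<lambda>l. kap (rD l)) (map (map_sum fst rl) v)))"
        by (rule sum_words_map[OF pw]) (auto split: sum.splits)
      then have "mu (ZZ CT) (map rl w) = (\<Sum>v\<in>words (case_sum id src) (case_sum id tgt) T w S M. mu (ZZ CZ) (map (\<lambda>l. kap (r3 l)) v))"
        unfolding k M[OF w] .
      then have "bval (fst T) (fst S) (mu (ZZ CT) (map rl w)) =
        (\<Sum>v\<in>{v \<in> V M. rights v = w}. bval (fst T) (fst S) (mu (ZZ CZ) (map (\<lambda>l. kap (r3 l)) v)))"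
        unfolding eq by (simp only: bval_sum)
      also have "\<dots> = (\<Sum>v\<in>{v \<in> V M. rights v = w}. ?\<Phi> v)"
        by (intro sum.cong refl \<Phi>[symmetric]) (use V in blast)+
      finally show ?thesis by (rule sym)
    qed
    \<comment> \<open>Words in D alone have no counterpart among the nonempty words
      \<open>w\<close>. They occur only for the empty string, and their sum vanishes by the
      Maurer--Cartan equation of the summands.\<close>
    have B: "(\<Sum>v\<in>{v \<in> V M. rights v = []}. ?\<Phi> v) = 0" if "[] \<in> W"
    proof -
      have e: "fs = []" "S = T" using W(1,2)[OF that] by auto
      have "{v \<in> V M. rights v = []} = words (case_sum id src) (case_sum id tgt) T [] T M - {[]}"
        by (auto simp: V_def words_def e)
      then have "(\<Sum>v\<in>{v \<in> V M. rights v = []}. ?\<Phi> v) = (\<Sum>q\<in>{1..M}. ?\<Phi> (replicate q (Inl T)))"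
        by (simp only: sum_words_Nil)
      also have "\<dots> = (\<Sum>q\<in>{1..M}. bval (fst T) (fst S) (mu (ZZ CZ) (map (\<lambda>l. kap (r3 l)) (replicate q (Inl T)))))"
      proof (intro sum.cong refl \<Phi>)
        fix q assume "q \<in> {1..M}"
        then show "replicate q (Inl T) \<noteq> []" by simp
        show "wpath2 src tgt T (replicate q (Inl T)) S" unfolding e(2) by (rule wpath_replicate)
        show "rights (rights (replicate q (Inl T))) = fs" by (simp add: e(1))
      qed
      also have "\<dots> = bval (fst T) (fst S) (\<Sum>q\<in>{1..M}. mu (ZZ CZ) (replicate q (kap (dD (fst T)))))"
        by (simp only: bval_sum map_replicate sum.case)
      finally show ?thesis unfolding M0 bval_zero .
    qed
    have "bval (fst T) (fst S) (\<Sum>w\<in>W - {[]}. mu (ZZ CT) (map rl w)) = (\<Sum>w\<in>W - {[]}. \<Sum>v\<in>{v \<in> V M. rights v = w}. ?\<Phi> v)"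
      unfolding bval_sum by (intro sum.cong refl A[symmetric])
    also have "\<dots> = (\<Sum>w\<in>W. \<Sum>v\<in>{v \<in> V M. rights v = w}. ?\<Phi> v)"
    proof (rule sum.mono_neutral_left)
      show "\<forall>w\<in>W - (W - {[]}). (\<Sum>v\<in>{v \<in> V M. rights v = w}. ?\<Phi> v) = 0"
      proof
        fix w assume "w \<in> W - (W - {[]})"
        then have "w = []" "[] \<in> W" by auto
        then show "(\<Sum>v\<in>{v \<in> V M. rights v = w}. ?\<Phi> v) = 0" using B by (simp only:)
      qed
    qed (auto simp: W_def)
    also have "\<dots> = sum ?\<Phi> (V M)"
    proof (rule sum.group[OF finV])
      show "rights ` V M \<subseteq> W"
      proof
        fix w assume "w \<in> rights ` V M"
        then obtain v where v: "v \<in> V M" "w = rights v" by blast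
        then show "w \<in> W" using V[OF v(1)] path_rights[OF V(1)[OF v(1)]] by (simp add: W_def words_def)
      qed
    qed (simp add: W_def)
    \<comment> \<open>The words longer than \<open>L\<close> vanish by the choice of
      \<open>L0\<close>. With the bound lowered to \<open>L\<close>, the set contains all
      refinements of a nonempty word \<open>u\<close> in \<open>W\<close>, so that the other
      grouping becomes possible.\<close>
    also have "\<dots> = sum ?\<Phi> (V L)"
    proof (rule sum.mono_neutral_right[OF finV])
      show "V L \<subseteq> V M" using LM by (auto simp: V_def)
      show "\<forall>v\<in>V M - V L. ?\<Phi> v = 0"
      proof
        fix v assume v: "v \<in> V M - V L"
        then have vM: "v \<in> V M" and "L \<le> length v" by (auto simp: V_def)
        then have "L0 \<le> length v" using L by simp
        then show "?\<Phi> v = 0" using V[OF vM] Vmors[OF vM] by (intro L0[rule_format, of T v S]) auto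
      qed
    qed
    also have "\<dots> = (\<Sum>u\<in>W - {[]}. sum ?\<Phi> {v \<in> V L. map collapse v = u})"
    proof (rule sum.group[OF finV, symmetric])
      show "map collapse ` V L \<subseteq> W - {[]}"
      proof
        fix u assume "u \<in> map collapse ` V L"
        then obtain v where v: "v \<in> V L" "u = map collapse v" by blast
        have "map collapse v \<in> W" unfolding W_def words_def mem_Collect_eq wpath_collapse rights_collapse length_map
          using V[OF v(1)] by blast
        then show "u \<in> W - {[]}" using v(2) V(5)[OF v(1)] by simp
      qed
    qed (simp add: W_def)
    also have "\<dots> = (\<Sum>u\<in>W - {[]}. mu (ZZ CZ) (map rF u))"
    proof (rule sum.cong[OF refl])
      fix u assume "u \<in> W - {[]}"
      then have u: "u \<in> W" "u \<noteq> []" by auto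
      have "v \<in> V L" if v: "map collapse v = u" for v
      proof -
        have "wpath2 src tgt T v S" using W(2)[OF u(1)] unfolding v[symmetric] wpath_collapse .
        moreover have "rights (rights v) = fs" using W(1)[OF u(1)] unfolding v[symmetric] rights_collapse .
        moreover have "length v \<le> L" using W(3)[OF u(1)] unfolding v[symmetric] length_map .
        ultimately show ?thesis using length_rights[of v] u(2) v by (auto simp: V_def)
      qed
      then have eq: "{v \<in> V L. map collapse v = u} = {v. map collapse v = u}" by blast
      have "pmors (ZZ CZ) (bobj (fst T)) ([] @ map rF u) (bobj (fst S))"
        unfolding append_Nil by (rule pmors_rF[OF W(2)[OF u(1)] T]) (simp add: W(1)[OF u(1)] fs)
      moreover have "\<forall>U. Inl U \<in> set u \<longrightarrow> preT U"
      proof (intro allI impI)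
        fix U assume "Inl U \<in> set u"
        from wpath_Inl[OF W(2)[OF u(1)] this] show "preT U" unfolding W(1)[OF u(1)] using Ob(2) by blast
      qed
      ultimately have "mu (ZZ CZ) ([] @ map rF u) = (\<Sum>v\<in>{v. map collapse v = u}. mu (ZZ CZ) ([] @ map (\<lambda>l. bet (r3 l)) v))"
        by (rule mu_rF)
      then show "sum ?\<Phi> {v \<in> V L. map collapse v = u} = mu (ZZ CZ) (map rF u)" unfolding eq append_Nil by (rule sym)
    qed
    finally show ?thesis unfolding W_def by (rule sym)
  qed
  then show ?thesis unfolding eventually_sequentially by blast
qed

end

lemma pos_zero:
  assumes "\<And>i. i < length Y \<Longrightarrow> snd (fst (Y ! i)) = 0"
  shows "pos Y = map (\<lambda>i. (i, [0..<length (fst (fst (Y ! i)))])) [0..<length Y]"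
proof -
  have cm: "concat (map g xs) = map h xs" if "\<forall>i\<in>set xs. g i = [h i]" for g :: "nat \<Rightarrow> (nat \<times> nat list) list" and h xs
    using that by (induction xs) auto
  show ?thesis unfolding pos_def
  proof (rule cm, rule ballI)
    fix i assume "i \<in> set [0..<length Y]"
    then have "snd (fst (Y ! i)) = 0" by (intro assms) simp
    then show "(if snd (fst (Y ! i)) = 0 then [(i, [0..<length (fst (fst (Y ! i)))])]
      else map (\<lambda>b. (i, [b])) [0..<length (fst (fst (Y ! i)))]) = [(i, [0..<length (fst (fst (Y ! i)))])]"
      by (rule if_P)
  qed
qed

section \<open>The functor on objects and morphisms\<close>

context ainf_category
begin

interpretation ZA: strict_action "ZZ A" shift_ZZ by (rule strict_action_shift_ZZ)
interpretation TA: strict_action "Tw A" shift_Tw by (rule strict_action_shift_Tw)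
interpretation CZ: ainf_category CZ by (rule ZA.ainf_category_skew)
interpretation CT: ainf_category CT by (rule TA.ainf_category_skew)
interpretation ZCZ: ainf_category "ZZ CZ" by (rule CZ.ainf_category_ZZ)
interpretation ZCT: ainf_category "ZZ CT" by (rule CT.ainf_category_ZZ)

text \<open>The case of the empty string in \<open>Fo_sum\<close>, where words are powers of the
  differential.\<close>

lemma Fo_MC:
  assumes "preT T"
  shows "\<forall>\<^sub>F L in sequentially. (\<Sum>d\<in>{1..L}. mu (ZZ CZ) (replicate d (tw_diff (Fo T)))) =
    bval (fst T) (fst T) (\<Sum>d\<in>{1..L}. mu (ZZ CT) (replicate d (tw_diff T)))"
proof -
  have "path src tgt T [] T" by simp
  from Fo_sum[OF assms this] show ?thesis unfolding sum_words_Nil map_replicate sum.case by simp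
qed

lemma Fo_obj:
  assumes T: "T \<in> Obj (Tw CT)"
  shows "Fo T \<in> Obj (Tw CZ)"
proof (rule CZ.Tw_objI[OF preT_Fo[OF preT_Tw[OF T]]])
  show "\<forall>\<^sub>F L in sequentially. (\<Sum>d\<in>{1..L}. mu (ZZ CZ) (replicate d (tw_diff (Fo T)))) = 0"
    using CT.Maurer_Cartan_sum[OF T] Fo_MC[OF preT_Tw[OF T]]
  proof eventually_elim
    case (elim L)
    show ?case unfolding elim by (rule bval_zero)
  qed
qed

lemma fhm_nu_mor:
  assumes "mor (Tw CT) f"
  shows "mor (Tw CZ) (fhm nu f)"
proof -
  have f: "src f \<in> Obj (Tw CT)" "tgt f \<in> Obj (Tw CT)" "val f \<in> Hom (ZZ CT) (fst (src f)) (fst (tgt f)) (deg f)"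
    using assms by (auto simp: mor_def Tw_sel(2))
  have "val (fhm nu f) = bval (fst (tgt f)) (fst (src f)) (val f)" "deg (fhm nu f) = deg f" by (simp_all add: fhm_def nu_def)
  then show ?thesis using Fo_obj[OF f(1)] Fo_obj[OF f(2)] bval_Hom[OF f(3)]
    unfolding mor_def Tw_sel(2) fhm_nu fst_Fo by simp
qed

lemma nu_mu:
  assumes "mors (Tw CT) as"
  shows "fmor nu (mu_mor (Tw CT) as) = mu (Tw CZ) (map (fhm nu) as)"
proof -
  obtain T S where TS: "pmors (Tw CT) T as S" "as \<noteq> []" using assms by (auto simp: mors_pmors)
  have "pmors (Tw CT) T fs S \<Longrightarrow> pmors (Tw CZ) (Fo T) (map (fhm nu) fs) (Fo S)" for T fs
    by (induction fs arbitrary: T) (auto simp: fhm_nu_mor)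
  then have TS': "pmors (Tw CZ) (Fo T) (map (fhm nu) as) (Fo S)" using TS(1) by blast
  have ne: "map (fhm nu) as \<noteq> []" using TS(2) by simp
  have p: "path src tgt T as S" using TS(1) by (simp add: pmors_def)
  have T: "preT T" using pmors_obj[OF TS] preT_Tw by blast
  have ms: "\<forall>f\<in>set as. mor (Tw CT) f" using TS(1) by (simp add: pmors_def)
  have fs: "\<forall>f\<in>set as. mor (ZZ CT) (untwist f) \<and> preT (src f)"
  proof
    fix f assume "f \<in> set as"
    then have f: "mor (Tw CT) f" using ms by blast
    then have "src f \<in> Obj (Tw CT)" by (simp add: mor_def)
    then show "mor (ZZ CT) (untwist f) \<and> preT (src f)" using mor_untwist[OF f] preT_Tw by blast
  qed
  have W: "words src tgt T as S L - {[]} = words src tgt T as S L" for L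
    using words_ne[of "[]" src tgt T as S L] TS(2) by auto
  have rl: "map rl (map (map_sum Fo (fhm nu)) u) = map rF u" for u by (auto split: sum.splits)
  have "\<forall>\<^sub>F L::nat in sequentially. mu (Tw CZ) (map (fhm nu) as) = bval (fst T) (fst S) (mu (Tw CT) as)"
    using CT.mu_Tw_words[OF TS] CZ.mu_Tw_words[OF TS' ne] Fo_sum[OF T p fs]
  proof eventually_elim
    case (elim L)
    have "(\<Sum>w\<in>words src tgt (Fo T) (map (fhm nu) as) (Fo S) L. mu (ZZ CZ) (map rl w)) =
      (\<Sum>u\<in>words src tgt T as S L. mu (ZZ CZ) (map rl (map (map_sum Fo (fhm nu)) u)))"
      by (rule sum_words_map[OF p]) auto
    then show ?case using elim(3) unfolding W rl elim(1,2) by (rule trans)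
  qed
  then have "mu (Tw CZ) (map (fhm nu) as) = bval (fst T) (fst S) (mu (Tw CT) as)" by simp
  moreover have "fmor nu (mu_mor (Tw CT) as) = bval (fst T) (fst S) (mu (Tw CT) as)"
    using pmors_ends[OF TS] by (simp add: nu_def mu_mor_def)
  ultimately show ?thesis by simp
qed

lemma bval_scl: "bval Y' Y (scl (Tw CT) c m) = scl (Tw CZ) c (bval Y' Y m)"
proof (rule bval_eqI[symmetric])
  have z: "scl (ZZ A) c 0 = 0" by (rule ZA.vs.scale_zero_right)
  show "scl (Tw CZ) c (bval Y' Y m) J I = 0" if "\<not> (J < length (pos Y') \<and> I < length (pos Y))" for J I
    unfolding Tw_sel(3) ZZ_sel(3)[of CZ] ZA.skew_sel(3) bval_outside[OF that]
    by (rule poly_mapping_eqI) (simp add: lookup_map_0 z del: zero_fun_def)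
  show "Poly_Mapping.lookup (scl (Tw CZ) c (bval Y' Y m) J I) g = bmat (snd (pos Y' ! J)) (snd (pos Y ! I))
      (Poly_Mapping.lookup (scl (Tw CT) c m (fst (pos Y' ! J)) (fst (pos Y ! I))) g)"
    if JI: "J < length (pos Y')" "I < length (pos Y)" for J I g
  proof -
    have "Poly_Mapping.lookup (scl (Tw CZ) c (bval Y' Y m) J I) g = scl (ZZ A) c (Poly_Mapping.lookup (bval Y' Y m J I) g)"
      unfolding Tw_sel(3) ZZ_sel(3)[of CZ] ZA.skew_sel(3) by (rule lookup_map_0) (rule z)
    moreover have "Poly_Mapping.lookup (scl (Tw CT) c m j i) g = scl (ZZ A) c (Poly_Mapping.lookup (m j i) g)" for j i
      unfolding Tw_sel(3)[of CT] ZZ_sel(3)[of CT] TA.skew_sel(3) Tw_sel(3) by (rule lookup_map_0) (rule z)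
    moreover have "scl A c 0 = 0" by (rule vs.scale_zero_right)
    ultimately show ?thesis
      unfolding lookup_bval[OF JI] ZZ_sel(3)[of A] by (auto simp: bmat_def fun_eq_iff)
  qed
qed

lemma Tw_obj_zero:
  assumes "x \<in> Obj (ZZ A)"
  shows "(x, 0) \<in> Obj (Tw A)"
proof (rule Tw_objI)
  show m: "mor (ZZ A) (tw_diff (x, 0))" using assms ZA.Hom_0[OF assms assms, of 1] by (simp add: mor_def del: zero_fun_def)
  show "strictly_lower_triangular (length (fst (x, 0 :: nat \<Rightarrow> nat \<Rightarrow> 'm))) (snd (x, 0 :: nat \<Rightarrow> nat \<Rightarrow> 'm))"
    by (rule rank_strictly_lower_triangular) simp
  have "mu (ZZ A) (replicate d (tw_diff (x, 0))) = 0" if "d \<in> {1..L}" for d L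
    by (rule ZA.mu_zero_entry[OF mors_diffs[OF m], of d "tw_diff (x, 0)"]) (use that in \<open>simp_all del: zero_fun_def\<close>)
  then have "(\<Sum>d\<in>{1..L}. mu (ZZ A) (replicate d (tw_diff (x, 0)))) = 0" for L by (intro sum.neutral) blast
  then show "\<forall>\<^sub>F L in sequentially. (\<Sum>d\<in>{1..L}. mu (ZZ A) (replicate d (tw_diff (x, 0)))) = 0"
    by (intro always_eventually allI)
qed

text \<open>Each object of \<int>A is regarded as a twisted complex with zero differential. Such
  objects are kept whole by \<open>pos\<close> and contribute nothing to D, so the given
  differential can be used unchanged.\<close>

lemma Fo_surj:
  assumes Z: "Z \<in> Obj (Tw CZ)"
  shows "\<exists>T\<in>Obj (Tw CT). Fo T = Z"
proof -
  obtain X \<delta> where XZ: "Z = (X, \<delta>)" by (cases Z)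
  have mZ: "mor (ZZ CZ) (tw_diff Z)" and sZ: "strictly_lower_triangular (length X) \<delta>"
    using Z unfolding Tw_sel(1) XZ fst_conv snd_conv by blast+
  have X: "X \<in> Obj (ZZ CZ)" and \<delta>: "\<delta> \<in> Hom (ZZ CZ) X X 1" using mZ by (simp_all add: mor_def XZ)
  define Y where "Y = map (\<lambda>(x, p). ((x, 0 :: nat \<Rightarrow> nat \<Rightarrow> 'm), p)) X"
  have lY: "length Y = length X" by (simp add: Y_def)
  have nY: "Y ! i = ((fst (X ! i), 0), snd (X ! i))" if "i < length X" for i
    using that by (simp add: Y_def case_prod_beta del: zero_fun_def)
  have pY: "pos Y = map (\<lambda>i. (i, [0..<length (fst (X ! i))])) [0..<length X]"
  proof -
    have "pos Y = map (\<lambda>i. (i, [0..<length (fst (fst (Y ! i)))])) [0..<length Y]"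
      by (rule pos_zero) (use lY nY in \<open>simp only: fst_conv snd_conv\<close>)
    then show ?thesis using lY nY by simp
  qed
  have bY: "bobj Y = X"
    by (rule nth_equalityI) (simp_all add: pY bobj_nth nY map_nth)
  \<comment> \<open>Every object forms a single block with its summands in the original order, so
    cutting into blocks has no effect.\<close>
  have id: "bval Y Y m = m" if m: "m \<in> Hom (ZZ CZ) X X p" for m p
  proof (rule bval_eqI[symmetric])
    show "m J I = 0" if "\<not> (J < length (pos Y) \<and> I < length (pos Y))" for J I
      using m[unfolded Hom_ZZ_CZ_iff, rule_format, of J I] that by (auto simp: pY)
    fix J I g assume JI: "J < length (pos Y)" "I < length (pos Y)"
    then have ji: "J < length X" "I < length X" by (simp_all add: pY)
    have "Poly_Mapping.lookup (m J I) g b' b = 0" if "\<not> (b' < length (fst (X ! J)) \<and> b < length (fst (X ! I)))" for b' b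
      using m[unfolded Hom_ZZ_CZ_iff, rule_format, of J I] ji that by auto
    then show "Poly_Mapping.lookup (m J I) g = bmat (snd (pos Y ! J)) (snd (pos Y ! I))
        (Poly_Mapping.lookup (m (fst (pos Y ! J)) (fst (pos Y ! I))) g)"
      using ji by (auto simp: pY bmat_def fun_eq_iff)
  qed
  have Hom: "Hom (ZZ CT) Y Y p = Hom (ZZ CZ) X X p" for p
    by (rule set_eqI) (simp only: Hom_ZZ_CT_iff Hom_ZZ_CZ_iff lY nY fst_conv snd_conv cong: if_cong conj_cong)
  have YO: "Y \<in> Obj (ZZ CT)"
    using X Tw_obj_zero unfolding ZZ_sel(1)[of CT] TA.skew_sel(1) ZZ_sel(1)[of CZ] ZA.skew_sel(1) Y_def
    by (auto simp del: zero_fun_def)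
  have dm: "dmat Y = 0"
  proof (intro ext)
    fix j i
    have "snd (fst (Y ! i)) = 0" if "i < length Y" using that lY nY by (simp only: fst_conv snd_conv)
    then show "dmat Y j i = (0 :: nat \<Rightarrow> nat \<Rightarrow> 'm mats) j i" by (cases "i < length Y") (simp_all only: dmat_def simp_thms if_True if_False single_zero if_cancel zero_fun_apply)
  qed
  define T where "T = (Y, \<delta>)"
  have FT: "Fo T = Z" unfolding Fo_def T_def fst_conv snd_conv dm bY add_0_right id[OF \<delta>] XZ ..
  have pT: "preT T" unfolding preT_def T_def fst_conv snd_conv lY
    using sZ YO \<delta> by (simp add: mor_def Hom)
  have "T \<in> Obj (Tw CT)"
  proof (rule CT.Tw_objI)
    show mT: "mor (ZZ CT) (tw_diff T)" "strictly_lower_triangular (length (fst T)) (snd T)" using pT by (auto simp: preT_def)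
    \<comment> \<open>\<open>Fo_MC\<close> is read backwards: the Maurer--Cartan sum of
      \<open>T\<close> is a morphism on which cutting into blocks is the identity, so it equals the
      sum of \<open>Z\<close>, which vanishes.\<close>
    show "\<forall>\<^sub>F L in sequentially. (\<Sum>d\<in>{1..L}. mu (ZZ CT) (replicate d (tw_diff T))) = 0"
      using CZ.Maurer_Cartan_sum[OF Z] Fo_MC[OF pT]
    proof eventually_elim
      case (elim L)
      have "(\<Sum>d\<in>{1..L}. mu (ZZ CT) (replicate d (tw_diff T))) \<in> Hom (ZZ CT) Y Y 2"
      proof (rule ZCT.Hom_sum[OF YO YO])
        fix d assume "d \<in> {1..L}"
        then have d: "0 < d" by simp
        from ZCT.mu_closed[OF CT.mors_diffs[OF mT(1) d]]
        show "mu (ZZ CT) (replicate d (tw_diff T)) \<in> Hom (ZZ CT) Y Y 2"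
          unfolding CT.mu_mor_diffs[OF d] by (simp add: mor_def T_def)
      qed
      from id[OF this[unfolded Hom]] show ?case using elim unfolding FT by (simp only: T_def fst_conv)
    qed
  qed
  then show ?thesis using FT by blast
qed

lemma quasi_equivalence_nu: "quasi_equivalence (Tw CT) (Tw CZ) nu"
proof (rule quasi_equivalenceI[OF CT.ainf_category_Tw CZ.ainf_category_Tw])
  have fm: "fmor nu (HMor X Y p a) = bval (fst Y) (fst X) a" for X Y :: "('o, 'm) ttwc" and p a
    by (simp add: nu_def)
  show "fobj nu X \<in> Obj (Tw CZ)" if "X \<in> Obj (Tw CT)" for X using Fo_obj[OF that] by simp
  show "\<exists>X\<in>Obj (Tw CT). fobj nu X = Z" if "Z \<in> Obj (Tw CZ)" for Z using Fo_surj[OF that] by simp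
  show "bij_betw (\<lambda>a. fmor nu (HMor X Y p a)) (Hom (Tw CT) X Y p) (Hom (Tw CZ) (fobj nu X) (fobj nu Y) p)" for X Y p
    unfolding fm Tw_sel(2) fhm_nu fst_Fo by (rule bval_bij)
  show "fmor nu (HMor X Y p (a + b)) = fmor nu (HMor X Y p a) + fmor nu (HMor X Y p b)" for X Y :: "('o, 'm) ttwc" and p a b
    unfolding fm by (rule bval_add)
  show "fmor nu (HMor X Y p (scl (Tw CT) c a)) = scl (Tw CZ) c (fmor nu (HMor X Y p a))" for X Y :: "('o, 'm) ttwc" and p a c
    unfolding fm by (rule bval_scl)
  show "fmor nu (mu_mor (Tw CT) as) = mu (Tw CZ) (map (fhm nu) as)" if "mors (Tw CT) as" for as
    by (rule nu_mu[OF that])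
qed

end

theorem mainTheorem2:
  fixes A :: "('o, 'm::ab_group_add, 'k::field) ainf"
  assumes "ainf_category A"
  shows "\<exists>\<nu>. quasi_equivalence (Tw (skew (Tw A) shift_Tw)) (Tw (skew (ZZ A) shift_ZZ)) \<nu>"
  using ainf_category.quasi_equivalence_nu[OF assms] by blast

end
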